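(* Let $(V_1,N_1),\ldots,(V_n,N_n)$ ($n>1$) be distinct DVRs with quotient field $F$, where each $V_i/N_i$ is finite. For each $i$ let $\overline{V_i/N_i}$ denote a fixed algebraic closure of $V_i/N_i$. Let $m$ be a positive integer, and let $S=\{S(V_1),\ldots,S(V_n)\}$ be an arbitrary $m$-consistent system for $\{V_1,\ldots,V_n\}$, where, for $i=1,\ldots,n$, $S(V_i)=\{(K_{i,j},f_{i,j},e_{i,j})\mid j=1,\ldots,s_i\}$ with $K_{i,j}\subseteq\overline{V_i/N_i}$ for all $j$. For $i=1,\ldots,n$ let $T^*(V_i)=\{(K_{i,j}^*,m f_{i,j},e_{i,j})\mid j=1,\ldots,s_i\}$, where $K_{i,j}^*\subseteq\overline{V_i/N_i}$ is the unique field extension of $K_{i,j}$ inside $\overline{V_i/N_i}$ with $[K_{i,j}^*:K_{i,j}]=m$. Then $T^*=\{T^*(V_1),\ldots,T^*(V_n)\}$ is a realizable $m^2$-consistent system for $\{V_1,\ldots,V_n\}$.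
   Context: A DVR is a rank one discrete valuation ring; $(V,N)$ means that $N$ is the maximal ideal of $V$. Let $(V_1,N_1),\ldots,(V_n,N_n)$ be distinct DVRs with quotient field $F$, and put $K_i=V_i/N_i$. For a positive integer $m$, an $m$-consistent system for $\{V_1,\ldots,V_n\}$ is a collection $S=\{S(V_1),\ldots,S(V_n)\}$ such that: (1) $S(V_i)=\{(K_{i,j},f_{i,j},e_{i,j})\mid j=1,\ldots,s_i\}$ is a finite family indexed by $j$ (repetitions of triples are allowed), where $K_{i,j}$ is a simple algebraic field extension of $K_i$, $f_{i,j}=[K_{i,j}:K_i]$, and $s_i,e_{i,j}$ are positive integers; (2) for each $i$, $\sum_{j=1}^{s_i}e_{i,j}f_{i,j}=m$. Such a system $S$ is realizable for $\{V_1,\ldots,V_n\}$ if there exists a separable algebraic extension field $L$ of $F$ such that: (a) $[L:F]=m$; (b) for $1\le i\le n$, $V_i$ has exactly $s_i$ extensions $(V_{i,1},N_{i,1}),\ldots,(V_{i,s_i},N_{i,s_i})$ to valuation rings of $L$; (c) (for a suitable numbering) the residue field $V_{i,j}/N_{i,j}$ is $K_i$-isomorphic to $K_{i,j}$, and the ramification index of $V_{i,j}$ over $V_i$ is $e_{i,j}$, i.e. $N_iV_{i,j}=N_{i,j}^{e_{i,j}}$. Such an $L$ is called a realization of $S$. *)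

theory Defs
  imports "HOL-Algebra.Algebra"
begin

text \<open>
  \<open>V\<close> is a rank one discrete valuation ring with quotient field \<open>F\<close>: it is the valuation ring
  of a surjective valuation \<open>v\<close> from the multiplicative group of \<open>F\<close> to the integers.
\<close>

definition DVR :: "'a ring \<Rightarrow> 'a set \<Rightarrow> bool" where
  "DVR F V \<longleftrightarrow> (\<exists>v :: 'a \<Rightarrow> int.
     v ` (carrier F - {\<zero>\<^bsub>F\<^esub>}) = UNIV \<and>
     (\<forall>x \<in> carrier F - {\<zero>\<^bsub>F\<^esub>}. \<forall>y \<in> carrier F - {\<zero>\<^bsub>F\<^esub>}. v (x \<otimes>\<^bsub>F\<^esub> y) = v x + v y) \<and>
     (\<forall>x \<in> carrier F - {\<zero>\<^bsub>F\<^esub>}. \<forall>y \<in> carrier F - {\<zero>\<^bsub>F\<^esub>}.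
        x \<oplus>\<^bsub>F\<^esub> y \<noteq> \<zero>\<^bsub>F\<^esub> \<longrightarrow> min (v x) (v y) \<le> v (x \<oplus>\<^bsub>F\<^esub> y)) \<and>
     V = insert \<zero>\<^bsub>F\<^esub> {x \<in> carrier F - {\<zero>\<^bsub>F\<^esub>}. 0 \<le> v x})"

definition valuation_ring :: "'a ring \<Rightarrow> 'a set \<Rightarrow> bool" where
  "valuation_ring L W \<longleftrightarrow>
     subring W L \<and> (\<forall>x \<in> carrier L - {\<zero>\<^bsub>L\<^esub>}. x \<in> W \<or> inv\<^bsub>L\<^esub> x \<in> W)"

abbreviation residue_field :: "'a ring \<Rightarrow> 'a set \<Rightarrow> 'a set \<Rightarrow> 'a set ring" where
  "residue_field F V N \<equiv> (F\<lparr>carrier := V\<rparr>) Quot N"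

text \<open>
  Field extensions are given by embeddings: \<open>\<phi> \<in> ring_hom F L\<close> makes \<open>L\<close> an extension of \<open>F\<close>,
  and \<open>F\<close> is then identified with the subfield \<open>\<phi> ` carrier F\<close> of \<open>L\<close>.
  An element of \<open>L\<close> is separable over a subfield \<open>k\<close> if it is algebraic over \<open>k\<close> and its
  minimal polynomial has no repeated root in an algebraic closure of \<open>L\<close> (the library's
  \<^const>\<open>field.alg_closure\<close>, in which \<open>L\<close> is embedded by \<^const>\<open>ring.indexed_const\<close>).
\<close>

definition separable_element :: "'b ring \<Rightarrow> 'b set \<Rightarrow> 'b \<Rightarrow> bool" where
  "separable_element L k x \<longleftrightarrow>
     (ring.algebraic L over k) x \<and>
     (\<forall>y. count (ring.roots (field.alg_closure L)
                  (map (ring.indexed_const L) (ring.Irr L k x))) y \<le> 1)"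

definition separable_extension :: "'a ring \<Rightarrow> 'b ring \<Rightarrow> ('a \<Rightarrow> 'b) \<Rightarrow> bool" where
  "separable_extension F L \<phi> \<longleftrightarrow>
     (\<forall>x \<in> carrier L. separable_element L (\<phi> ` carrier F) x)"

definition simple_algebraic_extension :: "'r ring \<Rightarrow> 'k ring \<Rightarrow> ('r \<Rightarrow> 'k) \<Rightarrow> bool" where
  "simple_algebraic_extension R E \<iota> \<longleftrightarrow>
     field E \<and> \<iota> \<in> ring_hom R E \<and>
     (\<exists>x \<in> carrier E. (ring.algebraic E over (\<iota> ` carrier R)) x \<and>
        carrier E = ring.simple_extension E (\<iota> ` carrier R) x)"

text \<open>
  A system \<open>S\<close> consists, for each \<open>i\<close>, of the triples indexed by \<open>j = 1, \<dots>, sys_num S i\<close>.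
  The extension field in the \<open>j\<close>-th triple is the ring \<open>sys_ext S i j\<close> together with the embedding
  \<open>sys_emb S i j\<close> of the residue field of \<open>V i\<close> (whose elements are cosets, of type \<open>'a set\<close>).
\<close>

record ('a, 'k) system =
  sys_num :: "nat \<Rightarrow> nat"
  sys_ext :: "nat \<Rightarrow> nat \<Rightarrow> 'k ring"
  sys_emb :: "nat \<Rightarrow> nat \<Rightarrow> 'a set \<Rightarrow> 'k"
  sys_deg :: "nat \<Rightarrow> nat \<Rightarrow> nat"
  sys_ram :: "nat \<Rightarrow> nat \<Rightarrow> nat"

definition consistent_system ::
  "'a ring \<Rightarrow> nat \<Rightarrow> (nat \<Rightarrow> 'a set) \<Rightarrow> (nat \<Rightarrow> 'a set) \<Rightarrow> nat \<Rightarrow> ('a, 'k) system \<Rightarrow> bool" where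
  "consistent_system F n V N m S \<longleftrightarrow> (\<forall>i \<in> {1..n}.
     0 < sys_num S i \<and>
     (\<forall>j \<in> {1..sys_num S i}.
        simple_algebraic_extension (residue_field F (V i) (N i)) (sys_ext S i j) (sys_emb S i j) \<and>
        ring.dimension (sys_ext S i j) (sys_deg S i j)
          (sys_emb S i j ` carrier (residue_field F (V i) (N i))) (carrier (sys_ext S i j)) \<and>
        0 < sys_ram S i j) \<and>
     (\<Sum>j = 1..sys_num S i. sys_ram S i j * sys_deg S i j) = m)"

text \<open>
  \<open>W i j\<close> and \<open>M i j\<close> are the valuation rings of \<open>L\<close> extending \<open>V i\<close> and their maximal ideals.
  The isomorphism \<open>h\<close> is one over the residue field of \<open>V i\<close>: it sends the image of the residue
  class of \<open>x \<in> V i\<close>, that is the class of \<open>\<phi> x\<close>, to the image of that class under \<open>sys_emb S i j\<close>.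
  In the last conjunct the ideal \<open>N\<^sub>i V\<^sub>i\<^sub>j\<close> is equated with a power taken in the monoid of ideals
  of \<open>W i j\<close>.
\<close>

definition is_realization ::
  "'a ring \<Rightarrow> nat \<Rightarrow> (nat \<Rightarrow> 'a set) \<Rightarrow> (nat \<Rightarrow> 'a set) \<Rightarrow> nat \<Rightarrow> ('a, 'k) system
    \<Rightarrow> 'b ring \<Rightarrow> ('a \<Rightarrow> 'b) \<Rightarrow> bool" where
  "is_realization F n V N m S L \<phi> \<longleftrightarrow>
     field L \<and> \<phi> \<in> ring_hom F L \<and> separable_extension F L \<phi> \<and>
     ring.dimension L m (\<phi> ` carrier F) (carrier L) \<and>
     (\<exists>W M. \<forall>i \<in> {1..n}.
        bij_betw (W i) {1..sys_num S i}
          {U. valuation_ring L U \<and> {x \<in> carrier F. \<phi> x \<in> U} = V i} \<and>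
        (\<forall>j \<in> {1..sys_num S i}.
           maximalideal (M i j) (L\<lparr>carrier := W i j\<rparr>) \<and>
           (\<exists>h \<in> ring_iso (residue_field L (W i j) (M i j)) (sys_ext S i j).
              \<forall>x \<in> V i. h (M i j +>\<^bsub>L\<lparr>carrier := W i j\<rparr>\<^esub> \<phi> x)
                = sys_emb S i j (N i +>\<^bsub>F\<lparr>carrier := V i\<rparr>\<^esub> x)) \<and>
           Idl\<^bsub>L\<lparr>carrier := W i j\<rparr>\<^esub> (\<phi> ` N i)
             = M i j [^]\<^bsub>ideals_set (L\<lparr>carrier := W i j\<rparr>)\<^esub> sys_ram S i j))"

text \<open>
  The existential quantifier over \<open>L\<close> needs a type for its elements. The one used here is the type
  of the library's algebraic closure \<^const>\<open>field.alg_closure\<close> of \<open>F\<close>; every algebraic extension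
  of \<open>F\<close> is \<open>F\<close>-isomorphic to a subfield of that closure, so this is no restriction.
\<close>

definition realizable_system ::
  "'a ring \<Rightarrow> nat \<Rightarrow> (nat \<Rightarrow> 'a set) \<Rightarrow> (nat \<Rightarrow> 'a set) \<Rightarrow> nat \<Rightarrow> ('a, 'k) system \<Rightarrow> bool" where
  "realizable_system F n V N m S \<longleftrightarrow>
     (\<exists>(L :: (('a list \<times> nat) multiset \<Rightarrow> 'a) ring) \<phi>. is_realization F n V N m S L \<phi>)"

text \<open>
  The unique extension of degree \<open>m\<close> of the subfield \<open>K\<close> inside \<open>\<Omega>\<close>; it exists and is unique if
  \<open>K\<close> is finite and \<open>\<Omega>\<close> is an algebraic closure of \<open>K\<close>.
\<close>

definition extension_of_degree :: "'k ring \<Rightarrow> nat \<Rightarrow> 'k set \<Rightarrow> 'k set" where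
  "extension_of_degree \<Omega> m K = (THE E. subfield E \<Omega> \<and> K \<subseteq> E \<and> ring.dimension \<Omega> m K E)"

end

theory Submission
  imports Defs
begin

text \<open>
  A finite field has exactly one extension of each degree inside an algebraic closure, the set of
  zeros of \<open>x ^ (q ^ r) - x\<close> (\<open>finite_field_extension\<close>, \<open>finite_field_extension_unique\<close>). So
  \<open>K*_ij\<close> is the extension of degree \<open>m * f_ij\<close> of the residue field of \<open>V_i\<close>, which gives
  consistency at once, and for realizability only ramification indices and residue degrees have to
  be prescribed: a residue field of degree \<open>m * f_ij\<close> inside the closure is \<open>K*_ij\<close>.

  Krull's method prescribes extensions of several valuations to one field: choose for each valuation
  a monic polynomial of the common degree with the wanted factorization, approximate all of them by
  one polynomial \<open>g\<close>, and adjoin a root. It may fail because \<open>g\<close> may be reducible or inseparable.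
  Both are excluded if one of the valuations is to be inert (one extension, unramified, of full
  residue degree), since \<open>g\<close> then has an irreducible and separable reduction
  (\<open>krull_realization\<close>). The factor \<open>m\<close> in the degrees makes room for an inert valuation: the
  field is a tower of two extensions of degree \<open>m\<close>. In the lower one \<open>V_1\<close> gets the data
  \<open>S(V_1)\<close> and every other \<open>V_i\<close> is inert; in the upper one the extensions of \<open>V_1\<close> are inert
  and the extension of each other \<open>V_i\<close> gets the data \<open>S(V_i)\<close>. Residue degrees and ramification
  indices multiply to \<open>m * f_ij\<close> and \<open>e_ij\<close> (\<open>grid_realization\<close>). This is where \<open>n > 1\<close> is
  used.

  At a single valuation with uniformizer \<open>p\<close>, choose \<open>\<alpha>_j \<noteq> 0\<close> of degree \<open>f_j\<close> over the residue
  field and a monic lift \<open>\<phi>_j\<close> of its minimal polynomial. The wanted polynomial is the product over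
  \<open>j\<close> of \<open>\<phi>_j ^ e_j + p\<close>, an Eisenstein polynomial in \<open>\<phi>_j\<close>, taken in the coordinate
  \<open>x / p ^ (j - 1)\<close> and made monic; the different scales keep the factors apart even if their data
  agree. If \<open>\<theta>\<close> is a root of a close \<open>g\<close> and \<open>y_j = \<theta> / p ^ (j - 1)\<close>, then \<open>y_j \<mapsto> \<alpha>_j\<close> is
  a well-defined map on \<open>V[y_j]\<close> by Gauss's lemma (\<open>gauss_kernel\<close>), and \<open>\<phi>_j(y_j) ^ e_j\<close> is
  \<open>p\<close> times a quotient of elements with nonzero image. Hence the localization of \<open>V[y_j]\<close> at the
  kernel is a discrete valuation ring with uniformizer \<open>\<phi>_j(y_j)\<close>, ramification index \<open>e_j\<close> and
  residue field generated by \<open>\<alpha>_j\<close> (locales \<open>localization\<close> and \<open>simple_place_extension\<close>). The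
  values of \<open>\<theta>\<close> distinguish these rings. Every valuation ring of the extension above \<open>V\<close> is one
  of them: in it some \<open>y_j\<close> is integral with \<open>\<phi>_j(y_j)\<close> in the maximal ideal
  (\<open>valuation_ring_hits_root\<close>), and this determines the ring (\<open>valuation_ring_unique\<close>).

  Separability is carried through the tower in the form that, in characteristic \<open>q\<close>, the larger
  field is spanned by its \<open>q\<close>-th powers over the smaller one (\<open>frobenius_spans\<close>). This is
  transitive, holds at an inert step because finite fields are perfect, and forces minimal
  polynomials to have simple roots (\<open>Irr_simple_roots\<close>).
\<close>

section \<open>Frobenius and multiple roots\<close>

lemma (in cring) binomial:
  assumes [simp]: "x \<in> carrier R" "y \<in> carrier R"
  shows "(x \<oplus> y) [^] n = (\<Oplus>k\<in>{..n}. add_pow R (n choose k) (x [^] k \<otimes> y [^] (n - k)))"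
proof (induction n)
  case 0
  then show ?case by simp
next
  case (Suc n)
  define g where "g k = add_pow R (n choose k) (x [^] k \<otimes> y [^] (n - k))" for k
  define a where "a k = add_pow R (n choose k) (x [^] Suc k \<otimes> y [^] (n - k))" for k
  define h where "h k = add_pow R (n choose k) (x [^] k \<otimes> y [^] (Suc n - k))" for k
  have [simp]: "g k \<in> carrier R" "a k \<in> carrier R" "h k \<in> carrier R" for k
    by (simp_all add: g_def a_def h_def)
  have X: "x \<otimes> (\<Oplus>k\<in>{..n}. g k) = (\<Oplus>k\<in>{..n}. a k)"
  proof -
    have "x \<otimes> g k = a k" for k
      by (simp add: g_def a_def add_pow_rdistr m_ac)
    then show ?thesis by (simp add: finsum_rdistr)
  qed
  have Y: "y \<otimes> (\<Oplus>k\<in>{..n}. g k) = (\<Oplus>k\<in>{..n}. h (Suc k)) \<oplus> h 0"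
  proof -
    have "y \<otimes> g k = h k" if "k \<le> n" for k
      using that by (simp add: g_def h_def add_pow_rdistr m_ac Suc_diff_le)
    then have "y \<otimes> (\<Oplus>k\<in>{..n}. g k) = (\<Oplus>k\<in>{..n}. h k)"
      by (subst finsum_rdistr) (auto intro!: finsum_cong')
    also have "\<dots> = (\<Oplus>k\<in>{..Suc n}. h k)"
    proof -
      have "h (Suc n) = \<zero>" by (simp add: h_def binomial_eq_0)
      moreover have "(\<Oplus>k\<in>{..Suc n}. h k) = h (Suc n) \<oplus> (\<Oplus>k\<in>{..n}. h k)"
        by (rule finsum_Suc) auto
      ultimately show ?thesis by simp
    qed
    also have "\<dots> = (\<Oplus>k\<in>{..n}. h (Suc k)) \<oplus> h 0"
      by (subst finsum_Suc2) auto
    finally show ?thesis .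
  qed
  let ?G = "\<lambda>k. add_pow R (Suc n choose k) (x [^] k \<otimes> y [^] (Suc n - k))"
  have G: "?G (Suc k) = a k \<oplus> h (Suc k)" for k
    by (simp add: a_def h_def add.nat_pow_mult)
  have "(\<Oplus>k\<in>{..Suc n}. ?G k) = (\<Oplus>k\<in>{..n}. ?G (Suc k)) \<oplus> ?G 0"
    by (subst finsum_Suc2) auto
  also have "(\<Oplus>k\<in>{..n}. ?G (Suc k)) = (\<Oplus>k\<in>{..n}. a k) \<oplus> (\<Oplus>k\<in>{..n}. h (Suc k))"
    unfolding G by (simp add: finsum_addf)
  also have "?G 0 = h 0" by (simp add: h_def)
  finally have "(\<Oplus>k\<in>{..Suc n}. ?G k) = x \<otimes> (\<Oplus>k\<in>{..n}. g k) \<oplus> y \<otimes> (\<Oplus>k\<in>{..n}. g k)"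
    unfolding X Y by (simp add: a_assoc)
  also have "\<dots> = (x \<oplus> y) \<otimes> (\<Oplus>k\<in>{..n}. g k)"
    by (simp add: l_distr)
  finally show ?case
    using Suc by (simp add: g_def m_comm)
qed

lemma (in cring) add_pow_char:
  assumes "add_pow R (p::nat) \<one> = \<zero>" "x \<in> carrier R" "p dvd c"
  shows "add_pow R c x = \<zero>"
proof -
  from assms(3) obtain d where d: "c = p * d" by blast
  have "add_pow R c x = add_pow R c \<one> \<otimes> x"
    using assms(2) by (simp add: add_pow_ldistr)
  also have "add_pow R c \<one> = add_pow R d (add_pow R p \<one>)"
    unfolding d by (simp add: add.nat_pow_pow mult.commute)
  finally show ?thesis using assms by simp
qed

lemma (in cring) frobenius_add:
  assumes p: "Factorial_Ring.prime (p::nat)" "add_pow R p \<one> = \<zero>" and x: "x \<in> carrier R" and y: "y \<in> carrier R"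
  shows "(x \<oplus> y) [^] p = x [^] p \<oplus> y [^] p"
proof -
  from prime_ge_2_nat[OF p(1)] obtain m where m: "p = Suc (Suc m)"
    by (metis add_2_eq_Suc le_Suc_ex)
  let ?f = "\<lambda>k. add_pow R (p choose k) (x [^] k \<otimes> y [^] (p - k))"
  have f: "?f \<in> A \<rightarrow> carrier R" for A using x y by auto
  have z: "?f (Suc k) = \<zero>" if "k \<le> m" for k
  proof (rule add_pow_char[OF p(2)])
    show "p dvd p choose Suc k"
      by (rule dvd_choose_prime) (use that m p(1) in auto)
  qed (use x y in auto)
  have "(x \<oplus> y) [^] p = (\<Oplus>k\<in>{..p}. ?f k)"
    by (rule binomial[OF x y])
  also have "\<dots> = ?f p \<oplus> (\<Oplus>k\<in>{..Suc m}. ?f k)"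
    using finsum_Suc[OF f, of "Suc m"] m by simp
  also have "(\<Oplus>k\<in>{..Suc m}. ?f k) = (\<Oplus>k\<in>{..m}. ?f (Suc k)) \<oplus> ?f 0"
    by (rule finsum_Suc2[OF f])
  also have "(\<Oplus>k\<in>{..m}. ?f (Suc k)) = \<zero>"
    using z by (intro add.finprod_one_eqI) auto
  finally show ?thesis using x y by simp
qed

lemma (in cring) frobenius_add_pow:
  assumes p: "Factorial_Ring.prime (p::nat)" "add_pow R p \<one> = \<zero>" and x: "x \<in> carrier R" and y: "y \<in> carrier R"
  shows "(x \<oplus> y) [^] (p ^ a) = x [^] (p ^ a) \<oplus> y [^] (p ^ a)"
proof (induction a)
  case 0
  then show ?case using x y by (simp add: nat_pow_eone)
next
  case (Suc a)
  have "(x \<oplus> y) [^] (p ^ Suc a) = ((x \<oplus> y) [^] (p ^ a)) [^] p"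
    using x y by (simp add: nat_pow_pow mult.commute)
  then show ?case
    using Suc x y by (simp add: frobenius_add[OF p] nat_pow_pow mult.commute)
qed

text \<open>Evaluating a polynomial at \<open>x + \<epsilon>\<close> with \<open>\<epsilon> ^ 2 = 0\<close> produces its value and its formal
  derivative at \<open>x\<close> together, so that the product rule for coefficient lists comes for free from
  the evaluation homomorphism.\<close>

definition dual_numbers :: "('a, 'm) ring_scheme \<Rightarrow> ('a \<times> 'a) ring" where
  "dual_numbers R = \<lparr>carrier = carrier R \<times> carrier R,
     monoid.mult = (\<lambda>(a, b) (c, d). (a \<otimes>\<^bsub>R\<^esub> c, a \<otimes>\<^bsub>R\<^esub> d \<oplus>\<^bsub>R\<^esub> b \<otimes>\<^bsub>R\<^esub> c)),
     monoid.one = (\<one>\<^bsub>R\<^esub>, \<zero>\<^bsub>R\<^esub>), ring.zero = (\<zero>\<^bsub>R\<^esub>, \<zero>\<^bsub>R\<^esub>),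
     ring.add = (\<lambda>(a, b) (c, d). (a \<oplus>\<^bsub>R\<^esub> c, b \<oplus>\<^bsub>R\<^esub> d))\<rparr>"

lemma dual_numbers_carrier: "carrier (dual_numbers R) = carrier R \<times> carrier R"
  by (simp add: dual_numbers_def)

lemma dual_numbers_mult:
  "(a, b) \<otimes>\<^bsub>dual_numbers R\<^esub> (c, d) = (a \<otimes>\<^bsub>R\<^esub> c, a \<otimes>\<^bsub>R\<^esub> d \<oplus>\<^bsub>R\<^esub> b \<otimes>\<^bsub>R\<^esub> c)"
  by (simp add: dual_numbers_def)

lemma dual_numbers_add:
  "(a, b) \<oplus>\<^bsub>dual_numbers R\<^esub> (c, d) = (a \<oplus>\<^bsub>R\<^esub> c, b \<oplus>\<^bsub>R\<^esub> d)"
  by (simp add: dual_numbers_def)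

lemma dual_numbers_zero: "\<zero>\<^bsub>dual_numbers R\<^esub> = (\<zero>\<^bsub>R\<^esub>, \<zero>\<^bsub>R\<^esub>)"
  by (simp add: dual_numbers_def)

lemma (in cring) dual_numbers_cring: "cring (dual_numbers R)"
proof (rule cringI)
  show "abelian_group (dual_numbers R)"
  proof (rule abelian_groupI)
    fix x assume "x \<in> carrier (dual_numbers R)"
    then obtain a b where "x = (a, b)" "a \<in> carrier R" "b \<in> carrier R"
      by (auto simp: dual_numbers_def)
    then show "\<exists>y\<in>carrier (dual_numbers R). y \<oplus>\<^bsub>dual_numbers R\<^esub> x = \<zero>\<^bsub>dual_numbers R\<^esub>"
      by (intro bexI[of _ "(\<ominus> a, \<ominus> b)"]) (auto simp: dual_numbers_def l_neg)
  qed (auto simp: dual_numbers_def a_ac)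
  show "Group.comm_monoid (dual_numbers R)"
    by (rule comm_monoidI) (auto simp: dual_numbers_def m_ac l_distr r_distr a_ac)
qed (auto simp: dual_numbers_def l_distr r_distr m_ac a_ac)

fun (in ring) deriv_eval :: "'a list \<Rightarrow> 'a \<Rightarrow> 'a" where
  "deriv_eval [] x = \<zero>"
| "deriv_eval (a # p) x = add_pow R (length p) (a \<otimes> x [^] (length p - 1)) \<oplus> deriv_eval p x"

lemma (in ring) deriv_eval_closed [simp]:
  "set p \<subseteq> carrier R \<Longrightarrow> x \<in> carrier R \<Longrightarrow> deriv_eval p x \<in> carrier R"
  by (induction p) auto

lemma (in cring) dual_eval:
  assumes "set p \<subseteq> carrier R" and x: "x \<in> carrier R"
  shows "ring.eval (dual_numbers R) (map (\<lambda>a. (a, \<zero>)) p) (x, \<one>) = (eval p x, deriv_eval p x)"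
proof -
  interpret D: cring "dual_numbers R" by (rule dual_numbers_cring)
  have pow: "(x, \<one>) [^]\<^bsub>dual_numbers R\<^esub> n = (x [^] n, add_pow R n (x [^] (n - 1)))" for n :: nat
  proof (induction n)
    case 0
    then show ?case by (simp add: dual_numbers_def)
  next
    case (Suc n)
    have "x [^] n \<oplus> add_pow R n (x [^] (n - 1)) \<otimes> x = add_pow R (Suc n) (x [^] n)"
      using x by (cases n) (auto simp: add_pow_ldistr a_comm l_distr)
    then show ?case
      using Suc x by (simp add: dual_numbers_def)
  qed
  show ?thesis
    using assms(1)
  proof (induction p)
    case Nil
    then show ?case by (simp add: dual_numbers_zero)
  next
    case (Cons a p)
    then show ?case
      using x by (simp add: pow dual_numbers_mult dual_numbers_add add_pow_rdistr)
  qed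
qed

text \<open>Over the dual numbers, the square of the value \<open>\<epsilon>\<close> of the linear factor vanishes.\<close>

lemma (in field) deriv_eval_multiple_root:
  assumes p: "p \<in> carrier (poly_ring R)" and a: "a \<in> carrier R"
    and mult: "2 \<le> count (roots p) a"
  shows "eval p a = \<zero>" "deriv_eval p a = \<zero>"
proof -
  interpret D: cring "dual_numbers R" by (rule dual_numbers_cring)
  interpret h: ring_hom_ring R "dual_numbers R" "\<lambda>a. (a, \<zero>)"
  proof (rule ring_hom_ringI2[OF ring_axioms D.ring_axioms])
    show "(\<lambda>a. (a, \<zero>)) \<in> ring_hom R (dual_numbers R)"
      by (rule ring_hom_memI) (auto simp: dual_numbers_def)
  qed
  interpret UP: domain "poly_ring R" by (rule univ_poly_is_domain[OF carrier_is_subring])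
  let ?l = "[\<one>, \<ominus> a]"
  have l: "?l \<in> carrier (poly_ring R)" "set ?l \<subseteq> carrier R"
    using a by (auto simp: univ_poly_carrier[symmetric] polynomial_def)
  have "2 \<le> alg_mult p a" using mult alg_mult_eq_count_roots[OF p] by simp
  then have "?l [^]\<^bsub>poly_ring R\<^esub> (2::nat) pdivides p"
    by (rule le_alg_mult_imp_pdivides[OF a p])
  then obtain r where r: "r \<in> carrier (poly_ring R)"
    and pe: "p = ?l [^]\<^bsub>poly_ring R\<^esub> (2::nat) \<otimes>\<^bsub>poly_ring R\<^esub> r"
    by (auto simp: pdivides_def)
  have rc: "set r \<subseteq> carrier R" using r by (simp add: polynomial_incl univ_poly_carrier)
  have "?l [^]\<^bsub>poly_ring R\<^esub> (2::nat) = ?l \<otimes>\<^bsub>poly_ring R\<^esub> ?l"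
    using UP.nat_pow_Suc[of ?l 1] UP.nat_pow_eone[OF l(1)] by (simp only: Suc_1)
  then have pe': "p = poly_mult (poly_mult ?l ?l) r"
    using pe unfolding univ_poly_mult by simp
  let ?m = "map (\<lambda>a. (a, \<zero>))"
  have pc: "set p \<subseteq> carrier R" using p by (simp add: polynomial_incl univ_poly_carrier)
  have ll: "set (poly_mult ?l ?l) \<subseteq> carrier R" by (rule poly_mult_in_carrier) (use l in auto)
  have mc: "set q \<subseteq> carrier R \<Longrightarrow> set (?m q) \<subseteq> carrier (dual_numbers R)" for q
    unfolding dual_numbers_carrier by auto
  have ac: "(a, \<one>) \<in> carrier (dual_numbers R)" using a unfolding dual_numbers_carrier by simp
  have hm: "D.eval (?m (poly_mult q q')) (a, \<one>) = D.eval (?m q) (a, \<one>) \<otimes>\<^bsub>dual_numbers R\<^esub> D.eval (?m q') (a, \<one>)"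
    if "set q \<subseteq> carrier R" "set q' \<subseteq> carrier R" for q q'
    using h.poly_mult_hom'[OF that] D.eval_normalize[OF mc[OF poly_mult_in_carrier[OF that]] ac]
      D.eval_poly_mult[OF mc[OF that(1)] mc[OF that(2)] ac] by simp
  have "(eval p a, deriv_eval p a) = D.eval (?m p) (a, \<one>)"
    using dual_eval[OF pc a] by simp
  also have "\<dots> = (D.eval (?m ?l) (a, \<one>) \<otimes>\<^bsub>dual_numbers R\<^esub> D.eval (?m ?l) (a, \<one>))
      \<otimes>\<^bsub>dual_numbers R\<^esub> D.eval (?m r) (a, \<one>)"
    unfolding pe' by (simp only: hm[OF ll rc] hm[OF l(2) l(2)])
  also have "D.eval (?m ?l) (a, \<one>) = (\<zero>, \<one>)"
    using dual_eval[OF l(2) a] a by (simp add: r_neg)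
  also have "D.eval (?m r) (a, \<one>) = (eval r a, deriv_eval r a)"
    by (rule dual_eval[OF rc a])
  finally have "(eval p a, deriv_eval p a) = (\<zero>, \<zero>)"
    using eval_in_carrier[OF rc a] deriv_eval_closed[OF rc a]
    unfolding dual_numbers_mult by simp
  then show "eval p a = \<zero>" "deriv_eval p a = \<zero>"
    unfolding prod.inject by blast+
qed

section \<open>Finite subfields of an algebraically closed field\<close>

lemma (in domain) nat_pow_nonzero:
  "x \<in> carrier R \<Longrightarrow> x \<noteq> \<zero> \<Longrightarrow> x [^] (n::nat) \<noteq> \<zero>"
  by (induction n) (auto simp: integral_iff)

lemma (in ring) card_of_dimension:
  assumes K: "subfield K R" "finite K" and d: "dimension n K E"
  shows "finite E \<and> card E = card K ^ n"
  using d
proof (induction n arbitrary: E)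
  case 0
  then have "E = {\<zero>}" by (rule dimension_zero[OF K(1)])
  then show ?case by simp
next
  case (Suc n)
  obtain v E' where v: "v \<in> carrier R" "v \<notin> E'" and E': "dimension n K E'"
    and E: "E = line_extension K v E'"
    using dimension_backwards[OF K(1) Suc.prems] by blast
  note sub = space_subgroup_props[OF K(1) E']
  note Kc = subfieldE(3)[OF K(1)]
  have "E = (\<lambda>(k, u). k \<otimes> v \<oplus> u) ` (K \<times> E')"
    unfolding E by (auto simp: line_extension_mem_iff image_iff Bex_def) blast+
  moreover have "inj_on (\<lambda>(k, u). k \<otimes> v \<oplus> u) (K \<times> E')"
  proof (rule inj_onI, clarify)
    fix k u k' u' assume m: "k \<in> K" "u \<in> E'" "k' \<in> K" "u' \<in> E'" and eq: "k \<otimes> v \<oplus> u = k' \<otimes> v \<oplus> u'"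
    have c: "k \<in> carrier R" "k' \<in> carrier R" "u \<in> carrier R" "u' \<in> carrier R"
      using m Kc sub(1) by auto
    have "(k \<ominus> k') \<otimes> v = u' \<ominus> u"
    proof -
      have "(k \<ominus> k') \<otimes> v = (k \<otimes> v \<oplus> u) \<ominus> k' \<otimes> v \<ominus> u"
        using c v(1) by algebra
      also have "\<dots> = u' \<ominus> u"
        unfolding eq using c v(1) by algebra
      finally show ?thesis .
    qed
    then have inE: "(k \<ominus> k') \<otimes> v \<in> E'"
      using sub(3,4) m by (simp add: a_minus_def)
    have "k \<ominus> k' = \<zero>"
    proof (rule ccontr)
      assume "k \<ominus> k' \<noteq> \<zero>"
      moreover have "k \<ominus> k' \<in> K"
        using m subringE(5,7)[OF subfieldE(1)[OF K(1)]] by (simp add: a_minus_def)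
      ultimately have "v \<in> E'" using sub(6)[of "k \<ominus> k'" v] v(1) inE by auto
      with v(2) show False by simp
    qed
    then have "k = k'" using c by (metis r_right_minus_eq)
    with eq show "k = k' \<and> u = u'" using c v(1) by auto
  qed
  ultimately show ?case
    using Suc.IH[OF E'] K(2) by (auto simp: card_image card_cartesian_product)
qed

lemma (in ring) finite_imp_finite_dimension:
  assumes "subfield K R" "subfield E R" "K \<subseteq> E" "finite E"
  shows "finite_dimension K E"
proof -
  obtain Us where Us: "set Us = E" using finite_list[OF assms(4)] by blast
  have E: "E \<subseteq> carrier R" by (rule subfieldE(3)[OF assms(2)])
  have "subalgebra K E R"
    unfolding subalgebra_def subalgebra_axioms_def
    using subring.axioms(1)[OF subfieldE(1)[OF assms(2)]] assms(3) subringE(6)[OF subfieldE(1)[OF assms(2)]]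
    by auto
  then have "Span K Us = E"
    using subalgebra_Span_incl[OF assms(1), of E Us] Span_base_incl[OF assms(1), of Us] Us E by auto
  with Span_finite_dimension[OF assms(1), of Us] Us E show ?thesis by simp
qed

lemma (in field) finite_subfield_pow_card:
  assumes E: "subfield E R" "finite E" and x: "x \<in> E"
  shows "x [^] card E = x"
proof -
  interpret E: field "R\<lparr>carrier := E\<rparr>" by (rule subfield_iff(2)[OF E(1)])
  have Ec: "E \<subseteq> carrier R" by (rule subfieldE(3)[OF E(1)])
  have pw: "y [^]\<^bsub>R\<lparr>carrier := E\<rparr>\<^esub> n = y [^] n" for y and n :: nat
    by (simp add: nat_pow_def)
  have z: "\<zero> \<in> E" using subringE(2)[OF subfieldE(1)[OF E(1)]] .
  then have pos: "0 < card E" using E(2) card_gt_0_iff by blast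
  show ?thesis
  proof (cases "x = \<zero>")
    case True
    then show ?thesis using pos by (simp add: nat_pow_zero)
  next
    case False
    interpret G: group "Multiplicative_Group.mult_of (R\<lparr>carrier := E\<rparr>)" by (rule E.field_mult_group)
    have "x [^]\<^bsub>Multiplicative_Group.mult_of (R\<lparr>carrier := E\<rparr>)\<^esub> order (Multiplicative_Group.mult_of (R\<lparr>carrier := E\<rparr>)) = \<one>"
      using G.pow_order_eq_1[of x] x False by simp
    then have "x [^] (card E - 1) = \<one>"
      using E.order_mult_of E(2) by (simp add: Multiplicative_Group.nat_pow_mult_of pw order_def)
    then show ?thesis
      using pos nat_pow_Suc[of x "card E - 1"] x Ec by auto
  qed
qed

text \<open>A generator of the cyclic group of units generates the field.\<close>

lemma (in field) finite_subfield_primitive_element: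
  assumes k: "subfield k R" and E: "subfield E R" "finite E" "k \<subseteq> E"
  obtains a where "a \<in> E" "a \<noteq> \<zero>" "simple_extension k a = E"
proof -
  interpret E: field "R\<lparr>carrier := E\<rparr>" by (rule subfield_iff(2)[OF E(1)])
  have pw: "y [^]\<^bsub>R\<lparr>carrier := E\<rparr>\<^esub> n = y [^] n" for y and n :: nat
    by (simp add: nat_pow_def)
  obtain a where a: "a \<in> E" "a \<noteq> \<zero>" "E - {\<zero>} = {a [^] i | i::nat. True}"
    using E.finite_field_mult_group_has_gen E(2) by (auto simp: pw)
  have ac: "a \<in> carrier R" using a(1) subfieldE(3)[OF E(1)] by auto
  have sub: "subring (simple_extension k a) R"
    by (rule simple_extension_is_subring[OF subfieldE(1)[OF k] ac])
  have aa: "a \<in> simple_extension k a"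
    by (rule simple_extension_mem[OF subfieldE(1)[OF k] ac])
  have pa: "a [^] (i::nat) \<in> simple_extension k a" for i
    by (induction i) (use subringE(3,6)[OF sub] aa in auto)
  have "E \<subseteq> simple_extension k a"
  proof
    fix x assume "x \<in> E"
    then have "x = \<zero> \<or> (\<exists>i::nat. x = a [^] i)" using a(3) by auto
    then show "x \<in> simple_extension k a" using pa subringE(2)[OF sub] by auto
  qed
  moreover have "simple_extension k a \<subseteq> E"
    by (rule simple_extension_subring_incl[OF subfieldE(1)[OF E(1)] E(3) a(1)])
  ultimately show thesis using that a(1,2) by blast
qed

lemma (in field) prime_characteristic:
  assumes "0 < d" "add_pow R (d::nat) \<one> = \<zero>"
  obtains p where "Factorial_Ring.prime (p::nat)" "add_pow R p \<one> = \<zero>"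
    "\<And>n. add_pow R (n::nat) \<one> = \<zero> \<longleftrightarrow> p dvd n"
proof -
  define p where "p = (LEAST d. 0 < d \<and> add_pow R (d::nat) \<one> = \<zero>)"
  have p: "0 < p" "add_pow R p \<one> = \<zero>"
    using LeastI[of "\<lambda>d. 0 < d \<and> add_pow R (d::nat) \<one> = \<zero>" d] assms unfolding p_def by auto
  have least: "p \<le> d" if "0 < d" "add_pow R (d::nat) \<one> = \<zero>" for d
    using that Least_le[of "\<lambda>d. 0 < d \<and> add_pow R (d::nat) \<one> = \<zero>" d] unfolding p_def by auto
  have mult: "add_pow R (a * b) \<one> = add_pow R a \<one> \<otimes> add_pow R b \<one>" for a b :: nat
    by (simp add: add_pow_ldistr add.nat_pow_pow mult.commute)
  have iff: "add_pow R n \<one> = \<zero> \<longleftrightarrow> p dvd n" for n :: nat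
  proof
    assume n: "add_pow R n \<one> = \<zero>"
    have "add_pow R n \<one> = add_pow R (p * (n div p)) \<one> \<oplus> add_pow R (n mod p) \<one>"
      by (metis add.nat_pow_mult mult_div_mod_eq one_closed)
    then have "add_pow R (n mod p) \<one> = \<zero>" using n p by (simp add: mult)
    then show "p dvd n" using least[of "n mod p"] p(1) mod_less_divisor[of p n]
      by (meson dvd_eq_mod_eq_0 leD neq0_conv)
  qed (use p in \<open>auto simp: mult elim!: dvdE\<close>)
  have "p \<noteq> 1" using p(2) by auto
  moreover have "p dvd a \<or> p dvd b" if "p dvd a * b" for a b
    using that unfolding iff[symmetric] by (simp add: mult integral_iff)
  ultimately have "Factorial_Ring.prime p"
    using p(1) by (intro Factorial_Ring.primeI prime_elemI) auto
  then show thesis using that p(2) iff by blast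
qed

text \<open>The multiples of \<open>\<one>\<close> form a subfield of prime order, over which \<open>k\<close> is a vector space.\<close>

lemma (in field) card_finite_subfield:
  assumes k: "subfield k R" "finite k"
  obtains p a where "Factorial_Ring.prime (p::nat)" "add_pow R p \<one> = \<zero>" "card k = p ^ a" "0 < a"
proof -
  note sk = subringE[OF subfieldE(1)[OF k(1)]]
  have in_k: "add_pow R (n::nat) \<one> \<in> k" for n
    by (induction n) (use sk in auto)
  have "\<not> inj (\<lambda>n::nat. add_pow R n \<one>)"
    using in_k k(2) finite_imageD[of "\<lambda>n. add_pow R (n::nat) \<one>" UNIV] finite_subset[of "range (\<lambda>n. add_pow R (n::nat) \<one>)" k]
    by auto
  then obtain m n where mn: "m < n" "add_pow R (m::nat) \<one> = add_pow R n \<one>"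
    unfolding inj_def by (metis linorder_neqE_nat)
  have "add_pow R n \<one> = add_pow R m \<one> \<oplus> add_pow R (n - m) \<one>"
    using mn(1) by (simp add: add.nat_pow_mult)
  then have "add_pow R (n - m) \<one> = \<zero>" using mn(2) by simp
  with mn(1) obtain p where p: "Factorial_Ring.prime (p::nat)" "add_pow R p \<one> = \<zero>"
    and iff: "\<And>n. add_pow R (n::nat) \<one> = \<zero> \<longleftrightarrow> p dvd n"
    using prime_characteristic[of "n - m"] by (metis zero_less_diff)
  (* the prime field *)
  define P where "P = (\<lambda>n::nat. add_pow R n \<one>) ` {..<p}"
  have modp: "add_pow R (n::nat) \<one> \<in> P" for n
  proof -
    have "add_pow R n \<one> = add_pow R (p * (n div p)) \<one> \<oplus> add_pow R (n mod p) \<one>"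
      by (metis add.nat_pow_mult mult_div_mod_eq one_closed)
    moreover have "add_pow R (p * (n div p)) \<one> = \<zero>" using iff by simp
    ultimately have "add_pow R n \<one> = add_pow R (n mod p) \<one>" by simp
    then show ?thesis using prime_gt_0_nat[OF p(1)] unfolding P_def by auto
  qed
  have "subring P R"
  proof (rule subringI)
    show "P \<subseteq> carrier R" by (auto simp: P_def)
    show "\<one> \<in> P" using modp[of 1] by simp
    fix x y assume "x \<in> P" "y \<in> P"
    then obtain a b where ab: "x = add_pow R (a::nat) \<one>" "y = add_pow R (b::nat) \<one>" "a < p"
      unfolding P_def by auto
    show "x \<oplus> y \<in> P" using modp[of "a + b"] ab by (simp add: add.nat_pow_mult)
    have "x \<otimes> y = add_pow R (b * a) \<one>" using ab by (simp add: add_pow_ldistr add.nat_pow_pow)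
    then show "x \<otimes> y \<in> P" using modp by simp
    have "add_pow R (p - a) \<one> \<oplus> x = \<zero>" using ab p(2) by (simp add: add.nat_pow_mult)
    then have "\<ominus> x = add_pow R (p - a) \<one>" using ab by (simp add: minus_equality)
    then show "\<ominus> x \<in> P" using modp by simp
  qed
  have "P \<subseteq> k" using in_k by (auto simp: P_def)
  have subP: "subfield P R"
  proof (rule subfieldI'[OF \<open>subring P R\<close>])
    fix x assume x: "x \<in> P - {\<zero>}"
    then have xk: "x \<in> k" "x \<in> carrier R" using \<open>P \<subseteq> k\<close> sk(1) by auto
    have pw: "x [^] (n::nat) \<in> P" for n
      by (induction n) (use x subringE(3,6)[OF \<open>subring P R\<close>] in auto)
    have "card {\<zero>, \<one>} \<le> card k" using sk k(2) by (intro card_mono) auto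
    then have c2: "2 \<le> card k" by simp
    then have "x [^] (card k - 1) \<otimes> x = \<one> \<otimes> x"
      using finite_subfield_pow_card[OF k xk(1)] nat_pow_Suc[of x "card k - 1"] xk by simp
    then have "x [^] (card k - 1) = \<one>" using x xk m_rcancel[of x "x [^] (card k - 1)" \<one>] by auto
    then have "x [^] (card k - 2) \<otimes> x = \<one>" 
      using nat_pow_Suc[of x "card k - 2"] c2 by (metis Suc_1 Suc_diff_Suc Suc_le_lessD One_nat_def)
    then have "inv x = x [^] (card k - 2)" using xk by (simp add: comm_inv_char m_comm)
    then show "inv x \<in> P" using pw by simp
  qed
  have "inj_on (\<lambda>n::nat. add_pow R n \<one>) {..<p}"
  proof (rule linorder_inj_onI)
    fix a b :: nat assume ab: "a < b" "a \<in> {..<p}" "b \<in> {..<p}"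
    show "add_pow R a \<one> \<noteq> add_pow R b \<one>"
    proof
      assume "add_pow R a \<one> = add_pow R b \<one>"
      moreover have "add_pow R b \<one> = add_pow R a \<one> \<oplus> add_pow R (b - a) \<one>"
        using ab(1) by (simp add: add.nat_pow_mult)
      ultimately have "add_pow R (b - a) \<one> = \<zero>" by simp
      then have "p dvd b - a" by (simp add: iff)
      with ab show False using dvd_imp_le[of p "b - a"] by auto
    qed
  qed auto
  then have cP: "card P = p" unfolding P_def by (simp add: card_image)
  obtain a where "dimension a P k"
    using finite_imp_finite_dimension[OF subP k(1) \<open>P \<subseteq> k\<close> k(2)] unfolding finite_dimension_def by blast
  then have c: "card k = p ^ a"
    using card_of_dimension[OF subP] \<open>P \<subseteq> k\<close> k(2) finite_subset cP by metis
  have "card {\<zero>, \<one>} \<le> card k" using sk k(2) by (intro card_mono) auto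
  then have "a \<noteq> 0" using c by (cases a) auto
  with that p c show thesis by blast
qed

text \<open>The coefficient list of \<open>x ^ Q - x\<close> for \<open>Q \<ge> 2\<close>, whose derivative is constant in
  characteristic dividing \<open>Q\<close>.\<close>

lemma (in field) frobenius_polynomial_eval:
  fixes n
  defines "h \<equiv> \<one> # replicate n \<zero> @ [\<ominus> \<one>, \<zero>]"
  shows "h \<in> carrier (poly_ring R)" "x \<in> carrier R \<Longrightarrow> eval h x = x [^] Suc (Suc n) \<ominus> x"
    "x \<in> carrier R \<Longrightarrow> deriv_eval h x = add_pow R (Suc (Suc n)) (x [^] Suc n) \<ominus> \<one>"
proof -
  show "h \<in> carrier (poly_ring R)"
    by (auto simp: h_def univ_poly_carrier[symmetric] polynomial_def)
  assume x: "x \<in> carrier R"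
  have "eval (replicate n \<zero> @ [\<ominus> \<one>, \<zero>]) x = eval [\<ominus> \<one>, \<zero>] x"
    by (rule eval_replicate) (use x in auto)
  then show "eval h x = x [^] Suc (Suc n) \<ominus> x"
    using x by (simp add: h_def l_minus a_minus_def)
  have "deriv_eval (replicate n \<zero> @ [\<ominus> \<one>, \<zero>]) x = \<ominus> \<one>"
    by (induction n) (use x in auto)
  then show "deriv_eval h x = add_pow R (Suc (Suc n)) (x [^] Suc n) \<ominus> \<one>"
    using x by (simp add: h_def a_minus_def)
qed

text \<open>The polynomial \<open>x ^ Q - x\<close> has derivative \<open>-1\<close>, so it has \<open>Q\<close> distinct roots, and the
  roots are the fixed points of a power of the Frobenius endomorphism.\<close>

lemma (in algebraically_closed) finite_field_extension:
  assumes k: "subfield k L" "finite k" and f: "0 < f"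
  defines "E \<equiv> {x \<in> carrier L. x [^] (card k ^ f) = x}"
  shows "subfield E L" "k \<subseteq> E" "finite E" "card E = card k ^ f" "dimension f k E"
proof -
  obtain p a where p: "Factorial_Ring.prime (p::nat)" "add_pow L p \<one> = \<zero>" and ck: "card k = p ^ a" "0 < a"
    using card_finite_subfield[OF k] by metis
  define Q where "Q = card k ^ f"
  have Qp: "Q = p ^ (a * f)" unfolding Q_def ck by (simp add: power_mult)
  have "p dvd Q" using Qp ck(2) f by (simp add: dvd_power)
  have "1 < Q" unfolding Qp using one_less_power[OF prime_gt_1_nat[OF p(1)], of "a * f"] ck(2) f by simp
  then obtain n where n: "Q = Suc (Suc n)" by (metis One_nat_def less_imp_Suc_add add_Suc plus_nat.add_0)
  define h where "h = \<one> # replicate n \<zero> @ [\<ominus> \<one>, \<zero>]"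
  note H = frobenius_polynomial_eval[where n = n, folded h_def]
  have E': "E = {x \<in> carrier L. x [^] Q = x}" by (simp add: E_def Q_def)
  have "E = set_mset (roots h)"
  proof -
    have "set_mset (roots h) = {x. is_root h x}" using roots_mem_iff_is_root[OF H(1)] by auto
    also have "\<dots> = {x \<in> carrier L. eval h x = \<zero>}" by (auto simp: is_root_def h_def)
    also have "\<dots> = {x \<in> carrier L. x [^] Suc (Suc n) = x}"
      using H(2) by (auto simp: simp del: nat_pow_Suc)
    finally show ?thesis unfolding E' n by simp
  qed
  moreover have "count (roots h) x \<le> 1" for x
  proof (rule ccontr)
    assume "\<not> count (roots h) x \<le> 1"
    then have c: "2 \<le> count (roots h) x" by simp
    then have "0 < count (roots h) x" by linarith
    then have "x \<in># roots h" by (simp only: count_greater_zero_iff)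
    then have x: "x \<in> carrier L" using roots_mem_iff_is_root[OF H(1)] by (simp add: is_root_def)
    have "add_pow L (Suc (Suc n)) (x [^] Suc n) = \<zero>"
      by (rule add_pow_char[OF p(2)]) (use x \<open>p dvd Q\<close> n in auto)
    then have "\<ominus> \<one> = \<zero>"
      using deriv_eval_multiple_root(2)[OF H(1) x c] H(3)[OF x] by (simp add: a_minus_def)
    then have "\<one> \<oplus> \<zero> = \<zero>" using r_neg[OF one_closed] by simp
    then show False by simp
  qed
  then have "count (roots h) x = count (mset_set (set_mset (roots h))) x" for x
    by (cases "x \<in># roots h") (auto simp: not_in_iff simp flip: count_greater_zero_iff intro: le_antisym)
  then have "roots h = mset_set (set_mset (roots h))" by (rule multiset_eqI)
  then have "size (roots h) = card (set_mset (roots h))" by (metis size_mset_set)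
  moreover have "size (roots h) = Q"
    using roots_over_carrier[OF H(1)] n by (simp add: splitted_def h_def)
  ultimately show card: "card E = card k ^ f" and "finite E" by (auto simp: Q_def)
  have frob: "(x \<oplus> y) [^] Q = x [^] Q \<oplus> y [^] Q" if "x \<in> carrier L" "y \<in> carrier L" for x y
    unfolding Qp by (rule frobenius_add_pow[OF p that])
  have "subring E L"
  proof (rule subringI)
    fix x y assume xy: "x \<in> E" "y \<in> E"
    then show "x \<oplus> y \<in> E" "x \<otimes> y \<in> E" by (auto simp: E' frob nat_pow_distrib)
    have "x [^] Q \<oplus> (\<ominus> x) [^] Q = \<zero>"
      using frob[of x "\<ominus> x"] xy n by (simp add: E' r_neg nat_pow_zero)
    then have "x \<oplus> (\<ominus> x) [^] Q = \<zero>" using xy by (simp add: E')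
    then have "(\<ominus> x) [^] Q \<oplus> x = \<zero>" using xy by (simp add: E' a_comm)
    then have "\<ominus> x = (\<ominus> x) [^] Q" using xy by (intro minus_equality) (auto simp: E')
    then have "(\<ominus> x) [^] Q = \<ominus> x" by (rule sym)
    then show "\<ominus> x \<in> E" using xy by (simp add: E')
  qed (auto simp: E')
  then show E: "subfield E L"
  proof (rule subfieldI')
    fix x assume "x \<in> E - {\<zero>}"
    then have x: "x \<in> Units L" "x [^] Q = x" by (auto simp: E' field_Units)
    then have xc: "x \<in> carrier L" "inv x \<in> carrier L" by auto
    have "x [^] Q \<otimes> inv x [^] Q = \<one>"
      using nat_pow_distrib[OF xc, of Q] x by simp
    then have "inv x = inv x [^] Q" using x xc by (intro comm_inv_char) auto
    then show "inv x \<in> E" using xc by (simp add: E')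
  qed
  show kE: "k \<subseteq> E"
  proof
    fix x assume x: "x \<in> k"
    then have xc: "x \<in> carrier L" using subfieldE(3)[OF k(1)] by auto
    have "x [^] (card k ^ f) = x"
    proof (induction f)
      case (Suc f)
      then show ?case using xc finite_subfield_pow_card[OF k x]
        by (simp add: nat_pow_pow[symmetric] mult.commute)
    qed (use xc in simp)
    then show "x \<in> E" using xc by (simp add: E_def)
  qed
  obtain d where d: "dimension d k E"
    using finite_imp_finite_dimension[OF k(1) E kE \<open>finite E\<close>] unfolding finite_dimension_def by blast
  have "card k ^ d = card k ^ f" using card_of_dimension[OF k d] card by simp
  moreover have "1 < card k" unfolding ck(1) by (rule one_less_power[OF prime_gt_1_nat[OF p(1)] ck(2)])
  ultimately have "d = f" by (simp add: power_inject_exp)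
  with d show "dimension f k E" by simp
qed

lemma (in algebraically_closed) finite_field_extension_unique:
  assumes k: "subfield k L" "finite k" and f: "0 < f"
    and E: "subfield E L" "dimension f k E"
  shows "E = {x \<in> carrier L. x [^] (card k ^ f) = x}"
proof -
  note X = finite_field_extension[OF k f]
  have c: "finite E" "card E = card k ^ f" using card_of_dimension[OF k E(2)] by auto
  have "E \<subseteq> {x \<in> carrier L. x [^] (card k ^ f) = x}"
    using finite_subfield_pow_card[OF E(1) c(1)] c(2) subfieldE(3)[OF E(1)] by auto
  then show ?thesis using c X(3,4) by (simp add: card_subset_eq)
qed

lemma (in algebraically_closed) infinite_if_finite_subfield:
  assumes k: "subfield k L" "finite k"
  shows "infinite (carrier L)"
proof
  assume fin: "finite (carrier L)"
  note X = finite_field_extension[OF carrier_is_subfield fin, of 2]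
  have "card (carrier L) ^ 2 \<le> card (carrier L)"
    using X(3,4) fin by (metis (no_types, lifting) card_mono mem_Collect_eq subsetI zero_less_numeral)
  moreover have "card {\<zero>, \<one>} \<le> card (carrier L)" using fin by (intro card_mono) auto
  ultimately show False by (simp add: power2_eq_square)
qed

text \<open>Finite fields are perfect: the Frobenius map is injective, hence surjective, on the finite field
  \<open>k(a ^ p)\<close>, and it is injective on all of \<open>R\<close>.\<close>

lemma (in field) simple_extension_frobenius:
  assumes k: "subfield k R" "finite k" and a: "a \<in> carrier R" "(algebraic over k) a"
    and p: "Factorial_Ring.prime (p::nat)" "add_pow R p \<one> = \<zero>"
  shows "a \<in> simple_extension k (a [^] p)"
proof -
  define E where "E = simple_extension k (a [^] p)"
  have fin: "finite (simple_extension k a)"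
    using card_of_dimension[OF k dimension_simple_extension[OF k(1) a]] by blast
  have sub: "subfield (simple_extension k a) R"
    using simple_extension_is_subfield[OF k(1) a(1)] a(2) by simp
  have pw: "x [^] (n::nat) \<in> H" if "subring H R" "x \<in> H" for x H n
    using that subringE(3,6)[OF that(1)] by (induction n) auto
  have "E \<subseteq> simple_extension k a"
    unfolding E_def
    using simple_extension_subring_incl[OF subfieldE(1)[OF sub]] simple_extension_incl[OF subfieldE(3)[OF k(1)] a(1)]
      pw[OF subfieldE(1)[OF sub] simple_extension_mem[OF subfieldE(1)[OF k(1)] a(1)]] by blast
  then have finE: "finite E" using fin finite_subset by blast
  have sE: "subring E R"
    unfolding E_def by (rule simple_extension_is_subring[OF subfieldE(1)[OF k(1)]]) (use a in simp)
  have inj: "x = y" if "x \<in> carrier R" "y \<in> carrier R" "x [^] p = y [^] p" for x y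
  proof -
    have "x [^] p = (x \<ominus> y) [^] p \<oplus> y [^] p"
    proof -
      have "(x \<ominus> y) \<oplus> y = x" using that by algebra
      then show ?thesis using frobenius_add[OF p, of "x \<ominus> y" y] that by simp
    qed
    then have "(x \<ominus> y) [^] p = \<zero>" using that by simp
    then have "x \<ominus> y = \<zero>" using that nat_pow_nonzero[of "x \<ominus> y" p] by auto
    then show ?thesis using r_right_minus_eq[OF that(1,2)] by blast
  qed
  have img: "(\<lambda>x. x [^] p) ` E = E"
  proof (rule endo_inj_surj[OF finE])
    show "(\<lambda>x. x [^] p) ` E \<subseteq> E" using pw[OF sE] by auto
    show "inj_on (\<lambda>x. x [^] p) E" using inj subringE(1)[OF sE] by (auto intro!: inj_onI)
  qed
  have "a [^] p \<in> E"
    unfolding E_def by (rule simple_extension_mem[OF subfieldE(1)[OF k(1)]]) (use a in simp)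
  then have "a [^] p \<in> (\<lambda>x. x [^] p) ` E" unfolding img .
  then obtain g where g: "g \<in> E" "a [^] p = g [^] p" by (rule imageE)
  then have "a = g" using inj[of a g] a(1) subringE(1)[OF sE] by blast
  then show ?thesis using g(1) unfolding E_def by simp
qed

section \<open>Discrete valuations and weak approximation\<close>

definition valuation_on :: "('a, 'm) ring_scheme \<Rightarrow> 'a set \<Rightarrow> ('a \<Rightarrow> int) \<Rightarrow> bool" where
  "valuation_on R K v \<longleftrightarrow> v ` (K - {\<zero>\<^bsub>R\<^esub>}) = UNIV \<and>
     (\<forall>x \<in> K - {\<zero>\<^bsub>R\<^esub>}. \<forall>y \<in> K - {\<zero>\<^bsub>R\<^esub>}. v (x \<otimes>\<^bsub>R\<^esub> y) = v x + v y) \<and>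
     (\<forall>x \<in> K - {\<zero>\<^bsub>R\<^esub>}. \<forall>y \<in> K - {\<zero>\<^bsub>R\<^esub>}.
        x \<oplus>\<^bsub>R\<^esub> y \<noteq> \<zero>\<^bsub>R\<^esub> \<longrightarrow> min (v x) (v y) \<le> v (x \<oplus>\<^bsub>R\<^esub> y))"

text \<open>The value of a valuation at zero is arbitrary; zero is treated as having infinite value.\<close>

definition val_ge :: "('a, 'm) ring_scheme \<Rightarrow> 'a set \<Rightarrow> ('a \<Rightarrow> int) \<Rightarrow> int \<Rightarrow> 'a set" where
  "val_ge R K v n = {x \<in> K. x = \<zero>\<^bsub>R\<^esub> \<or> n \<le> v x}"

locale valued_field = field R for R (structure) +
  fixes K :: "'a set" and v :: "'a \<Rightarrow> int"
  assumes K: "subfield K R" and v: "valuation_on R K v"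
begin

lemma K_carrier: "x \<in> K \<Longrightarrow> x \<in> carrier R"
  using subfieldE(3)[OF K] by auto

lemma K_closed [simp, intro]:
  "\<zero> \<in> K" "\<one> \<in> K" "x \<in> K \<Longrightarrow> y \<in> K \<Longrightarrow> x \<oplus> y \<in> K" "x \<in> K \<Longrightarrow> y \<in> K \<Longrightarrow> x \<otimes> y \<in> K"
  "x \<in> K \<Longrightarrow> \<ominus> x \<in> K"
  using subringE[OF subfieldE(1)[OF K]] by auto

lemma K_minus [simp, intro]: "x \<in> K \<Longrightarrow> y \<in> K \<Longrightarrow> x \<ominus> y \<in> K"
  by (simp add: a_minus_def)

lemma K_pow [simp, intro]: "x \<in> K \<Longrightarrow> x [^] (n::nat) \<in> K"
  by (induction n) auto

lemma K_inv: "x \<in> K \<Longrightarrow> x \<noteq> \<zero> \<Longrightarrow> inv x \<in> K \<and> inv x \<noteq> \<zero> \<and> x \<otimes> inv x = \<one> \<and> inv x \<otimes> x = \<one>"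
  using subfield_m_inv[OF K, of x] by auto

lemma v_surj: obtains x where "x \<in> K" "x \<noteq> \<zero>" "v x = n"
proof -
  have "n \<in> v ` (K - {\<zero>})" using v unfolding valuation_on_def by simp
  then show thesis using that by blast
qed

lemma v_mult: "x \<in> K \<Longrightarrow> x \<noteq> \<zero> \<Longrightarrow> y \<in> K \<Longrightarrow> y \<noteq> \<zero> \<Longrightarrow> v (x \<otimes> y) = v x + v y"
  using v unfolding valuation_on_def by auto

lemma mult_nonzero: "x \<in> K \<Longrightarrow> x \<noteq> \<zero> \<Longrightarrow> y \<in> K \<Longrightarrow> y \<noteq> \<zero> \<Longrightarrow> x \<otimes> y \<noteq> \<zero>"
  using K_carrier by (simp add: integral_iff)

lemma v_add: "x \<in> K \<Longrightarrow> x \<noteq> \<zero> \<Longrightarrow> y \<in> K \<Longrightarrow> y \<noteq> \<zero> \<Longrightarrow> x \<oplus> y \<noteq> \<zero> \<Longrightarrow> min (v x) (v y) \<le> v (x \<oplus> y)"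
  using v unfolding valuation_on_def by auto

lemma v_one [simp]: "v \<one> = 0"
  using v_mult[of \<one> \<one>] by simp

lemma v_inv: "x \<in> K \<Longrightarrow> x \<noteq> \<zero> \<Longrightarrow> v (inv x) = - v x"
  using v_mult[of x "inv x"] K_inv[of x] by simp

lemma v_neg: "x \<in> K \<Longrightarrow> x \<noteq> \<zero> \<Longrightarrow> v (\<ominus> x) = v x"
proof -
  assume x: "x \<in> K" "x \<noteq> \<zero>"
  have z: "\<ominus> \<one> \<noteq> \<zero>" using r_neg[OF one_closed] by auto
  have "v (\<ominus> \<one> \<otimes> \<ominus> \<one>) = 2 * v (\<ominus> \<one>)" using v_mult[of "\<ominus> \<one>" "\<ominus> \<one>"] z by simp
  then have "v (\<ominus> \<one>) = 0" by (simp add: l_minus)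
  then show ?thesis using v_mult[of "\<ominus> \<one>" x] z x K_carrier by (simp add: l_minus)
qed

lemma v_pow: "x \<in> K \<Longrightarrow> x \<noteq> \<zero> \<Longrightarrow> x [^] (n::nat) \<noteq> \<zero> \<and> v (x [^] n) = int n * v x"
proof (induction n)
  case (Suc n)
  then show ?case using v_mult[of "x [^] n" x] mult_nonzero[of "x [^] n" x] by (simp add: algebra_simps)
qed simp

lemma v_add_less:
  assumes x: "x \<in> K" "x \<noteq> \<zero>" and y: "y \<in> K" "y = \<zero> \<or> v x < v y"
  shows "x \<oplus> y \<noteq> \<zero> \<and> v (x \<oplus> y) = v x"
proof (cases "y = \<zero>")
  case False
  have c: "x \<in> carrier R" "y \<in> carrier R" using x y K_carrier by auto
  have nz: "x \<oplus> y \<noteq> \<zero>"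
  proof
    assume "x \<oplus> y = \<zero>"
    then have "\<ominus> y = x" using c by (simp add: a_comm minus_equality)
    then show False using v_neg[of y] y False by auto
  qed
  have xe: "(x \<oplus> y) \<oplus> \<ominus> y = x" using c by algebra
  have "\<ominus> y \<noteq> \<zero>" using False c by (metis minus_minus minus_zero)
  then have "min (v (x \<oplus> y)) (v y) \<le> v x"
    using v_add[of "x \<oplus> y" "\<ominus> y"] nz x y v_neg[of y] False xe by simp
  moreover have "v x \<le> v (x \<oplus> y)" using v_add[of x y] x y nz False by auto
  ultimately show ?thesis using nz y False by auto
qed (use x K_carrier in auto)

abbreviation "ge \<equiv> val_ge R K v"

lemma ge_K: "x \<in> ge n \<Longrightarrow> x \<in> K"
  by (simp add: val_ge_def)

lemma ge_zero [simp]: "\<zero> \<in> ge n"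
  by (simp add: val_ge_def)

lemma ge_add: "x \<in> ge n \<Longrightarrow> y \<in> ge n \<Longrightarrow> x \<oplus> y \<in> ge n"
  unfolding val_ge_def using v_add[of x y] K_carrier by (cases "x = \<zero> \<or> y = \<zero> \<or> x \<oplus> y = \<zero>") auto

lemma ge_neg: "x \<in> ge n \<Longrightarrow> \<ominus> x \<in> ge n"
  unfolding val_ge_def using v_neg[of x] by (cases "x = \<zero>") auto

lemma ge_mult: "x \<in> ge n \<Longrightarrow> y \<in> ge m \<Longrightarrow> x \<otimes> y \<in> ge (n + m)"
  unfolding val_ge_def using v_mult[of x y] K_carrier by (cases "x = \<zero> \<or> y = \<zero>") auto

lemma ge_mono: "x \<in> ge n \<Longrightarrow> m \<le> n \<Longrightarrow> x \<in> ge m"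
  unfolding val_ge_def by auto

lemma ge_mult_nonneg: "x \<in> ge n \<Longrightarrow> y \<in> ge 0 \<Longrightarrow> x \<otimes> y \<in> ge n"
  using ge_mult[of x n y 0] by simp

lemma ge_0_subring: "subring (ge 0) R"
proof (rule subringI)
  show "ge 0 \<subseteq> carrier R" using ge_K K_carrier by auto
  show "\<one> \<in> ge 0" by (simp add: val_ge_def)
qed (auto intro: ge_add ge_neg ge_mult_nonneg)

text \<open>Powers of an element of negative value have arbitrarily negative values, so together with
  the valuation ring they generate \<open>K\<close>.\<close>

lemma maximal_subring:
  assumes U: "subring U R" "ge 0 \<subseteq> U" "U \<subseteq> K" "U \<noteq> K"
  shows "U = ge 0"
proof (rule ccontr)
  assume "U \<noteq> ge 0"
  then obtain u where u: "u \<in> U" "u \<notin> ge 0" using U(2) by auto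
  then have uK: "u \<in> K" "u \<noteq> \<zero>" "v u < 0" using U(3) by (auto simp: val_ge_def)
  have up: "u [^] (n::nat) \<in> U" for n
    by (induction n) (use subringE(3,6)[OF U(1)] u in auto)
  have "z \<in> U" if z: "z \<in> K" for z
  proof (cases "z = \<zero>")
    case False
    define n where "n = nat \<bar>v z\<bar>"
    note un = v_pow[OF uK(1,2), of n]
    have i: "inv (u [^] n) \<in> K" "inv (u [^] n) \<noteq> \<zero>" "inv (u [^] n) \<otimes> u [^] n = \<one>"
      using K_inv[of "u [^] n"] un uK by auto
    have "v (z \<otimes> inv (u [^] n)) = v z - int n * v u"
      using v_mult[OF z False i(1,2)] v_inv[of "u [^] n"] un uK by simp
    moreover have "- v z \<le> int n * (- v u)"
    proof -
      have "- v z \<le> int n" by (simp add: n_def)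
      moreover have "int n * 1 \<le> int n * (- v u)" using uK(3) by (intro mult_left_mono) auto
      ultimately show ?thesis by linarith
    qed
    ultimately have "z \<otimes> inv (u [^] n) \<in> ge 0" using z i by (simp add: val_ge_def)
    then have "(z \<otimes> inv (u [^] n)) \<otimes> u [^] n \<in> U" using U(2) up subringE(6)[OF U(1)] by blast
    moreover have "(z \<otimes> inv (u [^] n)) \<otimes> u [^] n = z"
      using i z uK K_carrier by (simp add: m_assoc)
    ultimately show ?thesis by simp
  qed (use subringE(2)[OF U(1)] in simp)
  then show False using U(3,4) by auto
qed

lemma ge_0_neq_K: "ge 0 \<noteq> K"
proof -
  obtain x where "x \<in> K" "x \<noteq> \<zero>" "v x = -1" using v_surj .
  then have "x \<notin> ge 0" by (simp add: val_ge_def)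
  then show ?thesis using \<open>x \<in> K\<close> by blast
qed

lemma v_one_add:
  assumes "x \<in> K" "x \<noteq> \<zero>"
  shows "v x < 0 \<Longrightarrow> \<one> \<oplus> x \<noteq> \<zero> \<and> v (\<one> \<oplus> x) = v x"
    "0 < v x \<Longrightarrow> \<one> \<oplus> x \<noteq> \<zero> \<and> v (\<one> \<oplus> x) = 0"
  using v_add_less[of x \<one>] v_add_less[of \<one> x] assms K_carrier by (auto simp: a_comm)

lemma unit_ratio:
  assumes x: "x \<in> K" "x \<noteq> \<zero>"
  shows "v x < 0 \<Longrightarrow> v (x \<otimes> inv (\<one> \<oplus> x)) = 0"
    "0 < v x \<Longrightarrow> v (x \<otimes> inv (\<one> \<oplus> x)) = v x"
proof -
  have "v (x \<otimes> inv (\<one> \<oplus> x)) = v x - v (\<one> \<oplus> x)" if "\<one> \<oplus> x \<noteq> \<zero>"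
    using v_mult[OF x, of "inv (\<one> \<oplus> x)"] K_inv[of "\<one> \<oplus> x"] v_inv[of "\<one> \<oplus> x"] x that by simp
  then show "v x < 0 \<Longrightarrow> v (x \<otimes> inv (\<one> \<oplus> x)) = 0" "0 < v x \<Longrightarrow> v (x \<otimes> inv (\<one> \<oplus> x)) = v x"
    using v_one_add[OF x] by auto
qed

end

lemma (in field) valued_fieldI:
  "subfield K R \<Longrightarrow> valuation_on R K v \<Longrightarrow> valued_field R K v"
  by (simp add: valued_field_def valued_field_axioms_def field_axioms)

text \<open>Discrete valuation rings of \<open>K\<close> are maximal subrings, so neither of two distinct ones contains
  the other.\<close>

lemma (in field) separating_pair:
  assumes "subfield K R" "valuation_on R K v" "valuation_on R K w" "val_ge R K v 0 \<noteq> val_ge R K w 0"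
  shows "\<exists>x\<in>K. x \<noteq> \<zero> \<and> v x < 0 \<and> 0 < w x"
proof -
  interpret v: valued_field R K v by (rule valued_fieldI[OF assms(1,2)])
  interpret w: valued_field R K w by (rule valued_fieldI[OF assms(1,3)])
  have "\<not> v.ge 0 \<subseteq> w.ge 0"
    using v.maximal_subring[OF w.ge_0_subring _ _ w.ge_0_neq_K] assms(4) w.ge_K by auto
  then obtain a where "a \<in> v.ge 0" "a \<notin> w.ge 0" by blast
  then have a: "a \<in> K" "a \<noteq> \<zero>" "0 \<le> v a" "w a < 0" by (auto simp: val_ge_def)
  have "\<not> w.ge 0 \<subseteq> v.ge 0"
    using w.maximal_subring[OF v.ge_0_subring _ _ v.ge_0_neq_K] assms(4) v.ge_K by auto
  then obtain b where "b \<in> w.ge 0" "b \<notin> v.ge 0" by blast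
  then have b: "b \<in> K" "b \<noteq> \<zero>" "0 \<le> w b" "v b < 0" by (auto simp: val_ge_def)
  have i: "inv a \<in> K" "inv a \<noteq> \<zero>" using v.K_inv[OF a(1,2)] by auto
  have "v (b \<otimes> inv a) < 0" "0 < w (b \<otimes> inv a)"
    using v.v_mult[OF b(1,2) i] w.v_mult[OF b(1,2) i] v.v_inv[OF a(1,2)] w.v_inv[OF a(1,2)] a(3,4) b(3,4)
    by linarith+
  then show ?thesis using v.mult_nonzero[OF b(1,2) i] b(1) i(1) by blast
qed

text \<open>In the induction step \<open>x\<close> separates \<open>i\<close> from \<open>J\<close> and \<open>y\<close> separates \<open>i\<close> from \<open>k\<close>.
  According to the sign of the value of \<open>x\<close> at \<open>k\<close>, one of \<open>x\<close>, \<open>x ^ r y\<close> and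
  \<open>x ^ r y / (1 + x ^ r)\<close> does both, where \<open>r\<close> outweighs the values of \<open>y\<close> on \<open>J\<close>.\<close>

lemma (in field) separating_element:
  assumes K: "subfield K R" and fin: "finite J"
    and val: "\<And>j. j \<in> insert i J \<Longrightarrow> valuation_on R K (v j)"
    and neq: "\<And>j. j \<in> J \<Longrightarrow> val_ge R K (v i) 0 \<noteq> val_ge R K (v j) 0"
  shows "\<exists>x\<in>K. x \<noteq> \<zero> \<and> v i x < 0 \<and> (\<forall>j\<in>J. 0 < v j x)"
  using fin val neq
proof (induction J)
  case empty
  interpret valued_field R K "v i" by (rule valued_fieldI[OF K empty(1)]) simp
  obtain x where "x \<in> K" "x \<noteq> \<zero>" "v i x = -1" using v_surj .
  then show ?case by auto
next
  case (insert k J)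
  have V: "valued_field R K (v j)" if "j \<in> insert i (insert k J)" for j
    by (rule valued_fieldI[OF K insert.prems(1)[OF that]])
  interpret i: valued_field R K "v i" by (rule V) simp
  interpret k: valued_field R K "v k" by (rule V) simp
  obtain x where x: "x \<in> K" "x \<noteq> \<zero>" "v i x < 0" "\<forall>j\<in>J. 0 < v j x"
    using insert.IH insert.prems by auto
  obtain y where y: "y \<in> K" "y \<noteq> \<zero>" "v i y < 0" "0 < v k y"
    using separating_pair[OF K, of "v i" "v k"] insert.prems by auto
  define r where "r = Suc (nat (\<Sum>j\<in>J. \<bar>v j y\<bar>))"
  have rj: "0 < int r * v j x + v j y" if "j \<in> J" for j
  proof -
    have "\<bar>v j y\<bar> \<le> (\<Sum>j\<in>J. \<bar>v j y\<bar>)" using that insert.hyps by (intro member_le_sum) auto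
    then have "\<bar>v j y\<bar> < int r" by (simp add: r_def)
    moreover have "int r * 1 \<le> int r * v j x" using x(4) that by (intro mult_left_mono) auto
    ultimately show ?thesis by linarith
  qed
  have r0: "0 < int r" unfolding r_def by (rule of_nat_0_less_iff[THEN iffD2]) simp
  define z where "z = x [^] r"
  have z: "z \<in> K" "z \<noteq> \<zero>" using x i.v_pow[of x r] by (auto simp: z_def)
  have vz: "v j z = int r * v j x" if "j \<in> insert i (insert k J)" for j
    using valued_field.v_pow[OF V[OF that] x(1,2), of r] by (simp add: z_def)
  have viz: "v i z < 0" using vz[of i] x(3) r0 by (simp add: mult_pos_neg)
  consider "0 < v k x" | "v k x = 0" | "v k x < 0" by linarith
  then show ?case
  proof cases
    case 1
    then show ?thesis using x by auto
  next
    case 2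
    have "v j (z \<otimes> y) = int r * v j x + v j y" if "j \<in> insert i (insert k J)" for j
      using valued_field.v_mult[OF V[OF that] z y(1,2)] vz[OF that] by simp
    moreover have "v i z + v i y < 0" using viz y(3) by simp
    ultimately show ?thesis
      using i.mult_nonzero[OF z y(1,2)] z y 2 rj vz[of i]
      by (intro bexI[of _ "z \<otimes> y"]) auto
  next
    case 3
    have n: "\<one> \<oplus> z \<noteq> \<zero>" using i.v_one_add(1)[OF z viz] by simp
    define u where "u = z \<otimes> inv (\<one> \<oplus> z)"
    have u: "u \<in> K" "u \<noteq> \<zero>" using i.K_inv[of "\<one> \<oplus> z"] n z i.mult_nonzero[of z "inv (\<one> \<oplus> z)"]
      by (auto simp: u_def)
    have "v j (u \<otimes> y) = v j u + v j y" if "j \<in> insert i (insert k J)" for j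
      using valued_field.v_mult[OF V[OF that] u y(1,2)] by simp
    moreover have "v i u = 0" using i.unit_ratio(1)[OF z viz] by (simp add: u_def)
    moreover have "v k z < 0" using vz[of k] 3 r0 by (simp add: mult_pos_neg)
    then have "v k u = 0" using k.unit_ratio(1)[OF z] by (simp add: u_def)
    moreover have "v j u = int r * v j x" if "j \<in> J" for j
    proof -
      have "0 < v j z" using vz[of j] that x(4) r0 by simp
      then show ?thesis
        using valued_field.unit_ratio(2)[OF V z] that vz[of j] by (auto simp: u_def)
    qed
    ultimately show ?thesis
      using i.mult_nonzero[OF u y(1,2)] u y rj
      by (intro bexI[of _ "u \<otimes> y"]) auto
  qed
qed

text \<open>If \<open>y\<close> has negative value at \<open>i\<close> and positive value at the other places, then for large \<open>r\<close>
  the element \<open>y ^ r / (1 + y ^ r)\<close> is close to \<open>1\<close> at \<open>i\<close> and close to \<open>0\<close> elsewhere.\<close>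

lemma (in field) weak_approximation:
  fixes N :: int
  assumes K: "subfield K R" and fin: "finite I"
    and val: "\<And>i. i \<in> I \<Longrightarrow> valuation_on R K (v i)"
    and neq: "inj_on (\<lambda>i. val_ge R K (v i) 0) I"
    and a: "\<And>i. i \<in> I \<Longrightarrow> a i \<in> K"
  shows "\<exists>x\<in>K. \<forall>i\<in>I. x \<ominus> a i \<in> val_ge R K (v i) N"
  using fin val neq a
proof (induction I)
  case empty
  then show ?case using subringE(2)[OF subfieldE(1)[OF K]] by auto
next
  case (insert i J)
  have V: "valued_field R K (v j)" if "j \<in> insert i J" for j
    by (rule valued_fieldI[OF K insert.prems(1)[OF that]])
  interpret i: valued_field R K "v i" by (rule V) simp
  obtain x where x: "x \<in> K" "\<forall>j\<in>J. x \<ominus> a j \<in> val_ge R K (v j) N"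
    using insert.IH insert.prems by auto
  define c where "c = a i \<ominus> x"
  have aK: "a i \<in> K" using insert.prems by simp
  have c: "c \<in> K" using aK x by (simp add: c_def)
  have "\<exists>y\<in>K. y \<noteq> \<zero> \<and> v i y < 0 \<and> (\<forall>j\<in>J. 0 < v j y)"
  proof (rule separating_element[OF K insert.hyps(1)])
    show "val_ge R K (v i) 0 \<noteq> val_ge R K (v j) 0" if "j \<in> J" for j
      using insert.prems(2) insert.hyps(2) that unfolding inj_on_def by auto
  qed (use insert.prems in auto)
  then obtain y where y: "y \<in> K" "y \<noteq> \<zero>" "v i y < 0" "\<forall>j\<in>J. 0 < v j y" by auto
  define r where "r = Suc (nat (\<bar>N\<bar> + (\<Sum>j\<in>insert i J. \<bar>v j c\<bar>)))"
  have rj: "N - v j c \<le> int r" if "j \<in> insert i J" for j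
  proof -
    have "\<bar>v j c\<bar> \<le> (\<Sum>j\<in>insert i J. \<bar>v j c\<bar>)" using that insert.hyps by (intro member_le_sum) auto
    then show ?thesis unfolding r_def by linarith
  qed
  have r0: "0 < int r" unfolding r_def by (rule of_nat_0_less_iff[THEN iffD2]) simp
  define z where "z = y [^] r"
  have z: "z \<in> K" "z \<noteq> \<zero>" using y i.v_pow[of y r] by (auto simp: z_def)
  have vz: "v j z = int r * v j y" if "j \<in> insert i J" for j
    using valued_field.v_pow[OF V[OF that] y(1,2), of r] by (simp add: z_def)
  have viz: "v i z < 0" using vz[of i] y(3) r0 by (simp add: mult_pos_neg)
  have n: "\<one> \<oplus> z \<noteq> \<zero>" using i.v_one_add(1)[OF z viz] by simp
  define q where "q = inv (\<one> \<oplus> z)"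
  have q: "q \<in> K" "q \<noteq> \<zero>" "(\<one> \<oplus> z) \<otimes> q = \<one>"
    using i.K_inv[of "\<one> \<oplus> z"] n z by (auto simp: q_def)
  define u where "u = z \<otimes> q"
  have u: "u \<in> K" "u \<noteq> \<zero>" using q z i.mult_nonzero[of z q] by (auto simp: u_def)
  have cc: "z \<in> carrier R" "q \<in> carrier R" "c \<in> carrier R" "x \<in> carrier R" "a i \<in> carrier R"
    using q z c x aK i.K_carrier by auto
  have q_eq: "q = \<one> \<ominus> u"
  proof -
    have "q = (\<one> \<oplus> z) \<otimes> q \<ominus> u" unfolding u_def using cc by algebra
    then show ?thesis using q(3) by simp
  qed
  have vq: "int r \<le> v i q"
  proof -
    have "v i q = int r * (- v i y)"
      using i.v_one_add(1)[OF z viz] i.v_inv[of "\<one> \<oplus> z"] n z vz[of i] by (simp add: q_def)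
    moreover have "int r * 1 \<le> int r * (- v i y)" using y(3) by (intro mult_left_mono) auto
    ultimately show ?thesis by simp
  qed
  have vu: "int r \<le> v j u" if "j \<in> J" for j
  proof -
    have "0 < v j z" using vz[of j] that y(4) r0 by simp
    then have "v j u = int r * v j y"
      using valued_field.unit_ratio(2)[OF V z] that vz[of j] by (auto simp: u_def q_def)
    moreover have "int r * 1 \<le> int r * v j y" using y(4) that by (intro mult_left_mono) auto
    ultimately show ?thesis by simp
  qed
  show ?case
  proof (intro bexI ballI)
    show "x \<oplus> c \<otimes> u \<in> K" using x c u by simp
    fix j assume j: "j \<in> insert i J"
    interpret j: valued_field R K "v j" by (rule V[OF j])
    show "x \<oplus> c \<otimes> u \<ominus> a j \<in> val_ge R K (v j) N"
    proof (cases "j = i")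
      case True
      have "x \<oplus> c \<otimes> u \<ominus> a i = \<ominus> (c \<otimes> (\<one> \<ominus> u))"
        unfolding c_def using cc u i.K_carrier by algebra
      also have "\<dots> = \<ominus> (c \<otimes> q)" using q_eq by simp
      also have "\<dots> \<in> i.ge N"
      proof (cases "c = \<zero>")
        case False
        then have "c \<otimes> q \<in> i.ge N"
          using i.v_mult[OF c False q(1,2)] vq rj[of i] c q by (simp add: val_ge_def)
        then show ?thesis by (rule i.ge_neg)
      qed (use cc in simp)
      finally show ?thesis using True by simp
    next
      case False
      then have jJ: "j \<in> J" using j by simp
      have ajK: "a j \<in> carrier R" using insert.prems(3)[OF j] i.K_carrier by auto
      have "x \<oplus> c \<otimes> u \<ominus> a j = (x \<ominus> a j) \<oplus> c \<otimes> u"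
        using cc ajK u i.K_carrier by algebra
      moreover have "c \<otimes> u \<in> j.ge N"
      proof (cases "c = \<zero>")
        case False
        then show ?thesis using j.v_mult[OF c False u] vu[OF jJ] rj[OF j] c u by (simp add: val_ge_def)
      qed (use u i.K_carrier in simp)
      ultimately show ?thesis using x(2) jJ j.ge_add by simp
    qed
  qed
qed

section \<open>Localization of a ring at a residue map\<close>

text \<open>A discrete valuation of \<open>K\<close> with a residue map. The residue field is not a quotient but the image
  of \<open>\<rho>\<close> in a field \<open>S\<close> that also contains the residue fields of all extensions considered.\<close>

locale place = valued_field R K v + S: field S
  for R (structure) and S (structure) and K and v +
  fixes \<rho> :: "'a \<Rightarrow> 'c"
  assumes hom: "\<rho> \<in> ring_hom (R\<lparr>carrier := val_ge R K v 0\<rparr>) S"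
    and ker: "\<And>x. x \<in> val_ge R K v 0 \<Longrightarrow> \<rho> x = \<zero>\<^bsub>S\<^esub> \<longleftrightarrow> x \<in> val_ge R K v 1"

text \<open>The kernel of \<open>\<sigma>\<close> is generated by \<open>t\<close> up to elements with nonzero image (\<open>maximal\<close>), and
  every nonzero element divides a power of \<open>t\<close> up to such elements (\<open>power\<close>). The localization
  of \<open>A\<close> at the kernel is then a discrete valuation ring of the quotient field \<open>L\<close> with
  uniformizer \<open>t\<close>.\<close>

locale localization = field R + S: field S
  for R (structure) and S (structure) +
  fixes A :: "'a set" and \<sigma> :: "'a \<Rightarrow> 'c" and t :: 'a and L :: "'a set"
  assumes A: "subring A R" and \<sigma>: "\<sigma> \<in> ring_hom (R\<lparr>carrier := A\<rparr>) S"
    and t: "t \<in> A" "\<sigma> t = \<zero>\<^bsub>S\<^esub>" "t \<noteq> \<zero>"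
    and maximal: "\<And>a. a \<in> A \<Longrightarrow> \<sigma> a = \<zero>\<^bsub>S\<^esub> \<Longrightarrow>
          \<exists>r\<in>A. \<exists>b\<in>A. \<sigma> r \<noteq> \<zero>\<^bsub>S\<^esub> \<and> a \<otimes> r = t \<otimes> b"
    and power: "\<And>a. a \<in> A \<Longrightarrow> a \<noteq> \<zero> \<Longrightarrow> \<exists>n::nat. \<exists>b\<in>A. \<exists>c\<in>A. \<exists>d\<in>A.
          \<sigma> c \<noteq> \<zero>\<^bsub>S\<^esub> \<and> \<sigma> d \<noteq> \<zero>\<^bsub>S\<^esub> \<and> a \<otimes> b \<otimes> c = t [^] n \<otimes> d"
    and L: "L = {z \<in> carrier R. \<exists>b\<in>A. b \<noteq> \<zero> \<and> z \<otimes> b \<in> A}"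
    and L_subfield: "subfield L R"
begin

lemma A_carrier: "x \<in> A \<Longrightarrow> x \<in> carrier R"
  using subringE(1)[OF A] by auto

lemma A_closed [simp, intro]:
  "\<zero> \<in> A" "\<one> \<in> A" "x \<in> A \<Longrightarrow> y \<in> A \<Longrightarrow> x \<oplus> y \<in> A" "x \<in> A \<Longrightarrow> y \<in> A \<Longrightarrow> x \<otimes> y \<in> A"
  "x \<in> A \<Longrightarrow> \<ominus> x \<in> A"
  using subringE[OF A] by auto

lemma A_pow [simp, intro]: "x \<in> A \<Longrightarrow> x [^] (n::nat) \<in> A"
  by (induction n) auto

lemma \<sigma>_simps:
  "x \<in> A \<Longrightarrow> \<sigma> x \<in> carrier S"
  "x \<in> A \<Longrightarrow> y \<in> A \<Longrightarrow> \<sigma> (x \<oplus> y) = \<sigma> x \<oplus>\<^bsub>S\<^esub> \<sigma> y"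
  "x \<in> A \<Longrightarrow> y \<in> A \<Longrightarrow> \<sigma> (x \<otimes> y) = \<sigma> x \<otimes>\<^bsub>S\<^esub> \<sigma> y"
  "\<sigma> \<one> = \<one>\<^bsub>S\<^esub>"
  using ring_hom_memE[OF \<sigma>] by auto

lemma \<sigma>_zero: "\<sigma> \<zero> = \<zero>\<^bsub>S\<^esub>"
  using ring_hom_zero[OF \<sigma> subring_is_ring[OF A] S.ring_axioms] by simp

definition unit where "unit a \<longleftrightarrow> a \<in> A \<and> \<sigma> a \<noteq> \<zero>\<^bsub>S\<^esub>"

lemma unitD: "unit a \<Longrightarrow> a \<in> A" "unit a \<Longrightarrow> a \<in> carrier R" "unit a \<Longrightarrow> a \<noteq> \<zero>"
  using A_carrier \<sigma>_zero by (auto simp: unit_def)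

lemma unit_one: "unit \<one>"
  by (simp add: unit_def \<sigma>_simps)

lemma unit_mult: "unit a \<Longrightarrow> unit b \<Longrightarrow> unit (a \<otimes> b)"
  by (auto simp: unit_def \<sigma>_simps S.integral_iff)

lemma t_carrier: "t \<in> carrier R" "t [^] (n::nat) \<in> carrier R" "t [^] (n::nat) \<noteq> \<zero>"
  using A_carrier[OF t(1)] nat_pow_nonzero t(3) by auto

text \<open>Dividing by \<open>t\<close> as long as possible terminates, because the element divides a power of \<open>t\<close>.\<close>

lemma factor: 
  assumes "a \<in> A" "a \<noteq> \<zero>"
  shows "\<exists>l::nat. \<exists>c d. unit c \<and> unit d \<and> a \<otimes> c = t [^] l \<otimes> d"
proof -
  have *: "\<exists>l::nat. \<exists>c d. unit c \<and> unit d \<and> a \<otimes> c = t [^] l \<otimes> d"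
    if "a \<in> A" "b \<in> A" "unit c" "unit d" "a \<otimes> b \<otimes> c = t [^] (n::nat) \<otimes> d" for a b c d n
    using that
  proof (induction n arbitrary: a c d)
    case 0
    have "\<sigma> a \<otimes>\<^bsub>S\<^esub> \<sigma> b \<otimes>\<^bsub>S\<^esub> \<sigma> c = \<sigma> d"
      using 0 unitD[OF 0(3)] unitD[OF 0(4)] by (simp flip: \<sigma>_simps(3))
    then have "unit a" using 0 by (auto simp: unit_def \<sigma>_simps)
    then show ?case using unitD[of a] unit_one by (intro exI[of _ 0] exI[of _ \<one>] exI[of _ a]) auto
  next
    case (Suc n)
    show ?case
    proof (cases "unit a")
      case True
      then show ?thesis using unitD[of a] unit_one by (intro exI[of _ 0] exI[of _ \<one>] exI[of _ a]) auto
    next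
      case False
      then obtain r a' where r: "unit r" "a' \<in> A" "a \<otimes> r = t \<otimes> a'"
        using maximal[of a] Suc.prems(1) by (auto simp: unit_def)
      have C: "a \<in> carrier R" "b \<in> carrier R" "c \<in> carrier R" "d \<in> carrier R" "r \<in> carrier R" "a' \<in> carrier R"
        using Suc.prems r A_carrier unitD by auto
      have "t \<otimes> (a' \<otimes> b \<otimes> c) = (a \<otimes> r) \<otimes> b \<otimes> c"
        unfolding r(3) using C t_carrier by algebra
      also have "\<dots> = (a \<otimes> b \<otimes> c) \<otimes> r" using C by algebra
      also have "\<dots> = t \<otimes> (t [^] n \<otimes> (d \<otimes> r))"
        unfolding Suc.prems(5) nat_pow_Suc using C t_carrier(1) t_carrier(2)[of n] by algebra
      finally have "a' \<otimes> b \<otimes> c = t [^] n \<otimes> (d \<otimes> r)"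
        using m_lcancel[OF t(3) t_carrier(1)] C t_carrier(2)[of n] by simp
      from Suc.IH[OF r(2) Suc.prems(2,3) unit_mult[OF Suc.prems(4) r(1)] this]
      obtain l e g where l: "unit e" "unit g" "a' \<otimes> e = t [^] (l::nat) \<otimes> g" by auto
      have E: "e \<in> carrier R" "g \<in> carrier R" using l unitD by auto
      have "a \<otimes> (r \<otimes> e) = t \<otimes> (a' \<otimes> e)"
        using r(3) C E t_carrier by (simp flip: m_assoc)
      also have "\<dots> = t [^] Suc l \<otimes> g"
        unfolding l(3) nat_pow_Suc using E t_carrier(1) t_carrier(2)[of l] by algebra
      finally show ?thesis using unit_mult[OF r(1) l(1)] l(2) by blast
    qed
  qed
  show ?thesis using power[OF assms] * [OF assms(1)] by (metis unit_def)
qed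

lemma power_unique:
  assumes "unit c" "unit d" "t [^] (l::nat) \<otimes> c = t [^] (m::nat) \<otimes> d"
  shows "l = m"
proof -
  have *: False if "l < m" "unit c" "unit d" "t [^] (l::nat) \<otimes> c = t [^] (m::nat) \<otimes> d" for l m c d
  proof -
    note C = unitD[OF that(2)] unitD[OF that(3)]
    have m: "t [^] m = t [^] l \<otimes> (t \<otimes> t [^] (m - l - 1))"
    proof -
      have "t [^] m = t [^] (l + Suc (m - l - 1))" using that(1) by simp
      then show ?thesis using t_carrier by (simp only: nat_pow_mult[symmetric] nat_pow_Suc m_comm)
    qed
    have "t [^] l \<otimes> c = t [^] l \<otimes> (t \<otimes> (t [^] (m - l - 1) \<otimes> d))"
      using that(4) C t_carrier unfolding m by (simp add: m_assoc)
    then have "c = t \<otimes> (t [^] (m - l - 1) \<otimes> d)"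
      using m_lcancel[OF t_carrier(3) t_carrier(2)] C t_carrier by simp
    then have "\<sigma> c = \<zero>\<^bsub>S\<^esub>" using t C by (simp add: \<sigma>_simps)
    then show False using that(2) by (simp add: unit_def)
  qed
  show ?thesis using *[of l m c d] *[of m l d c] assms by (metis linorder_neqE_nat)
qed

text \<open>The value of \<open>z\<close> is the exponent of \<open>t\<close> in \<open>z\<close>, up to units of the localization; denominators
  are cleared on both sides.\<close>

definition has_val :: "'a \<Rightarrow> int \<Rightarrow> bool" where
  "has_val z k \<longleftrightarrow> (\<exists>(l::nat) (m::nat) c d. unit c \<and> unit d \<and> z \<otimes> t [^] m \<otimes> c = t [^] l \<otimes> d \<and> k = int l - int m)"

lemma has_val_exists:
  assumes "z \<in> L" "z \<noteq> \<zero>" shows "\<exists>k. has_val z k"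
proof -
  obtain b where b: "b \<in> A" "b \<noteq> \<zero>" "z \<otimes> b \<in> A" and z: "z \<in> carrier R"
    using assms(1) unfolding L by auto
  obtain m c d where m: "unit c" "unit d" "b \<otimes> c = t [^] (m::nat) \<otimes> d"
    using factor[OF b(1,2)] by auto
  have "z \<otimes> b \<noteq> \<zero>" using z b A_carrier assms(2) by (simp add: integral_iff)
  from factor[OF b(3) this] obtain l e g where l: "unit e" "unit g" "z \<otimes> b \<otimes> e = t [^] (l::nat) \<otimes> g"
    by auto
  note C = z A_carrier[OF b(1)] unitD(2)[OF m(1)] unitD(2)[OF m(2)] unitD(2)[OF l(1)] unitD(2)[OF l(2)] t_carrier(2)[of m] t_carrier(2)[of l]
  have "z \<otimes> t [^] m \<otimes> (d \<otimes> e) = z \<otimes> e \<otimes> (t [^] m \<otimes> d)" using C by algebra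
  also have "\<dots> = (z \<otimes> b \<otimes> e) \<otimes> c" unfolding m(3)[symmetric] using C by algebra
  also have "\<dots> = t [^] l \<otimes> (g \<otimes> c)" unfolding l(3) using C by algebra
  finally show ?thesis
    unfolding has_val_def using unit_mult[OF m(2) l(1)] unit_mult[OF l(2) m(1)] by blast
qed

lemma has_val_unique:
  assumes "z \<in> carrier R" "has_val z k" "has_val z k'" shows "k = k'"
proof -
  obtain l m c d where 1: "unit c" "unit d" "z \<otimes> t [^] (m::nat) \<otimes> c = t [^] (l::nat) \<otimes> d" "k = int l - int m"
    using assms(2) unfolding has_val_def by blast
  obtain l' m' c' d' where 2: "unit c'" "unit d'" "z \<otimes> t [^] (m'::nat) \<otimes> c' = t [^] (l'::nat) \<otimes> d'" "k' = int l' - int m'"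
    using assms(3) unfolding has_val_def by blast
  note C = assms(1) unitD(2)[OF 1(1)] unitD(2)[OF 1(2)] unitD(2)[OF 2(1)] unitD(2)[OF 2(2)]
    t_carrier(2)[of m] t_carrier(2)[of l] t_carrier(2)[of m'] t_carrier(2)[of l']
  have "t [^] (m' + l) \<otimes> (d \<otimes> c') = (t [^] l \<otimes> d) \<otimes> t [^] m' \<otimes> c'"
    unfolding nat_pow_mult[OF t_carrier(1), symmetric] using C by algebra
  also have "\<dots> = (z \<otimes> t [^] m' \<otimes> c') \<otimes> t [^] m \<otimes> c"
    unfolding 1(3)[symmetric] using C by algebra
  also have "\<dots> = t [^] (m + l') \<otimes> (d' \<otimes> c)"
    unfolding 2(3) nat_pow_mult[OF t_carrier(1), symmetric] using C by algebra
  finally have "m' + l = m + l'"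
    using power_unique unit_mult 1(1,2) 2(1,2) by blast
  then show ?thesis using 1(4) 2(4) by linarith
qed

lemma has_val_mult:
  assumes "x \<in> carrier R" "y \<in> carrier R" "has_val x k" "has_val y k'"
  shows "has_val (x \<otimes> y) (k + k')"
proof -
  obtain l m c d where 1: "unit c" "unit d" "x \<otimes> t [^] (m::nat) \<otimes> c = t [^] (l::nat) \<otimes> d" "k = int l - int m"
    using assms(3) unfolding has_val_def by blast
  obtain l' m' c' d' where 2: "unit c'" "unit d'" "y \<otimes> t [^] (m'::nat) \<otimes> c' = t [^] (l'::nat) \<otimes> d'" "k' = int l' - int m'"
    using assms(4) unfolding has_val_def by blast
  note C = assms(1,2) unitD(2)[OF 1(1)] unitD(2)[OF 1(2)] unitD(2)[OF 2(1)] unitD(2)[OF 2(2)]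
    t_carrier(2)[of m] t_carrier(2)[of l] t_carrier(2)[of m'] t_carrier(2)[of l']
  have "x \<otimes> y \<otimes> t [^] (m + m') \<otimes> (c \<otimes> c') = (x \<otimes> t [^] m \<otimes> c) \<otimes> (y \<otimes> t [^] m' \<otimes> c')"
    unfolding nat_pow_mult[OF t_carrier(1), symmetric] using C by algebra
  also have "\<dots> = t [^] (l + l') \<otimes> (d \<otimes> d')"
    unfolding 1(3) 2(3) nat_pow_mult[OF t_carrier(1), symmetric] using C by algebra
  finally show ?thesis
    unfolding has_val_def using unit_mult[OF 1(1) 2(1)] unit_mult[OF 1(2) 2(2)] 1(4) 2(4)
    by (intro exI[of _ "l + l'"] exI[of _ "m + m'"] exI[of _ "c \<otimes> c'"] exI[of _ "d \<otimes> d'"]) simp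
qed

lemma has_val_add:
  assumes "x \<in> carrier R" "y \<in> carrier R" "has_val x k" "has_val y k'" "k \<le> k'" "x \<oplus> y \<noteq> \<zero>"
  shows "\<exists>r\<ge>k. has_val (x \<oplus> y) r"
proof -
  obtain l m c d where 1: "unit c" "unit d" "x \<otimes> t [^] (m::nat) \<otimes> c = t [^] (l::nat) \<otimes> d" "k = int l - int m"
    using assms(3) unfolding has_val_def by blast
  obtain l' m' c' d' where 2: "unit c'" "unit d'" "y \<otimes> t [^] (m'::nat) \<otimes> c' = t [^] (l'::nat) \<otimes> d'" "k' = int l' - int m'"
    using assms(4) unfolding has_val_def by blast
  define q where "q = m + l' - (m' + l)"
  have q: "m + l' = m' + l + q" using assms(5) 1(4) 2(4) by (simp add: q_def)
  define a where "a = d \<otimes> c' \<oplus> t [^] q \<otimes> (d' \<otimes> c)"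
  note C = assms(1,2) unitD(2)[OF 1(1)] unitD(2)[OF 1(2)] unitD(2)[OF 2(1)] unitD(2)[OF 2(2)]
    t_carrier(2)[of m] t_carrier(2)[of l] t_carrier(2)[of m'] t_carrier(2)[of l'] t_carrier(2)[of q]
  have aA: "a \<in> A" using unitD(1) 1 2 t by (auto simp: a_def)
  have eq: "(x \<oplus> y) \<otimes> t [^] (m + m') \<otimes> (c \<otimes> c') = t [^] (m' + l) \<otimes> a"
  proof -
    have "(x \<oplus> y) \<otimes> t [^] (m + m') \<otimes> (c \<otimes> c')
        = (x \<otimes> t [^] m \<otimes> c) \<otimes> (t [^] m' \<otimes> c') \<oplus> (y \<otimes> t [^] m' \<otimes> c') \<otimes> (t [^] m \<otimes> c)"
      unfolding nat_pow_mult[OF t_carrier(1), symmetric] using C by algebra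
    also have "\<dots> = t [^] (m' + l) \<otimes> (d \<otimes> c') \<oplus> t [^] (m + l') \<otimes> (d' \<otimes> c)"
      unfolding 1(3) 2(3) nat_pow_mult[OF t_carrier(1), symmetric] using C by algebra
    also have "\<dots> = t [^] (m' + l) \<otimes> a"
      unfolding q nat_pow_mult[OF t_carrier(1), symmetric] a_def using C by algebra
    finally show ?thesis .
  qed
  have "a \<noteq> \<zero>"
  proof
    assume "a = \<zero>"
    then have "(x \<oplus> y) \<otimes> t [^] (m + m') \<otimes> (c \<otimes> c') = \<zero>" using eq t_carrier by simp
    then show False using assms(6) C t_carrier unitD(3)[OF 1(1)] unitD(3)[OF 2(1)]
      by (simp add: integral_iff)
  qed
  from factor[OF aA this] obtain r e g where r: "unit e" "unit g" "a \<otimes> e = t [^] (r::nat) \<otimes> g" by auto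
  note C' = C A_carrier[OF aA] unitD(2)[OF r(1)] unitD(2)[OF r(2)] t_carrier(2)[of r] t_carrier(2)[of "m+m'"] t_carrier(2)[of "m'+l"]
  have "(x \<oplus> y) \<otimes> t [^] (m + m') \<otimes> (c \<otimes> c' \<otimes> e) = ((x \<oplus> y) \<otimes> t [^] (m + m') \<otimes> (c \<otimes> c')) \<otimes> e"
    using C' by algebra
  also have "\<dots> = t [^] (m' + l) \<otimes> (a \<otimes> e)" unfolding eq using C' by algebra
  also have "\<dots> = t [^] (m' + l + r) \<otimes> g"
    unfolding r(3) nat_pow_mult[OF t_carrier(1), of "m' + l" r, symmetric] using C' by algebra
  finally have "has_val (x \<oplus> y) (k + int r)"
    unfolding has_val_def using unit_mult[OF unit_mult[OF 1(1) 2(1)] r(1)] r(2) 1(4)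
    by (intro exI[of _ "m' + l + r"] exI[of _ "m + m'"] exI[of _ "c \<otimes> c' \<otimes> e"] exI[of _ g]) simp
  then show ?thesis by (intro exI[of _ "k + int r"]) simp
qed

definition w :: "'a \<Rightarrow> int" where "w z = (SOME k. has_val z k)"

lemma L_carrier: "z \<in> L \<Longrightarrow> z \<in> carrier R"
  by (auto simp: L)

lemma w: "z \<in> L \<Longrightarrow> z \<noteq> \<zero> \<Longrightarrow> has_val z (w z)"
  unfolding w_def using has_val_exists[of z] by (metis someI_ex)

lemma w_eq: "z \<in> L \<Longrightarrow> z \<noteq> \<zero> \<Longrightarrow> has_val z k \<Longrightarrow> w z = k"
  using has_val_unique[OF L_carrier w] by blast

lemma A_subset_L: "x \<in> A \<Longrightarrow> x \<in> L"
  unfolding L using A_carrier one_not_zero by (auto intro!: bexI[of _ \<one>])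

lemma has_valI:
  "unit c \<Longrightarrow> unit d \<Longrightarrow> z \<in> carrier R \<Longrightarrow> z \<otimes> c = t [^] (l::nat) \<otimes> d \<Longrightarrow> has_val z (int l)"
  unfolding has_val_def by (intro exI[of _ l] exI[of _ 0] exI[of _ c] exI[of _ d]) simp

lemma w_t: "w t = 1"
  using w_eq[OF A_subset_L[OF t(1)] t(3) has_valI[OF unit_one unit_one, of t 1]] t_carrier(1)
  by simp

lemma w_unit: "unit a \<Longrightarrow> w a = 0"
  using w_eq[OF A_subset_L _ has_valI[OF unit_one, of a a 0]] unitD[of a] by simp

lemma valuation_w: "valuation_on R L w"
  unfolding valuation_on_def
proof (intro conjI ballI impI)
  note sL = subringE[OF subfieldE(1)[OF L_subfield]]
  show M: "w (x \<otimes> y) = w x + w y" if "x \<in> L - {\<zero>}" "y \<in> L - {\<zero>}" for x y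
    using that sL L_carrier by (intro w_eq has_val_mult w) (auto simp: integral_iff)
  have tp: "t [^] n \<in> L - {\<zero>} \<and> w (t [^] n) = int n" for n :: nat
  proof (induction n)
    case 0
    then show ?case using w_unit[OF unit_one] A_subset_L[of \<one>] by simp
  next
    case (Suc n)
    have "t \<in> L - {\<zero>}" using t(1,3) A_subset_L by blast
    then have "w (t [^] n \<otimes> t) = int n + 1" using M[of "t [^] n" t] w_t Suc by linarith
    moreover have "t [^] Suc n \<in> L - {\<zero>}"
      using t_carrier(3)[of "Suc n"] A_subset_L[OF A_pow[OF t(1)]] by blast
    ultimately show ?case by simp
  qed
  show "w ` (L - {\<zero>}) = UNIV"
  proof (rule UNIV_eq_I[symmetric])
    fix n :: int
    show "n \<in> w ` (L - {\<zero>})"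
    proof (cases "0 \<le> n")
      case True
      then show ?thesis using tp[of "nat n"] by (intro image_eqI[of _ _ "t [^] nat n"]) auto
    next
      case False
      define u where "u = t [^] nat (- n)"
      have u: "u \<in> L - {\<zero>}" "w u = - n" using tp[of "nat (- n)"] False by (auto simp: u_def)
      have i: "inv u \<in> L - {\<zero>}" "u \<otimes> inv u = \<one>" using subfield_m_inv[OF L_subfield u(1)] by auto
      have "w (u \<otimes> inv u) = w u + w (inv u)" by (rule M[OF u(1) i(1)])
      then have "w (inv u) = n" using i(2) u(2) w_unit[OF unit_one] by simp
      then show ?thesis using i(1) by (intro image_eqI[of _ _ "inv u"]) auto
    qed
  qed
  show "min (w x) (w y) \<le> w (x \<oplus> y)" if xy: "x \<in> L - {\<zero>}" "y \<in> L - {\<zero>}" "x \<oplus> y \<noteq> \<zero>" for x y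
  proof (cases "w x \<le> w y")
    case True
    then obtain r where "r \<ge> w x" "has_val (x \<oplus> y) r"
      using has_val_add[of x y "w x" "w y"] xy w L_carrier by auto
    moreover have "x \<oplus> y \<in> L" using xy sL by auto
    ultimately show ?thesis using w_eq[of "x \<oplus> y" r] xy by simp
  next
    case False
    then obtain r where "r \<ge> w y" "has_val (y \<oplus> x) r"
      using has_val_add[of y x "w y" "w x"] xy w L_carrier a_comm[of x y] by auto
    moreover have "x \<oplus> y \<in> L" "x \<oplus> y = y \<oplus> x" using xy sL L_carrier by (auto simp: a_comm)
    ultimately show ?thesis using w_eq[of "x \<oplus> y" r] xy by simp
  qed
qed

sublocale L: valued_field R L w
  by (rule valued_fieldI[OF L_subfield valuation_w])

lemma ge_iff: "z \<in> val_ge R L w 0 \<longleftrightarrow> z \<in> carrier R \<and> (\<exists>b. unit b \<and> z \<otimes> b \<in> A)"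
proof
  assume z: "z \<in> val_ge R L w 0"
  then have zc: "z \<in> carrier R" using L_carrier L.ge_K by blast
  show "z \<in> carrier R \<and> (\<exists>b. unit b \<and> z \<otimes> b \<in> A)"
  proof (cases "z = \<zero>")
    case True
    then show ?thesis using unit_one by (auto intro!: exI[of _ \<one>])
  next
    case False
    have nn: "0 \<le> w z" using z False unfolding val_ge_def by blast
    have "has_val z (w z)" using w[OF L.ge_K[OF z] False] .
    then obtain l m c d where 1: "unit c" "unit d" "z \<otimes> t [^] (m::nat) \<otimes> c = t [^] (l::nat) \<otimes> d"
      and "w z = int l - int m"
      unfolding has_val_def by blast
    with nn have ml: "m \<le> l" by linarith
    note C = zc unitD(2)[OF 1(1)] unitD(2)[OF 1(2)] t_carrier(2)[of m] t_carrier(2)[of "l - m"]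
    have "t [^] m \<otimes> (z \<otimes> c) = z \<otimes> t [^] m \<otimes> c" using C by algebra
    also have "\<dots> = t [^] m \<otimes> (t [^] (l - m) \<otimes> d)"
      unfolding 1(3) using ml C nat_pow_mult[OF t_carrier(1), of m "l - m"] by (simp flip: m_assoc)
    finally have "z \<otimes> c = t [^] (l - m) \<otimes> d"
      using m_lcancel[OF t_carrier(3)[of m] t_carrier(2)] C by simp
    then have "z \<otimes> c \<in> A" using t unitD(1)[OF 1(2)] by simp
    then show ?thesis using zc 1(1) by auto
  qed
next
  assume z: "z \<in> carrier R \<and> (\<exists>b. unit b \<and> z \<otimes> b \<in> A)"
  then obtain b where b: "unit b" "z \<otimes> b \<in> A" by auto
  then have zL: "z \<in> L" using z unitD[OF b(1)] by (auto simp: L)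
  show "z \<in> val_ge R L w 0"
  proof (cases "z = \<zero>")
    case False
    then have "z \<otimes> b \<noteq> \<zero>" using z unitD[OF b(1)] by (simp add: integral_iff)
    from factor[OF b(2) this] obtain l c d where l: "unit c" "unit d" "z \<otimes> b \<otimes> c = t [^] (l::nat) \<otimes> d" by auto
    have "has_val z (int l)"
      unfolding has_val_def using l unit_mult[OF b(1) l(1)] z unitD(2)[OF b(1)] unitD(2)[OF l(1)]
      by (intro exI[of _ l] exI[of _ 0] exI[of _ "b \<otimes> c"] exI[of _ d]) (simp add: m_assoc)
    then show ?thesis using w_eq[OF zL False] zL by (simp add: val_ge_def)
  qed simp
qed

text \<open>The extension of \<open>\<sigma>\<close> to the localization: the quotient of the images of numerator and denominator.\<close>

definition res :: "'a \<Rightarrow> 'c" where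
  "res z = (SOME s. \<exists>b. unit b \<and> z \<otimes> b \<in> A \<and> s \<in> carrier S \<and> s \<otimes>\<^bsub>S\<^esub> \<sigma> b = \<sigma> (z \<otimes> b))"

lemma res_unique:
  assumes z: "z \<in> carrier R" and b: "unit b" "z \<otimes> b \<in> A" "s \<in> carrier S" "s \<otimes>\<^bsub>S\<^esub> \<sigma> b = \<sigma> (z \<otimes> b)"
    and b': "unit b'" "z \<otimes> b' \<in> A" "s' \<in> carrier S" "s' \<otimes>\<^bsub>S\<^esub> \<sigma> b' = \<sigma> (z \<otimes> b')"
  shows "s = s'"
proof -
  note C = unitD(1)[OF b(1)] unitD(1)[OF b'(1)]
  note D = \<sigma>_simps(1)[OF C(1)] \<sigma>_simps(1)[OF C(2)]
  have "s \<otimes>\<^bsub>S\<^esub> (\<sigma> b \<otimes>\<^bsub>S\<^esub> \<sigma> b') = \<sigma> (z \<otimes> b) \<otimes>\<^bsub>S\<^esub> \<sigma> b'"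
    using b(3,4) D by (simp flip: S.m_assoc)
  also have "\<dots> = \<sigma> (z \<otimes> b' \<otimes> b)"
    using b b' C z A_carrier by (simp add: m_ac flip: \<sigma>_simps(3))
  also have "\<dots> = s' \<otimes>\<^bsub>S\<^esub> \<sigma> b' \<otimes>\<^bsub>S\<^esub> \<sigma> b"
    unfolding b'(4) using b' C by (simp add: \<sigma>_simps)
  also have "\<dots> = s' \<otimes>\<^bsub>S\<^esub> (\<sigma> b \<otimes>\<^bsub>S\<^esub> \<sigma> b')"
    using b'(3) D unfolding S.m_assoc[OF b'(3) D(2) D(1)] by (simp only: S.m_comm)
  finally show ?thesis
    using b b' D by (subst (asm) S.m_rcancel) (auto simp: unit_def S.integral_iff)
qed

lemma res_eq:
  assumes z: "z \<in> carrier R" and b: "unit b" "z \<otimes> b \<in> A" "s \<in> carrier S" "s \<otimes>\<^bsub>S\<^esub> \<sigma> b = \<sigma> (z \<otimes> b)"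
  shows "res z = s"
proof -
  have "\<exists>s b. unit b \<and> z \<otimes> b \<in> A \<and> s \<in> carrier S \<and> s \<otimes>\<^bsub>S\<^esub> \<sigma> b = \<sigma> (z \<otimes> b)" using b by blast
  then have "\<exists>b. unit b \<and> z \<otimes> b \<in> A \<and> res z \<in> carrier S \<and> res z \<otimes>\<^bsub>S\<^esub> \<sigma> b = \<sigma> (z \<otimes> b)"
    unfolding res_def by (rule someI_ex)
  then show ?thesis using res_unique[OF z _ _ _ _ b] by blast
qed

lemma res:
  assumes z: "z \<in> val_ge R L w 0"
  obtains b where "unit b" "z \<otimes> b \<in> A" "res z \<in> carrier S" "res z \<otimes>\<^bsub>S\<^esub> \<sigma> b = \<sigma> (z \<otimes> b)"
proof -
  obtain b where b: "unit b" "z \<otimes> b \<in> A" and zc: "z \<in> carrier R" using z unfolding ge_iff by auto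
  have u: "\<sigma> b \<in> carrier S" "\<sigma> b \<in> Units S" using b \<sigma>_simps(1) by (auto simp: unit_def S.field_Units)
  define s where "s = \<sigma> (z \<otimes> b) \<otimes>\<^bsub>S\<^esub> inv\<^bsub>S\<^esub> \<sigma> b"
  have s: "s \<in> carrier S" "s \<otimes>\<^bsub>S\<^esub> \<sigma> b = \<sigma> (z \<otimes> b)"
    using u \<sigma>_simps(1)[OF b(2)] by (auto simp: s_def S.m_assoc)
  have "res z = s" by (rule res_eq[OF zc b s])
  then show thesis using that b s by blast
qed

lemma res_A: "a \<in> A \<Longrightarrow> res a = \<sigma> a"
  using A_carrier \<sigma>_simps by (intro res_eq[OF _ unit_one]) auto

lemma res_hom: "res \<in> ring_hom (R\<lparr>carrier := val_ge R L w 0\<rparr>) S"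
proof (rule ring_hom_memI)
  fix x assume "x \<in> carrier (R\<lparr>carrier := val_ge R L w 0\<rparr>)"
  then have x: "x \<in> val_ge R L w 0" by simp
  then obtain b where b: "unit b" "x \<otimes> b \<in> A" "res x \<in> carrier S" "res x \<otimes>\<^bsub>S\<^esub> \<sigma> b = \<sigma> (x \<otimes> b)"
    by (rule res)
  show "res x \<in> carrier S" by fact
  fix y assume "y \<in> carrier (R\<lparr>carrier := val_ge R L w 0\<rparr>)"
  then have y: "y \<in> val_ge R L w 0" by simp
  then obtain c where c: "unit c" "y \<otimes> c \<in> A" "res y \<in> carrier S" "res y \<otimes>\<^bsub>S\<^esub> \<sigma> c = \<sigma> (y \<otimes> c)"
    by (rule res)
  have xy: "x \<in> carrier R" "y \<in> carrier R" using x y L_carrier L.ge_K by blast+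
  note C = xy unitD(1,2)[OF b(1)] unitD(1,2)[OF c(1)] \<sigma>_simps(1)[OF unitD(1)[OF b(1)]] \<sigma>_simps(1)[OF unitD(1)[OF c(1)]]
  have "res (x \<otimes> y) = res x \<otimes>\<^bsub>S\<^esub> res y"
  proof (rule res_eq[OF _ unit_mult[OF b(1) c(1)]])
    have e: "x \<otimes> y \<otimes> (b \<otimes> c) = (x \<otimes> b) \<otimes> (y \<otimes> c)" using C by algebra
    show "x \<otimes> y \<otimes> (b \<otimes> c) \<in> A" unfolding e using b c by simp
    have "\<sigma> (x \<otimes> y \<otimes> (b \<otimes> c)) = (res x \<otimes>\<^bsub>S\<^esub> \<sigma> b) \<otimes>\<^bsub>S\<^esub> (res y \<otimes>\<^bsub>S\<^esub> \<sigma> c)"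
      unfolding e b(4) c(4) using b c by (simp add: \<sigma>_simps)
    then show "res x \<otimes>\<^bsub>S\<^esub> res y \<otimes>\<^bsub>S\<^esub> \<sigma> (b \<otimes> c) = \<sigma> (x \<otimes> y \<otimes> (b \<otimes> c))"
      using C b(3) c(3) by (simp add: \<sigma>_simps S.m_ac)
  qed (use b c xy in auto)
  then show "res (x \<otimes>\<^bsub>R\<lparr>carrier := val_ge R L w 0\<rparr>\<^esub> y) = res x \<otimes>\<^bsub>S\<^esub> res y" by simp
  have "res (x \<oplus> y) = res x \<oplus>\<^bsub>S\<^esub> res y"
  proof (rule res_eq[OF _ unit_mult[OF b(1) c(1)]])
    have e: "(x \<oplus> y) \<otimes> (b \<otimes> c) = (x \<otimes> b) \<otimes> c \<oplus> (y \<otimes> c) \<otimes> b" using C by algebra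
    show "(x \<oplus> y) \<otimes> (b \<otimes> c) \<in> A" unfolding e using b c C by simp
    have "\<sigma> ((x \<oplus> y) \<otimes> (b \<otimes> c)) = (res x \<otimes>\<^bsub>S\<^esub> \<sigma> b) \<otimes>\<^bsub>S\<^esub> \<sigma> c \<oplus>\<^bsub>S\<^esub> (res y \<otimes>\<^bsub>S\<^esub> \<sigma> c) \<otimes>\<^bsub>S\<^esub> \<sigma> b"
      unfolding e b(4) c(4) using b c C by (simp add: \<sigma>_simps)
    then show "(res x \<oplus>\<^bsub>S\<^esub> res y) \<otimes>\<^bsub>S\<^esub> \<sigma> (b \<otimes> c) = \<sigma> ((x \<oplus> y) \<otimes> (b \<otimes> c))"
      using C b(3) c(3) by (simp add: \<sigma>_simps S.m_ac S.r_distr)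
  qed (use b c xy in auto)
  then show "res (x \<oplus>\<^bsub>R\<lparr>carrier := val_ge R L w 0\<rparr>\<^esub> y) = res x \<oplus>\<^bsub>S\<^esub> res y" by simp
next
  show "res \<one>\<^bsub>R\<lparr>carrier := val_ge R L w 0\<rparr>\<^esub> = \<one>\<^bsub>S\<^esub>" using res_A[of \<one>] by (simp add: \<sigma>_simps)
qed

lemma res_ker:
  assumes z: "z \<in> val_ge R L w 0" shows "res z = \<zero>\<^bsub>S\<^esub> \<longleftrightarrow> z \<in> val_ge R L w 1"
proof (cases "z = \<zero>")
  case True
  then show ?thesis using res_A[of \<zero>] \<sigma>_zero by simp
next
  case False
  obtain b where b: "unit b" "z \<otimes> b \<in> A" "res z \<in> carrier S" "res z \<otimes>\<^bsub>S\<^esub> \<sigma> b = \<sigma> (z \<otimes> b)"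
    using res[OF z] .
  have zL: "z \<in> L" "z \<in> carrier R" using z L.ge_K L_carrier by auto
  have bb: "\<sigma> b \<in> carrier S" "\<sigma> b \<noteq> \<zero>\<^bsub>S\<^esub>" using b \<sigma>_simps by (auto simp: unit_def)
  have nz: "z \<otimes> b \<noteq> \<zero>" using zL False unitD[OF b(1)] by (simp add: integral_iff)
  from factor[OF b(2) nz] obtain l c d where l: "unit c" "unit d" "z \<otimes> b \<otimes> c = t [^] (l::nat) \<otimes> d" by auto
  have "has_val z (int l)"
    unfolding has_val_def using l unit_mult[OF b(1) l(1)] zL unitD(2)[OF b(1)] unitD(2)[OF l(1)]
    by (intro exI[of _ l] exI[of _ 0] exI[of _ "b \<otimes> c"] exI[of _ d]) (simp add: m_assoc)
  then have wz: "w z = int l" by (rule w_eq[OF zL(1) False])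
  have "res z = \<zero>\<^bsub>S\<^esub> \<longleftrightarrow> \<sigma> (z \<otimes> b) = \<zero>\<^bsub>S\<^esub>"
    unfolding b(4)[symmetric] using b(3) bb by (simp add: S.integral_iff)
  also have "\<dots> \<longleftrightarrow> \<sigma> (z \<otimes> b \<otimes> c) = \<zero>\<^bsub>S\<^esub>"
    using l(1) b(2) \<sigma>_simps by (auto simp: unit_def S.integral_iff)
  also have "\<dots> \<longleftrightarrow> \<sigma> (t [^] l) = \<zero>\<^bsub>S\<^esub>"
    unfolding l(3) using l(2) t(1) \<sigma>_simps by (auto simp: unit_def S.integral_iff)
  also have "\<dots> \<longleftrightarrow> 1 \<le> int l"
    using t \<sigma>_simps by (cases l) auto
  finally show ?thesis using wz zL False by (simp add: val_ge_def)
qed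

lemma place_res: "place R S L w res"
  by unfold_locales (rule res_hom, rule res_ker)

end

section \<open>Polynomials over a valuation ring and their reductions\<close>

lemma (in field) eval_zero_imp_coeffs_zero:
  assumes "infinite (carrier R)" "set q \<subseteq> carrier R" "\<And>x. x \<in> carrier R \<Longrightarrow> eval q x = \<zero>"
  shows "set q \<subseteq> {\<zero>}"
proof -
  have n: "normalize q \<in> carrier (poly_ring R)"
    using normalize_gives_polynomial[OF assms(2)] univ_poly_carrier by blast
  have "normalize q = []"
  proof (rule ccontr)
    assume "normalize q \<noteq> []"
    then have "carrier R \<subseteq> {x. is_root (normalize q) x}"
      using assms(2,3) eval_normalize by (auto simp: is_root_def)
    then show False using finite_number_of_roots[OF n] assms(1) finite_subset by blast
  qed
  then show ?thesis
    by (induction q) (auto split: if_splits)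
qed

lemma (in ring) eval_pow_closed: "x \<in> H \<Longrightarrow> subring H R \<Longrightarrow> x [^] (n::nat) \<in> H"
  by (induction n) (auto simp: subringE)

lemma (in ring) eval_in_subring:
  assumes "subring H R" "set p \<subseteq> H" "x \<in> H" shows "eval p x \<in> H"
  using assms(2) by (induction p) (use assms eval_pow_closed[OF assms(3,1)] in \<open>auto simp: subringE\<close>)

lemma (in cring) eval_scale:
  "c \<in> carrier R \<Longrightarrow> set P \<subseteq> carrier R \<Longrightarrow> z \<in> carrier R \<Longrightarrow> eval (map ((\<otimes>) c) P) z = c \<otimes> eval P z"
  by (induction P) (auto simp: r_distr m_assoc eval_in_carrier)

text \<open>An infinite \<open>S\<close> makes a polynomial over \<open>S\<close> determined by its values, which allows arguing with
  polynomial functions instead of coefficients.\<close>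

locale residue_place = place +
  assumes S_infinite: "infinite (carrier S)"
begin

abbreviation "V \<equiv> val_ge R K v 0"

lemma V_carrier: "x \<in> V \<Longrightarrow> x \<in> carrier R"
  using ge_K K_carrier by blast

lemma V_ring: "ring (R\<lparr>carrier := V\<rparr>)"
  by (rule subring_is_ring[OF ge_0_subring])

sublocale \<rho>: ring_hom_ring "R\<lparr>carrier := V\<rparr>" S \<rho>
  by (rule ring_hom_ringI2[OF V_ring S.ring_axioms hom])

lemma \<rho>_simps:
  "x \<in> V \<Longrightarrow> \<rho> x \<in> carrier S"
  "x \<in> V \<Longrightarrow> y \<in> V \<Longrightarrow> \<rho> (x \<oplus> y) = \<rho> x \<oplus>\<^bsub>S\<^esub> \<rho> y"
  "x \<in> V \<Longrightarrow> y \<in> V \<Longrightarrow> \<rho> (x \<otimes> y) = \<rho> x \<otimes>\<^bsub>S\<^esub> \<rho> y"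
  "\<rho> \<one> = \<one>\<^bsub>S\<^esub>" "\<rho> \<zero> = \<zero>\<^bsub>S\<^esub>"
  using ring_hom_memE[OF hom] \<rho>.hom_zero by auto

lemma V_closed [simp, intro]:
  "\<zero> \<in> V" "\<one> \<in> V" "x \<in> V \<Longrightarrow> y \<in> V \<Longrightarrow> x \<oplus> y \<in> V" "x \<in> V \<Longrightarrow> y \<in> V \<Longrightarrow> x \<otimes> y \<in> V"
  "x \<in> V \<Longrightarrow> \<ominus> x \<in> V"
  using subringE[OF ge_0_subring] by auto

lemma V_pow [simp, intro]: "x \<in> V \<Longrightarrow> x [^] (n::nat) \<in> V"
  by (induction n) auto

lemma \<rho>_neg: "x \<in> V \<Longrightarrow> \<rho> (\<ominus> x) = \<ominus>\<^bsub>S\<^esub> \<rho> x"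
proof -
  assume x: "x \<in> V"
  have "\<rho> (\<ominus> x) \<oplus>\<^bsub>S\<^esub> \<rho> x = \<zero>\<^bsub>S\<^esub>"
    using \<rho>_simps(2)[of "\<ominus> x" x] x V_carrier[OF x] \<rho>_simps(5) by (simp add: l_neg)
  then show ?thesis using x \<rho>_simps(1) by (metis S.minus_equality V_closed(5))
qed

lemma R_infinite: "infinite (carrier R)"
proof
  assume "finite (carrier R)"
  then have "finite (v ` (K - {\<zero>}))" using K_carrier by (meson finite_Diff finite_imageI finite_subset subsetI)
  then show False using v unfolding valuation_on_def by simp
qed

text \<open>Evaluation of the reduced polynomial.\<close>

definition reval where "reval P \<beta> = S.eval (map \<rho> P) \<beta>"

text \<open>A pair of functions induced by one polynomial over the valuation ring. An identity between
  functions on \<open>R\<close> passes to the second components (\<open>pf_ext\<close>), so that reductions can be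
  computed without manipulating coefficient lists.\<close>

definition pf where
  "pf f g \<longleftrightarrow> (\<exists>P. set P \<subseteq> V \<and> (\<forall>z\<in>carrier R. eval P z = f z) \<and> (\<forall>\<beta>\<in>carrier S. reval P \<beta> = g \<beta>))"

lemma map_\<rho>_closed: "set P \<subseteq> V \<Longrightarrow> set (map \<rho> P) \<subseteq> carrier S"
  using \<rho>_simps(1) by auto

lemma reval_closed: "set P \<subseteq> V \<Longrightarrow> \<beta> \<in> carrier S \<Longrightarrow> reval P \<beta> \<in> carrier S"
  unfolding reval_def by (rule S.eval_in_carrier[OF map_\<rho>_closed])

lemma pf_self: "set P \<subseteq> V \<Longrightarrow> pf (eval P) (reval P)"
  unfolding pf_def by auto

lemma pf_cong:
  "pf f g \<Longrightarrow> (\<And>z. z \<in> carrier R \<Longrightarrow> f z = f' z) \<Longrightarrow> (\<And>\<beta>. \<beta> \<in> carrier S \<Longrightarrow> g \<beta> = g' \<beta>) \<Longrightarrow> pf f' g'"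
  unfolding pf_def by auto

lemma pf_const: "c \<in> V \<Longrightarrow> pf (\<lambda>_. c) (\<lambda>_. \<rho> c)"
  using V_carrier \<rho>_simps(1) by (auto simp: pf_def reval_def intro!: exI[of _ "[c]"])

lemma pf_var: "pf (\<lambda>z. z) (\<lambda>\<beta>. \<beta>)"
  by (auto simp: pf_def reval_def \<rho>_simps intro!: exI[of _ "[\<one>, \<zero>]"])

lemma poly_ops:
  assumes P: "set P \<subseteq> V" and Q: "set Q \<subseteq> V"
  shows "set (poly_add P Q) \<subseteq> V" "set (poly_mult P Q) \<subseteq> V"
    "\<beta> \<in> carrier S \<Longrightarrow> reval (poly_add P Q) \<beta> = reval P \<beta> \<oplus>\<^bsub>S\<^esub> reval Q \<beta>"
    "\<beta> \<in> carrier S \<Longrightarrow> reval (poly_mult P Q) \<beta> = reval P \<beta> \<otimes>\<^bsub>S\<^esub> reval Q \<beta>"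
proof -
  have "polynomial V (poly_add P Q)" "polynomial V (poly_mult P Q)"
    using poly_add_is_polynomial[OF ge_0_subring P Q] poly_mult_is_polynomial[OF ge_0_subring P Q] .
  then show c: "set (poly_add P Q) \<subseteq> V" "set (poly_mult P Q) \<subseteq> V"
    using polynomial_incl by blast+
  have pa: "ring.poly_add (R\<lparr>carrier := V\<rparr>) P Q = poly_add P Q"
    "ring.poly_mult (R\<lparr>carrier := V\<rparr>) P Q = poly_mult P Q"
    using poly_add_consistent[OF ge_0_subring] poly_mult_consistent[OF ge_0_subring] by simp_all
  note m = map_\<rho>_closed[OF P] map_\<rho>_closed[OF Q]
  assume b: "\<beta> \<in> carrier S"
  show "reval (poly_add P Q) \<beta> = reval P \<beta> \<oplus>\<^bsub>S\<^esub> reval Q \<beta>"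
    using \<rho>.poly_add_hom'[of P Q] P Q S.eval_normalize[OF map_\<rho>_closed[OF c(1)] b] S.eval_poly_add[OF m b]
    unfolding reval_def pa by simp
  show "reval (poly_mult P Q) \<beta> = reval P \<beta> \<otimes>\<^bsub>S\<^esub> reval Q \<beta>"
    using \<rho>.poly_mult_hom'[of P Q] P Q S.eval_normalize[OF map_\<rho>_closed[OF c(2)] b] S.eval_poly_mult[OF m b]
    unfolding reval_def pa by simp
qed

lemma V_list_carrier: "set P \<subseteq> V \<Longrightarrow> set P \<subseteq> carrier R"
  using V_carrier by auto

lemma pf_add: 
  assumes "pf f g" "pf f' g'" shows "pf (\<lambda>z. f z \<oplus> f' z) (\<lambda>\<beta>. g \<beta> \<oplus>\<^bsub>S\<^esub> g' \<beta>)"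
proof -
  obtain P Q where P: "set P \<subseteq> V" "\<forall>z\<in>carrier R. eval P z = f z" "\<forall>\<beta>\<in>carrier S. reval P \<beta> = g \<beta>"
    and Q: "set Q \<subseteq> V" "\<forall>z\<in>carrier R. eval Q z = f' z" "\<forall>\<beta>\<in>carrier S. reval Q \<beta> = g' \<beta>"
    using assms unfolding pf_def by auto
  show ?thesis unfolding pf_def
    by (rule exI[of _ "poly_add P Q"])
      (use P Q poly_ops[OF P(1) Q(1)] eval_poly_add[OF V_list_carrier[OF P(1)] V_list_carrier[OF Q(1)]] in auto)
qed

lemma pf_mult: 
  assumes "pf f g" "pf f' g'" shows "pf (\<lambda>z. f z \<otimes> f' z) (\<lambda>\<beta>. g \<beta> \<otimes>\<^bsub>S\<^esub> g' \<beta>)"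
proof -
  obtain P Q where P: "set P \<subseteq> V" "\<forall>z\<in>carrier R. eval P z = f z" "\<forall>\<beta>\<in>carrier S. reval P \<beta> = g \<beta>"
    and Q: "set Q \<subseteq> V" "\<forall>z\<in>carrier R. eval Q z = f' z" "\<forall>\<beta>\<in>carrier S. reval Q \<beta> = g' \<beta>"
    using assms unfolding pf_def by auto
  show ?thesis unfolding pf_def
    by (rule exI[of _ "poly_mult P Q"])
      (use P Q poly_ops[OF P(1) Q(1)] eval_poly_mult[OF V_list_carrier[OF P(1)] V_list_carrier[OF Q(1)]] in auto)
qed

lemma pf_pow: "pf f g \<Longrightarrow> pf (\<lambda>z. f z [^] (n::nat)) (\<lambda>\<beta>. g \<beta> [^]\<^bsub>S\<^esub> n)"
proof (induction n)
  case 0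
  then show ?case using pf_const[of \<one>] by (simp add: \<rho>_simps)
next
  case (Suc n)
  then show ?case using pf_mult[OF Suc.IH Suc.prems] by simp
qed

lemma pf_minus: 
  assumes "pf f g" "pf f' g'"
  shows "pf (\<lambda>z. f z \<ominus> f' z) (\<lambda>\<beta>. g \<beta> \<ominus>\<^bsub>S\<^esub> g' \<beta>)"
proof -
  have c: "f' z \<in> carrier R" if "z \<in> carrier R" for z
    using assms(2) that V_list_carrier eval_in_carrier unfolding pf_def by metis
  have d: "g' \<beta> \<in> carrier S" if "\<beta> \<in> carrier S" for \<beta>
    using assms(2) that reval_closed unfolding pf_def by metis
  have "pf (\<lambda>z. f z \<oplus> \<ominus> \<one> \<otimes> f' z) (\<lambda>\<beta>. g \<beta> \<oplus>\<^bsub>S\<^esub> \<rho> (\<ominus> \<one>) \<otimes>\<^bsub>S\<^esub> g' \<beta>)"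
    by (intro pf_add pf_mult assms pf_const) auto
  then show ?thesis
    by (rule pf_cong) (use c d in \<open>auto simp: a_minus_def \<rho>_neg \<rho>_simps l_minus S.l_minus\<close>)
qed

lemma pf_closed:
  "pf f g \<Longrightarrow> z \<in> carrier R \<Longrightarrow> f z \<in> carrier R" "pf f g \<Longrightarrow> \<beta> \<in> carrier S \<Longrightarrow> g \<beta> \<in> carrier S"
  unfolding pf_def using V_list_carrier eval_in_carrier reval_closed by metis+

lemma normalize_eval_zero:
  assumes "set P \<subseteq> V" "\<And>z. z \<in> carrier R \<Longrightarrow> eval P z = \<zero>" "\<beta> \<in> carrier S"
  shows "reval P \<beta> = \<zero>\<^bsub>S\<^esub>"
proof -
  have "set P \<subseteq> {\<zero>}"
    by (rule eval_zero_imp_coeffs_zero[OF R_infinite V_list_carrier[OF assms(1)] assms(2)])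
  then show ?thesis
    unfolding reval_def by (induction P) (use assms(3) in \<open>auto simp: \<rho>_simps\<close>)
qed

lemma pf_ext:
  assumes "pf f g" "pf f' g'" "\<And>z. z \<in> carrier R \<Longrightarrow> f z = f' z" "\<beta> \<in> carrier S"
  shows "g \<beta> = g' \<beta>"
proof -
  obtain P where P: "set P \<subseteq> V" "\<forall>z\<in>carrier R. eval P z = f z \<ominus> f' z" "\<forall>\<beta>\<in>carrier S. reval P \<beta> = g \<beta> \<ominus>\<^bsub>S\<^esub> g' \<beta>"
    using pf_minus[OF assms(1,2)] unfolding pf_def by blast
  have "g \<beta> \<ominus>\<^bsub>S\<^esub> g' \<beta> = \<zero>\<^bsub>S\<^esub>"
    using normalize_eval_zero[OF P(1) _ assms(4)] P assms(3,4) pf_closed(1)[OF assms(2)] by (simp add: r_neg a_minus_def)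
  then show ?thesis using S.r_right_minus_eq pf_closed(2)[OF assms(1,4)] pf_closed(2)[OF assms(2,4)] by blast
qed

lemma reval_zero_imp:
  assumes "set P \<subseteq> V" "\<And>\<beta>. \<beta> \<in> carrier S \<Longrightarrow> reval P \<beta> = \<zero>\<^bsub>S\<^esub>"
  shows "set P \<subseteq> val_ge R K v 1"
proof -
  have "set (map \<rho> P) \<subseteq> {\<zero>\<^bsub>S\<^esub>}"
    by (rule S.eval_zero_imp_coeffs_zero[OF S_infinite map_\<rho>_closed[OF assms(1)]])
      (use assms(2) in \<open>simp add: reval_def\<close>)
  then show ?thesis using assms(1) ker by auto
qed

lemma finite_zeros:
  assumes "set P \<subseteq> V" "\<beta> \<in> carrier S" "reval P \<beta> \<noteq> \<zero>\<^bsub>S\<^esub>"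
  shows "finite {\<gamma> \<in> carrier S. reval P \<gamma> = \<zero>\<^bsub>S\<^esub>}"
proof -
  let ?q = "S.normalize (map \<rho> P)"
  note m = map_\<rho>_closed[OF assms(1)]
  have n: "?q \<in> carrier (poly_ring S)"
    using S.normalize_gives_polynomial[OF m] univ_poly_carrier by blast
  have e: "S.eval ?q \<gamma> = reval P \<gamma>" if "\<gamma> \<in> carrier S" for \<gamma>
    unfolding reval_def by (rule S.eval_normalize[OF m that])
  have "?q \<noteq> []" using e[OF assms(2)] assms(3) by auto
  then have "{\<gamma> \<in> carrier S. reval P \<gamma> = \<zero>\<^bsub>S\<^esub>} \<subseteq> {x. S.is_root ?q x}"
    using e by (auto simp: S.is_root_def)
  then show ?thesis using S.finite_number_of_roots[OF n] finite_subset by blast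
qed

lemma common_nonzero:
  assumes "set P \<subseteq> V" "\<beta> \<in> carrier S" "reval P \<beta> \<noteq> \<zero>\<^bsub>S\<^esub>"
    and "set Q \<subseteq> V" "\<gamma> \<in> carrier S" "reval Q \<gamma> \<noteq> \<zero>\<^bsub>S\<^esub>"
  shows "\<exists>\<delta>\<in>carrier S. reval P \<delta> \<noteq> \<zero>\<^bsub>S\<^esub> \<and> reval Q \<delta> \<noteq> \<zero>\<^bsub>S\<^esub>"
proof (rule ccontr)
  assume "\<not> ?thesis"
  then have "carrier S \<subseteq> {\<gamma> \<in> carrier S. reval P \<gamma> = \<zero>\<^bsub>S\<^esub>} \<union> {\<gamma> \<in> carrier S. reval Q \<gamma> = \<zero>\<^bsub>S\<^esub>}" by auto
  then show False using finite_zeros[OF assms(1-3)] finite_zeros[OF assms(4-6)] S_infinite finite_subset by blast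
qed

text \<open>Dividing by a coefficient of least value makes a polynomial primitive.\<close>

lemma primitive_multiple:
  assumes "set H \<subseteq> K" "\<not> set H \<subseteq> {\<zero>}"
  shows "\<exists>c\<in>K. c \<noteq> \<zero> \<and> set (map ((\<otimes>) c) H) \<subseteq> V \<and> (\<exists>\<beta>\<in>carrier S. reval (map ((\<otimes>) c) H) \<beta> \<noteq> \<zero>\<^bsub>S\<^esub>)"
proof -
  have "finite (set H - {\<zero>})" "set H - {\<zero>} \<noteq> {}" using assms(2) by auto
  then obtain a where a: "a \<in> set H" "a \<noteq> \<zero>" and min: "\<And>b. b \<in> set H \<Longrightarrow> b \<noteq> \<zero> \<Longrightarrow> v a \<le> v b"
    using ex_min_if_finite[of "v ` (set H - {\<zero>})"] 
    by (metis (no_types, lifting) DiffD1 DiffD2 DiffI arg_min_if_finite(1) arg_min_least singletonI singletonD)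
  have aK: "a \<in> K" using a assms(1) by auto
  note i = K_inv[OF aK a(2)]
  have sc: "set (map ((\<otimes>) (inv a)) H) \<subseteq> V"
  proof
    fix x assume "x \<in> set (map ((\<otimes>) (inv a)) H)"
    then obtain b where b: "b \<in> set H" "x = inv a \<otimes> b" by auto
    show "x \<in> V"
    proof (cases "b = \<zero>")
      case False
      then show ?thesis
        using v_mult[of "inv a" b] v_inv[OF aK a(2)] i min[OF b(1)] b assms(1) by (auto simp: val_ge_def)
    qed (use b i K_carrier in auto)
  qed
  moreover have "\<exists>\<beta>\<in>carrier S. reval (map ((\<otimes>) (inv a)) H) \<beta> \<noteq> \<zero>\<^bsub>S\<^esub>"
  proof (rule ccontr)
    assume "\<not> ?thesis"
    then have "set (map ((\<otimes>) (inv a)) H) \<subseteq> val_ge R K v 1" using reval_zero_imp[OF sc] by blast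
    moreover have "inv a \<otimes> a \<in> set (map ((\<otimes>) (inv a)) H)" using a by auto
    ultimately have "\<one> \<in> val_ge R K v 1" using i by auto
    then show False by (simp add: val_ge_def)
  qed
  ultimately show ?thesis using i by blast
qed

text \<open>Gauss's lemma: a product of primitive polynomials is primitive. So if \<open>G\<close> is primitive and
  \<open>G H\<close> has coefficients in the valuation ring, then \<open>H\<close> has too, and zeros of the reduction
  of \<open>G\<close> are zeros of the reduction of the product.\<close>

lemma gauss_kernel:
  assumes G: "set G \<subseteq> V" "\<beta> \<in> carrier S" "reval G \<beta> \<noteq> \<zero>\<^bsub>S\<^esub>"
    and \<alpha>: "\<alpha> \<in> carrier S" "reval G \<alpha> = \<zero>\<^bsub>S\<^esub>"
    and P: "set P \<subseteq> V" and H: "set H \<subseteq> K"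
    and eq: "\<And>z. z \<in> carrier R \<Longrightarrow> eval P z = eval G z \<otimes> eval H z"
  shows "reval P \<alpha> = \<zero>\<^bsub>S\<^esub>"
proof (cases "set H \<subseteq> {\<zero>}")
  case True
  have "eval H z = \<zero>" if "z \<in> carrier R" for z
    using True by (induction H) (use that in auto)
  then show ?thesis
    using normalize_eval_zero[OF P _ \<alpha>(1)] eq eval_in_carrier[OF V_list_carrier[OF G(1)]] by simp
next
  case False
  then obtain c \<gamma> where c: "c \<in> K" "c \<noteq> \<zero>" and cH: "set (map ((\<otimes>) c) H) \<subseteq> V"
    and \<gamma>: "\<gamma> \<in> carrier S" "reval (map ((\<otimes>) c) H) \<gamma> \<noteq> \<zero>\<^bsub>S\<^esub>"
    using primitive_multiple[OF H] by auto
  define H' where "H' = map ((\<otimes>) c) H"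
  note cH = cH[folded H'_def] and \<gamma> = \<gamma>[folded H'_def]
  have Hc: "set H \<subseteq> carrier R" using H K_carrier by auto
  have cc: "c \<in> carrier R" using c K_carrier by auto
  have GH: "pf (\<lambda>z. eval G z \<otimes> eval H' z) (\<lambda>\<beta>. reval G \<beta> \<otimes>\<^bsub>S\<^esub> reval H' \<beta>)"
    by (rule pf_mult[OF pf_self[OF G(1)] pf_self[OF cH]])
  have e: "eval G z \<otimes> eval H' z = c \<otimes> eval P z" if "z \<in> carrier R" for z
    unfolding H'_def eval_scale[OF cc Hc that] eq[OF that]
    using cc eval_in_carrier[OF Hc that] eval_in_carrier[OF V_list_carrier[OF G(1)] that] by (simp add: m_ac)
  show ?thesis
  proof (cases "c \<in> val_ge R K v 1")
    case True
    then have cV: "c \<in> V" and "\<rho> c = \<zero>\<^bsub>S\<^esub>" using ker ge_mono[of c 1 0] by auto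
    obtain \<delta> where d: "\<delta> \<in> carrier S" "reval G \<delta> \<noteq> \<zero>\<^bsub>S\<^esub>" "reval H' \<delta> \<noteq> \<zero>\<^bsub>S\<^esub>"
      using common_nonzero[OF G cH \<gamma>] by auto
    have "reval G \<delta> \<otimes>\<^bsub>S\<^esub> reval H' \<delta> = \<rho> c \<otimes>\<^bsub>S\<^esub> reval P \<delta>"
      by (rule pf_ext[OF GH pf_mult[OF pf_const[OF cV] pf_self[OF P]]]) (use e d in auto)
    then have "reval G \<delta> \<otimes>\<^bsub>S\<^esub> reval H' \<delta> = \<zero>\<^bsub>S\<^esub>"
      using \<open>\<rho> c = \<zero>\<^bsub>S\<^esub>\<close> reval_closed[OF P d(1)] by simp
    then show ?thesis using d reval_closed[OF G(1) d(1)] reval_closed[OF cH d(1)] by (simp add: S.integral_iff)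
  next
    case False
    note i = K_inv[OF c]
    have iV: "inv c \<in> V" using False c i v_inv[OF c] by (auto simp: val_ge_def)
    have "reval P \<alpha> = \<rho> (inv c) \<otimes>\<^bsub>S\<^esub> (reval G \<alpha> \<otimes>\<^bsub>S\<^esub> reval H' \<alpha>)"
    proof (rule pf_ext[OF pf_self[OF P] pf_mult[OF pf_const[OF iV] GH]])
      fix z assume z: "z \<in> carrier R"
      show "eval P z = inv c \<otimes> (eval G z \<otimes> eval H' z)"
        unfolding e[OF z] using i cc K_carrier[of "inv c"] eval_in_carrier[OF V_list_carrier[OF P] z]
        by (simp flip: m_assoc)
    qed (rule \<alpha>)
    then show ?thesis
      using \<alpha> reval_closed[OF cH \<alpha>(1)] \<rho>_simps(1)[OF iV] by simp
  qed
qed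

end

section \<open>Extending a place to a simple extension\<close>

lemma (in ring) simple_extension_cases:
  assumes "K \<subseteq> carrier R" "x \<in> carrier R" "z \<in> simple_extension K x"
  shows "\<exists>q. set q \<subseteq> K \<and> z = eval q x"
proof -
  have "z \<in> (\<lambda>p. eval p x) ` carrier (K[X])"
    using assms(3) simple_extension_as_eval_img[OF assms(1,2)] by simp
  then obtain q where q: "z = eval q x" "q \<in> carrier (K[X])" by (rule imageE)
  have "polynomial K q" using q(2) by (simp only: univ_poly_carrier)
  then show ?thesis using polynomial_incl q(1) by blast
qed

context residue_place
begin

abbreviation "k \<equiv> \<rho> ` V"

lemma unit_inv: "x \<in> V \<Longrightarrow> \<rho> x \<noteq> \<zero>\<^bsub>S\<^esub> \<Longrightarrow> x \<in> K \<and> x \<noteq> \<zero> \<and> v x = 0 \<and> inv x \<in> V \<and> \<rho> (inv x) = inv\<^bsub>S\<^esub> (\<rho> x)"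
proof -
  assume x: "x \<in> V" "\<rho> x \<noteq> \<zero>\<^bsub>S\<^esub>"
  then have xK: "x \<in> K" "x \<noteq> \<zero>" "v x = 0"
    using ker[OF x(1)] \<rho>_simps(5) by (auto simp: val_ge_def)
  note i = K_inv[OF xK(1,2)]
  have iV: "inv x \<in> V" using v_inv[OF xK(1,2)] xK(3) i by (simp add: val_ge_def)
  have "\<rho> x \<otimes>\<^bsub>S\<^esub> \<rho> (inv x) = \<one>\<^bsub>S\<^esub>"
    using \<rho>_simps(3)[OF x(1) iV] i \<rho>_simps(4) by simp
  then have "inv\<^bsub>S\<^esub> (\<rho> x) = \<rho> (inv x)"
    using \<rho>_simps(1)[OF x(1)] \<rho>_simps(1)[OF iV] by (intro S.comm_inv_char) auto
  then show ?thesis using xK iV by simp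
qed

lemma k_subfield: "subfield k S"
proof (rule S.subfieldI')
  show "subring k S"
    using \<rho>.img_is_subring[OF ring.carrier_is_subring[OF V_ring]] by simp
  fix x assume "x \<in> k - {\<zero>\<^bsub>S\<^esub>}"
  then obtain z where z: "z \<in> V" "x = \<rho> z" "\<rho> z \<noteq> \<zero>\<^bsub>S\<^esub>" by auto
  then have "inv z \<in> V" "\<rho> (inv z) = inv\<^bsub>S\<^esub> x" using unit_inv[OF z(1,3)] by auto
  then show "inv\<^bsub>S\<^esub> x \<in> k" by (metis imageI)
qed

lemma lift_list:
  assumes "set q \<subseteq> k" obtains Q where "set Q \<subseteq> V" "map \<rho> Q = q"
proof -
  have "\<exists>Q. set Q \<subseteq> V \<and> map \<rho> Q = q"
    using assms
  proof (induction q)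
    case (Cons a q)
    then obtain Q b where "set Q \<subseteq> V" "map \<rho> Q = q" "b \<in> V" "\<rho> b = a" by auto
    then show ?case by (intro exI[of _ "b # Q"]) simp
  qed simp
  then show thesis using that by blast
qed

lemma divide_by_uniformizer:
  assumes p: "p \<in> K" "p \<noteq> \<zero>" "v p = 1" and D: "set D \<subseteq> val_ge R K v 1"
  obtains T where "set T \<subseteq> V" "\<And>z. z \<in> carrier R \<Longrightarrow> eval D z = p \<otimes> eval T z"
proof -
  note i = K_inv[OF p(1,2)]
  define T where "T = map ((\<otimes>) (inv p)) D"
  have "inv p \<in> val_ge R K v (-1)" using i v_inv[OF p(1,2)] p(3) by (simp add: val_ge_def)
  then have T: "set T \<subseteq> V" using D ge_mult[of "inv p" "-1" _ 1] by (auto simp: T_def)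
  have "eval D z = p \<otimes> eval T z" if z: "z \<in> carrier R" for z
  proof -
    have Dc: "set D \<subseteq> carrier R" using D ge_K K_carrier by blast
    show ?thesis
      unfolding T_def using eval_scale[OF K_carrier Dc z, of "inv p"] i p K_carrier eval_in_carrier[OF Dc z]
      by (simp flip: m_assoc)
  qed
  with T that show thesis by blast
qed

text \<open>Divide by the minimal polynomial after reduction and lift the quotient; the difference has
  coefficients in the maximal ideal.\<close>

lemma vanishing_decomposition:
  assumes p: "p \<in> K" "p \<noteq> \<zero>" "v p = 1"
    and \<alpha>: "\<alpha> \<in> carrier S" "(S.algebraic over k) \<alpha>"
    and \<phi>: "set \<phi> \<subseteq> V" "map \<rho> \<phi> = S.Irr k \<alpha>"
    and P: "set P \<subseteq> V" "reval P \<alpha> = \<zero>\<^bsub>S\<^esub>"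
  obtains Q T where "set Q \<subseteq> V" "set T \<subseteq> V"
    "\<And>z. z \<in> carrier R \<Longrightarrow> eval P z = eval \<phi> z \<otimes> eval Q z \<oplus> p \<otimes> eval T z"
proof -
  let ?q = "S.normalize (map \<rho> P)"
  note m = map_\<rho>_closed[OF P(1)]
  have n: "?q \<in> carrier (k[X]\<^bsub>S\<^esub>)"
    using S.normalize_gives_polynomial[of "map \<rho> P" k] P(1) by (auto simp: univ_poly_carrier)
  have e: "S.eval ?q \<gamma> = reval P \<gamma>" if "\<gamma> \<in> carrier S" for \<gamma>
    unfolding reval_def by (rule S.eval_normalize[OF m that])
  note I = S.IrrE[OF k_subfield \<alpha>]
  have "S.Irr k \<alpha> pdivides\<^bsub>S\<^esub> ?q"
    by (rule S.Irr_minimal[OF k_subfield \<alpha> n]) (use e[OF \<alpha>(1)] P(2) in simp)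
  then have "S.Irr k \<alpha> divides\<^bsub>k[X]\<^bsub>S\<^esub>\<^esub> ?q"
    using S.pdivides_iff_shell[OF k_subfield I(1) n] by simp
  then obtain q where q: "q \<in> carrier (k[X]\<^bsub>S\<^esub>)" "?q = S.Irr k \<alpha> \<otimes>\<^bsub>k[X]\<^bsub>S\<^esub>\<^esub> q"
    unfolding factor_def by auto
  have qk: "set q \<subseteq> k" using q(1) by (simp add: S.polynomial_incl univ_poly_carrier)
  then obtain Q where Q: "set Q \<subseteq> V" "map \<rho> Q = q" by (rule lift_list)
  have ks: "k \<subseteq> carrier S" by (rule subfieldE(3)[OF k_subfield])
  have "reval P \<gamma> = reval \<phi> \<gamma> \<otimes>\<^bsub>S\<^esub> reval Q \<gamma>" if g: "\<gamma> \<in> carrier S" for \<gamma>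
  proof -
    have "reval P \<gamma> = S.eval (S.poly_mult (S.Irr k \<alpha>) q) \<gamma>"
      using e[OF g] q(2) by (simp add: univ_poly_mult)
    also have "\<dots> = S.eval (S.Irr k \<alpha>) \<gamma> \<otimes>\<^bsub>S\<^esub> S.eval q \<gamma>"
    proof (rule S.eval_poly_mult[OF _ _ g])
      show "set (S.Irr k \<alpha>) \<subseteq> carrier S" using map_\<rho>_closed[OF \<phi>(1)] \<phi>(2) by simp
      show "set q \<subseteq> carrier S" using qk ks by auto
    qed
    finally show ?thesis unfolding reval_def \<phi>(2) Q(2) .
  qed note red = this
  obtain D where D: "set D \<subseteq> V" "\<forall>z\<in>carrier R. eval D z = eval P z \<ominus> eval \<phi> z \<otimes> eval Q z"
    "\<forall>\<gamma>\<in>carrier S. reval D \<gamma> = reval P \<gamma> \<ominus>\<^bsub>S\<^esub> reval \<phi> \<gamma> \<otimes>\<^bsub>S\<^esub> reval Q \<gamma>"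
    using pf_minus[OF pf_self[OF P(1)] pf_mult[OF pf_self[OF \<phi>(1)] pf_self[OF Q(1)]]]
    unfolding pf_def by blast
  have "reval D \<gamma> = \<zero>\<^bsub>S\<^esub>" if "\<gamma> \<in> carrier S" for \<gamma>
    using D(3) red[OF that] that reval_closed[OF P(1) that] by (simp add: S.r_neg S.minus_eq)
  then have "set D \<subseteq> val_ge R K v 1" by (rule reval_zero_imp[OF D(1)])
  then obtain T where T: "set T \<subseteq> V" "\<And>z. z \<in> carrier R \<Longrightarrow> eval D z = p \<otimes> eval T z"
    using divide_by_uniformizer[OF p] by blast
  have "eval P z = eval \<phi> z \<otimes> eval Q z \<oplus> p \<otimes> eval T z" if z: "z \<in> carrier R" for z
  proof -
    have c: "eval P z \<in> carrier R" "eval \<phi> z \<otimes> eval Q z \<in> carrier R"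
      using eval_in_carrier[OF V_list_carrier z] P(1) \<phi>(1) Q(1) by auto
    have "p \<otimes> eval T z = eval P z \<ominus> eval \<phi> z \<otimes> eval Q z" using T(2)[OF z] D(2) z by simp
    moreover have "eval P z = eval \<phi> z \<otimes> eval Q z \<oplus> (eval P z \<ominus> eval \<phi> z \<otimes> eval Q z)"
      using c by algebra
    ultimately show ?thesis by simp
  qed
  with Q(1) T(1) that show thesis by blast
qed

lemma clear_denominators:
  assumes p: "p \<in> K" "p \<noteq> \<zero>" "v p = 1" and H: "set H \<subseteq> K"
  shows "\<exists>n::nat. set (map ((\<otimes>) (p [^] n)) H) \<subseteq> V"
proof -
  define n where "n = nat (\<Sum>x\<in>set H. \<bar>v x\<bar>)"
  have "p [^] n \<otimes> x \<in> V" if x: "x \<in> set H" for x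
  proof (cases "x = \<zero>")
    case False
    have "\<bar>v x\<bar> \<le> (\<Sum>x\<in>set H. \<bar>v x\<bar>)" using x by (intro member_le_sum) auto
    then have "0 \<le> int n + v x" by (simp add: n_def)
    moreover have "x \<in> K" using x H by auto
    ultimately show ?thesis
      using v_mult[of "p [^] n" x] v_pow[OF p(1,2), of n] p False by (simp add: val_ge_def)
  qed (use p K_carrier in auto)
  then show ?thesis by (intro exI[of _ n]) auto
qed

end

text \<open>The element \<open>y\<close> is to reduce to \<open>\<alpha>\<close>. This is well defined on the ring generated by \<open>y\<close> over
  the valuation ring by \<open>kernel\<close>, and \<open>eq\<close> says that \<open>p\<close> is the \<open>e\<close>-th power of
  \<open>t = \<phi>(y)\<close> up to units of the localization of that ring.\<close>

locale simple_place_extension = residue_place +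
  fixes p y \<alpha> \<phi> e u r
  assumes p: "p \<in> K" "p \<noteq> \<zero>" "v p = 1"
    and y: "y \<in> carrier R" "(algebraic over K) y"
    and \<alpha>: "\<alpha> \<in> carrier S" "(S.algebraic over (\<rho> ` val_ge R K v 0)) \<alpha>"
    and \<phi>: "set \<phi> \<subseteq> val_ge R K v 0" "map \<rho> \<phi> = S.Irr (\<rho> ` val_ge R K v 0) \<alpha>"
    and e: "0 < (e::nat)"
    and u: "set u \<subseteq> val_ge R K v 0" "reval u \<alpha> \<noteq> \<zero>\<^bsub>S\<^esub>"
    and r: "set r \<subseteq> val_ge R K v 0" "reval r \<alpha> \<noteq> \<zero>\<^bsub>S\<^esub>"
    and eq: "eval u y \<otimes> eval \<phi> y [^] e = p \<otimes> eval r y"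
    and kernel: "\<And>P. set P \<subseteq> val_ge R K v 0 \<Longrightarrow> eval P y = \<zero> \<Longrightarrow> reval P \<alpha> = \<zero>\<^bsub>S\<^esub>"
begin

definition "A = {eval P y | P. set P \<subseteq> V}"
text \<open>The map that sends \<open>y\<close> to \<open>\<alpha>\<close> and extends \<open>\<rho>\<close>; the choice of \<open>P\<close> does not matter by
  \<open>kernel\<close>.\<close>

definition sg where "sg a = reval (SOME P. set P \<subseteq> V \<and> eval P y = a) \<alpha>"
abbreviation "t \<equiv> eval \<phi> y"
abbreviation "L \<equiv> simple_extension K y"

lemma sg_eval: 
  assumes P: "set P \<subseteq> V" shows "sg (eval P y) = reval P \<alpha>"
proof -
  define Q where "Q = (SOME Q. set Q \<subseteq> V \<and> eval Q y = eval P y)"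
  have Q: "set Q \<subseteq> V" "eval Q y = eval P y"
    using someI[of "\<lambda>Q. set Q \<subseteq> V \<and> eval Q y = eval P y" P] P unfolding Q_def by auto
  obtain D where D: "set D \<subseteq> V" "\<forall>z\<in>carrier R. eval D z = eval P z \<ominus> eval Q z"
    "\<forall>\<gamma>\<in>carrier S. reval D \<gamma> = reval P \<gamma> \<ominus>\<^bsub>S\<^esub> reval Q \<gamma>"
    using pf_minus[OF pf_self[OF P] pf_self[OF Q(1)]] unfolding pf_def by blast
  have "eval D y = \<zero>" using D(2) y Q(2) eval_in_carrier[OF V_list_carrier[OF P] y(1)] by (simp add: r_neg minus_eq)
  then have "reval P \<alpha> \<ominus>\<^bsub>S\<^esub> reval Q \<alpha> = \<zero>\<^bsub>S\<^esub>" using kernel[OF D(1)] D(3) \<alpha> by simp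
  then have "reval P \<alpha> = reval Q \<alpha>"
    using S.r_right_minus_eq[OF reval_closed[OF P \<alpha>(1)] reval_closed[OF Q(1) \<alpha>(1)]] by blast
  then show ?thesis unfolding sg_def Q_def by simp
qed

lemma pf_A: 
  assumes "pf f g" shows "f y \<in> A" "sg (f y) = g \<alpha>"
proof -
  obtain P where "set P \<subseteq> V" "\<forall>z\<in>carrier R. eval P z = f z" "\<forall>\<beta>\<in>carrier S. reval P \<beta> = g \<beta>"
    using assms unfolding pf_def by auto
  then have "eval P y = f y" "reval P \<alpha> = g \<alpha>" "set P \<subseteq> V" using y \<alpha> by auto
  then show "f y \<in> A" "sg (f y) = g \<alpha>"
    using sg_eval[of P] unfolding A_def by (auto intro!: exI[of _ P])
qed

lemma A_cases: "a \<in> A \<Longrightarrow> \<exists>P. set P \<subseteq> V \<and> a = eval P y"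
  by (auto simp: A_def)

lemma A_E: "set P \<subseteq> V \<Longrightarrow> eval P y \<in> A \<and> sg (eval P y) = reval P \<alpha>"
  using pf_A[OF pf_self] by simp

lemma A_ops:
  assumes "a \<in> A" "b \<in> A"
  shows "a \<oplus> b \<in> A \<and> sg (a \<oplus> b) = sg a \<oplus>\<^bsub>S\<^esub> sg b" "a \<otimes> b \<in> A \<and> sg (a \<otimes> b) = sg a \<otimes>\<^bsub>S\<^esub> sg b"
    "\<ominus> a \<in> A" "sg a \<in> carrier S" "a \<in> carrier R"
proof -
  obtain P Q where P: "set P \<subseteq> V" "a = eval P y" and Q: "set Q \<subseteq> V" "b = eval Q y"
    using A_cases assms by metis
  note s = pf_self[OF P(1)] pf_self[OF Q(1)]
  have c: "a \<in> carrier R" "b \<in> carrier R" using eval_in_carrier[OF V_list_carrier y(1)] P Q by auto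
  show "a \<oplus> b \<in> A \<and> sg (a \<oplus> b) = sg a \<oplus>\<^bsub>S\<^esub> sg b"
    using pf_A[OF pf_add[OF s]] A_E[OF P(1)] A_E[OF Q(1)] P(2) Q(2) by simp
  show "a \<otimes> b \<in> A \<and> sg (a \<otimes> b) = sg a \<otimes>\<^bsub>S\<^esub> sg b"
    using pf_A[OF pf_mult[OF s]] A_E[OF P(1)] A_E[OF Q(1)] P(2) Q(2) by simp
  show "\<ominus> a \<in> A"
    using pf_A(1)[OF pf_mult[OF pf_const[of "\<ominus> \<one>"] s(1)]] P(2) c by (simp add: l_minus)
  show "sg a \<in> carrier S" using A_E[OF P(1)] P reval_closed[OF P(1) \<alpha>(1)] by simp
  show "a \<in> carrier R" by (rule c)
qed

lemma A_const: "c \<in> V \<Longrightarrow> c \<in> A \<and> sg c = \<rho> c"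
  using pf_A[OF pf_const] by simp

lemma A_subring: "subring A R"
  by (rule subringI) (use A_ops A_const in auto)

lemma sg_hom: "sg \<in> ring_hom (R\<lparr>carrier := A\<rparr>) S"
  by (rule ring_hom_memI) (use A_ops A_const[of \<one>] \<rho>_simps in auto)

lemma L_subfield: "subfield L R"
  using simple_extension_is_subfield[OF K y(1)] y(2) by simp

lemma K_L: "K \<subseteq> L"
  by (rule simple_extension_incl[OF subfieldE(3)[OF K] y(1)])

lemma y_L: "y \<in> L"
  by (rule simple_extension_mem[OF subfieldE(1)[OF K] y(1)])

lemma A_L: "a \<in> A \<Longrightarrow> a \<in> L"
proof -
  assume "a \<in> A"
  then obtain P where P: "set P \<subseteq> V" "a = eval P y" using A_cases by blast
  have "set P \<subseteq> L" using P(1) K_L ge_K by blast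
  then show ?thesis using eval_in_subring[OF subfieldE(1)[OF L_subfield] _ y_L] P(2) by simp
qed

lemma p_V: "p \<in> V"
  using p by (simp add: val_ge_def)

lemma p_A: "p [^] (n::nat) \<in> A"
  using A_const[OF V_pow[OF p_V]] by simp

lemma L_cases: "z \<in> L \<Longrightarrow> \<exists>H. set H \<subseteq> K \<and> z = eval H y"
  using simple_extension_cases[OF subfieldE(3)[OF K] y(1)] .

lemma L_clear: "z \<in> L \<Longrightarrow> \<exists>n::nat. p [^] n \<otimes> z \<in> A"
proof -
  assume "z \<in> L"
  then obtain H where H: "set H \<subseteq> K" "z = eval H y" using L_cases by auto
  obtain n :: nat where n: "set (map ((\<otimes>) (p [^] n)) H) \<subseteq> V" using clear_denominators[OF p H(1)] by auto
  have Hc: "set H \<subseteq> carrier R" using H(1) K_carrier by auto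
  have "p [^] n \<otimes> z = eval (map ((\<otimes>) (p [^] n)) H) y"
    using eval_scale[OF _ Hc y(1), of "p [^] n"] p K_carrier H by simp
  then show ?thesis using A_E[OF n] by (metis)
qed

lemma t_A: "t \<in> A" and sg_t: "sg t = \<zero>\<^bsub>S\<^esub>"
proof -
  show "t \<in> A" using A_E[OF \<phi>(1)] by simp
  show "sg t = \<zero>\<^bsub>S\<^esub>" using A_E[OF \<phi>(1)] S.IrrE(4)[OF k_subfield \<alpha>] by (simp add: reval_def \<phi>(2))
qed

lemma p_pow: "p [^] (n::nat) \<in> carrier R" "p [^] n \<noteq> \<zero>"
  using K_carrier[OF p(1)] nat_pow_nonzero[OF K_carrier[OF p(1)] p(2)] by simp_all

lemma ur: "eval u y \<in> A" "eval r y \<in> A" "sg (eval u y) \<noteq> \<zero>\<^bsub>S\<^esub>" "sg (eval r y) \<noteq> \<zero>\<^bsub>S\<^esub>"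
  using A_E u r by auto

sublocale loc: localization R S A sg t L
proof (rule localization.intro[OF field_axioms S.field_axioms], rule localization_axioms.intro)
  show "subring A R" by (rule A_subring)
  show "sg \<in> ring_hom (R\<lparr>carrier := A\<rparr>) S" by (rule sg_hom)
  show "t \<in> A" by (rule t_A)
  show "sg t = \<zero>\<^bsub>S\<^esub>" by (rule sg_t)
  have tc: "t \<in> carrier R" "eval u y \<in> carrier R" "eval r y \<in> carrier R" "p \<in> carrier R"
    using A_ops(5) t_A ur p K_carrier by auto
  show "t \<noteq> \<zero>"
  proof
    assume "t = \<zero>"
    then have "p \<otimes> eval r y = \<zero>" using eq[symmetric] e tc by (simp add: nat_pow_zero)
    then have "eval r y = \<zero>" using p tc by (simp add: integral_iff)
    then show False using kernel[OF r(1)] r(2) by simp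
  qed
  show "subfield L R" by (rule L_subfield)
  obtain e' where e': "e = Suc e'" using e gr0_implies_Suc by blast
  show "\<exists>s\<in>A. \<exists>b\<in>A. sg s \<noteq> \<zero>\<^bsub>S\<^esub> \<and> a \<otimes> s = t \<otimes> b" if a: "a \<in> A" "sg a = \<zero>\<^bsub>S\<^esub>" for a
  proof -
    obtain P where P: "set P \<subseteq> V" "a = eval P y" using A_cases[OF a(1)] by blast
    have "reval P \<alpha> = \<zero>\<^bsub>S\<^esub>" using a(2) P A_E by simp
    then obtain Q T where Q: "set Q \<subseteq> V" "set T \<subseteq> V"
      and d: "\<And>z. z \<in> carrier R \<Longrightarrow> eval P z = eval \<phi> z \<otimes> eval Q z \<oplus> p \<otimes> eval T z"
      using vanishing_decomposition[OF p \<alpha> \<phi> P(1)] by blast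
    have qA: "eval Q y \<in> A" "eval T y \<in> A" using A_E Q by auto
    then have qc: "eval Q y \<in> carrier R" "eval T y \<in> carrier R" "t [^] e' \<in> carrier R" using A_ops(5) tc by auto
    have "t [^] e' \<in> A" using eval_pow_closed[OF t_A A_subring] .
    then have bA: "eval Q y \<otimes> eval r y \<oplus> eval u y \<otimes> t [^] e' \<otimes> eval T y \<in> A"
      using qA ur by (intro subringE(6,7)[OF A_subring])
    have "a \<otimes> eval r y = t \<otimes> eval Q y \<otimes> eval r y \<oplus> (p \<otimes> eval r y) \<otimes> eval T y"
      unfolding P(2) d[OF y(1)] using tc qc by algebra
    also have "\<dots> = t \<otimes> (eval Q y \<otimes> eval r y \<oplus> eval u y \<otimes> t [^] e' \<otimes> eval T y)"
      unfolding eq[symmetric] e' nat_pow_Suc using tc qc by algebra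
    finally show ?thesis using ur bA by blast
  qed
  show "\<exists>n::nat. \<exists>b\<in>A. \<exists>c\<in>A. \<exists>d\<in>A. sg c \<noteq> \<zero>\<^bsub>S\<^esub> \<and> sg d \<noteq> \<zero>\<^bsub>S\<^esub> \<and> a \<otimes> b \<otimes> c = t [^] n \<otimes> d"
    if a: "a \<in> A" "a \<noteq> \<zero>" for a
  proof -
    have ac: "a \<in> carrier R" using A_ops(5) a by auto
    have i: "inv a \<in> L" "a \<otimes> inv a = \<one>" using subfield_m_inv[OF L_subfield, of a] A_L a by auto
    then have ic: "inv a \<in> carrier R" using subfieldE(3)[OF L_subfield] by auto
    obtain n :: nat where n: "p [^] n \<otimes> inv a \<in> A" using L_clear i(1) by blast
    have pw: "c [^] (m::nat) \<in> A \<and> sg (c [^] m) \<noteq> \<zero>\<^bsub>S\<^esub>" if "c \<in> A" "sg c \<noteq> \<zero>\<^bsub>S\<^esub>" for c m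
    proof (induction m)
      case 0
      then show ?case using A_const[of \<one>] \<rho>_simps by simp
    next
      case (Suc m)
      then show ?case using A_ops[of "c [^] m" c] A_ops(4)[of c] that by (simp add: S.integral_iff A_ops(4))
    qed
    have "a \<otimes> (p [^] n \<otimes> inv a) \<otimes> eval r y [^] n = (a \<otimes> inv a) \<otimes> (p [^] n \<otimes> eval r y [^] n)"
      using ac ic tc p_pow(1)[of n] nat_pow_closed[OF tc(3), of n] by algebra
    also have "\<dots> = (p \<otimes> eval r y) [^] n"
      using i tc by (simp add: nat_pow_distrib)
    also have "\<dots> = t [^] (e * n) \<otimes> eval u y [^] n"
      unfolding eq[symmetric] using tc by (simp add: nat_pow_distrib nat_pow_pow m_comm)
    finally show ?thesis using n pw[OF ur(2,4)] pw[OF ur(1,3)] by blast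
  qed
  show "L = {z \<in> carrier R. \<exists>b\<in>A. b \<noteq> \<zero> \<and> z \<otimes> b \<in> A}"
  proof (rule Set.set_eqI, rule iffI)
    fix z assume z: "z \<in> L"
    then have zc: "z \<in> carrier R" using subfieldE(3)[OF L_subfield] by auto
    obtain n :: nat where "p [^] n \<otimes> z \<in> A" using L_clear z by blast
    then have "z \<otimes> p [^] n \<in> A" using zc p_pow(1)[of n] by (simp add: m_comm)
    then show "z \<in> {z \<in> carrier R. \<exists>b\<in>A. b \<noteq> \<zero> \<and> z \<otimes> b \<in> A}"
      using p_A[of n] p_pow[of n] zc by blast
  next
    fix z assume "z \<in> {z \<in> carrier R. \<exists>b\<in>A. b \<noteq> \<zero> \<and> z \<otimes> b \<in> A}"
    then obtain b where b: "z \<in> carrier R" "b \<in> A" "b \<noteq> \<zero>" "z \<otimes> b \<in> A" by auto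
    have "b \<otimes> z \<in> L" using b A_L A_ops(5) by (simp add: m_comm)
    then show "z \<in> L"
      using subfield_m_inv_simprule[OF L_subfield, of b z] b A_L by auto
  qed
qed

abbreviation "w \<equiv> loc.w"
abbreviation "\<rho>' \<equiv> loc.res"

lemma w_K: "x \<in> K \<Longrightarrow> x \<noteq> \<zero> \<Longrightarrow> w x = int e * v x"
proof -
  have wp: "w p = int e"
  proof -
    have "loc.has_val p (int e)"
    proof (rule loc.has_valI)
      show "loc.unit (eval r y)" "loc.unit (eval u y)" using ur by (auto simp: loc.unit_def)
      show "p \<in> carrier R" using p K_carrier by simp
      show "p \<otimes> eval r y = t [^] e \<otimes> eval u y"
        using eq A_ops(5) t_A ur by (simp add: m_comm)
    qed
    then show ?thesis using loc.w_eq[of p] p K_L by auto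
  qed
  have u0: "w x = 0" if "x \<in> K" "x \<noteq> \<zero>" "v x = 0" for x
  proof -
    have "x \<in> V" using that by (simp add: val_ge_def)
    moreover have "\<rho> x \<noteq> \<zero>\<^bsub>S\<^esub>" using ker[OF \<open>x \<in> V\<close>] that by (simp add: val_ge_def)
    ultimately show ?thesis using A_const by (intro loc.w_unit) (simp add: loc.unit_def)
  qed
  have pos: "w x = int e * v x" if x: "x \<in> K" "x \<noteq> \<zero>" "0 \<le> v x" for x
  proof -
    define n where "n = nat (v x)"
    have pn: "p [^] n \<in> K" "p [^] n \<noteq> \<zero>" "v (p [^] n) = v x"
      using K_pow[OF p(1), of n] v_pow[OF p(1,2), of n] p(3) x(3) by (simp_all add: n_def)
    note i = K_inv[OF pn(1,2)]
    define c where "c = x \<otimes> inv (p [^] n)"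
    have c: "c \<in> K" "c \<noteq> \<zero>" "v c = 0"
      using i x mult_nonzero[OF x(1,2)] v_mult[OF x(1,2), of "inv (p [^] n)"] v_inv[OF pn(1,2)] pn(3) by (auto simp: c_def)
    have "x = p [^] n \<otimes> c" using i x pn K_carrier by (simp add: c_def m_lcomm)
    then have "w x = w (p [^] n) + w c" using loc.L.v_mult[of "p [^] n" c] pn c K_L by auto
    also have "w (p [^] n) = int n * int e" using loc.L.v_pow[of p n] p K_L wp by auto
    finally show ?thesis using u0[OF c] x(3) by (simp add: n_def)
  qed
  assume x: "x \<in> K" "x \<noteq> \<zero>"
  show ?thesis
  proof (cases "0 \<le> v x")
    case False
    note i = K_inv[OF x]
    have "w (inv x) = int e * v (inv x)" using pos[of "inv x"] i v_inv[OF x] False by simp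
    then show ?thesis using v_inv[OF x] loc.L.v_inv[of x] x K_L by auto
  qed (use pos x in simp)
qed

lemma \<rho>'_V: "x \<in> V \<Longrightarrow> \<rho>' x = \<rho> x"
  using loc.res_A A_const by simp

lemma A_ge: "a \<in> A \<Longrightarrow> a \<in> val_ge R L w 0"
  unfolding loc.ge_iff using loc.unit_one A_ops(5) by (auto intro!: exI[of _ \<one>])

lemma y_ge: "y \<in> val_ge R L w 0" and \<rho>'_y: "\<rho>' y = \<alpha>"
  using pf_A[OF pf_var] A_ge loc.res_A by auto

lemma sg_image: "sg ` A = S.simple_extension k \<alpha>"
proof -
  have "S.simple_extension k \<alpha> = sg ` A"
  proof (rule Set.set_eqI, rule iffI)
    fix s assume "s \<in> S.simple_extension k \<alpha>"
    then obtain q where q: "set q \<subseteq> k" "s = S.eval q \<alpha>"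
      using S.simple_extension_cases[OF subfieldE(3)[OF k_subfield] \<alpha>(1)] by blast
    obtain Q where "set Q \<subseteq> V" "map \<rho> Q = q" using lift_list[OF q(1)] .
    then show "s \<in> sg ` A" using A_E[of Q] q(2) by (auto simp: reval_def intro!: image_eqI[of _ _ "eval Q y"])
  next
    fix s assume "s \<in> sg ` A"
    then obtain a where a: "a \<in> A" "s = sg a" by blast
    then obtain P where P: "set P \<subseteq> V" "s = reval P \<alpha>" using A_cases[OF a(1)] A_E by auto
    have m: "set (map \<rho> P) \<subseteq> k" using P(1) by auto
    have "S.normalize (map \<rho> P) \<in> carrier (k[X]\<^bsub>S\<^esub>)"
      using S.normalize_gives_polynomial[OF m] univ_poly_carrier by blast
    moreover have "S.eval (S.normalize (map \<rho> P)) \<alpha> = s"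
      using S.eval_normalize[OF map_\<rho>_closed[OF P(1)] \<alpha>(1)] P(2) by (simp add: reval_def)
    ultimately show "s \<in> S.simple_extension k \<alpha>"
      unfolding S.simple_extension_as_eval_img[OF subfieldE(3)[OF k_subfield] \<alpha>(1)] by blast
  qed
  then show ?thesis by simp
qed

lemma k\<alpha>_subfield: "subfield (S.simple_extension k \<alpha>) S"
  using S.simple_extension_is_subfield[OF k_subfield \<alpha>(1)] \<alpha>(2) by simp

lemma \<rho>'_image: "\<rho>' ` val_ge R L w 0 = S.simple_extension k \<alpha>"
proof
  show "S.simple_extension k \<alpha> \<subseteq> \<rho>' ` val_ge R L w 0"
    unfolding sg_image[symmetric] using A_ge loc.res_A by force
  show "\<rho>' ` val_ge R L w 0 \<subseteq> S.simple_extension k \<alpha>"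
  proof
    fix s assume "s \<in> \<rho>' ` val_ge R L w 0"
    then obtain z where z: "z \<in> val_ge R L w 0" "s = \<rho>' z" by auto
    obtain b where b: "loc.unit b" "z \<otimes> b \<in> A" "\<rho>' z \<in> carrier S" "\<rho>' z \<otimes>\<^bsub>S\<^esub> sg b = sg (z \<otimes> b)"
      using loc.res[OF z(1)] .
    have bk: "sg b \<in> S.simple_extension k \<alpha> - {\<zero>\<^bsub>S\<^esub>}" "sg (z \<otimes> b) \<in> S.simple_extension k \<alpha>"
      using b(1,2) sg_image by (auto simp: loc.unit_def)
    have "sg b \<otimes>\<^bsub>S\<^esub> \<rho>' z \<in> S.simple_extension k \<alpha>"
      using bk(2) b(3,4) A_ops(4) b(1) by (metis S.m_comm loc.unitD(1))
    then show "s \<in> S.simple_extension k \<alpha>"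
      using S.subfield_m_inv_simprule[OF k\<alpha>_subfield bk(1) b(3)] z(2) by simp
  qed
qed

end

text \<open>In a valuation ring, a sum of non-units is a non-unit: one of the quotients of the summands
  lies in the ring.\<close>

lemma (in field) valuation_ring_unit_add:
  assumes U: "subring U R" "\<And>x. x \<in> L \<Longrightarrow> x \<noteq> \<zero> \<Longrightarrow> x \<in> U \<or> inv x \<in> U"
    and L: "subfield L R" "U \<subseteq> L"
    and x: "x \<in> U" and y: "y \<in> U" and xy: "x \<oplus> y \<noteq> \<zero>" "inv (x \<oplus> y) \<in> U"
  shows "(x \<noteq> \<zero> \<and> inv x \<in> U) \<or> (y \<noteq> \<zero> \<and> inv y \<in> U)"
proof -
  note sU = subringE[OF U(1)]
  have c: "x \<in> carrier R" "y \<in> carrier R" using sU(1) x y by auto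
  have *: "inv y \<in> U" if "x \<in> U" "y \<in> U" "x \<oplus> y \<noteq> \<zero>" "inv (x \<oplus> y) \<in> U" "y \<noteq> \<zero>" "x \<otimes> inv y \<in> U" for x y
  proof -
    have c: "x \<in> carrier R" "y \<in> carrier R" using sU(1) that by auto
    have i: "inv y \<in> carrier R" "y \<otimes> inv y = \<one>" using c that(5) field_Units by auto
    have j: "inv (x \<oplus> y) \<in> carrier R" "(x \<oplus> y) \<otimes> inv (x \<oplus> y) = \<one>" using c that(3) field_Units by auto
    have "inv y = inv y \<otimes> ((x \<oplus> y) \<otimes> inv (x \<oplus> y))" using i j by simp
    also have "\<dots> = (x \<otimes> inv y \<oplus> y \<otimes> inv y) \<otimes> inv (x \<oplus> y)" using c i(1) j(1) by algebra
    also have "\<dots> = (x \<otimes> inv y \<oplus> \<one>) \<otimes> inv (x \<oplus> y)" using i by simp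
    also have "\<dots> \<in> U" using that sU by auto
    finally show ?thesis .
  qed
  consider "x = \<zero>" | "y = \<zero>" | "x \<noteq> \<zero>" "y \<noteq> \<zero>" by auto
  then show ?thesis
  proof cases
    case 3
    have i: "inv x \<in> carrier R" "inv y \<in> carrier R" "inv x \<noteq> \<zero>" "inv y \<noteq> \<zero>" "x \<otimes> inv x = \<one>" "y \<otimes> inv y = \<one>"
      "inv x \<in> L" "inv y \<in> L"
      using subfield_m_inv[OF L(1), of x] subfield_m_inv[OF L(1), of y] 3 x y L(2) c field_Units by auto
    have "x \<otimes> inv y \<in> L" "x \<otimes> inv y \<noteq> \<zero>"
      using i c x L(2) subringE(6)[OF subfieldE(1)[OF L(1)]] 3 by (auto simp: integral_iff)
    then have "x \<otimes> inv y \<in> U \<or> inv (x \<otimes> inv y) \<in> U" by (rule U(2))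
    moreover have "inv (x \<otimes> inv y) = y \<otimes> inv x"
    proof (rule comm_inv_char)
      have "x \<otimes> inv y \<otimes> (y \<otimes> inv x) = (x \<otimes> inv x) \<otimes> (y \<otimes> inv y)" using c i(1,2) by algebra
      then show "x \<otimes> inv y \<otimes> (y \<otimes> inv x) = \<one>" using i by simp
    qed (use c i in auto)
    ultimately show ?thesis
      using *[OF x y xy 3(2)] *[OF y x _ _ 3(1)] xy a_comm[OF c] 3 by auto
  qed (use xy c in auto)
qed

text \<open>The maximal ideal of \<open>U\<close> contains \<open>p\<close> and \<open>t\<close>, which generate the kernel of \<open>sg\<close>. Since the
  image of \<open>sg\<close> is a field, elements of \<open>A\<close> outside the kernel are units of \<open>U\<close>. So \<open>U\<close>
  contains the localization, which is a maximal subring.\<close>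

lemma (in simple_place_extension) valuation_ring_unique:
  assumes U: "subring U R" "U \<subseteq> L" "U \<noteq> L" "\<And>x. x \<in> L \<Longrightarrow> x \<noteq> \<zero> \<Longrightarrow> x \<in> U \<or> inv x \<in> U"
    and UV: "V \<subseteq> U" "inv p \<notin> U" and yU: "y \<in> U" and tU: "inv t \<notin> U"
  shows "U = val_ge R L w 0"
proof -
  note sU = subringE[OF U(1)]
  have AU: "a \<in> U" if "a \<in> A" for a
    using that eval_in_subring[OF U(1) _ yU] UV(1) by (auto simp: A_def)
  have nonunit_mult: "inv (a \<otimes> b) \<notin> U" if "a \<in> U" "b \<in> U" "a \<noteq> \<zero>" "inv a \<notin> U" "b \<noteq> \<zero>" for a b
  proof
    assume i: "inv (a \<otimes> b) \<in> U"
    have c: "a \<in> carrier R" "b \<in> carrier R" using that sU(1) by auto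
    have "a \<otimes> b \<in> Units R" using c that by (simp add: field_Units integral_iff)
    then have "a \<otimes> (b \<otimes> inv (a \<otimes> b)) = \<one>" using c by (simp flip: m_assoc)
    then have "inv a = b \<otimes> inv (a \<otimes> b)" using c i sU(1) by (intro comm_inv_char) auto
    then show False using i that sU by auto
  qed
  have pc: "p \<in> U" using p_V UV(1) by auto
  have unit_inv_U: "inv a \<in> U" if a: "loc.unit a" for a
  proof -
    have aA: "a \<in> A" "sg a \<noteq> \<zero>\<^bsub>S\<^esub>" "a \<noteq> \<zero>" "a \<in> carrier R" using a loc.unitD[OF a] by (auto simp: loc.unit_def)
    have "sg a \<in> S.simple_extension k \<alpha> - {\<zero>\<^bsub>S\<^esub>}" using aA sg_image by auto
    then have "inv\<^bsub>S\<^esub> (sg a) \<in> sg ` A" "sg a \<otimes>\<^bsub>S\<^esub> inv\<^bsub>S\<^esub> (sg a) = \<one>\<^bsub>S\<^esub>"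
      using S.subfield_m_inv[OF k\<alpha>_subfield] sg_image by auto
    then obtain b where b: "b \<in> A" "sg a \<otimes>\<^bsub>S\<^esub> sg b = \<one>\<^bsub>S\<^esub>" by auto
    have bc: "b \<in> carrier R" using A_ops(5) b by auto
    have ab: "a \<otimes> b \<in> A" "sg (a \<otimes> b) = \<one>\<^bsub>S\<^esub>" using A_ops(2)[OF aA(1) b(1)] b(2) by auto
    have m1: "\<ominus> \<one> \<in> A" "sg (\<ominus> \<one>) = \<ominus>\<^bsub>S\<^esub> \<one>\<^bsub>S\<^esub>" using A_const[of "\<ominus> \<one>"] \<rho>_neg[of \<one>] \<rho>_simps(4) by auto
    have "a \<otimes> b \<oplus> \<ominus> \<one> \<in> A" "sg (a \<otimes> b \<oplus> \<ominus> \<one>) = \<zero>\<^bsub>S\<^esub>"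
      using A_ops(1)[OF ab(1) m1(1)] ab(2) m1(2) by (auto simp: S.r_neg)
    then obtain P where P: "set P \<subseteq> V" "a \<otimes> b \<oplus> \<ominus> \<one> = eval P y" "reval P \<alpha> = \<zero>\<^bsub>S\<^esub>"
      using A_cases[of "a \<otimes> b \<oplus> \<ominus> \<one>"] A_E by auto
    obtain Q T where Q: "set Q \<subseteq> V" "set T \<subseteq> V"
      and d: "\<And>z. z \<in> carrier R \<Longrightarrow> eval P z = eval \<phi> z \<otimes> eval Q z \<oplus> p \<otimes> eval T z"
      using vanishing_decomposition[OF p \<alpha> \<phi> P(1,3)] by blast
    have q: "eval Q y \<in> U" "eval T y \<in> U" "t \<in> U" using A_E Q t_A AU by auto
    have cc: "eval Q y \<in> carrier R" "eval T y \<in> carrier R" "t \<in> carrier R" "p \<in> carrier R"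
      using q sU(1) p K_carrier by auto
    have one: "a \<otimes> b \<oplus> \<ominus> (t \<otimes> eval Q y \<oplus> p \<otimes> eval T y) = \<one>"
    proof -
      have "t \<otimes> eval Q y \<oplus> p \<otimes> eval T y = a \<otimes> b \<oplus> \<ominus> \<one>" using d[OF y(1)] P(2) by simp
      then show ?thesis using aA bc by (simp add: minus_add a_assoc[symmetric] r_neg)
    qed
    have nz: "inv x \<notin> U" if "x = t \<otimes> eval Q y \<oplus> p \<otimes> eval T y" "x \<noteq> \<zero>" for x
    proof
      assume "inv x \<in> U"
      then have "(t \<otimes> eval Q y \<noteq> \<zero> \<and> inv (t \<otimes> eval Q y) \<in> U) \<or> (p \<otimes> eval T y \<noteq> \<zero> \<and> inv (p \<otimes> eval T y) \<in> U)"
        using that q pc sU cc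
        by (intro valuation_ring_unit_add[OF U(1) U(4) L_subfield U(2)]) auto
      then show False
        using nonunit_mult[OF q(3) q(1)] nonunit_mult[OF pc q(2)] tU UV(2) p(2) cc loc.t(3) by (auto simp: integral_iff)
    qed
    let ?x = "t \<otimes> eval Q y \<oplus> p \<otimes> eval T y"
    have "(a \<otimes> b \<noteq> \<zero> \<and> inv (a \<otimes> b) \<in> U) \<or> (\<ominus> ?x \<noteq> \<zero> \<and> inv (\<ominus> ?x) \<in> U)"
      by (rule valuation_ring_unit_add[OF U(1) U(4) L_subfield U(2)]) (use AU[OF ab(1)] q pc sU one in auto)
    moreover have "\<not> (\<ominus> ?x \<noteq> \<zero> \<and> inv (\<ominus> ?x) \<in> U)"
    proof
      assume n: "\<ominus> ?x \<noteq> \<zero> \<and> inv (\<ominus> ?x) \<in> U"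
      have xc: "?x \<in> carrier R" using cc by simp
      have x0: "?x \<noteq> \<zero>" using n by auto
      define j where "j = inv (\<ominus> ?x)"
      have j: "j \<in> carrier R" "\<ominus> ?x \<otimes> j = \<one>" using n xc field_Units by (auto simp: j_def)
      then have "?x \<otimes> \<ominus> j = \<one>" using xc by (simp add: r_minus l_minus)
      then have "inv ?x = \<ominus> j"
        using xc j(1) by (intro comm_inv_char) auto
      then show False using nz[OF refl x0] n sU by (auto simp: j_def)
    qed
    ultimately have "a \<otimes> b \<noteq> \<zero>" "inv (a \<otimes> b) \<in> U" by auto
    then show "inv a \<in> U"
      using nonunit_mult[OF AU[OF aA(1)] AU[OF b(1)] aA(3)] bc aA by (cases "b = \<zero>") auto
  qed
  have "val_ge R L w 0 \<subseteq> U"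
  proof
    fix z assume "z \<in> val_ge R L w 0"
    then obtain b where b: "z \<in> carrier R" "loc.unit b" "z \<otimes> b \<in> A" unfolding loc.ge_iff by auto
    have "(z \<otimes> b) \<otimes> inv b \<in> U" using AU[OF b(3)] unit_inv_U[OF b(2)] sU by auto
    moreover have "b \<in> Units R" "b \<in> carrier R" using loc.unitD[OF b(2)] field_Units by auto
    then have "(z \<otimes> b) \<otimes> inv b = z" using b(1) by (simp add: m_assoc)
    ultimately show "z \<in> U" by simp
  qed
  then show ?thesis using loc.L.maximal_subring[OF U(1) _ U(2,3)] by simp
qed

section \<open>Valuation rings and monic polynomials\<close>

text \<open>The homogenization of a polynomial, as a function of two variables.\<close>

fun (in ring) homog :: "'a list \<Rightarrow> 'a \<Rightarrow> 'a \<Rightarrow> 'a" where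
  "homog [] x z = \<zero>"
| "homog (a # p) x z = a \<otimes> x [^] length p \<oplus> z \<otimes> homog p x z"

lemma (in ring) homog_in_subring:
  "subring H R \<Longrightarrow> set p \<subseteq> H \<Longrightarrow> x \<in> H \<Longrightarrow> z \<in> H \<Longrightarrow> homog p x z \<in> H"
  by (induction p) (auto simp: subringE eval_pow_closed)

lemma (in ring) homog_closed:
  "set p \<subseteq> carrier R \<Longrightarrow> x \<in> carrier R \<Longrightarrow> z \<in> carrier R \<Longrightarrow> homog p x z \<in> carrier R"
  by (rule homog_in_subring[OF carrier_is_subring])

lemma (in ring) homog_one:
  "set p \<subseteq> carrier R \<Longrightarrow> x \<in> carrier R \<Longrightarrow> homog p x \<one> = eval p x"
  by (induction p) (auto simp: eval_in_carrier)

lemma (in cring) homog_scale: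
  assumes "set p \<subseteq> carrier R" and [simp]: "x \<in> carrier R" "z \<in> carrier R" "t \<in> carrier R"
  shows "homog p (t \<otimes> x) (t \<otimes> z) = t [^] (length p - 1) \<otimes> homog p x z"
  using assms(1)
proof (induction p)
  case (Cons a p)
  then have c [simp]: "a \<in> carrier R" "homog p x z \<in> carrier R" by (auto intro: homog_closed)
  have "(t \<otimes> z) \<otimes> homog p (t \<otimes> x) (t \<otimes> z) = t [^] length p \<otimes> (z \<otimes> homog p x z)"
  proof (cases p)
    case (Cons b q)
    then have "t [^] length p = t \<otimes> t [^] (length p - 1)" by (simp add: m_comm)
    moreover have "(t \<otimes> z) \<otimes> homog p (t \<otimes> x) (t \<otimes> z) = (t \<otimes> t [^] (length p - 1)) \<otimes> (z \<otimes> homog p x z)"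
      using Cons.IH Cons.prems by (simp add: m_ac)
    ultimately show ?thesis by simp
  qed simp
  then show ?case
    by (simp add: nat_pow_distrib r_distr m_lcomm)
qed simp

lemma (in cring) homog_zero:
  "a \<in> carrier R \<Longrightarrow> set p \<subseteq> carrier R \<Longrightarrow> x \<in> carrier R \<Longrightarrow> homog (a # p) x \<zero> = a \<otimes> x [^] length p"
  by (simp add: homog_closed)

lemma (in field) inv_product:
  assumes "x \<in> carrier R" "x \<noteq> \<zero>" "y \<in> carrier R" "y \<noteq> \<zero>"
  shows "inv (x \<otimes> y) = inv x \<otimes> inv y"
proof (rule comm_inv_char)
  have i: "inv x \<in> carrier R" "x \<otimes> inv x = \<one>" "inv y \<in> carrier R" "y \<otimes> inv y = \<one>"
    using assms field_Units by auto
  have "x \<otimes> y \<otimes> (inv x \<otimes> inv y) = (x \<otimes> inv x) \<otimes> (y \<otimes> inv y)" using assms i(1,3) by (simp add: m_ac)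
  then show "x \<otimes> y \<otimes> (inv x \<otimes> inv y) = \<one>" using i by simp
qed (use assms field_Units in auto)

lemma (in field) inv_props:
  assumes "x \<in> carrier R" "x \<noteq> \<zero>"
  shows "inv x \<in> carrier R" "inv x \<noteq> \<zero>" "x \<otimes> inv x = \<one>" "inv x \<otimes> x = \<one>" "inv (inv x) = x"
proof -
  show i: "inv x \<in> carrier R" "x \<otimes> inv x = \<one>" "inv x \<otimes> x = \<one>" "inv (inv x) = x"
    using assms field_Units by auto
  show "inv x \<noteq> \<zero>" using i(2) assms by auto
qed

text \<open>Valuation rings of \<open>L\<close> of arbitrary rank: that there are only discrete ones above a given place
  is a result.\<close>

locale valuation_subring = field R for R (structure) +
  fixes L U :: "'a set"
  assumes L: "subfield L R" and U: "subring U R" and UL: "U \<subseteq> L"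
    and total: "\<And>x. x \<in> L \<Longrightarrow> x \<noteq> \<zero> \<Longrightarrow> x \<in> U \<or> inv x \<in> U"
begin

definition unit where "unit x \<longleftrightarrow> x \<in> U \<and> x \<noteq> \<zero> \<and> inv x \<in> U"

lemma U_carrier: "x \<in> U \<Longrightarrow> x \<in> carrier R"
  using subringE(1)[OF U] by auto

lemma U_closed: "\<zero> \<in> U" "\<one> \<in> U" "x \<in> U \<Longrightarrow> y \<in> U \<Longrightarrow> x \<oplus> y \<in> U" "x \<in> U \<Longrightarrow> y \<in> U \<Longrightarrow> x \<otimes> y \<in> U"
  "x \<in> U \<Longrightarrow> \<ominus> x \<in> U" "x \<in> U \<Longrightarrow> x [^] (n::nat) \<in> U"
  using subringE[OF U] eval_pow_closed[OF _ U] by auto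

lemma unitI: "x \<in> U \<Longrightarrow> y \<in> U \<Longrightarrow> x \<otimes> y = \<one> \<Longrightarrow> unit x"
  unfolding unit_def using U_carrier comm_inv_char[of x y] by auto

lemma unit_mult_iff: 
  assumes "x \<in> U" "y \<in> U" shows "unit (x \<otimes> y) \<longleftrightarrow> unit x \<and> unit y"
proof
  assume u: "unit (x \<otimes> y)"
  let ?i = "inv (x \<otimes> y)"
  have c: "x \<in> carrier R" "y \<in> carrier R" "?i \<in> carrier R" using assms U_carrier u by (auto simp: unit_def)
  have "x \<otimes> y \<otimes> ?i = \<one>" using inv_props(3)[of "x \<otimes> y"] u c by (auto simp: unit_def)
  then have 1: "x \<otimes> (y \<otimes> ?i) = \<one>" and 2: "y \<otimes> (x \<otimes> ?i) = \<one>" using c by (simp_all add: m_ac)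
  have iU: "?i \<in> U" using u by (simp add: unit_def)
  show "unit x \<and> unit y"
    using unitI[OF assms(1) U_closed(4)[OF assms(2) iU] 1] unitI[OF assms(2) U_closed(4)[OF assms(1) iU] 2] by simp
next
  assume u: "unit x \<and> unit y"
  have c: "x \<in> carrier R" "y \<in> carrier R" using assms U_carrier by auto
  show "unit (x \<otimes> y)"
    unfolding unit_def using u inv_product[OF c(1) _ c(2)] c assms
    by (auto simp: unit_def integral_iff intro: U_closed(4))
qed

lemma unit_one: "unit \<one>"
  using U_closed by (simp add: unit_def)

lemma unit_pow: "unit x \<Longrightarrow> unit (x [^] (n::nat))"
proof (induction n)
  case (Suc n)
  then show ?case using unit_mult_iff[of "x [^] n" x] by (simp add: unit_def)
qed (simp add: unit_one)

lemma unit_neg: "unit x \<Longrightarrow> unit (\<ominus> x)"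
proof -
  assume "unit x"
  then have x: "x \<in> U" "inv x \<in> U" "x \<in> carrier R" "x \<noteq> \<zero>" using U_carrier by (auto simp: unit_def)
  show ?thesis
    using unitI[OF U_closed(5)[OF x(1)] U_closed(5)[OF x(2)]] inv_props(1,3)[OF x(3,4)] x(3)
    by (simp add: l_minus r_minus)
qed

lemma unit_add: "x \<in> U \<Longrightarrow> y \<in> U \<Longrightarrow> unit (x \<oplus> y) \<Longrightarrow> unit x \<or> unit y"
  using valuation_ring_unit_add[OF U total L UL] unfolding unit_def by blast

lemma unit_add_nonunit:
  assumes "unit x" "y \<in> U" "\<not> unit y" shows "unit (x \<oplus> y)"
proof -
  have c: "x \<in> U" "x \<in> carrier R" "y \<in> carrier R" using assms U_carrier by (auto simp: unit_def)
  have "(x \<oplus> y) \<oplus> \<ominus> y = x" using c by algebra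
  then have "unit (x \<oplus> y) \<or> unit (\<ominus> y)"
    using unit_add[of "x \<oplus> y" "\<ominus> y"] assms c U_closed by simp
  moreover have "\<not> unit (\<ominus> y)" using unit_neg[of "\<ominus> y"] assms(3) c by auto
  ultimately show ?thesis by simp
qed

text \<open>The value is \<open>1\<close> plus a multiple of \<open>z\<close>. This expresses integral closedness: a root outside
  \<open>U\<close> of a monic polynomial over \<open>U\<close> would have a nonunit as inverse.\<close>

lemma homog_monic_unit:
  assumes "z \<in> U" "\<not> unit z" "set T \<subseteq> U"
  shows "unit (homog (\<one> # T) \<one> z)"
proof -
  have b: "homog T \<one> z \<in> U" by (rule homog_in_subring[OF U]) (use assms U_closed in auto)
  have "unit (\<one> \<oplus> z \<otimes> homog T \<one> z)"
    by (rule unit_add_nonunit[OF unit_one]) (use assms b U_closed unit_mult_iff in auto)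
  then show ?thesis by simp
qed

lemma inv_nonunit: "x \<in> L \<Longrightarrow> x \<notin> U \<Longrightarrow> x \<noteq> \<zero> \<Longrightarrow> inv x \<in> U \<and> \<not> unit (inv x)"
  using total[of x] subfieldE(3)[OF L] inv_props[of x] by (auto simp: unit_def)

end

lemma (in cring) scale_var_exists:
  assumes "subring H R" "c \<in> H" "set P \<subseteq> H"
  shows "\<exists>Q. set Q \<subseteq> H \<and> length Q = length P \<and> (\<forall>z\<in>carrier R. eval Q z = eval P (c \<otimes> z))"
  using assms(3)
proof (induction P)
  case (Cons a P)
  then obtain Q where Q: "set Q \<subseteq> H" "length Q = length P" "\<forall>z\<in>carrier R. eval Q z = eval P (c \<otimes> z)" by auto
  note sH = subringE[OF assms(1)]
  have c: "c [^] length P \<in> H" by (rule eval_pow_closed[OF assms(2,1)])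
  have "eval (a \<otimes> c [^] length P # Q) z = eval (a # P) (c \<otimes> z)" if "z \<in> carrier R" for z
    using Q that c sH(1) assms(2) Cons.prems by (auto simp: nat_pow_distrib m_assoc subset_iff)
  then show ?case using Q c Cons.prems sH by (intro exI[of _ "a \<otimes> c [^] length P # Q"]) auto
qed simp

lemma (in cring) homog_as_eval:
  assumes "subring H R" "c \<in> H" "set P \<subseteq> H"
  shows "\<exists>Q. set Q \<subseteq> H \<and> length Q = length P \<and> (P \<noteq> [] \<longrightarrow> hd Q = hd P) \<and> (\<forall>z\<in>carrier R. eval Q z = homog P z c)"
  using assms(3)
proof (induction P)
  case (Cons a P)
  then obtain Q where Q: "set Q \<subseteq> H" "length Q = length P" "\<forall>z\<in>carrier R. eval Q z = homog P z c" by auto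
  note sH = subringE[OF assms(1)]
  have "eval (a # map ((\<otimes>) c) Q) z = homog (a # P) z c" if "z \<in> carrier R" for z
    using eval_scale[of c Q z] Q that sH(1) assms(2) by (simp add: subset_iff)
  moreover have "set (map ((\<otimes>) c) Q) \<subseteq> H" using Q(1) assms(2) sH(6) by auto
  ultimately show ?case using Q(2) Cons.prems by (intro exI[of _ "a # map ((\<otimes>) c) Q"]) auto
qed simp

definition (in ring) monics :: "'a set \<Rightarrow> nat \<Rightarrow> 'a list set" where
  "monics H d = {P. set P \<subseteq> H \<and> length P = Suc d \<and> hd P = \<one>}"

lemma (in ring) monicsE:
  assumes "P \<in> monics H d" obtains T where "P = \<one> # T" "set T \<subseteq> H" "length T = d"
  using assms by (cases P) (auto simp: monics_def)

lemma (in domain) monic_mult: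
  assumes H: "subring H R" and P: "P \<in> monics H d" and Q: "Q \<in> monics H d'"
  shows "\<exists>T\<in>monics H (d + d'). \<forall>z\<in>carrier R. eval T z = eval P z \<otimes> eval Q z"
proof (intro bexI ballI)
  have p: "polynomial H P" "polynomial H Q" "P \<noteq> []" "Q \<noteq> []"
    using P Q by (auto simp: monics_def polynomial_def)
  have c: "set P \<subseteq> carrier R" "set Q \<subseteq> carrier R" using P Q subringE(1)[OF H] by (auto simp: monics_def)
  show "eval (poly_mult P Q) z = eval P z \<otimes> eval Q z" if "z \<in> carrier R" for z
    by (rule eval_poly_mult[OF c that])
  have lc: "lead_coeff (poly_mult P Q) = \<one>"
    using poly_mult_lead_coeff[OF H p] P Q by (simp add: monics_def)
  have nz: "poly_mult P Q \<noteq> []" using poly_mult_integral[OF H p(1,2)] p(3,4) by blast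
  have "degree (poly_mult P Q) = d + d'"
    using poly_mult_degree_eq[OF H p(1,2)] p(3,4) P Q by (simp add: monics_def)
  then have "length (poly_mult P Q) = Suc (d + d')" using nz by (cases "poly_mult P Q") auto
  moreover have "set (poly_mult P Q) \<subseteq> H"
    using poly_mult_closed[OF H p(1,2)] polynomial_incl by blast
  ultimately show "poly_mult P Q \<in> monics H (d + d')" using lc by (simp add: monics_def)
qed

lemma (in domain) monic_one: "subring H R \<Longrightarrow> [\<one>] \<in> monics H 0"
  using subringE(3) by (auto simp: monics_def)

lemma (in domain) monic_pow:
  assumes H: "subring H R" and P: "P \<in> monics H d"
  shows "\<exists>T\<in>monics H (n * d). \<forall>z\<in>carrier R. eval T z = eval P z [^] (n::nat)"
proof (induction n)
  case 0
  then show ?case using monic_one[OF H] by (intro bexI[of _ "[\<one>]"]) auto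
next
  case (Suc n)
  then obtain T where T: "T \<in> monics H (n * d)" "\<forall>z\<in>carrier R. eval T z = eval P z [^] n" by auto
  obtain T' where "T' \<in> monics H (n * d + d)" "\<forall>z\<in>carrier R. eval T' z = eval T z \<otimes> eval P z"
    using monic_mult[OF H T(1) P] by blast
  then show ?case using T(2) by (intro bexI[of _ T']) (auto simp: add.commute)
qed

lemma (in domain) monic_finprod:
  assumes H: "subring H R" and fin: "finite J" and P: "\<And>j. j \<in> J \<Longrightarrow> P j \<in> monics H (d j)"
  shows "\<exists>T\<in>monics H (\<Sum>j\<in>J. d j). \<forall>z\<in>carrier R. eval T z = (\<Otimes>j\<in>J. eval (P j) z)"
  using fin P
proof (induction J)
  case empty
  then show ?case using monic_one[OF H] by (intro bexI[of _ "[\<one>]"]) auto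
next
  case (insert i J)
  then obtain T where T: "T \<in> monics H (\<Sum>j\<in>J. d j)" "\<forall>z\<in>carrier R. eval T z = (\<Otimes>j\<in>J. eval (P j) z)"
    by auto
  obtain T' where T': "T' \<in> monics H (d i + (\<Sum>j\<in>J. d j))" "\<forall>z\<in>carrier R. eval T' z = eval (P i) z \<otimes> eval T z"
    using monic_mult[OF H insert.prems[of i] T(1)] by auto
  have c: "eval (P j) z \<in> carrier R" if "j \<in> insert i J" "z \<in> carrier R" for j z
    using insert.prems[OF that(1)] that(2) subringE(1)[OF H] by (intro eval_in_carrier) (auto simp: monics_def)
  show ?case
    using T' T insert.hyps c by (intro bexI[of _ T']) (auto simp: Pi_def)
qed

lemma (in domain) monic_add_const:
  assumes H: "subring H R" and P: "P \<in> monics H (Suc d)" and c: "c \<in> H"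
  shows "\<exists>T\<in>monics H (Suc d). \<forall>z\<in>carrier R. eval T z = eval P z \<oplus> c"
proof -
  note sH = subringE[OF H]
  obtain P' a where PP: "P = P' @ [a]" using P by (cases P rule: rev_cases) (auto simp: monics_def)
  have in_H: "a \<in> H" "set P' \<subseteq> H" "hd P' = \<one>" "length P' = Suc d"
    using P unfolding PP monics_def by (cases P'; auto)+
  have "P' @ [a \<oplus> c] \<in> monics H (Suc d)"
    using in_H c sH by (cases P') (auto simp: monics_def)
  moreover have "eval (P' @ [a \<oplus> c]) z = eval P z \<oplus> c" if "z \<in> carrier R" for z
  proof -
    have cc: "set P' \<subseteq> carrier R" "a \<in> carrier R" "c \<in> carrier R" using in_H c sH(1) by auto
    show ?thesis unfolding PP using eval_append_aux[OF cc(1) _ that] cc eval_in_carrier[OF cc(1) that] that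
      by (simp add: a_assoc)
  qed
  ultimately show ?thesis by blast
qed

lemma (in domain) Irr_const_nonzero:
  assumes k: "subfield k R" and a: "a \<in> carrier R" "(algebraic over k) a" "a \<noteq> \<zero>"
  shows "eval (Irr k a) \<zero> \<noteq> \<zero>"
proof
  assume z: "eval (Irr k a) \<zero> = \<zero>"
  note I = IrrE[OF k a(1,2)]
  have nz: "Irr k a \<noteq> []" using pirreducibleE(1)[OF subfieldE(1)[OF k] I(1,2)] .
  obtain p where p: "polynomial k p" "p \<noteq> []" "Irr k a = p @ [\<zero>]"
    using const_term_zero[OF subfieldE(1)[OF k] _ nz] I(1) z
    unfolding const_term_def univ_poly_carrier by metis
  have pc: "set p \<subseteq> carrier R" using polynomial_incl[OF p(1)] subfieldE(3)[OF k] by auto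
  have "eval p a \<otimes> a \<oplus> \<zero> = \<zero>"
    using eval_append_aux[OF pc zero_closed a(1)] I(4) p(3) by simp
  then have "eval p a = \<zero>" using a eval_in_carrier[OF pc a(1)] by (simp add: integral_iff)
  moreover have pk: "p \<in> carrier (k[X])" using p(1) by (simp add: univ_poly_carrier)
  ultimately have "Irr k a pdivides p" by (intro Irr_minimal[OF k a(1,2)])
  then have "degree (Irr k a) \<le> degree p"
    by (rule pdivides_imp_degree_le[OF subfieldE(1)[OF k] I(1) pk p(2)])
  then show False using p(2,3) by (cases p) auto
qed

context residue_place
begin

lemma pf_homog:
  assumes "set h \<subseteq> V" "pf f g" "pf f' g'"
  shows "pf (\<lambda>z. homog h (f z) (f' z)) (\<lambda>\<beta>. S.homog (map \<rho> h) (g \<beta>) (g' \<beta>))"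
  using assms(1)
proof (induction h)
  case Nil
  then show ?case using pf_const[of \<zero>] by (simp add: \<rho>_simps)
next
  case (Cons a h)
  then have "pf (\<lambda>z. a \<otimes> f z [^] length h \<oplus> f' z \<otimes> homog h (f z) (f' z))
     (\<lambda>\<beta>. \<rho> a \<otimes>\<^bsub>S\<^esub> g \<beta> [^]\<^bsub>S\<^esub> length h \<oplus>\<^bsub>S\<^esub> g' \<beta> \<otimes>\<^bsub>S\<^esub> S.homog (map \<rho> h) (g \<beta>) (g' \<beta>))"
    using assms by (intro pf_add pf_mult pf_pow pf_const) auto
  then show ?case by simp
qed

lemma pf_compose:
  assumes "set h \<subseteq> V" "pf f g"
  shows "pf (\<lambda>z. eval h (f z)) (\<lambda>\<beta>. reval h (g \<beta>))"
  using pf_homog[OF assms pf_const[of \<one>]]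
  by (rule pf_cong)
    (use assms homog_one V_list_carrier pf_closed[OF assms(2)] S.homog_one[OF map_\<rho>_closed] in
      \<open>auto simp: \<rho>_simps reval_def\<close>)

lemma pf_finprod:
  assumes "finite J" "\<And>j. j \<in> J \<Longrightarrow> pf (f j) (g j)"
  shows "pf (\<lambda>z. \<Otimes>j\<in>J. f j z) (\<lambda>\<beta>. \<Otimes>\<^bsub>S\<^esub>j\<in>J. g j \<beta>)"
  using assms
proof (induction J)
  case empty
  then show ?case using pf_const[of \<one>] by (simp add: \<rho>_simps)
next
  case (insert i J)
  then have "pf (\<lambda>z. f i z \<otimes> (\<Otimes>j\<in>J. f j z)) (\<lambda>\<beta>. g i \<beta> \<otimes>\<^bsub>S\<^esub> (\<Otimes>\<^bsub>S\<^esub>j\<in>J. g j \<beta>))"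
    by (intro pf_mult) auto
  then show ?case
  proof (rule pf_cong)
    have pf: "pf (f j) (g j)" if "j \<in> insert i J" for j using insert.prems that by simp
    show "f i z \<otimes> (\<Otimes>j\<in>J. f j z) = (\<Otimes>j\<in>insert i J. f j z)" if "z \<in> carrier R" for z
      using finprod_insert[OF insert.hyps, of "\<lambda>j. f j z"] pf_closed(1)[OF pf that] by auto
    show "g i \<beta> \<otimes>\<^bsub>S\<^esub> (\<Otimes>\<^bsub>S\<^esub>j\<in>J. g j \<beta>) = (\<Otimes>\<^bsub>S\<^esub>j\<in>insert i J. g j \<beta>)" if "\<beta> \<in> carrier S" for \<beta>
      using S.finprod_insert[OF insert.hyps, of "\<lambda>j. g j \<beta>"] pf_closed(2)[OF pf that] by auto
  qed
qed

end

lemma (in domain) finprod_nonzero: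
  assumes "finite J" "\<And>j. j \<in> J \<Longrightarrow> f j \<in> carrier R \<and> f j \<noteq> \<zero>"
  shows "(\<Otimes>j\<in>J. f j) \<in> carrier R \<and> (\<Otimes>j\<in>J. f j) \<noteq> \<zero>"
  using assms
proof (induction J)
  case (insert i J)
  then have "(\<Otimes>j\<in>insert i J. f j) = f i \<otimes> (\<Otimes>j\<in>J. f j)" by (intro finprod_insert) auto
  then show ?case using insert by (simp add: integral_iff)
qed simp

section \<open>Roots of a polynomial close to the local target\<close>

text \<open>The data at one place: for each \<open>j\<close> an element \<open>\<alpha> j\<close> that is to generate the residue field of
  the \<open>j\<close>-th extension, and a monic lift \<open>\<phi> j\<close> of its minimal polynomial. As \<open>\<alpha> j\<close> does
  not vanish, roots of factors at different scales have different values.\<close>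

locale local_target = residue_place +
  fixes p and s :: nat and \<alpha> and \<phi> and e f :: "nat \<Rightarrow> nat"
  assumes p: "p \<in> K" "p \<noteq> \<zero>" "v p = 1"
    and \<alpha>: "\<And>j. j \<in> {1..s} \<Longrightarrow> \<alpha> j \<in> carrier S"
      "\<And>j. j \<in> {1..s} \<Longrightarrow> (S.algebraic over (\<rho> ` val_ge R K v 0)) (\<alpha> j)"
      "\<And>j. j \<in> {1..s} \<Longrightarrow> \<alpha> j \<noteq> \<zero>\<^bsub>S\<^esub>"
    and \<phi>: "\<And>j. j \<in> {1..s} \<Longrightarrow> \<phi> j \<in> monics (val_ge R K v 0) (f j)"
      "\<And>j. j \<in> {1..s} \<Longrightarrow> map \<rho> (\<phi> j) = S.Irr (\<rho> ` val_ge R K v 0) (\<alpha> j)"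
    and e: "\<And>j. j \<in> {1..s} \<Longrightarrow> 0 < e j" and f: "\<And>j. j \<in> {1..s} \<Longrightarrow> 0 < f j"
begin

abbreviation "d j \<equiv> e j * f j"

lemma p_V: "p \<in> V" "\<rho> p = \<zero>\<^bsub>S\<^esub>" "p \<in> carrier R"
proof -
  show "p \<in> V" using p by (simp add: val_ge_def)
  then show "\<rho> p = \<zero>\<^bsub>S\<^esub>" using ker p by (simp add: val_ge_def)
  show "p \<in> carrier R" by (rule K_carrier[OF p(1)])
qed

lemma p_pow: "p [^] (n::nat) \<in> V" "p [^] n \<in> carrier R" "p [^] n \<in> K" "p [^] n \<noteq> \<zero>" 
  "\<rho> (p [^] Suc n) = \<zero>\<^bsub>S\<^esub>"
  using p_V p nat_pow_nonzero[OF p_V(3) p(2)] \<rho>_simps(3)[of "p [^] n" p] \<rho>_simps(1)[of "p [^] n"] by auto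

lemma \<phi>_V: "j \<in> {1..s} \<Longrightarrow> set (\<phi> j) \<subseteq> V"
  using \<phi>(1) by (auto simp: monics_def)

text \<open>The \<open>j\<close>-th factor in its own coordinate: Eisenstein in \<open>\<phi> j\<close>, so that at a root the
  \<open>e j\<close>-th power of the value of \<open>\<phi> j\<close> is associated to \<open>p\<close>.\<close>

definition h where
  "h j = (SOME T. T \<in> monics V (d j) \<and> (\<forall>z\<in>carrier R. eval T z = eval (\<phi> j) z [^] e j \<oplus> p))"

lemma h:
  assumes "j \<in> {1..s}"
  shows "h j \<in> monics V (d j)" "\<And>z. z \<in> carrier R \<Longrightarrow> eval (h j) z = eval (\<phi> j) z [^] e j \<oplus> p"
    "set (h j) \<subseteq> V" "length (h j) = Suc (d j)"
    "\<And>\<beta>. \<beta> \<in> carrier S \<Longrightarrow> reval (h j) \<beta> = reval (\<phi> j) \<beta> [^]\<^bsub>S\<^esub> e j"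
proof -
  obtain T where T: "T \<in> monics V (e j * f j)" "\<forall>z\<in>carrier R. eval T z = eval (\<phi> j) z [^] e j"
    using monic_pow[OF ge_0_subring \<phi>(1)[OF assms]] by blast
  have "0 < d j" using e f assms by simp
  then obtain d' where "d j = Suc d'" using gr0_implies_Suc by blast
  then have "\<exists>T'\<in>monics V (d j). \<forall>z\<in>carrier R. eval T' z = eval T z \<oplus> p"
    using monic_add_const[OF ge_0_subring _ p_V(1), of T d'] T(1) by metis
  then have ex: "\<exists>T. T \<in> monics V (d j) \<and> (\<forall>z\<in>carrier R. eval T z = eval (\<phi> j) z [^] e j \<oplus> p)"
    using T(2) by auto
  from someI_ex[OF this, folded h_def]
  show *: "h j \<in> monics V (d j)" "\<And>z. z \<in> carrier R \<Longrightarrow> eval (h j) z = eval (\<phi> j) z [^] e j \<oplus> p" by auto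
  show V: "set (h j) \<subseteq> V" "length (h j) = Suc (d j)" using *(1) by (auto simp: monics_def)
  fix \<beta> assume b: "\<beta> \<in> carrier S"
  have "reval (h j) \<beta> = reval (\<phi> j) \<beta> [^]\<^bsub>S\<^esub> e j \<oplus>\<^bsub>S\<^esub> \<rho> p"
    by (rule pf_ext[OF pf_self[OF V(1)] pf_add[OF pf_pow[OF pf_self[OF \<phi>_V[OF assms]]] pf_const[OF p_V(1)]] _ b])
      (use * in simp)
  then show "reval (h j) \<beta> = reval (\<phi> j) \<beta> [^]\<^bsub>S\<^esub> e j"
    using p_V reval_closed[OF \<phi>_V[OF assms] b] by simp
qed

text \<open>The monic polynomial \<open>p ^ ((j - 1) * d j) * h j (z / p ^ (j - 1))\<close>.\<close>

definition factor where "factor j z = homog (h j) z (p [^] (j - 1))"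

lemma factor_closed: "j \<in> {1..s} \<Longrightarrow> z \<in> carrier R \<Longrightarrow> factor j z \<in> carrier R"
  unfolding factor_def using V_list_carrier[OF h(3)] p_pow by (intro homog_closed) auto

lemma target_exists:
  "\<exists>g\<in>monics V (\<Sum>j\<in>{1..s}. d j). \<forall>z\<in>carrier R. eval g z = (\<Otimes>j\<in>{1..s}. factor j z)"
proof -
  have "\<exists>Q. Q \<in> monics V (d j) \<and> (\<forall>z\<in>carrier R. eval Q z = factor j z)" if j: "j \<in> {1..s}" for j
  proof -
    obtain Q where Q: "set Q \<subseteq> V" "length Q = length (h j)" "h j \<noteq> [] \<longrightarrow> hd Q = hd (h j)"
      "\<forall>z\<in>carrier R. eval Q z = homog (h j) z (p [^] (j - 1))"
      using homog_as_eval[OF ge_0_subring p_pow(1) h(3)[OF j]] by metis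
    have "h j \<noteq> []" using h(4)[OF j] by auto
    then have "Q \<in> monics V (d j)" using Q h(1)[OF j] by (simp add: monics_def)
    then show ?thesis using Q(4) by (auto simp: factor_def)
  qed
  then have "\<forall>j\<in>{1..s}. \<exists>Q. Q \<in> monics V (d j) \<and> (\<forall>z\<in>carrier R. eval Q z = factor j z)" by blast
  from bchoice[OF this] obtain Q where
    "\<forall>j\<in>{1..s}. Q j \<in> monics V (d j) \<and> (\<forall>z\<in>carrier R. eval (Q j) z = factor j z)" by blast
  then have Q: "\<And>j. j \<in> {1..s} \<Longrightarrow> Q j \<in> monics V (d j)"
    "\<And>j z. j \<in> {1..s} \<Longrightarrow> z \<in> carrier R \<Longrightarrow> eval (Q j) z = factor j z" by auto
  obtain T where T: "T \<in> monics V (\<Sum>j\<in>{1..s}. d j)" "\<forall>z\<in>carrier R. eval T z = (\<Otimes>j\<in>{1..s}. eval (Q j) z)"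
    using monic_finprod[OF ge_0_subring, of "{1..s}" Q d] Q(1) by auto
  have "(\<Otimes>j\<in>{1..s}. eval (Q j) z) = (\<Otimes>j\<in>{1..s}. factor j z)" if "z \<in> carrier R" for z
    by (rule finprod_cong') (use Q(2) that factor_closed in auto)
  then show ?thesis using T by auto
qed

text \<open>The \<open>i\<close>-th factor in the coordinate \<open>z\<close> for which \<open>x = p ^ (j - 1) z\<close>, without its
  content.\<close>

definition rescaled where
  "rescaled j i z = homog (h i) (p [^] (j - 1 - (i - 1)) \<otimes> z) (p [^] (i - 1 - (j - 1)))"

definition rescaled_S where
  "rescaled_S j i \<beta> = S.homog (map \<rho> (h i)) (\<rho> (p [^] (j - 1 - (i - 1))) \<otimes>\<^bsub>S\<^esub> \<beta>) (\<rho> (p [^] (i - 1 - (j - 1))))"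

text \<open>The exponent of \<open>p\<close> in the \<open>i\<close>-th factor in the \<open>j\<close>-th coordinate.\<close>

definition content where "content j i = min (i - 1) (j - 1) * d i"

lemma pf_rescaled: "i \<in> {1..s} \<Longrightarrow> pf (rescaled j i) (rescaled_S j i)"
  unfolding rescaled_def[abs_def] rescaled_S_def[abs_def]
  by (intro pf_homog pf_mult pf_const pf_var h(3) p_pow)

lemma factor_rescaled:
  assumes i: "i \<in> {1..s}" and z: "z \<in> carrier R"
  shows "factor i (p [^] (j - 1) \<otimes> z) = p [^] content j i \<otimes> rescaled j i z"
proof -
  let ?t = "p [^] min (i - 1) (j - 1)"
  have "min (i - 1) (j - 1) + (j - 1 - (i - 1)) = j - 1" "min (i - 1) (j - 1) + (i - 1 - (j - 1)) = i - 1"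
    by linarith+
  then have "?t \<otimes> p [^] (j - 1 - (i - 1)) = p [^] (j - 1)" and 2: "p [^] (i - 1) = ?t \<otimes> p [^] (i - 1 - (j - 1))"
    unfolding nat_pow_mult[OF p_V(3)] by simp_all
  then have 1: "p [^] (j - 1) \<otimes> z = ?t \<otimes> (p [^] (j - 1 - (i - 1)) \<otimes> z)"
    using p_pow(2) z by (simp flip: m_assoc)
  have "factor i (p [^] (j - 1) \<otimes> z) = ?t [^] d i \<otimes> rescaled j i z"
    unfolding factor_def rescaled_def 1 2
    using homog_scale[OF V_list_carrier[OF h(3)[OF i]], of "p [^] (j - 1 - (i - 1)) \<otimes> z" "p [^] (i - 1 - (j - 1))" ?t]
      p_pow(2) z h(4)[OF i] by simp
  then show ?thesis using p_V(3) by (simp add: nat_pow_pow content_def)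
qed

lemma rescaled_self: "j \<in> {1..s} \<Longrightarrow> z \<in> carrier R \<Longrightarrow> rescaled j j z = eval (\<phi> j) z [^] e j \<oplus> p"
  unfolding rescaled_def using homog_one[OF V_list_carrier[OF h(3)]] h(2) by simp

text \<open>In the \<open>j\<close>-th coordinate the \<open>i\<close>-th factor reduces to its constant term, a power of
  \<open>\<phi> i\<close> at zero, if \<open>i < j\<close>, and to its leading term, a power of \<open>\<beta>\<close>, if \<open>i > j\<close>.\<close>

lemma rescaled_S_nonzero:
  assumes i: "i \<in> {1..s}" "i \<noteq> j" "1 \<le> j" and \<beta>: "\<beta> \<in> carrier S" "\<beta> \<noteq> \<zero>\<^bsub>S\<^esub>"
  shows "rescaled_S j i \<beta> \<noteq> \<zero>\<^bsub>S\<^esub>"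
proof (cases "i < j")
  case True
  define n where "n = j - i - 1"
  have n: "j - 1 - (i - 1) = Suc n" "i - 1 - (j - 1) = 0"
    using True i by (auto simp: n_def)
  have "rescaled_S j i \<beta> = S.homog (map \<rho> (h i)) \<zero>\<^bsub>S\<^esub> \<one>\<^bsub>S\<^esub>"
    unfolding rescaled_S_def n using \<beta> p_pow(5) \<rho>_simps(4) by simp
  also have "\<dots> = reval (h i) \<zero>\<^bsub>S\<^esub>"
    unfolding reval_def by (rule S.homog_one[OF map_\<rho>_closed[OF h(3)[OF i(1)]]]) simp
  also have "\<dots> = reval (\<phi> i) \<zero>\<^bsub>S\<^esub> [^]\<^bsub>S\<^esub> e i" by (rule h(5)[OF i(1)]) simp
  also have "\<dots> \<noteq> \<zero>\<^bsub>S\<^esub>"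
  proof (rule S.nat_pow_nonzero)
    show "reval (\<phi> i) \<zero>\<^bsub>S\<^esub> \<in> carrier S" by (rule reval_closed[OF \<phi>_V[OF i(1)]]) simp
    show "reval (\<phi> i) \<zero>\<^bsub>S\<^esub> \<noteq> \<zero>\<^bsub>S\<^esub>"
      unfolding reval_def \<phi>(2)[OF i(1)] by (rule S.Irr_const_nonzero[OF k_subfield \<alpha>(1-3)[OF i(1)]])
  qed
  finally show ?thesis .
next
  case False
  define n where "n = i - j - 1"
  have n: "i - 1 - (j - 1) = Suc n" "j - 1 - (i - 1) = 0"
    using False i by (auto simp: n_def)
  obtain T where T: "h i = \<one> # T" "set T \<subseteq> V" using h(1)[OF i(1)] by (rule monicsE)
  have "rescaled_S j i \<beta> = \<one>\<^bsub>S\<^esub> \<otimes>\<^bsub>S\<^esub> \<beta> [^]\<^bsub>S\<^esub> length (map \<rho> T)"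
    unfolding rescaled_S_def n T(1)
    using \<beta> p_pow(5) \<rho>_simps(4) S.homog_zero[OF S.one_closed map_\<rho>_closed[OF T(2)] \<beta>(1)] by simp
  then show ?thesis using S.nat_pow_nonzero[OF \<beta>] \<beta>(1) by simp
qed

end

text \<open>The polynomial \<open>g\<close> differs from the target by a multiple of \<open>p ^ N\<close>, where \<open>N\<close> exceeds by at least
  two the content of the target in each coordinate: after division by the content and by one more
  \<open>p\<close> the error still reduces to zero. By \<open>divides\<close>, \<open>g\<close> is the minimal polynomial of \<open>\<theta>\<close>.\<close>

locale target_root = local_target +
  fixes g D :: "'a list" and \<theta> :: 'a and N :: nat
  assumes N: "(\<Sum>j\<in>{1..s}. (j - 1) * (e j * f j)) + 2 \<le> N"
    and g: "set g \<subseteq> val_ge R K v 0" "hd g = \<one>" "g \<noteq> []" and D: "set D \<subseteq> val_ge R K v 0"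
    and approx: "\<And>z. z \<in> carrier R \<Longrightarrow> eval g z = (\<Otimes>j\<in>{1..s}. factor j z) \<oplus> p [^] N \<otimes> eval D z"
    and \<theta>: "\<theta> \<in> carrier R" "eval g \<theta> = \<zero>" "(algebraic over K) \<theta>"
    and divides: "\<And>P. set P \<subseteq> K \<Longrightarrow> eval P \<theta> = \<zero> \<Longrightarrow>
      \<exists>H. set H \<subseteq> K \<and> (\<forall>z\<in>carrier R. eval P z = eval g z \<otimes> eval H z)"
begin

definition y :: "nat \<Rightarrow> _" where "y j = \<theta> \<otimes> inv (p [^] (j - 1))"

lemma p_inv: "inv (p [^] (n::nat)) \<in> K" "inv (p [^] n) \<in> carrier R" "inv (p [^] n) \<noteq> \<zero>" "p [^] n \<otimes> inv (p [^] n) = \<one>"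
  using K_inv[OF p_pow(3,4)] K_carrier by auto

lemma y_carrier: "y j \<in> carrier R" and \<theta>_y: "\<theta> = p [^] (j - 1) \<otimes> y j"
proof -
  show "y j \<in> carrier R" unfolding y_def using \<theta> p_inv by simp
  have "p [^] (j - 1) \<otimes> y j = \<theta> \<otimes> (p [^] (j - 1) \<otimes> inv (p [^] (j - 1)))"
    unfolding y_def using \<theta>(1) p_pow(2) p_inv(2) by (simp only: m_lcomm m_closed)
  then show "\<theta> = p [^] (j - 1) \<otimes> y j" using p_inv(4) \<theta>(1) by simp
qed

lemma simple_extension_y: "simple_extension K (y j) = simple_extension K \<theta>"
proof -
  note sK = subfieldE(1)[OF K]
  have a: "y j \<in> simple_extension K \<theta>"
    unfolding y_def using simple_extension_mem[OF sK \<theta>(1)] simple_extension_incl[OF subfieldE(3)[OF K] \<theta>(1)] p_inv(1)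
    by (intro subringE(6)[OF simple_extension_is_subring[OF sK \<theta>(1)]]) auto
  have b: "\<theta> \<in> simple_extension K (y j)"
    using simple_extension_mem[OF sK y_carrier] simple_extension_incl[OF subfieldE(3)[OF K] y_carrier] p_pow(3)
    by (subst \<theta>_y[of j], intro subringE(6)[OF simple_extension_is_subring[OF sK y_carrier]]) auto
  show ?thesis
    using simple_extension_subring_incl[OF simple_extension_is_subring[OF sK \<theta>(1)] simple_extension_incl[OF subfieldE(3)[OF K] \<theta>(1)] a]
      simple_extension_subring_incl[OF simple_extension_is_subring[OF sK y_carrier] simple_extension_incl[OF subfieldE(3)[OF K] y_carrier] b]
    by blast
qed

definition rest where "rest j z = (\<Otimes>i\<in>{1..s} - {j}. rescaled j i z)"
definition rest_S where "rest_S j \<beta> = (\<Otimes>\<^bsub>S\<^esub>i\<in>{1..s} - {j}. rescaled_S j i \<beta>)"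
definition total_content where "total_content j = (\<Sum>i\<in>{1..s}. content j i)"
definition tail where "tail j z = p [^] (N - total_content j - 1) \<otimes> eval D (p [^] (j - 1) \<otimes> z)"
definition tail_S where "tail_S j \<beta> = \<rho> (p [^] (N - total_content j - 1)) \<otimes>\<^bsub>S\<^esub> reval D (\<rho> (p [^] (j - 1)) \<otimes>\<^bsub>S\<^esub> \<beta>)"

lemma N_large: "total_content j + 2 \<le> N"
proof -
  have "total_content j \<le> (\<Sum>i\<in>{1..s}. (i - 1) * d i)"
    unfolding total_content_def content_def by (intro sum_mono mult_right_mono) auto
  then show ?thesis using N by simp
qed

lemma pf_rest: "pf (rest j) (rest_S j)"
  unfolding rest_def[abs_def] rest_S_def[abs_def] by (intro pf_finprod pf_rescaled) auto

lemma pf_tail: "pf (tail j) (tail_S j)"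
  unfolding tail_def[abs_def] tail_S_def[abs_def]
  by (intro pf_mult pf_const pf_compose pf_var D p_pow)

lemma tail_S_zero: "\<beta> \<in> carrier S \<Longrightarrow> tail_S j \<beta> = \<zero>\<^bsub>S\<^esub>"
proof -
  assume b: "\<beta> \<in> carrier S"
  define n where "n = N - total_content j - 2"
  have n: "N - total_content j - 1 = Suc n" using N_large[of j] by (simp add: n_def)
  show ?thesis unfolding tail_S_def n p_pow(5)
    using reval_closed[OF D, of "\<rho> (p [^] (j - 1)) \<otimes>\<^bsub>S\<^esub> \<beta>"] b \<rho>_simps(1)[OF p_pow(1)] by simp
qed

lemma rest_S_nonzero:
  assumes "j \<in> {1..s}" "\<beta> \<in> carrier S" "\<beta> \<noteq> \<zero>\<^bsub>S\<^esub>"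
  shows "rest_S j \<beta> \<in> carrier S" "rest_S j \<beta> \<noteq> \<zero>\<^bsub>S\<^esub>"
  unfolding rest_S_def
  using S.finprod_nonzero[of "{1..s} - {j}" "\<lambda>i. rescaled_S j i \<beta>"]
    rescaled_S_nonzero[OF _ _ _ assms(2,3)] pf_closed(2)[OF pf_rescaled assms(2)] assms(1) by auto

lemma closed: "z \<in> carrier R \<Longrightarrow> rest j z \<in> carrier R" "z \<in> carrier R \<Longrightarrow> tail j z \<in> carrier R"
  "z \<in> carrier R \<Longrightarrow> j \<in> {1..s} \<Longrightarrow> eval (\<phi> j) z \<in> carrier R"
  using pf_closed(1)[OF pf_rest] pf_closed(1)[OF pf_tail] eval_in_carrier[OF V_list_carrier[OF \<phi>_V]] by auto

text \<open>The polynomial \<open>g\<close> in the coordinate \<open>z\<close>, divided by its content.\<close>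

definition scaled where
  "scaled j z = (eval (\<phi> j) z [^] e j \<oplus> p) \<otimes> rest j z \<oplus> p \<otimes> tail j z"

definition scaled_S where
  "scaled_S j \<beta> = (reval (\<phi> j) \<beta> [^]\<^bsub>S\<^esub> e j \<oplus>\<^bsub>S\<^esub> \<rho> p) \<otimes>\<^bsub>S\<^esub> rest_S j \<beta> \<oplus>\<^bsub>S\<^esub> \<rho> p \<otimes>\<^bsub>S\<^esub> tail_S j \<beta>"

lemma pf_scaled: "j \<in> {1..s} \<Longrightarrow> pf (scaled j) (scaled_S j)"
  unfolding scaled_def[abs_def] scaled_S_def[abs_def]
  by (intro pf_add pf_mult pf_pow pf_const pf_rest pf_tail pf_self \<phi>_V p_V)

lemma scaled_S_eq:
  assumes "j \<in> {1..s}" "\<beta> \<in> carrier S"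
  shows "scaled_S j \<beta> = reval (\<phi> j) \<beta> [^]\<^bsub>S\<^esub> e j \<otimes>\<^bsub>S\<^esub> rest_S j \<beta>"
  unfolding scaled_S_def p_V(2) tail_S_zero[OF assms(2)]
  using reval_closed[OF \<phi>_V[OF assms(1)] assms(2)] pf_closed(2)[OF pf_rest assms(2)] by simp

lemma finprod_power:
  assumes "finite J" "\<And>i. i \<in> J \<Longrightarrow> x i \<in> carrier R"
  shows "(\<Otimes>i\<in>J. p [^] (n i :: nat) \<otimes> x i) = p [^] (\<Sum>i\<in>J. n i) \<otimes> (\<Otimes>i\<in>J. x i)"
  using assms
proof (induction J)
  case (insert i J)
  have x: "x j \<in> carrier R" if "j \<in> insert i J" for j using insert.prems that by auto
  have "(\<Otimes>j\<in>insert i J. p [^] n j \<otimes> x j) = p [^] n i \<otimes> x i \<otimes> (\<Otimes>j\<in>J. p [^] n j \<otimes> x j)"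
    by (rule finprod_insert[OF insert.hyps]) (use x p_pow in auto)
  also have "(\<Otimes>j\<in>J. p [^] n j \<otimes> x j) = p [^] (\<Sum>j\<in>J. n j) \<otimes> (\<Otimes>j\<in>J. x j)"
    using insert by simp
  also have "p [^] n i \<otimes> x i \<otimes> (p [^] (\<Sum>j\<in>J. n j) \<otimes> (\<Otimes>j\<in>J. x j))
      = (p [^] n i \<otimes> p [^] (\<Sum>j\<in>J. n j)) \<otimes> (x i \<otimes> (\<Otimes>j\<in>J. x j))"
    using x p_pow(2) by (simp add: m_ac Pi_def)
  also have "x i \<otimes> (\<Otimes>j\<in>J. x j) = (\<Otimes>j\<in>insert i J. x j)"
    by (rule finprod_insert[symmetric, OF insert.hyps]) (use x in auto)
  also have "p [^] n i \<otimes> p [^] (\<Sum>j\<in>J. n j) = p [^] (\<Sum>j\<in>insert i J. n j)"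
    using insert.hyps p_V(3) by (simp add: nat_pow_mult)
  finally show ?case .
qed simp

lemma eval_g_scaled:
  assumes j: "j \<in> {1..s}" and z: "z \<in> carrier R"
  shows "eval g (p [^] (j - 1) \<otimes> z) = p [^] total_content j \<otimes> scaled j z"
proof -
  have rc: "rescaled j i z \<in> carrier R" if "i \<in> {1..s}" for i by (rule pf_closed(1)[OF pf_rescaled[OF that] z])
  have pz: "p [^] (j - 1) \<otimes> z \<in> carrier R" using z p_pow by simp
  have "(\<Otimes>i\<in>{1..s}. factor i (p [^] (j - 1) \<otimes> z)) = (\<Otimes>i\<in>{1..s}. p [^] content j i \<otimes> rescaled j i z)"
    by (rule finprod_cong') (use factor_rescaled[OF _ z] rc p_pow in auto)
  also have "\<dots> = p [^] total_content j \<otimes> (\<Otimes>i\<in>{1..s}. rescaled j i z)"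
    unfolding total_content_def by (rule finprod_power) (use rc in auto)
  also have "(\<Otimes>i\<in>{1..s}. rescaled j i z) = (\<Otimes>i\<in>insert j ({1..s} - {j}). rescaled j i z)"
    using j by (simp add: insert_absorb)
  also have "\<dots> = rescaled j j z \<otimes> rest j z"
    unfolding rest_def by (rule finprod_insert) (use rc j in auto)
  also have "rescaled j j z = eval (\<phi> j) z [^] e j \<oplus> p" by (rule rescaled_self[OF j z])
  finally have 1: "(\<Otimes>i\<in>{1..s}. factor i (p [^] (j - 1) \<otimes> z)) = p [^] total_content j \<otimes> ((eval (\<phi> j) z [^] e j \<oplus> p) \<otimes> rest j z)" .
  have "N = total_content j + Suc (N - total_content j - 1)" using N_large[of j] by simp
  then have pN: "p [^] N = p [^] total_content j \<otimes> (p [^] (N - total_content j - 1) \<otimes> p)"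
    using nat_pow_mult[OF p_V(3), of "total_content j" "Suc (N - total_content j - 1)"] by simp
  have Dc: "eval D (p [^] (j - 1) \<otimes> z) \<in> carrier R" by (rule eval_in_carrier[OF V_list_carrier[OF D] pz])
  have "p [^] N \<otimes> eval D (p [^] (j - 1) \<otimes> z) = p [^] total_content j \<otimes> (p \<otimes> tail j z)"
    unfolding pN tail_def using Dc p_pow(2) p_V(3) by (simp add: m_ac)
  then show ?thesis
    unfolding approx[OF pz] 1 scaled_def using closed z j p_pow(2) p_V(3) by (simp add: r_distr)
qed

text \<open>In the coordinate of \<open>y j\<close> the primitive part of \<open>g\<close> reduces to \<open>(\<phi> j) ^ e j\<close> times
  factors without zero at \<open>\<alpha> j\<close>; it divides every polynomial that vanishes at \<open>y j\<close>, so
  Gauss's lemma applies.\<close>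

lemma kernel:
  assumes j: "j \<in> {1..s}" and P: "set P \<subseteq> V" "eval P (y j) = \<zero>"
  shows "reval P (\<alpha> j) = \<zero>\<^bsub>S\<^esub>"
proof -
  let ?c = "p [^] (j - 1)"
  have sK: "subring K R" by (rule subfieldE(1)[OF K])
  have PK: "set P \<subseteq> K" using P(1) ge_K by blast
  obtain P' where P': "set P' \<subseteq> K" "\<forall>z\<in>carrier R. eval P' z = eval P (inv ?c \<otimes> z)"
    using scale_var_exists[OF sK p_inv(1) PK] by blast
  have "eval P' \<theta> = \<zero>" using P'(2) \<theta>(1) P(2) m_comm[OF \<theta>(1) p_inv(2)] by (simp add: y_def)
  then obtain H where H: "set H \<subseteq> K" "\<forall>z\<in>carrier R. eval P' z = eval g z \<otimes> eval H z"
    using divides[OF P'(1)] by blast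
  obtain H' where H': "set H' \<subseteq> K" "\<forall>z\<in>carrier R. eval H' z = eval H (?c \<otimes> z)"
    using scale_var_exists[OF sK p_pow(3) H(1)] by blast
  define H2 where "H2 = map ((\<otimes>) (p [^] total_content j)) H'"
  have H2K: "set H2 \<subseteq> K" using H'(1) p_pow(3) by (auto simp: H2_def)
  have Kc: "set Q \<subseteq> carrier R" if "set Q \<subseteq> K" for Q using that K_carrier by auto
  obtain G where G: "set G \<subseteq> V" "\<forall>z\<in>carrier R. eval G z = scaled j z" "\<forall>\<beta>\<in>carrier S. reval G \<beta> = scaled_S j \<beta>"
    using pf_scaled[OF j] unfolding pf_def by auto
  have eq: "eval P z = eval G z \<otimes> eval H2 z" if z: "z \<in> carrier R" for z
  proof -
    have cz: "?c \<otimes> z \<in> carrier R" using z p_pow by simp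
    have "inv ?c \<otimes> (?c \<otimes> z) = z" using p_inv[of "j - 1"] p_pow(2)[of "j - 1"] z m_comm[OF p_inv(2) p_pow(2), of "j - 1" "j - 1"] by (simp flip: m_assoc)
    then have "eval P z = eval P' (?c \<otimes> z)" using P'(2) cz by simp
    also have "\<dots> = p [^] total_content j \<otimes> scaled j z \<otimes> eval H' z"
      using H(2) cz H'(2) z eval_g_scaled[OF j z] by simp
    also have "\<dots> = eval G z \<otimes> eval H2 z"
      unfolding H2_def eval_scale[OF p_pow(2) Kc[OF H'(1)] z]
      using G(2) z pf_closed(1)[OF pf_scaled[OF j] z] p_pow(2) eval_in_carrier[OF Kc[OF H'(1)] z] by (simp add: m_ac)
    finally show ?thesis .
  qed
  have aS: "\<alpha> j \<in> carrier S" by (rule \<alpha>(1)[OF j])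
  have "reval (\<phi> j) (\<alpha> j) = \<zero>\<^bsub>S\<^esub>"
    unfolding reval_def \<phi>(2)[OF j] by (rule S.IrrE(4)[OF k_subfield \<alpha>(1,2)[OF j]])
  then have Ga: "reval G (\<alpha> j) = \<zero>\<^bsub>S\<^esub>"
    using G(3) aS scaled_S_eq[OF j aS] e[OF j] pf_closed(2)[OF pf_rest aS] by (simp add: S.nat_pow_zero)
  obtain \<beta> where b: "\<beta> \<in> carrier S" "reval (\<phi> j) \<beta> \<noteq> \<zero>\<^bsub>S\<^esub>"
  proof -
    have "\<one> \<in> set (\<phi> j)" using \<phi>(1)[OF j] by (auto elim!: monicsE)
    then have "\<not> set (\<phi> j) \<subseteq> val_ge R K v 1" by (auto simp: val_ge_def)
    then show thesis using reval_zero_imp[OF \<phi>_V[OF j]] that by blast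
  qed
  have "finite ({\<gamma> \<in> carrier S. reval (\<phi> j) \<gamma> = \<zero>\<^bsub>S\<^esub>} \<union> {\<zero>\<^bsub>S\<^esub>})"
    using finite_zeros[OF \<phi>_V[OF j] b] by simp
  then obtain \<gamma> where c: "\<gamma> \<in> carrier S" "reval (\<phi> j) \<gamma> \<noteq> \<zero>\<^bsub>S\<^esub>" "\<gamma> \<noteq> \<zero>\<^bsub>S\<^esub>"
    using S_infinite finite_subset[of "carrier S" "{\<gamma> \<in> carrier S. reval (\<phi> j) \<gamma> = \<zero>\<^bsub>S\<^esub>} \<union> {\<zero>\<^bsub>S\<^esub>}"] by blast
  have "reval G \<gamma> \<noteq> \<zero>\<^bsub>S\<^esub>"
    using G(3) c scaled_S_eq[OF j c(1)] rest_S_nonzero[OF j c(1,3)] S.nat_pow_nonzero[OF _ c(2)]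
      reval_closed[OF \<phi>_V[OF j] c(1)] by (simp add: S.integral_iff)
  then show ?thesis by (rule gauss_kernel[OF G(1) c(1) _ aS Ga P(1) H2K eq])
qed

lemma y_algebraic: "(algebraic over K) (y j)"
proof -
  have "subfield (simple_extension K (y j)) R"
    unfolding simple_extension_y using simple_extension_is_subfield[OF K \<theta>(1)] \<theta>(3) by simp
  then show ?thesis using simple_extension_is_subfield[OF K y_carrier] by simp
qed

text \<open>The equation \<open>scaled j (y j) = 0\<close> solved for \<open>\<phi> j (y j) ^ e j\<close>: the coefficient \<open>rest j\<close> does
  not vanish at \<open>\<alpha> j\<close>, and the remainder is \<open>p\<close> times \<open>- rest j - tail j\<close>, whose reduction
  is \<open>- rest_S j\<close>.\<close>

lemma extension:
  assumes j: "j \<in> {1..s}"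
  shows "\<exists>u r. simple_place_extension R S K v \<rho> p (y j) (\<alpha> j) (\<phi> j) (e j) u r"
proof -
  have aS: "\<alpha> j \<in> carrier S" by (rule \<alpha>(1)[OF j])
  obtain u where u: "set u \<subseteq> V" "\<forall>z\<in>carrier R. eval u z = rest j z" "\<forall>\<beta>\<in>carrier S. reval u \<beta> = rest_S j \<beta>"
    using pf_rest unfolding pf_def by blast
  have "pf (\<lambda>z. \<zero> \<ominus> (rest j z \<oplus> tail j z)) (\<lambda>\<beta>. \<rho> \<zero> \<ominus>\<^bsub>S\<^esub> (rest_S j \<beta> \<oplus>\<^bsub>S\<^esub> tail_S j \<beta>))"
    by (intro pf_minus pf_add pf_rest pf_tail pf_const) simp
  then obtain r where r: "set r \<subseteq> V" "\<forall>z\<in>carrier R. eval r z = \<zero> \<ominus> (rest j z \<oplus> tail j z)"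
    "\<forall>\<beta>\<in>carrier S. reval r \<beta> = \<rho> \<zero> \<ominus>\<^bsub>S\<^esub> (rest_S j \<beta> \<oplus>\<^bsub>S\<^esub> tail_S j \<beta>)" unfolding pf_def by blast
  note R0 = rest_S_nonzero[OF j aS \<alpha>(3)[OF j]]
  have c: "rest j (y j) \<in> carrier R" "tail j (y j) \<in> carrier R" "eval (\<phi> j) (y j) [^] e j \<in> carrier R"
    using closed[OF y_carrier] j by auto
  have "p [^] total_content j \<otimes> scaled j (y j) = \<zero>"
    using eval_g_scaled[OF j y_carrier, of j] \<theta>(2) unfolding \<theta>_y[of j, symmetric] by simp
  then have s0: "scaled j (y j) = \<zero>"
    using p_pow(2,4) pf_closed(1)[OF pf_scaled[OF j] y_carrier] by (simp add: integral_iff)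
  have eq: "eval u (y j) \<otimes> eval (\<phi> j) (y j) [^] e j = p \<otimes> eval r (y j)"
  proof -
    have "rest j (y j) \<otimes> eval (\<phi> j) (y j) [^] e j
        = scaled j (y j) \<oplus> p \<otimes> (\<zero> \<ominus> (rest j (y j) \<oplus> tail j (y j)))"
      unfolding scaled_def using c p_V(3) by algebra
    then show ?thesis using u(2) r(2) y_carrier s0 c p_V(3) by simp
  qed
  have rnz: "reval r (\<alpha> j) \<noteq> \<zero>\<^bsub>S\<^esub>"
  proof
    assume "reval r (\<alpha> j) = \<zero>\<^bsub>S\<^esub>"
    then have "\<ominus>\<^bsub>S\<^esub> rest_S j (\<alpha> j) = \<zero>\<^bsub>S\<^esub>"
      using r(3) aS tail_S_zero[OF aS, of j] R0(1) \<rho>_simps(5) by (simp add: S.minus_eq)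
    then have "rest_S j (\<alpha> j) = \<zero>\<^bsub>S\<^esub>" using S.minus_minus[OF R0(1)] by simp
    then show False using R0 by simp
  qed
  have "simple_place_extension R S K v \<rho> p (y j) (\<alpha> j) (\<phi> j) (e j) u r"
  proof (rule simple_place_extension.intro[OF residue_place_axioms], rule simple_place_extension_axioms.intro)
    show "reval u (\<alpha> j) \<noteq> \<zero>\<^bsub>S\<^esub>" using u(3) R0 aS by simp
  qed (use p y_carrier y_algebraic aS \<alpha>(2)[OF j] \<phi>_V[OF j] \<phi>(2)[OF j] e[OF j] u(1) r(1) rnz eq kernel[OF j] in auto)
  then show ?thesis by blast
qed

text \<open>A valuation ring above the given one sees some \<open>y j\<close> as an integral element whose minimal
  polynomial over the residue field is approximated by \<open>\<phi> j\<close>: otherwise each factor of the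
  target would be as large as possible, and their product could not be cancelled by the error term.\<close>

lemma valuation_ring_hits_root:
  assumes U: "valuation_subring R (simple_extension K \<theta>) U" and UK: "U \<inter> K = V"
  shows "\<exists>j\<in>{1..s}. y j \<in> U \<and> \<not> valuation_subring.unit R U (eval (\<phi> j) (y j))"
proof (rule ccontr)
  assume neg: "\<not> ?thesis"
  interpret U: valuation_subring R "simple_extension K \<theta>" U by fact
  have VU: "V \<subseteq> U" using UK by auto
  have KL: "K \<subseteq> simple_extension K \<theta>" by (rule simple_extension_incl[OF subfieldE(3)[OF K] \<theta>(1)])
  have \<theta>L: "\<theta> \<in> simple_extension K \<theta>" by (rule simple_extension_mem[OF subfieldE(1)[OF K] \<theta>(1)])
  have pU: "p \<in> U" "\<not> U.unit p"
  proof -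
    show "p \<in> U" using p_V VU by auto
    have "v (inv p) = -1" "inv p \<in> K" "inv p \<noteq> \<zero>" using v_inv[OF p(1,2)] p(3) K_inv[OF p(1,2)] by auto
    then have "inv p \<notin> V" by (simp add: val_ge_def)
    then show "\<not> U.unit p" using UK K_inv[OF p(1,2)] by (auto simp: U.unit_def)
  qed
  obtain T where T: "g = \<one> # T" "set T \<subseteq> V" using g by (cases g) auto
  have gc: "set g \<subseteq> carrier R" by (rule V_list_carrier[OF g(1)])
  have \<theta>U: "\<theta> \<in> U"
  proof (rule ccontr)
    assume n: "\<theta> \<notin> U"
    then have nz: "\<theta> \<noteq> \<zero>" using U.U_closed by auto
    have i: "inv \<theta> \<in> U" "\<not> U.unit (inv \<theta>)" using U.inv_nonunit[OF \<theta>L n nz] by auto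
    note ic = inv_props[OF \<theta>(1) nz]
    have u: "U.unit (homog g \<one> (inv \<theta>))" unfolding T(1) by (rule U.homog_monic_unit[OF i]) (use T VU in auto)
    have "homog g (\<theta> \<otimes> \<one>) (\<theta> \<otimes> inv \<theta>) = \<theta> [^] (length g - 1) \<otimes> homog g \<one> (inv \<theta>)"
      by (rule homog_scale[OF gc]) (use \<theta>(1) ic in auto)
    then have "\<theta> [^] (length g - 1) \<otimes> homog g \<one> (inv \<theta>) = \<zero>"
      using homog_one[OF gc \<theta>(1)] \<theta>(1,2) ic by simp
    then show False
      using nat_pow_nonzero[OF \<theta>(1) nz] \<theta>(1) u homog_closed[OF gc one_closed ic(1)] by (simp add: integral_iff U.unit_def)
  qed
  have fac: "factor j \<theta> \<noteq> \<zero> \<and> p [^] ((j - 1) * d j) \<otimes> inv (factor j \<theta>) \<in> U" if j: "j \<in> {1..s}" for j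
  proof -
    let ?c = "p [^] (j - 1)"
    obtain T where T: "h j = \<one> # T" "set T \<subseteq> V" using h(1)[OF j] by (rule monicsE)
    have lT: "length T = d j" using h(4)[OF j] T(1) by simp
    have hc: "set (h j) \<subseteq> carrier R" by (rule V_list_carrier[OF h(3)[OF j]])
    show ?thesis
    proof (cases "y j \<in> U")
      case False
      have yL: "y j \<in> simple_extension K \<theta>"
        using simple_extension_mem[OF subfieldE(1)[OF K] y_carrier, of j] simple_extension_y[of j] by simp
      have y0: "y j \<noteq> \<zero>" using False U.U_closed by auto
      have i: "inv (y j) \<in> U" "\<not> U.unit (inv (y j))" using U.inv_nonunit[OF yL False y0] by auto
      note ic = inv_props[OF y_carrier y0]
      have \<theta>0: "\<theta> \<noteq> \<zero>"
        by (subst \<theta>_y[of j]) (use y0 p_pow(2,4) y_carrier in \<open>simp add: integral_iff\<close>)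
      have c: "?c = \<theta> \<otimes> inv (y j)"
      proof -
        have "\<theta> \<otimes> inv (y j) = ?c \<otimes> (y j \<otimes> inv (y j))"
          by (subst \<theta>_y[of j]) (use y_carrier[of j] ic(1) p_pow(2) in \<open>simp add: m_assoc\<close>)
        then show ?thesis using ic p_pow by simp
      qed
      define x where "x = homog (h j) \<one> (inv (y j))"
      have xu: "U.unit x" unfolding x_def T(1) by (rule U.homog_monic_unit[OF i]) (use T VU in auto)
      have xc: "x \<in> carrier R" "x \<noteq> \<zero>" using xu U.U_carrier by (auto simp: U.unit_def)
      note xi = inv_props[OF xc]
      have F: "factor j \<theta> = \<theta> [^] d j \<otimes> x"
        unfolding factor_def c x_def
        using homog_scale[OF hc one_closed ic(1) \<theta>(1)] \<theta>(1) h(4)[OF j] by simp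
      note tn = nat_pow_closed[OF \<theta>(1), of "d j"] nat_pow_nonzero[OF \<theta>(1) \<theta>0, of "d j"]
      have "p [^] ((j - 1) * d j) = ?c [^] d j" using p_V(3) by (simp add: nat_pow_pow)
      also have "\<dots> = \<theta> [^] d j \<otimes> inv (y j) [^] d j" unfolding c using \<theta>(1) ic by (simp add: nat_pow_distrib)
      finally have pe: "p [^] ((j - 1) * d j) = \<theta> [^] d j \<otimes> inv (y j) [^] d j" .
      have "p [^] ((j - 1) * d j) \<otimes> inv (factor j \<theta>) = (\<theta> [^] d j \<otimes> inv (y j) [^] d j) \<otimes> (inv (\<theta> [^] d j) \<otimes> inv x)"
        unfolding pe F using inv_product[OF tn xc] by simp
      also have "\<dots> = (\<theta> [^] d j \<otimes> inv (\<theta> [^] d j)) \<otimes> (inv (y j) [^] d j \<otimes> inv x)"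
        using tn(1) inv_props(1)[OF tn] ic(1) xi(1) by (simp add: m_ac)
      also have "\<dots> = inv (y j) [^] d j \<otimes> inv x" using inv_props(3)[OF tn] ic(1) xi(1) by simp
      also have "\<dots> \<in> U" using i(1) xu U.U_closed by (simp add: U.unit_def)
      finally show ?thesis using F tn xc by (simp add: integral_iff)
    next
      case True
      define t where "t = eval (\<phi> j) (y j)"
      have tu: "U.unit t" using neg j True by (auto simp: t_def)
      define x where "x = t [^] e j \<oplus> p"
      have xu: "U.unit x" unfolding x_def by (rule U.unit_add_nonunit[OF U.unit_pow[OF tu] pU])
      have xc: "x \<in> carrier R" "x \<noteq> \<zero>" using xu U.U_carrier by (auto simp: U.unit_def)
      note xi = inv_props[OF xc]
      have "homog (h j) (y j) \<one> = x"
        unfolding x_def t_def using homog_one[OF hc y_carrier] h(2)[OF j y_carrier] by simp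
      then have F: "factor j \<theta> = ?c [^] d j \<otimes> x"
        unfolding factor_def
        using homog_scale[OF hc y_carrier[of j] one_closed p_pow(2), of "j - 1"] \<theta>_y[of j, symmetric] h(4)[OF j] p_pow(2)
        by simp
      have pe: "p [^] ((j - 1) * d j) = ?c [^] d j" using p_V(3) by (simp add: nat_pow_pow)
      note tn = nat_pow_closed[OF p_pow(2), of "j - 1" "d j"] nat_pow_nonzero[OF p_pow(2,4), of "j - 1" "d j"]
      have "p [^] ((j - 1) * d j) \<otimes> inv (factor j \<theta>) = ?c [^] d j \<otimes> (inv (?c [^] d j) \<otimes> inv x)"
        unfolding pe F using inv_product[OF tn xc] by simp
      also have "\<dots> = inv x" using inv_props(1,3)[OF tn] tn xi by (simp flip: m_assoc)
      finally show ?thesis using F tn xc xu by (simp add: integral_iff U.unit_def)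
    qed
  qed
  define Q where "Q = (\<Otimes>j\<in>{1..s}. factor j \<theta>)"
  have Q: "Q \<in> carrier R \<and> Q \<noteq> \<zero> \<and> p [^] (\<Sum>j\<in>J. (j - 1) * d j) \<otimes> inv (\<Otimes>j\<in>J. factor j \<theta>) \<in> U"
    if "J \<subseteq> {1..s}" for J
  proof -
    have "finite J" using that finite_subset by blast
    then have "p [^] (\<Sum>j\<in>J. (j - 1) * d j) \<otimes> inv (\<Otimes>j\<in>J. factor j \<theta>) \<in> U" using that
    proof (induction J)
      case empty
      then show ?case using U.U_closed by simp
    next
      case (insert i J)
      have c: "factor j \<theta> \<in> carrier R \<and> factor j \<theta> \<noteq> \<zero>" if "j \<in> insert i J" for j
        using that insert.prems fac factor_closed \<theta>(1) by blast
      have J: "(\<Otimes>j\<in>J. factor j \<theta>) \<in> carrier R \<and> (\<Otimes>j\<in>J. factor j \<theta>) \<noteq> \<zero>"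
        by (rule finprod_nonzero[OF insert.hyps(1)]) (use c in auto)
      have e1: "(\<Otimes>j\<in>insert i J. factor j \<theta>) = factor i \<theta> \<otimes> (\<Otimes>j\<in>J. factor j \<theta>)"
        by (rule finprod_insert[OF insert.hyps]) (use c in auto)
      have e2: "p [^] (\<Sum>j\<in>insert i J. (j - 1) * d j) = p [^] ((i - 1) * d i) \<otimes> p [^] (\<Sum>j\<in>J. (j - 1) * d j)"
        using insert.hyps p_V(3) by (simp add: nat_pow_mult)
      have ii: "inv (factor i \<theta>) \<in> carrier R" "inv (\<Otimes>j\<in>J. factor j \<theta>) \<in> carrier R"
        using inv_props(1) c[of i] J by auto
      have "p [^] (\<Sum>j\<in>insert i J. (j - 1) * d j) \<otimes> inv (\<Otimes>j\<in>insert i J. factor j \<theta>)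
        = (p [^] ((i - 1) * d i) \<otimes> inv (factor i \<theta>)) \<otimes> (p [^] (\<Sum>j\<in>J. (j - 1) * d j) \<otimes> inv (\<Otimes>j\<in>J. factor j \<theta>))"
        unfolding e1 e2 using inv_product[of "factor i \<theta>" "\<Otimes>j\<in>J. factor j \<theta>"] c[of i] J ii p_pow(2) by (simp add: m_ac)
      also have "\<dots> \<in> U" using fac[of i] insert U.U_closed by simp
      finally show ?case .
    qed
    moreover have "Q \<in> carrier R \<and> Q \<noteq> \<zero>"
      unfolding Q_def using fac factor_closed \<theta>(1) by (intro finprod_nonzero) auto
    ultimately show ?thesis by simp
  qed
  (* the product Q of the factors divides p ^ n in U, but equals p ^ n times a nonunit *)
  define n where "n = (\<Sum>j\<in>{1..s}. (j - 1) * d j)"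
  have QU: "p [^] n \<otimes> inv Q \<in> U" "Q \<in> carrier R" "Q \<noteq> \<zero>" using Q[of "{1..s}"] by (auto simp: n_def Q_def)
  define m where "m = N - n - 1"
  have Nm: "N = n + Suc m" using N by (simp add: m_def n_def)
  have DU: "eval D \<theta> \<in> U" by (rule eval_in_subring[OF U.U _ \<theta>U]) (use D VU in auto)
  define b where "b = p [^] m \<otimes> eval D \<theta>"
  have bU: "b \<in> U" unfolding b_def using DU pU U.U_closed by auto
  have bc: "b \<in> carrier R" using bU U.U_carrier by auto
  have Dc: "eval D \<theta> \<in> carrier R" using DU U.U_carrier by auto
  have "p [^] N \<otimes> eval D \<theta> = p [^] n \<otimes> (p \<otimes> b)"
    unfolding Nm b_def nat_pow_mult[OF p_V(3), symmetric] nat_pow_Suc using p_pow(2) p_V(3) Dc by (simp add: m_ac)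
  then have "Q \<oplus> p [^] n \<otimes> (p \<otimes> b) = \<zero>" using approx[OF \<theta>(1)] \<theta>(2) by (simp add: Q_def)
  then have "\<ominus> (p [^] n \<otimes> (p \<otimes> b)) = Q"
    using QU bc p_pow(2) p_V(3) by (intro minus_equality) auto
  then have Qe: "Q = p [^] n \<otimes> \<ominus> (p \<otimes> b)"
    using bc p_pow(2) p_V(3) by (simp add: r_minus)
  have "(p [^] n \<otimes> inv Q) \<otimes> \<ominus> (p \<otimes> b) = Q \<otimes> inv Q"
    using inv_props(1)[OF QU(2,3)] p_pow(2)[of n] bc p_V(3)
    by (subst (2) Qe) (simp add: m_ac)
  also have "\<dots> = \<one>" by (rule inv_props(3)[OF QU(2,3)])
  finally have q1: "(p [^] n \<otimes> inv Q) \<otimes> \<ominus> (p \<otimes> b) = \<one>" .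
  have pbU: "\<ominus> (p \<otimes> b) \<in> U" using U.U_closed(4,5) pU(1) bU by blast
  have "U.unit (\<ominus> (p \<otimes> b))"
    using U.unitI[OF pbU QU(1)] q1 m_comm[OF U.U_carrier[OF QU(1)] U.U_carrier[OF pbU]] by simp
  then have "U.unit (p \<otimes> b)" using U.unit_neg[of "\<ominus> (p \<otimes> b)"] bc p_V(3) by simp
  then show False using U.unit_mult_iff[OF pU(1) bU] pU(2) by simp
qed

end

section \<open>Approximation of the target and irreducibility\<close>

text \<open>Extension of a place with ramification index \<open>e\<close>; both valuations are normalized.\<close>

definition extends_place where
  "extends_place R S K v \<rho> L w \<rho>' e \<longleftrightarrow> place R S L w \<rho>' \<and>
     (\<forall>x\<in>K. x \<noteq> \<zero>\<^bsub>R\<^esub> \<longrightarrow> w x = int e * v x) \<and> (\<forall>x\<in>val_ge R K v 0. \<rho>' x = \<rho> x)"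

text \<open>In characteristic \<open>q\<close> a finite extension \<open>L / K\<close> is separable iff \<open>L\<close> is spanned over
  \<open>K\<close> by \<open>q\<close>-th powers. Spans are described by the sets \<open>T\<close> that contain them, and the condition
  is vacuous in characteristic zero.\<close>

definition frobenius_spans where
  "frobenius_spans R K L \<longleftrightarrow> (\<forall>(q::nat) T. Factorial_Ring.prime q \<and> add_pow R q \<one>\<^bsub>R\<^esub> = \<zero>\<^bsub>R\<^esub> \<and> T \<subseteq> carrier R \<and>
     (\<forall>x\<in>T. \<forall>y\<in>T. x \<oplus>\<^bsub>R\<^esub> y \<in> T) \<and> (\<forall>a\<in>K. \<forall>x\<in>T. a \<otimes>\<^bsub>R\<^esub> x \<in> T) \<and>
     (\<forall>x\<in>L. x [^]\<^bsub>R\<^esub> q \<in> T) \<longrightarrow> L \<subseteq> T)"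

lemma (in ring) dimension_subset_eq:
  assumes "subfield K R" "dimension n K E" "dimension n' K F" "E \<subseteq> F"
  shows "n \<le> n'" "n' \<le> n \<Longrightarrow> E = F"
proof -
  obtain Us where Us: "set Us \<subseteq> carrier R" "independent K Us" "length Us = n" "Span K Us = E"
    using exists_base[OF assms(1,2)] by blast
  have sub: "set Us \<subseteq> F" using Span_base_incl[OF assms(1) Us(1)] Us(4) assms(4) by blast
  show "n \<le> n'" using independent_length_le_dimension[OF assms(1,3) Us(2) sub] Us(3) by simp
  then show "n' \<le> n \<Longrightarrow> E = F"
    using independent_length_eq_dimension[OF assms(1,3) Us(2) sub] Us(3,4) by simp
qed

lemma (in domain) degree_Irr_dimension:
  assumes "subfield K R" "x \<in> carrier R" "(algebraic over K) x" "dimension n K (simple_extension K x)"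
  shows "length (Irr K x) = Suc n"
proof -
  have "degree (Irr K x) = n"
    using dimension_is_inj[OF assms(1) dimension_simple_extension[OF assms(1-3)] assms(4)] .
  moreover have "Irr K x \<noteq> []"
    using pirreducibleE(1)[OF subfieldE(1)[OF assms(1)] IrrE(1,2)[OF assms(1-3)]] .
  ultimately show ?thesis by (cases "Irr K x") auto
qed

text \<open>A monic polynomial with root \<open>\<theta>\<close> and the degree of the minimal polynomial is the minimal
  polynomial.\<close>

lemma (in field) monic_divides:
  assumes K: "subfield K R" and \<theta>: "\<theta> \<in> carrier R" "(algebraic over K) \<theta>"
    and g: "set g \<subseteq> K" "hd g = \<one>" "length g = length (Irr K \<theta>)" "eval g \<theta> = \<zero>"
    and P: "set P \<subseteq> K" "eval P \<theta> = \<zero>"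
  shows "\<exists>H. set H \<subseteq> K \<and> (\<forall>z\<in>carrier R. eval P z = eval g z \<otimes> eval H z)"
proof -
  note I = IrrE[OF K \<theta>]
  have sK: "subring K R" by (rule subfieldE(1)[OF K])
  have nz: "Irr K \<theta> \<noteq> []" by (rule pirreducibleE(1)[OF sK I(1,2)])
  have Kc: "set Q \<subseteq> carrier R" if "set Q \<subseteq> K" for Q using that subfieldE(3)[OF K] by auto
  have poly: "set Q \<subseteq> K" "polynomial K Q" if "Q \<in> carrier (K[X])" for Q
    using that polynomial_incl by (auto simp: univ_poly_carrier)
  have gn: "g \<noteq> []" using g(3) nz by auto
  have gK: "g \<in> carrier (K[X])" using g(1,2) gn by (auto simp: univ_poly_carrier[symmetric] polynomial_def)
  have div: "\<exists>H \<in> carrier (K[X]). Q = Irr K \<theta> \<otimes>\<^bsub>K[X]\<^esub> H" if "Q \<in> carrier (K[X])" "eval Q \<theta> = \<zero>" for Q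
    using Irr_minimal[OF K \<theta> that] pdivides_iff_shell[OF K I(1) that(1)] unfolding factor_def by blast
  obtain H where H: "H \<in> carrier (K[X])" "g = Irr K \<theta> \<otimes>\<^bsub>K[X]\<^esub> H" using div[OF gK g(4)] by blast
  have "degree g = (if Irr K \<theta> = [] \<or> H = [] then 0 else degree (Irr K \<theta>) + degree H)"
    unfolding H(2) univ_poly_mult by (rule poly_mult_degree_eq[OF sK poly(2)[OF I(1)] poly(2)[OF H(1)]])
  moreover have Hn: "H \<noteq> []"
  proof
    assume "H = []"
    then have "g = []" using H(2) unfolding univ_poly_mult using poly_mult_zero(2)[OF Kc[OF poly(1)[OF I(1)]]] by simp
    then show False using gn by simp
  qed
  ultimately have "degree H = 0" using g(3) nz by simp
  then obtain c where c: "H = [c]" using Hn by (cases H) auto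
  have cK: "c \<in> K" "c \<noteq> \<zero>" using poly[OF H(1)] c by (auto simp: polynomial_def)
  have cc: "c \<in> carrier R" using cK subfieldE(3)[OF K] by auto
  have ic: "inv c \<in> K" "c \<otimes> inv c = \<one>" using subfield_m_inv[OF K] cK by auto
  have icc: "inv c \<in> carrier R" using ic subfieldE(3)[OF K] by auto
  have nP: "normalize P \<in> carrier (K[X])" using normalize_gives_polynomial[OF P(1)] univ_poly_carrier by blast
  have "eval (normalize P) \<theta> = \<zero>" using eval_normalize[OF Kc[OF P(1)] \<theta>(1)] P(2) by simp
  from div[OF nP this] obtain Q where Q: "Q \<in> carrier (K[X])" "normalize P = Irr K \<theta> \<otimes>\<^bsub>K[X]\<^esub> Q" by blast
  have "eval P z = eval g z \<otimes> eval (map ((\<otimes>) (inv c)) Q) z" if z: "z \<in> carrier R" for z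
  proof -
    have Ic: "eval (Irr K \<theta>) z \<in> carrier R" by (rule eval_in_carrier[OF Kc[OF poly(1)[OF I(1)]] z])
    have Qc: "eval Q z \<in> carrier R" by (rule eval_in_carrier[OF Kc[OF poly(1)[OF Q(1)]] z])
    have "eval g z = eval (Irr K \<theta>) z \<otimes> c"
      unfolding H(2) univ_poly_mult c using eval_poly_mult[OF Kc[OF poly(1)[OF I(1)]] _ z, of "[c]"] cc z by simp
    moreover have "eval P z = eval (Irr K \<theta>) z \<otimes> eval Q z"
      using eval_normalize[OF Kc[OF P(1)] z] eval_poly_mult[OF Kc[OF poly(1)[OF I(1)]] Kc[OF poly(1)[OF Q(1)]] z] Q(2)
      unfolding univ_poly_mult by simp
    moreover have "eval (map ((\<otimes>) (inv c)) Q) z = inv c \<otimes> eval Q z"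
      by (rule eval_scale[OF icc Kc[OF poly(1)[OF Q(1)]] z])
    moreover have "eval (Irr K \<theta>) z \<otimes> c \<otimes> (inv c \<otimes> eval Q z) = eval (Irr K \<theta>) z \<otimes> (c \<otimes> inv c) \<otimes> eval Q z"
      using Ic Qc cc icc by (simp add: m_assoc)
    ultimately show ?thesis using ic Ic Qc by simp
  qed
  moreover have "set (map ((\<otimes>) (inv c)) Q) \<subseteq> K" using poly(1)[OF Q(1)] ic(1) subringE(6)[OF sK] by auto
  ultimately show ?thesis by blast
qed

lemma (in field) eval_difference:
  assumes "length g = length g0" "set g \<subseteq> carrier R" "set g0 \<subseteq> carrier R" and c: "c \<in> carrier R" "c \<noteq> \<zero>"
    and z: "z \<in> carrier R"
  shows "eval g z = eval g0 z \<oplus> c \<otimes> eval (map2 (\<lambda>a b. inv c \<otimes> (a \<ominus> b)) g g0) z"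
  using assms(1-3)
proof (induction g g0 rule: list_induct2)
  case (Cons a g b g0)
  let ?D = "map2 (\<lambda>a b. inv c \<otimes> (a \<ominus> b)) g g0"
  have i: "inv c \<in> carrier R" "c \<otimes> inv c = \<one>" using inv_props[OF c] by auto
  have Dc: "set ?D \<subseteq> carrier R"
  proof
    fix x assume "x \<in> set ?D"
    then obtain a b where "(a, b) \<in> set (zip g g0)" "x = inv c \<otimes> (a \<ominus> b)" by auto
    then show "x \<in> carrier R"
      using Cons.prems i(1) set_zip_leftD[of a b g g0] set_zip_rightD[of a b g g0] by auto
  qed
  define E where "E = eval ?D z"
  define Z where "Z = z [^] length g"
  define j where "j = inv c"
  have cl: "a \<in> carrier R" "b \<in> carrier R" "eval g0 z \<in> carrier R" "E \<in> carrier R" "Z \<in> carrier R" "j \<in> carrier R"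
    using Cons.prems eval_in_carrier[OF Dc z] eval_in_carrier[of g0 z] z i by (auto simp: E_def Z_def j_def)
  have "c \<otimes> (j \<otimes> (a \<ominus> b) \<otimes> Z \<oplus> E) = (c \<otimes> j) \<otimes> ((a \<ominus> b) \<otimes> Z) \<oplus> c \<otimes> E"
    using cl c(1) by algebra
  also have "\<dots> = (a \<ominus> b) \<otimes> Z \<oplus> c \<otimes> E" using i cl by (simp add: j_def)
  finally have e: "c \<otimes> (j \<otimes> (a \<ominus> b) \<otimes> Z \<oplus> E) = (a \<ominus> b) \<otimes> Z \<oplus> c \<otimes> E" .
  have "eval g z = eval g0 z \<oplus> c \<otimes> E" using Cons by (simp add: E_def)
  then have "eval (a # g) z = a \<otimes> Z \<oplus> (eval g0 z \<oplus> c \<otimes> E)" by (simp add: Z_def)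
  also have "\<dots> = (b \<otimes> Z \<oplus> eval g0 z) \<oplus> ((a \<ominus> b) \<otimes> Z \<oplus> c \<otimes> E)"
    using cl c(1) by algebra
  finally show ?case using Cons.hyps e by (simp add: E_def Z_def j_def)
qed (use c in simp)

context residue_place
begin

lemma degree_bound:
  assumes P: "set P \<subseteq> V" and a: "a \<in> carrier S" "(S.algebraic over k) a" "reval P a = \<zero>\<^bsub>S\<^esub>"
    and b: "b \<in> carrier S" "reval P b \<noteq> \<zero>\<^bsub>S\<^esub>"
  shows "length (S.Irr k a) \<le> length P"
proof -
  let ?q = "S.normalize (map \<rho> P)"
  have m: "set (map \<rho> P) \<subseteq> k" using P by auto
  have n: "?q \<in> carrier (k[X]\<^bsub>S\<^esub>)"
    using S.normalize_gives_polynomial[OF m] univ_poly_carrier by blast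
  have ev: "S.eval ?q \<gamma> = reval P \<gamma>" if "\<gamma> \<in> carrier S" for \<gamma>
    unfolding reval_def by (rule S.eval_normalize[OF map_\<rho>_closed[OF P] that])
  have nz: "?q \<noteq> []" using ev[OF b(1)] b(2) by auto
  note I = S.IrrE[OF k_subfield a(1,2)]
  have "S.Irr k a pdivides\<^bsub>S\<^esub> ?q"
    by (rule S.Irr_minimal[OF k_subfield a(1,2) n]) (use ev[OF a(1)] a(3) in simp)
  then have "length (S.Irr k a) - 1 \<le> length ?q - 1"
    by (rule S.pdivides_imp_degree_le[OF subfieldE(1)[OF k_subfield] I(1) n nz])
  then have "length (S.Irr k a) \<le> length ?q" using nz by (cases ?q) auto
  also have "\<dots> \<le> length P" using S.normalize_length_le[of "map \<rho> P"] by simp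
  finally show ?thesis .
qed

text \<open>A monic polynomial with irreducible reduction is the minimal polynomial of each of its roots:
  by Gauss's lemma the primitive multiple of one of two factors would reduce to a nonzero
  polynomial that vanishes at \<open>a\<close> and has too small a degree.\<close>

lemma irreducible_lift:
  assumes g: "set g \<subseteq> V" "hd g = \<one>" "length g = length (S.Irr k a)"
    and a: "a \<in> carrier S" "(S.algebraic over k) a" "reval g a = \<zero>\<^bsub>S\<^esub>"
    and \<theta>: "\<theta> \<in> carrier R" "eval g \<theta> = \<zero>" "(algebraic over K) \<theta>"
  shows "length (Irr K \<theta>) = length g"
proof -
  have sK: "subring K R" by (rule subfieldE(1)[OF K])
  note I = IrrE[OF K \<theta>(1,3)]
  have nzI: "Irr K \<theta> \<noteq> []" by (rule pirreducibleE(1)[OF sK I(1,2)])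
  have aI: "S.Irr k a \<noteq> []"
    by (rule S.pirreducibleE(1)[OF subfieldE(1)[OF k_subfield] S.IrrE(1,2)[OF k_subfield a(1,2)]])
  have gn: "g \<noteq> []" using g(3) aI by auto
  have gK: "set g \<subseteq> K" using g(1) ge_K by blast
  have gX: "g \<in> carrier (K[X])" using g(2) gK gn by (auto simp: univ_poly_carrier[symmetric] polynomial_def)
  have poly: "set Q \<subseteq> K" "polynomial K Q" if "Q \<in> carrier (K[X])" for Q
    using that polynomial_incl by (auto simp: univ_poly_carrier)
  have Kc: "set Q \<subseteq> carrier R" if "set Q \<subseteq> K" for Q using that K_carrier by auto
  have "Irr K \<theta> divides\<^bsub>K[X]\<^esub> g"
    using Irr_minimal[OF K \<theta>(1,3) gX \<theta>(2)] pdivides_iff_shell[OF K I(1) gX] by simp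
  then obtain Q where Q: "Q \<in> carrier (K[X])" "g = Irr K \<theta> \<otimes>\<^bsub>K[X]\<^esub> Q" unfolding factor_def by blast
  have Qn: "Q \<noteq> []"
  proof
    assume "Q = []"
    then have "g = []" using Q(2) unfolding univ_poly_mult using poly_mult_zero(2)[OF Kc[OF poly(1)[OF I(1)]]] by simp
    then show False using gn by simp
  qed
  have deg: "degree g = degree (Irr K \<theta>) + degree Q"
    unfolding Q(2) univ_poly_mult using poly_mult_degree_eq[OF sK poly(2)[OF I(1)] poly(2)[OF Q(1)]] nzI Qn by simp
  have degI: "1 \<le> degree (Irr K \<theta>)" by (rule pirreducible_degree[OF K I(1,2)])
  have nz: "\<not> set P \<subseteq> {\<zero>}" if "P \<in> carrier (K[X])" "P \<noteq> []" for P
    using that poly(2)[OF that(1)] by (cases P) (auto simp: polynomial_def)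
  let ?I = "Irr K \<theta>"
  obtain c b where c: "c \<in> K" "c \<noteq> \<zero>" and cI: "set (map ((\<otimes>) c) ?I) \<subseteq> V"
    and b: "b \<in> carrier S" "reval (map ((\<otimes>) c) ?I) b \<noteq> \<zero>\<^bsub>S\<^esub>"
    using primitive_multiple[OF poly(1)[OF I(1)] nz[OF I(1) nzI]] by auto
  obtain c' b' where c': "c' \<in> K" "c' \<noteq> \<zero>" and cQ: "set (map ((\<otimes>) c') Q) \<subseteq> V"
    and b': "b' \<in> carrier S" "reval (map ((\<otimes>) c') Q) b' \<noteq> \<zero>\<^bsub>S\<^esub>"
    using primitive_multiple[OF poly(1)[OF Q(1)] nz[OF Q(1) Qn]] by auto
  define A where "A = map ((\<otimes>) c) ?I"
  define B where "B = map ((\<otimes>) c') Q"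
  have A: "set A \<subseteq> V" "reval A b \<noteq> \<zero>\<^bsub>S\<^esub>" "length A = length ?I" and B: "set B \<subseteq> V" "reval B b' \<noteq> \<zero>\<^bsub>S\<^esub>" "length B = length Q"
    using cI b cQ b' by (auto simp: A_def B_def)
  define u where "u = c \<otimes> c'"
  have u: "u \<in> K" "u \<noteq> \<zero>" using c c' mult_nonzero by (auto simp: u_def)
  have uc: "u \<in> carrier R" "c \<in> carrier R" "c' \<in> carrier R" using u c c' K_carrier by auto
  have eq: "u \<otimes> eval g z = eval A z \<otimes> eval B z" if z: "z \<in> carrier R" for z
  proof -
    have "eval g z = eval ?I z \<otimes> eval Q z"
      using Q(2) eval_poly_mult[OF Kc[OF poly(1)[OF I(1)]] Kc[OF poly(1)[OF Q(1)]] z] unfolding univ_poly_mult by simp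
    then show ?thesis
      unfolding A_def B_def u_def
      using eval_scale[OF uc(2) Kc[OF poly(1)[OF I(1)]] z] eval_scale[OF uc(3) Kc[OF poly(1)[OF Q(1)]] z]
        eval_in_carrier[OF Kc[OF poly(1)[OF I(1)]] z] eval_in_carrier[OF Kc[OF poly(1)[OF Q(1)]] z] uc by (simp add: m_ac)
  qed
  have AB: "pf (\<lambda>z. eval A z \<otimes> eval B z) (\<lambda>\<gamma>. reval A \<gamma> \<otimes>\<^bsub>S\<^esub> reval B \<gamma>)"
    by (intro pf_mult pf_self A B)
  have gc: "eval g z \<in> carrier R" if "z \<in> carrier R" for z by (rule eval_in_carrier[OF Kc[OF gK] that])
  have zero: "reval A a \<otimes>\<^bsub>S\<^esub> reval B a = \<zero>\<^bsub>S\<^esub>"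
  proof (cases "u \<in> V")
    case True
    have "\<rho> u \<otimes>\<^bsub>S\<^esub> reval g a = reval A a \<otimes>\<^bsub>S\<^esub> reval B a"
      by (rule pf_ext[OF pf_mult[OF pf_const[OF True] pf_self[OF g(1)]] AB eq a(1)])
    then show ?thesis using a(3) \<rho>_simps(1)[OF True] by simp
  next
    case False
    note i = K_inv[OF u]
    have iu: "inv u \<in> val_ge R K v 1" using False u i v_inv[OF u] by (auto simp: val_ge_def)
    then have iV: "inv u \<in> V" "\<rho> (inv u) = \<zero>\<^bsub>S\<^esub>" using ge_mono[OF iu] ker by auto
    have "reval g \<gamma> = \<zero>\<^bsub>S\<^esub>" if \<gamma>: "\<gamma> \<in> carrier S" for \<gamma>
    proof -
      have "reval g \<gamma> = \<rho> (inv u) \<otimes>\<^bsub>S\<^esub> (reval A \<gamma> \<otimes>\<^bsub>S\<^esub> reval B \<gamma>)"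
      proof (rule pf_ext[OF pf_self[OF g(1)] pf_mult[OF pf_const[OF iV(1)] AB] _ \<gamma>])
        fix z assume z: "z \<in> carrier R"
        show "eval g z = inv u \<otimes> (eval A z \<otimes> eval B z)"
          unfolding eq[OF z, symmetric] using i uc(1) K_carrier[of "inv u"] gc[OF z] by (simp flip: m_assoc)
      qed
      then show ?thesis using iV reval_closed[OF A(1) \<gamma>] reval_closed[OF B(1) \<gamma>] by simp
    qed
    then have "set g \<subseteq> val_ge R K v 1" by (rule reval_zero_imp[OF g(1)])
    then have "\<one> \<in> val_ge R K v 1" using g(2) gn hd_in_set[of g] by auto
    then show ?thesis by (simp add: val_ge_def)
  qed
  then have "reval A a = \<zero>\<^bsub>S\<^esub> \<or> reval B a = \<zero>\<^bsub>S\<^esub>"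
    using reval_closed[OF A(1) a(1)] reval_closed[OF B(1) a(1)] by (simp add: S.integral_iff)
  then have "length g \<le> length ?I \<or> length g \<le> length Q"
    using degree_bound[OF A(1) a(1,2) _ b(1) A(2)] degree_bound[OF B(1) a(1,2) _ b'(1) B(2)] A(3) B(3) g(3) by auto
  then show ?thesis using deg degI gn nzI Qn by (cases g; cases ?I; cases Q) auto
qed

text \<open>Over a finite residue field, the extension of degree \<open>f j\<close> has a nonzero primitive element.\<close>

lemma local_target_exists:
  assumes cl: "algebraically_closed S" and fin: "finite k"
    and ef: "\<And>j. j \<in> {1..s} \<Longrightarrow> 0 < e j \<and> 0 < f j"
  shows "\<exists>p \<alpha> \<phi>. local_target R S K v \<rho> p s \<alpha> \<phi> e f \<and> 
     (\<forall>j\<in>{1..s}. S.dimension (f j) k (S.simple_extension k (\<alpha> j)))"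
proof -
  interpret C: algebraically_closed S by (rule cl)
  obtain p where p: "p \<in> K" "p \<noteq> \<zero>" "v p = 1" using v_surj .
  have "\<exists>a T. a \<in> carrier S \<and> (S.algebraic over k) a \<and> a \<noteq> \<zero>\<^bsub>S\<^esub> \<and> T \<in> monics V (f j) \<and> map \<rho> T = S.Irr k a
      \<and> S.dimension (f j) k (S.simple_extension k a)"
    if j: "j \<in> {1..s}" for j
  proof -
    have "0 < f j" using ef j by simp
    note E = C.finite_field_extension[OF k_subfield fin this]
    obtain a where a: "a \<in> {x \<in> carrier S. x [^]\<^bsub>S\<^esub> (card k ^ f j) = x}" "a \<noteq> \<zero>\<^bsub>S\<^esub>"
      "S.simple_extension k a = {x \<in> carrier S. x [^]\<^bsub>S\<^esub> (card k ^ f j) = x}"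
      using S.finite_subfield_primitive_element[OF k_subfield E(1,3,2)] by blast
    have ac: "a \<in> carrier S" using a by simp
    have alg: "(S.algebraic over k) a"
      using S.simple_extension_is_subfield[OF k_subfield ac] E(1) a(3) by simp
    have dim: "S.dimension (f j) k (S.simple_extension k a)" using E(5) a(3) by simp
    note I = S.IrrE[OF k_subfield ac alg]
    have l: "length (S.Irr k a) = Suc (f j)" by (rule S.degree_Irr_dimension[OF k_subfield ac alg dim])
    then obtain t where t: "S.Irr k a = \<one>\<^bsub>S\<^esub> # t" "length t = f j" using I(3) by (cases "S.Irr k a") auto
    have "set t \<subseteq> k" using S.polynomial_incl I(1) t(1) unfolding univ_poly_carrier[symmetric] by fastforce
    then obtain T where T: "set T \<subseteq> V" "map \<rho> T = t" by (rule lift_list)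
    have "\<one> # T \<in> monics V (f j)" using T t(2) by (auto simp: monics_def)
    moreover have "map \<rho> (\<one> # T) = S.Irr k a" using T t(1) \<rho>_simps(4) by simp
    ultimately show ?thesis using ac alg a(2) dim by blast
  qed
  then have "\<forall>j\<in>{1..s}. \<exists>aT. fst aT \<in> carrier S \<and> (S.algebraic over k) (fst aT) \<and> fst aT \<noteq> \<zero>\<^bsub>S\<^esub> \<and> snd aT \<in> monics V (f j)
      \<and> map \<rho> (snd aT) = S.Irr k (fst aT) \<and> S.dimension (f j) k (S.simple_extension k (fst aT))"
    by (metis fst_conv snd_conv)
  from bchoice[OF this] obtain aT where aT: "\<forall>j\<in>{1..s}. fst (aT j) \<in> carrier S \<and> (S.algebraic over k) (fst (aT j)) \<and> fst (aT j) \<noteq> \<zero>\<^bsub>S\<^esub> \<and> snd (aT j) \<in> monics V (f j)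
      \<and> map \<rho> (snd (aT j)) = S.Irr k (fst (aT j)) \<and> S.dimension (f j) k (S.simple_extension k (fst (aT j)))" by blast
  have "local_target R S K v \<rho> p s (\<lambda>j. fst (aT j)) (\<lambda>j. snd (aT j)) e f"
    by (rule local_target.intro[OF residue_place_axioms], rule local_target_axioms.intro)
      (use p aT ef in auto)
  then show ?thesis using aT by blast
qed

end

context local_target
begin

definition target where
  "target = (SOME g. g \<in> monics V (\<Sum>j\<in>{1..s}. d j) \<and> (\<forall>z\<in>carrier R. eval g z = (\<Otimes>j\<in>{1..s}. factor j z)))"

lemma target: "target \<in> monics V (\<Sum>j\<in>{1..s}. d j)" "\<And>z. z \<in> carrier R \<Longrightarrow> eval target z = (\<Otimes>j\<in>{1..s}. factor j z)"
proof -
  have "\<exists>g. g \<in> monics V (\<Sum>j\<in>{1..s}. d j) \<and> (\<forall>z\<in>carrier R. eval g z = (\<Otimes>j\<in>{1..s}. factor j z))"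
    using target_exists by blast
  from someI_ex[OF this, folded target_def]
  show "target \<in> monics V (\<Sum>j\<in>{1..s}. d j)" "\<And>z. z \<in> carrier R \<Longrightarrow> eval target z = (\<Otimes>j\<in>{1..s}. factor j z)" by auto
qed

lemma approximation:
  assumes g: "set g \<subseteq> K" "length g = length target" and near: "\<And>l. l < length g \<Longrightarrow> g ! l \<ominus> target ! l \<in> val_ge R K v (int (N::nat))"
  shows "set g \<subseteq> V" "\<exists>D. set D \<subseteq> V \<and> (\<forall>z\<in>carrier R. eval g z = (\<Otimes>j\<in>{1..s}. factor j z) \<oplus> p [^] N \<otimes> eval D z)"
proof -
  have tV: "set target \<subseteq> V" using target(1) by (simp add: monics_def)
  have tc: "set target \<subseteq> carrier R" by (rule V_list_carrier[OF tV])
  have gc: "set g \<subseteq> carrier R" using g K_carrier by auto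
  show gV: "set g \<subseteq> V"
  proof
    fix x assume "x \<in> set g"
    then obtain l where l: "l < length g" "x = g ! l" by (metis in_set_conv_nth)
    have t: "target ! l \<in> V" using tV l g(2) by (metis nth_mem subsetD)
    have "g ! l \<in> carrier R" using gc l(1) nth_mem by blast
    then have "x = (g ! l \<ominus> target ! l) \<oplus> target ! l"
      unfolding l(2) using V_carrier[OF t] by algebra
    then show "x \<in> V" using ge_add[OF ge_mono[OF near[OF l(1)], of 0] t] by simp
  qed
  let ?c = "p [^] N"
  let ?D = "map2 (\<lambda>a b. inv ?c \<otimes> (a \<ominus> b)) g target"
  have i: "inv ?c \<in> val_ge R K v (- int N)"
    using K_inv[OF p_pow(3,4)] v_inv[OF p_pow(3,4)] v_pow[OF p(1,2), of N] p(3) by (simp add: val_ge_def)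
  have "set ?D \<subseteq> V"
  proof
    fix x assume "x \<in> set ?D"
    then obtain l where l: "l < length g" "x = inv ?c \<otimes> (g ! l \<ominus> target ! l)"
      using g(2) by (auto simp: set_zip)
    show "x \<in> V" using ge_mult[OF i near[OF l(1)]] l(2) by simp
  qed
  moreover have "eval g z = (\<Otimes>j\<in>{1..s}. factor j z) \<oplus> ?c \<otimes> eval ?D z" if "z \<in> carrier R" for z
    using eval_difference[OF g(2) gc tc p_pow(2,4) that] target(2)[OF that] by simp
  ultimately show "\<exists>D. set D \<subseteq> V \<and> (\<forall>z\<in>carrier R. eval g z = (\<Otimes>j\<in>{1..s}. factor j z) \<oplus> p [^] N \<otimes> eval D z)" by blast
qed

text \<open>At a place with a single unramified datum, the target reduces to the chosen irreducible
  polynomial.\<close>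

lemma inert_reduction:
  assumes "s = 1" "e 1 = 1" "set g \<subseteq> V" "set D \<subseteq> V" "0 < (N::nat)"
    and ap: "\<And>z. z \<in> carrier R \<Longrightarrow> eval g z = (\<Otimes>j\<in>{1..s}. factor j z) \<oplus> p [^] N \<otimes> eval D z"
  shows "reval g (\<alpha> 1) = \<zero>\<^bsub>S\<^esub>"
proof -
  have 1: "1 \<in> {1..s}" using assms(1) by simp
  obtain n where n: "N = Suc n" using assms(5) gr0_implies_Suc by blast
  have e: "eval g z = (eval (\<phi> 1) z \<oplus> p) \<oplus> p [^] N \<otimes> eval D z" if z: "z \<in> carrier R" for z
  proof -
    have "factor 1 z = eval (\<phi> 1) z \<oplus> p"
      unfolding factor_def using homog_one[OF V_list_carrier[OF h(3)[OF 1]] z] h(2)[OF 1 z] assms(2)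
        eval_in_carrier[OF V_list_carrier[OF \<phi>_V[OF 1]] z] by (simp add: nat_pow_eone)
    moreover have "(\<Otimes>j\<in>{1..s}. factor j z) = factor 1 z"
      using assms(1) factor_closed[OF 1 z] by simp
    ultimately show ?thesis using ap[OF z] by simp
  qed
  have "reval g (\<alpha> 1) = (reval (\<phi> 1) (\<alpha> 1) \<oplus>\<^bsub>S\<^esub> \<rho> p) \<oplus>\<^bsub>S\<^esub> \<rho> (p [^] N) \<otimes>\<^bsub>S\<^esub> reval D (\<alpha> 1)"
    by (rule pf_ext[OF pf_self[OF assms(3)] pf_add[OF pf_add[OF pf_self[OF \<phi>_V[OF 1]] pf_const[OF p_V(1)]]
          pf_mult[OF pf_const[OF p_pow(1)] pf_self[OF assms(4)]]] e \<alpha>(1)[OF 1]])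
  moreover have "reval (\<phi> 1) (\<alpha> 1) = \<zero>\<^bsub>S\<^esub>"
    unfolding reval_def \<phi>(2)[OF 1] by (rule S.IrrE(4)[OF k_subfield \<alpha>(1,2)[OF 1]])
  ultimately show ?thesis
    using p_V(2) p_pow(5)[of n] n reval_closed[OF assms(4) \<alpha>(1)[OF 1]] by simp
qed

end

text \<open>Since \<open>\<alpha>\<close> and \<open>\<alpha> ^ q\<close> generate the same finite field, \<open>\<alpha> ^ q\<close> has the degree of \<open>\<alpha>\<close>.
  A primitive multiple of the minimal polynomial of \<open>y ^ q\<close> reduces to a polynomial that
  vanishes at \<open>\<alpha> ^ q\<close>, so \<open>y ^ q\<close> has at least the degree of \<open>y\<close> and generates \<open>L\<close> too.\<close>

lemma (in simple_place_extension) frobenius_spans: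
  assumes fin: "finite k" and deg: "length (Irr K y) = length (S.Irr k \<alpha>)"
  shows "frobenius_spans R K L"
  unfolding frobenius_spans_def
proof (intro allI impI, elim conjE)
  fix q :: nat and T
  assume q: "Factorial_Ring.prime q" "add_pow R q \<one> = \<zero>" and T: "T \<subseteq> carrier R" "\<forall>x\<in>T. \<forall>y\<in>T. x \<oplus> y \<in> T"
    "\<forall>a\<in>K. \<forall>x\<in>T. a \<otimes> x \<in> T" "\<forall>x\<in>L. x [^] q \<in> T"
  have add_pow_V: "add_pow R n \<one> \<in> V \<and> \<rho> (add_pow R n \<one>) = add_pow S n \<one>\<^bsub>S\<^esub>" for n :: nat
    by (induction n) (auto simp: \<rho>_simps)
  have qS: "add_pow S q \<one>\<^bsub>S\<^esub> = \<zero>\<^bsub>S\<^esub>" using add_pow_V[of q] q(2) \<rho>_simps(5) by simp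
  have yq: "y [^] q \<in> carrier R" using y by simp
  have yqL: "y [^] q \<in> L" by (rule eval_pow_closed[OF y_L subfieldE(1)[OF L_subfield]])
  have KLq: "simple_extension K (y [^] q) \<subseteq> L"
    by (rule simple_extension_subring_incl[OF subfieldE(1)[OF L_subfield] K_L yqL])
  have alg: "(algebraic over K) (y [^] q)"
    using finite_dimension_imp_algebraic[OF K subfieldE(1)[OF L_subfield] _ yqL]
      finite_dimensionI[OF dimension_simple_extension[OF K y]] by blast
  have aq: "\<alpha> [^]\<^bsub>S\<^esub> q \<in> carrier S" using \<alpha> by simp
  have ks: "subring k S" by (rule subfieldE(1)[OF k_subfield])
  have sub: "subring (S.simple_extension k \<alpha>) S" by (rule S.simple_extension_is_subring[OF ks \<alpha>(1)])
  have "S.simple_extension k (\<alpha> [^]\<^bsub>S\<^esub> q) = S.simple_extension k \<alpha>"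
  proof
    show "S.simple_extension k (\<alpha> [^]\<^bsub>S\<^esub> q) \<subseteq> S.simple_extension k \<alpha>"
      by (rule S.simple_extension_subring_incl[OF sub S.simple_extension_incl[OF subringE(1)[OF ks] \<alpha>(1)]
            S.eval_pow_closed[OF S.simple_extension_mem[OF ks \<alpha>(1)] sub]])
    show "S.simple_extension k \<alpha> \<subseteq> S.simple_extension k (\<alpha> [^]\<^bsub>S\<^esub> q)"
      by (rule S.simple_extension_subring_incl[OF S.simple_extension_is_subring[OF ks aq]
            S.simple_extension_incl[OF subringE(1)[OF ks] aq] S.simple_extension_frobenius[OF k_subfield fin \<alpha> q(1) qS]])
  qed note se = this
  have algq: "(S.algebraic over k) (\<alpha> [^]\<^bsub>S\<^esub> q)"
    using S.simple_extension_is_subfield[OF k_subfield aq] S.simple_extension_is_subfield[OF k_subfield \<alpha>(1)] \<alpha>(2) se by simp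
  have dq: "length (S.Irr k (\<alpha> [^]\<^bsub>S\<^esub> q)) = length (S.Irr k \<alpha>)"
  proof -
    have "S.dimension (length (S.Irr k \<alpha>) - 1) k (S.simple_extension k (\<alpha> [^]\<^bsub>S\<^esub> q))"
      unfolding se by (rule S.dimension_simple_extension[OF k_subfield \<alpha>])
    from S.degree_Irr_dimension[OF k_subfield aq algq this]
      S.pirreducibleE(1)[OF ks S.IrrE(1,2)[OF k_subfield \<alpha>]]
    show ?thesis by (cases "S.Irr k \<alpha>") auto
  qed
  note I = IrrE[OF K yq alg]
  let ?I = "Irr K (y [^] q)"
  have nzI: "?I \<noteq> []" by (rule pirreducibleE(1)[OF subfieldE(1)[OF K] I(1,2)])
  have pI: "polynomial K ?I" using I(1) by (simp add: univ_poly_carrier)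
  have IK: "set ?I \<subseteq> K" by (rule polynomial_incl[OF pI])
  have "\<not> set ?I \<subseteq> {\<zero>}" using nzI pI by (cases ?I) (auto simp: polynomial_def)
  then obtain c b where c: "c \<in> K" "c \<noteq> \<zero>" and cI: "set (map ((\<otimes>) c) ?I) \<subseteq> V"
    and b: "b \<in> carrier S" "reval (map ((\<otimes>) c) ?I) b \<noteq> \<zero>\<^bsub>S\<^esub>"
    using primitive_multiple[OF IK] by auto
  let ?A = "map ((\<otimes>) c) ?I"
  obtain P where P: "set P \<subseteq> V" "\<forall>z\<in>carrier R. eval P z = eval ?A (z [^] q)" "\<forall>\<beta>\<in>carrier S. reval P \<beta> = reval ?A (\<beta> [^]\<^bsub>S\<^esub> q)"
    using pf_compose[OF cI pf_pow[OF pf_var]] unfolding pf_def by blast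
  have Ic: "set ?I \<subseteq> carrier R" using IK K_carrier by auto
  have "eval P y = \<zero>"
    using P(2) y(1) eval_scale[OF K_carrier[OF c(1)] Ic yq] I(4) K_carrier[OF c(1)] by simp
  then have "reval ?A (\<alpha> [^]\<^bsub>S\<^esub> q) = \<zero>\<^bsub>S\<^esub>" using kernel[OF P(1)] P(3) \<alpha>(1) by simp
  then have "length (S.Irr k \<alpha>) \<le> length ?I" using degree_bound[OF cI aq algq _ b] dq by simp
  then have "degree (Irr K y) \<le> degree ?I" using deg by simp
  then have L_eq: "simple_extension K (y [^] q) = L"
    using dimension_subset_eq(2)[OF K dimension_simple_extension[OF K yq alg] dimension_simple_extension[OF K y] KLq] by simp
  have zT: "\<zero> \<in> T"
  proof -
    have "\<zero> [^] q \<in> T" using T(4) subringE(2)[OF subfieldE(1)[OF L_subfield]] by blast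
    then show ?thesis using prime_gt_0_nat[OF q(1)] by (simp add: nat_pow_zero)
  qed
  have ev: "eval H (y [^] q) \<in> T" if "set H \<subseteq> K" for H
    using that
  proof (induction H)
    case (Cons a H)
    have "(y [^] length H) [^] q \<in> T"
      using T(4) eval_pow_closed[OF y_L subfieldE(1)[OF L_subfield]] by blast
    then have "(y [^] q) [^] length H \<in> T" using y by (simp add: nat_pow_pow mult.commute)
    then show ?case using Cons T by simp
  qed (use zT in simp)
  show "L \<subseteq> T"
  proof
    fix x assume "x \<in> L"
    then obtain H where "set H \<subseteq> K" "x = eval H (y [^] q)"
      using simple_extension_cases[OF subfieldE(3)[OF K] yq] L_eq by blast
    then show "x \<in> T" using ev by simp
  qed
qed

section \<open>Prescribed extensions when one place is inert\<close>

lemma (in algebraically_closed) exists_root: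
  assumes "p \<in> carrier (poly_ring L)" "1 < length p"
  shows "\<exists>x\<in>carrier L. eval p x = \<zero>"
proof -
  have "size (roots p) = degree p" using roots_over_carrier[OF assms(1)] by (simp add: splitted_def)
  then have "roots p \<noteq> {#}" using assms(2) by auto
  then obtain x where "x \<in># roots p" by blast
  then have "is_root p x" using roots_mem_iff_is_root[OF assms(1)] by simp
  then show ?thesis by (auto simp: is_root_def)
qed

text \<open>Algebraically closed fields with a finite subfield are infinite.\<close>

lemma place_residue:
  assumes "place R S K v \<rho>" "algebraically_closed S" "finite (\<rho> ` val_ge R K v 0)"
  shows "residue_place R S K v \<rho>"
proof -
  interpret place R S K v \<rho> by fact
  interpret C: algebraically_closed S by fact
  have "subring (val_ge R K v 0) R" by (rule ge_0_subring)
  then interpret h: ring_hom_ring "R\<lparr>carrier := val_ge R K v 0\<rparr>" S \<rho>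
    by (intro ring_hom_ringI2 subring_is_ring S.ring_axioms hom)
  have inf: "infinite (carrier S)"
  proof
    assume fin: "finite (carrier S)"
    then show False using C.infinite_if_finite_subfield[OF S.carrier_is_subfield] by simp
  qed
  show ?thesis by (rule residue_place.intro[OF \<open>place R S K v \<rho>\<close>], unfold_locales, rule inf)
qed

text \<open>Krull's existence theorem in the case where the prescribed data at one place are inert. The
  inert place makes the approximating polynomial irreducible and the extension separable; the
  extensions of each place are those of \<open>target_root\<close>.\<close>

theorem (in field) krull_realization:
  fixes v :: "'i \<Rightarrow> 'a \<Rightarrow> int" and S :: "'i \<Rightarrow> 'k ring" and e f :: "'i \<Rightarrow> nat \<Rightarrow> nat"
  assumes alg: "algebraically_closed R" and K: "subfield K R" and fin: "finite I"
    and pl: "\<And>i. i \<in> I \<Longrightarrow> place R (S i) K (v i) (\<rho> i)"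
    and closed: "\<And>i. i \<in> I \<Longrightarrow> algebraically_closed (S i)"
    and fink: "\<And>i. i \<in> I \<Longrightarrow> finite (\<rho> i ` val_ge R K (v i) 0)"
    and distinct: "inj_on (\<lambda>i. val_ge R K (v i) 0) I"
    and data: "\<And>i j. i \<in> I \<Longrightarrow> j \<in> {1..s i} \<Longrightarrow> 0 < e i j \<and> 0 < f i j"
    and sum: "\<And>i. i \<in> I \<Longrightarrow> (\<Sum>j\<in>{1..s i}. e i j * f i j) = m" and m: "0 < m"
    and inert: "i0 \<in> I" "s i0 = 1" "e i0 1 = 1" "f i0 1 = m"
  shows "\<exists>L w \<rho>'. subfield L R \<and> K \<subseteq> L \<and> dimension m K L \<and> frobenius_spans R K L \<and>
     (\<forall>i\<in>I. (\<forall>j\<in>{1..s i}. extends_place R (S i) K (v i) (\<rho> i) L (w i j) (\<rho>' i j) (e i j) \<and>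
        ring.dimension (S i) (f i j) (\<rho> i ` val_ge R K (v i) 0) (\<rho>' i j ` val_ge R L (w i j) 0)) \<and>
       inj_on (\<lambda>j. val_ge R L (w i j) 0) {1..s i} \<and>
       (\<forall>U. valuation_subring R L U \<and> U \<inter> K = val_ge R K (v i) 0 \<longrightarrow> (\<exists>j\<in>{1..s i}. U = val_ge R L (w i j) 0)))"
proof -
  interpret A: algebraically_closed R by (rule alg)
  have res: "residue_place R (S i) K (v i) (\<rho> i)" if "i \<in> I" for i
    by (rule place_residue[OF pl closed fink]) (use that in auto)
  define good where "good i x \<longleftrightarrow> local_target R (S i) K (v i) (\<rho> i) (fst x) (s i) (fst (snd x)) (snd (snd x)) (e i) (f i) \<and>
     (\<forall>j\<in>{1..s i}. ring.dimension (S i) (f i j) (\<rho> i ` val_ge R K (v i) 0)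
        (ring.simple_extension (S i) (\<rho> i ` val_ge R K (v i) 0) (fst (snd x) j)))" for i x
  have "\<forall>i\<in>I. \<exists>x. good i x"
  proof
    fix i assume i: "i \<in> I"
    have "\<exists>p \<alpha> \<phi>. local_target R (S i) K (v i) (\<rho> i) p (s i) \<alpha> \<phi> (e i) (f i) \<and>
      (\<forall>j\<in>{1..s i}. ring.dimension (S i) (f i j) (\<rho> i ` val_ge R K (v i) 0)
        (ring.simple_extension (S i) (\<rho> i ` val_ge R K (v i) 0) (\<alpha> j)))"
      by (rule residue_place.local_target_exists[OF res[OF i] closed[OF i] fink[OF i]]) (rule data[OF i])
    then obtain p \<alpha> \<phi> where "good i (p, \<alpha>, \<phi>)" unfolding good_def by auto
    then show "\<exists>x. good i x" by blast
  qed
  from bchoice[OF this] obtain x where x: "\<forall>i\<in>I. good i (x i)" by blast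
  define p where "p i = fst (x i)" for i
  define \<alpha> where "\<alpha> i = fst (snd (x i))" for i
  define \<phi> where "\<phi> i = snd (snd (x i))" for i
  have lt: "local_target R (S i) K (v i) (\<rho> i) (p i) (s i) (\<alpha> i) (\<phi> i) (e i) (f i)" if "i \<in> I" for i
    using x that by (auto simp: good_def p_def \<alpha>_def \<phi>_def)
  have dim: "ring.dimension (S i) (f i j) (\<rho> i ` val_ge R K (v i) 0)
        (ring.simple_extension (S i) (\<rho> i ` val_ge R K (v i) 0) (\<alpha> i j))" if "i \<in> I" "j \<in> {1..s i}" for i j
    using x that by (auto simp: good_def p_def \<alpha>_def \<phi>_def)
  define tg where "tg i = local_target.target R K (v i) (p i) (s i) (\<phi> i) (e i) (f i)" for i
  have tg: "tg i \<in> monics (val_ge R K (v i) 0) m" if "i \<in> I" for i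
    using local_target.target(1)[OF lt[OF that]] sum[OF that] by (simp add: tg_def)
  (* one precision that is sufficient at all places *)
  define N where "N = (\<Sum>i\<in>I. \<Sum>j\<in>{1..s i}. (j - 1) * (e i j * f i j)) + 2"
  have N: "(\<Sum>j\<in>{1..s i}. (j - 1) * (e i j * f i j)) + 2 \<le> N" if "i \<in> I" for i
    unfolding N_def using member_le_sum[OF that, of "\<lambda>i. \<Sum>j\<in>{1..s i}. (j - 1) * (e i j * f i j)"] fin by simp
  have V: "valuation_on R K (v i)" if "i \<in> I" for i
  proof -
    interpret place R "S i" K "v i" "\<rho> i" by (rule pl[OF that])
    show ?thesis by (rule v)
  qed
  have "\<forall>l\<in>{..m}. \<exists>a\<in>K. \<forall>i\<in>I. a \<ominus> tg i ! l \<in> val_ge R K (v i) (int N)"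
  proof
    fix l assume l: "l \<in> {..m}"
    show "\<exists>a\<in>K. \<forall>i\<in>I. a \<ominus> tg i ! l \<in> val_ge R K (v i) (int N)"
    proof (rule weak_approximation[OF K fin V distinct])
      fix i assume "i \<in> I"
      from tg[OF this] have "set (tg i) \<subseteq> val_ge R K (v i) 0" "l < length (tg i)"
        using l by (auto simp: monics_def)
      then show "tg i ! l \<in> K" using nth_mem by (auto simp: val_ge_def)
    qed
  qed
  then have "\<forall>l\<in>{..m}. \<exists>a. a \<in> K \<and> (\<forall>i\<in>I. a \<ominus> tg i ! l \<in> val_ge R K (v i) (int N))" by blast
  from bchoice[OF this] obtain a where a: "\<forall>l\<in>{..m}. a l \<in> K \<and> (\<forall>i\<in>I. a l \<ominus> tg i ! l \<in> val_ge R K (v i) (int N))" by blast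
  (* only the coefficients after the leading one are approximated *)
  define g where "g = \<one> # map a [1..<Suc m]"
  have one_K: "\<one> \<in> K" using subringE(3)[OF subfieldE(1)[OF K]] .
  have gK: "set g \<subseteq> K" using a one_K by (auto simp: g_def)
  have gl: "length g = Suc m" "hd g = \<one>" "g \<noteq> []" by (auto simp: g_def)
  have near: "g ! l \<ominus> tg i ! l \<in> val_ge R K (v i) (int N)" if "i \<in> I" "l < length g" for i l
  proof (cases l)
    case 0
    have "tg i ! 0 = \<one>" using tg[OF that(1)] by (cases "tg i") (auto simp: monics_def)
    then have "g ! l \<ominus> tg i ! l = \<zero>" using 0 by (simp add: g_def r_neg a_minus_def)
    then show ?thesis using subringE(2)[OF subfieldE(1)[OF K]] by (simp add: val_ge_def)
  next
    case (Suc l')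
    then have "g ! l = a l" using that(2) gl by (simp add: g_def nth_map_upt del: upt_Suc)
    then show ?thesis using a that Suc gl by auto
  qed
  have gX: "g \<in> carrier (poly_ring R)"
    using gK gl subfieldE(3)[OF K] by (auto simp: univ_poly_carrier[symmetric] polynomial_def)
  obtain \<theta> where \<theta>: "\<theta> \<in> carrier R" "eval g \<theta> = \<zero>"
    using A.exists_root[OF gX] gl m by auto
  have \<theta>_alg: "(algebraic over K) \<theta>"
    by (rule algebraicI[OF _ gl(3) \<theta>(2)]) (use gK gl in \<open>auto simp: univ_poly_carrier[symmetric] polynomial_def\<close>)
  have appr: "set g \<subseteq> val_ge R K (v i) 0 \<and> (\<exists>D. set D \<subseteq> val_ge R K (v i) 0 \<and>
      (\<forall>z\<in>carrier R. eval g z = (\<Otimes>j\<in>{1..s i}. local_target.factor R K (v i) (p i) (\<phi> i) (e i) (f i) j z) \<oplus> p i [^] N \<otimes> eval D z))"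
    if i: "i \<in> I" for i
    using local_target.approximation[OF lt[OF i] gK, folded tg_def, of N] near[OF i] tg[OF i] gl
    by (auto simp: monics_def)
  from appr have "\<forall>i\<in>I. \<exists>D. set D \<subseteq> val_ge R K (v i) 0 \<and>
      (\<forall>z\<in>carrier R. eval g z = (\<Otimes>j\<in>{1..s i}. local_target.factor R K (v i) (p i) (\<phi> i) (e i) (f i) j z) \<oplus> p i [^] N \<otimes> eval D z)" by blast
  from bchoice[OF this] obtain D where D: "\<And>i. i \<in> I \<Longrightarrow> set (D i) \<subseteq> val_ge R K (v i) 0"
    "\<And>i z. i \<in> I \<Longrightarrow> z \<in> carrier R \<Longrightarrow> eval g z = (\<Otimes>j\<in>{1..s i}. local_target.factor R K (v i) (p i) (\<phi> i) (e i) (f i) j z) \<oplus> p i [^] N \<otimes> eval (D i) z" by blast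
  have N0: "0 < N" by (simp add: N_def)
  let ?k = "\<lambda>i. \<rho> i ` val_ge R K (v i) 0"
  (* the inert place shows that the polynomial g is irreducible over K *)
  have Irr0: "length (ring.Irr (S i0) (?k i0) (\<alpha> i0 1)) = Suc m" and Irr_len: "length (Irr K \<theta>) = Suc m"
  proof -
    interpret T: local_target R "S i0" K "v i0" "\<rho> i0" "p i0" "s i0" "\<alpha> i0" "\<phi> i0" "e i0" "f i0" by (rule lt[OF inert(1)])
    have 1: "1 \<in> {1..s i0}" using inert(2) by simp
    show l: "length (T.S.Irr (?k i0) (\<alpha> i0 1)) = Suc m"
      by (rule T.S.degree_Irr_dimension[OF T.k_subfield T.\<alpha>(1,2)[OF 1]]) (use dim[OF inert(1) 1] inert(4) in simp)
    have "T.reval g (\<alpha> i0 1) = \<zero>\<^bsub>S i0\<^esub>"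
      by (rule T.inert_reduction[OF inert(2,3) _ D(1)[OF inert(1)] N0 D(2)[OF inert(1)]]) (use appr[OF inert(1)] in auto)
    then show "length (Irr K \<theta>) = Suc m"
      using T.irreducible_lift[of g, OF _ gl(2) _ T.\<alpha>(1,2)[OF 1] _ \<theta> \<theta>_alg] appr[OF inert(1)] gl l by auto
  qed
  define L where "L = simple_extension K \<theta>"
  have Ldim: "dimension m K L"
    using dimension_simple_extension[OF K \<theta>(1) \<theta>_alg] Irr_len by (simp add: L_def)
  have Lsub: "subfield L R" unfolding L_def using simple_extension_is_subfield[OF K \<theta>(1)] \<theta>_alg by simp
  have KL: "K \<subseteq> L" unfolding L_def by (rule simple_extension_incl[OF subfieldE(3)[OF K] \<theta>(1)])
  have tr: "target_root R (S i) K (v i) (\<rho> i) (p i) (s i) (\<alpha> i) (\<phi> i) (e i) (f i) g (D i) \<theta> N" if i: "i \<in> I" for i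
  proof (rule target_root.intro[OF lt[OF i]], rule target_root_axioms.intro)
    show "\<exists>H. set H \<subseteq> K \<and> (\<forall>z\<in>carrier R. eval P z = eval g z \<otimes> eval H z)" if "set P \<subseteq> K" "eval P \<theta> = \<zero>" for P
      by (rule monic_divides[OF K \<theta>(1) \<theta>_alg gK gl(2) _ \<theta>(2) that]) (use gl Irr_len in simp)
  qed (use N[OF i] appr[OF i] gl D[OF i] \<theta> \<theta>_alg in auto)
  define yy where "yy i j = target_root.y R (p i) \<theta> j" for i j
  have ext: "\<exists>u r. simple_place_extension R (S i) K (v i) (\<rho> i) (p i) (yy i j) (\<alpha> i j) (\<phi> i j) (e i j) u r"
    if "i \<in> I" "j \<in> {1..s i}" for i j
    using target_root.extension[OF tr[OF that(1)] that(2)] by (simp add: yy_def)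
  have yL: "simple_extension K (yy i j) = L" if "i \<in> I" for i j
    using target_root.simple_extension_y[OF tr[OF that]] by (simp add: yy_def L_def)
  have frob: "frobenius_spans R K L"
  proof -
    have 1: "1 \<in> {1..s i0}" using inert(2) by simp
    obtain u r where "simple_place_extension R (S i0) K (v i0) (\<rho> i0) (p i0) (yy i0 1) (\<alpha> i0 1) (\<phi> i0 1) (e i0 1) u r"
      using ext[OF inert(1) 1] by blast
    then interpret E: simple_place_extension R "S i0" K "v i0" "\<rho> i0" "p i0" "yy i0 1" "\<alpha> i0 1" "\<phi> i0 1" "e i0 1" u r .
    have "dimension m K (simple_extension K (yy i0 1))" using Ldim yL[OF inert(1)] by simp
    then have "length (Irr K (yy i0 1)) = Suc m" by (rule degree_Irr_dimension[OF K E.y])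
    then show ?thesis using E.frobenius_spans[OF fink[OF inert(1)]] Irr0 yL[OF inert(1)] by simp
  qed
  define place_at where "place_at i j wr \<longleftrightarrow>
      extends_place R (S i) K (v i) (\<rho> i) L (fst wr) (snd wr) (e i j) \<and>
      ring.dimension (S i) (f i j) (?k i) (snd wr ` val_ge R L (fst wr) 0) \<and>
      yy i j \<in> val_ge R L (fst wr) 0 \<and> snd wr (yy i j) = \<alpha> i j \<and>
      (\<forall>U. valuation_subring R L U \<and> U \<inter> K = val_ge R K (v i) 0 \<and> yy i j \<in> U \<and> \<not> valuation_subring.unit R U (eval (\<phi> i j) (yy i j))
         \<longrightarrow> U = val_ge R L (fst wr) 0)" for i j wr
  have "\<exists>wr. place_at i j wr" if i: "i \<in> I" and j: "j \<in> {1..s i}" for i j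
  proof -
    obtain u r where "simple_place_extension R (S i) K (v i) (\<rho> i) (p i) (yy i j) (\<alpha> i j) (\<phi> i j) (e i j) u r"
      using ext[OF i j] by blast
    then interpret E: simple_place_extension R "S i" K "v i" "\<rho> i" "p i" "yy i j" "\<alpha> i j" "\<phi> i j" "e i j" u r .
    have "place_at i j (E.w, E.\<rho>')"
      unfolding place_at_def fst_conv snd_conv yL[OF i, of j, symmetric]
    proof (intro conjI allI impI)
      show "extends_place R (S i) K (v i) (\<rho> i) E.L E.w E.\<rho>' (e i j)"
        unfolding extends_place_def using E.loc.place_res E.w_K E.\<rho>'_V by blast
      show "E.S.dimension (f i j) (?k i) (E.\<rho>' ` val_ge R E.L E.w 0)"
        using dim[OF i j] E.\<rho>'_image by simp
      show "yy i j \<in> val_ge R E.L E.w 0" "E.\<rho>' (yy i j) = \<alpha> i j" by (rule E.y_ge, rule E.\<rho>'_y)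
      fix U assume U: "valuation_subring R E.L U \<and> U \<inter> K = val_ge R K (v i) 0 \<and> yy i j \<in> U \<and> \<not> valuation_subring.unit R U E.t"
      then interpret U: valuation_subring R E.L U by blast
      have "v i (inv (p i)) = -1" "inv (p i) \<in> K" "inv (p i) \<noteq> \<zero>"
        using E.v_inv[OF E.p(1,2)] E.p(3) E.K_inv[OF E.p(1,2)] by auto
      then have pU: "inv (p i) \<notin> U" using U by (auto simp: val_ge_def)
      show "U = val_ge R E.L E.w 0"
      proof (rule E.valuation_ring_unique[OF U.U U.UL _ U.total])
        show "U \<noteq> E.L" using pU \<open>inv (p i) \<in> K\<close> E.K_L by auto
        have "E.t \<in> U" using U.U eval_in_subring[OF U.U _, of "\<phi> i j" "yy i j"] E.\<phi>(1) U by auto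
        then show "inv E.t \<notin> U" using U E.loc.t(3) by (auto simp: U.unit_def)
      qed (use U pU in auto)
    qed
    then show ?thesis by blast
  qed
  then have "\<forall>ij\<in>Sigma I (\<lambda>i. {1..s i}). \<exists>wr. place_at (fst ij) (snd ij) wr" by auto
  from bchoice[OF this] obtain wr where wr: "\<forall>ij\<in>Sigma I (\<lambda>i. {1..s i}). place_at (fst ij) (snd ij) (wr ij)" by blast
  define w where "w i j = fst (wr (i, j))" for i j
  define \<rho>' where "\<rho>' i j = snd (wr (i, j))" for i j
  have P: "place_at i j (w i j, \<rho>' i j)" if "i \<in> I" "j \<in> {1..s i}" for i j
    using wr that by (auto simp: w_def \<rho>'_def)
  show ?thesis
  proof (rule exI[of _ L], rule exI[of _ w], rule exI[of _ \<rho>'], intro conjI ballI)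
    fix i assume i: "i \<in> I"
    show "extends_place R (S i) K (v i) (\<rho> i) L (w i j) (\<rho>' i j) (e i j)"
      "ring.dimension (S i) (f i j) (?k i) (\<rho>' i j ` val_ge R L (w i j) 0)" if j: "j \<in> {1..s i}" for j
      using P[OF i j] by (auto simp: place_at_def)
    interpret T: target_root R "S i" K "v i" "\<rho> i" "p i" "s i" "\<alpha> i" "\<phi> i" "e i" "f i" g "D i" \<theta> N by (rule tr[OF i])
    (* the value of \<theta>, relative to the ramification index, recovers j *)
    have val: "w i j \<theta> = int (e i j) * int (j - 1)" "\<theta> \<noteq> \<zero>" "yy i j \<in> L" "yy i j \<noteq> \<zero>" "w i j (yy i j) = 0"
      if j: "j \<in> {1..s i}" for j
    proof -
      have X: "place R (S i) L (w i j) (\<rho>' i j)" "\<And>x. x \<in> K \<Longrightarrow> x \<noteq> \<zero> \<Longrightarrow> w i j x = int (e i j) * v i x"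
        "yy i j \<in> val_ge R L (w i j) 0" "\<rho>' i j (yy i j) = \<alpha> i j"
        using P[OF i j] by (auto simp: place_at_def extends_place_def)
      interpret W: place R "S i" L "w i j" "\<rho>' i j" by (rule X(1))
      have "\<rho>' i j (yy i j) \<noteq> \<zero>\<^bsub>S i\<^esub>" using X(4) T.\<alpha>(3)[OF j] by simp
      then have "yy i j \<notin> val_ge R L (w i j) 1" using W.ker[OF X(3)] by simp
      then show y: "yy i j \<in> L" "yy i j \<noteq> \<zero>" "w i j (yy i j) = 0" using X(3) by (auto simp: val_ge_def)
      have pw: "p i [^] (j - 1) \<in> L" "p i [^] (j - 1) \<noteq> \<zero>" using T.p_pow KL by auto
      have t: "\<theta> = p i [^] (j - 1) \<otimes> yy i j" using T.\<theta>_y by (simp add: yy_def)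
      show "\<theta> \<noteq> \<zero>" using W.mult_nonzero[OF pw y(1,2)] t by simp
      have "w i j \<theta> = w i j (p i [^] (j - 1)) + 0" using W.v_mult[OF pw y(1,2)] t y(3) by simp
      also have "w i j (p i [^] (j - 1)) = int (e i j) * v i (p i [^] (j - 1))" by (rule X(2)) (use T.p_pow in auto)
      also have "v i (p i [^] (j - 1)) = int (j - 1)" using T.v_pow[OF T.p(1,2)] T.p(3) by simp
      finally show "w i j \<theta> = int (e i j) * int (j - 1)" by simp
    qed
    show "inj_on (\<lambda>j. val_ge R L (w i j) 0) {1..s i}"
    proof (rule inj_onI)
      fix j j' assume j: "j \<in> {1..s i}" and j': "j' \<in> {1..s i}" and eq: "val_ge R L (w i j) 0 = val_ge R L (w i j') 0"
      have X': "place R (S i) L (w i j') (\<rho>' i j')" "\<And>x. x \<in> K \<Longrightarrow> x \<noteq> \<zero> \<Longrightarrow> w i j' x = int (e i j') * v i x"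
        using P[OF i j'] by (auto simp: place_at_def extends_place_def)
      have X: "place R (S i) L (w i j) (\<rho>' i j)" using P[OF i j] by (auto simp: place_at_def extends_place_def)
      interpret W: place R "S i" L "w i j" "\<rho>' i j" by (rule X)
      interpret W': place R "S i" L "w i j'" "\<rho>' i j'" by (rule X'(1))
      note y = val(3-5)[OF j]
      have "yy i j \<in> val_ge R L (w i j') 0" "inv (yy i j) \<in> val_ge R L (w i j') 0"
        unfolding eq[symmetric] using y W.K_inv[OF y(1,2)] W.v_inv[OF y(1,2)] by (auto simp: val_ge_def)
      then have w0: "w i j' (yy i j) = 0"
        using y W'.K_inv[OF y(1,2)] W'.v_inv[OF y(1,2)] by (auto simp: val_ge_def)
      have pw: "p i [^] (j - 1) \<in> L" "p i [^] (j - 1) \<noteq> \<zero>" using T.p_pow KL by auto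
      have t: "\<theta> = p i [^] (j - 1) \<otimes> yy i j" using T.\<theta>_y by (simp add: yy_def)
      have "w i j' \<theta> = w i j' (p i [^] (j - 1)) + 0" using W'.v_mult[OF pw y(1,2)] t w0 by simp
      also have "w i j' (p i [^] (j - 1)) = int (e i j') * v i (p i [^] (j - 1))" by (rule X'(2)) (use T.p_pow in auto)
      also have "v i (p i [^] (j - 1)) = int (j - 1)" using T.v_pow[OF T.p(1,2)] T.p(3) by simp
      finally have "int (e i j') * int (j - 1) = int (e i j') * int (j' - 1)" using val(1)[OF j'] by linarith
      then have "j - 1 = j' - 1" using data[OF i j'] by simp
      then show "j = j'" using j j' by auto
    qed
    show "\<forall>U. valuation_subring R L U \<and> U \<inter> K = val_ge R K (v i) 0 \<longrightarrow> (\<exists>j\<in>{1..s i}. U = val_ge R L (w i j) 0)"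
    proof (intro allI impI)
      fix U assume U: "valuation_subring R L U \<and> U \<inter> K = val_ge R K (v i) 0"
      then obtain j where j: "j \<in> {1..s i}" "yy i j \<in> U" "\<not> valuation_subring.unit R U (eval (\<phi> i j) (yy i j))"
        using T.valuation_ring_hits_root[of U] unfolding yy_def L_def by blast
      then have "U = val_ge R L (w i j) 0" using P[OF i j(1)] U by (simp add: place_at_def)
      then show "\<exists>j\<in>{1..s i}. U = val_ge R L (w i j) 0" using j(1) by blast
    qed
  qed (use Lsub KL Ldim frob in auto)
qed

section \<open>Separability\<close>

text \<open>Dimension is defined by adjoining vectors from the carrier of the ambient ring; the vectors
  needed lie in the space itself.\<close>

lemma (in ring) dimension_restrict:
  assumes L: "subring L R" and K: "subfield K R" "K \<subseteq> L" and d: "dimension n K E" and E: "E \<subseteq> L"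
  shows "ring.dimension (R\<lparr>carrier := L\<rparr>) n K E"
  using d E
proof (induction n arbitrary: E)
  case 0
  interpret L: ring "R\<lparr>carrier := L\<rparr>" by (rule subring_is_ring[OF L])
  have "E = {\<zero>}" by (rule dimension_zero[OF K(1) 0(1)])
  then show ?case using L.zero_dim[of K] by simp
next
  case (Suc n)
  interpret L: ring "R\<lparr>carrier := L\<rparr>" by (rule subring_is_ring[OF L])
  obtain v E' where v: "v \<in> carrier R" "v \<notin> E'" and E': "dimension n K E'" and E: "E = line_extension K v E'"
    using dimension_backwards[OF K(1) Suc.prems(1)] by blast
  note sub = space_subgroup_props[OF K(1) E']
  note sK = subringE[OF subfieldE(1)[OF K(1)]]
  have "v \<in> E" unfolding E line_extension_mem_iff
    using sK(3) sub(2) v(1) by (intro bexI[of _ \<one>] bexI[of _ \<zero>]) auto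
  moreover have "E' \<subseteq> E"
  proof
    fix x assume "x \<in> E'"
    then show "x \<in> E" unfolding E line_extension_mem_iff
      using sK(2) sub(1) v(1) by (intro bexI[of _ \<zero>] bexI[of _ x]) auto
  qed
  ultimately have "v \<in> L" "L.dimension n K E'" using Suc.IH[OF E'] Suc.prems(2) by auto
  then show ?case
    unfolding E using L.Suc_dim[of v E' n K] v(2) line_extension_consistent[OF L] by simp
qed

lemma (in ring) dimension_extend:
  assumes L: "subring L R" and d: "ring.dimension (R\<lparr>carrier := L\<rparr>) n K E"
  shows "dimension n K E"
proof -
  interpret L: ring "R\<lparr>carrier := L\<rparr>" by (rule subring_is_ring[OF L])
  from d show ?thesis
  proof (induction rule: L.dimension.induct)
    case (zero_dim K)
    then show ?case by simp
  next
    case (Suc_dim v E n K)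
    then show ?case
      using dimension.Suc_dim[of v E n K] line_extension_consistent[OF L] subringE(1)[OF L] by auto
  qed
qed

lemma extends_place_trans:
  assumes "extends_place R S K v \<rho> L w \<rho>' e" "extends_place R S L w \<rho>' M x \<rho>'' e'" "K \<subseteq> L"
  shows "extends_place R S K v \<rho> M x \<rho>'' (e * e')"
proof -
  have "z \<in> val_ge R L w 0" if "z \<in> val_ge R K v 0" for z
    using that assms(1,3) unfolding extends_place_def val_ge_def by auto
  then show ?thesis using assms unfolding extends_place_def by (auto simp: subset_iff)
qed

lemma extends_place_restrict:
  assumes "extends_place R S K v \<rho> L w \<rho>' e" "K \<subseteq> L" "0 < e"
  shows "val_ge R L w 0 \<inter> K = val_ge R K v 0"
  using assms unfolding extends_place_def val_ge_def by (auto simp: zero_le_mult_iff)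

lemma frobenius_spansD:
  assumes "frobenius_spans R K L" "Factorial_Ring.prime (q::nat)" "add_pow R q \<one>\<^bsub>R\<^esub> = \<zero>\<^bsub>R\<^esub>" "T \<subseteq> carrier R"
    "\<And>x y. x \<in> T \<Longrightarrow> y \<in> T \<Longrightarrow> x \<oplus>\<^bsub>R\<^esub> y \<in> T" "\<And>a x. a \<in> K \<Longrightarrow> x \<in> T \<Longrightarrow> a \<otimes>\<^bsub>R\<^esub> x \<in> T"
    "\<And>x. x \<in> L \<Longrightarrow> x [^]\<^bsub>R\<^esub> q \<in> T"
  shows "L \<subseteq> T"
proof -
  have "\<forall>x\<in>T. \<forall>y\<in>T. x \<oplus>\<^bsub>R\<^esub> y \<in> T" "\<forall>a\<in>K. \<forall>x\<in>T. a \<otimes>\<^bsub>R\<^esub> x \<in> T" "\<forall>x\<in>L. x [^]\<^bsub>R\<^esub> q \<in> T"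
    using assms(5-7) by simp_all
  with assms(2-4) show ?thesis
    using assms(1)[unfolded frobenius_spans_def, rule_format, of q T] by simp
qed

text \<open>If \<open>M\<close> is spanned by \<open>q\<close>-th powers over \<open>L\<close> and \<open>L\<close> by those over \<open>K\<close>, expand
  the coefficients; products of \<open>q\<close>-th powers are \<open>q\<close>-th powers.\<close>

lemma (in field) frobenius_spans_trans:
  assumes KL: "frobenius_spans R K L" "frobenius_spans R L M"
    and L: "subfield L R" and M: "subfield M R" and sub: "K \<subseteq> L" "L \<subseteq> M"
  shows "frobenius_spans R K M"
  unfolding frobenius_spans_def
proof (intro allI impI, elim conjE)
  fix q :: nat and T
  assume q: "Factorial_Ring.prime q" "add_pow R q \<one> = \<zero>" and T: "T \<subseteq> carrier R" "\<forall>x\<in>T. \<forall>y\<in>T. x \<oplus> y \<in> T"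
    "\<forall>a\<in>K. \<forall>x\<in>T. a \<otimes> x \<in> T" "\<forall>x\<in>M. x [^] q \<in> T"
  note sM = subringE[OF subfieldE(1)[OF M]]
  note sL = subringE[OF subfieldE(1)[OF L]]
  have Mc: "x \<in> carrier R" if "x \<in> M" for x using that sM(1) by auto
  have step: "a \<otimes> u [^] q \<in> T" if u: "u \<in> M" and a: "a \<in> L" for u a
  proof -
    let ?T = "{a \<in> M. a \<otimes> u [^] q \<in> T}"
    have uq: "u [^] q \<in> carrier R" using Mc[OF u] by simp
    have "L \<subseteq> ?T"
    proof (rule frobenius_spansD[OF KL(1) q])
      show "?T \<subseteq> carrier R" using Mc by auto
      fix x y assume x: "x \<in> ?T" and y: "y \<in> ?T"
      have "(x \<oplus> y) \<otimes> u [^] q = x \<otimes> u [^] q \<oplus> y \<otimes> u [^] q" using x y Mc uq by (simp add: l_distr)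
      then show "x \<oplus> y \<in> ?T" using x y T(2) sM by simp
    next
      fix a x assume a: "a \<in> K" and x: "x \<in> ?T"
      then have aM: "a \<in> M" using sub by auto
      have "(a \<otimes> x) \<otimes> u [^] q = a \<otimes> (x \<otimes> u [^] q)" using aM x Mc uq by (simp add: m_assoc)
      then show "a \<otimes> x \<in> ?T" using a aM x T(3) sM by simp
    next
      fix x assume x: "x \<in> L"
      then have xM: "x \<in> M" using sub by auto
      have "(x \<otimes> u) [^] q \<in> T" using T(4) sM(6)[OF xM u] by blast
      then show "x [^] q \<in> ?T"
        using eval_pow_closed[OF xM subfieldE(1)[OF M]] nat_pow_distrib[OF Mc[OF xM] Mc[OF u]] by simp
    qed
    then show ?thesis using a by auto
  qed
  let ?T = "{z \<in> carrier R. \<forall>a\<in>L. a \<otimes> z \<in> T}"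
  have "M \<subseteq> ?T"
  proof (rule frobenius_spansD[OF KL(2) q])
    show "?T \<subseteq> carrier R" by auto
    fix x y assume x: "x \<in> ?T" and y: "y \<in> ?T"
    have "a \<otimes> (x \<oplus> y) \<in> T" if "a \<in> L" for a
    proof -
      have "a \<otimes> (x \<oplus> y) = a \<otimes> x \<oplus> a \<otimes> y" using x y sL(1) that by (auto intro!: r_distr)
      then show ?thesis using x y that T(2) by simp
    qed
    then show "x \<oplus> y \<in> ?T" using x y by simp
  next
    fix a x assume a: "a \<in> L" and x: "x \<in> ?T"
    have ac: "a \<in> carrier R" using a sL(1) by auto
    have "b \<otimes> (a \<otimes> x) \<in> T" if b: "b \<in> L" for b
    proof -
      have "b \<otimes> (a \<otimes> x) = (b \<otimes> a) \<otimes> x" using x b sL(1) ac by (auto simp: m_assoc)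
      then show ?thesis using x sL(6)[OF b a] by simp
    qed
    then show "a \<otimes> x \<in> ?T" using ac x by simp
  next
    fix x assume x: "x \<in> M"
    then show "x [^] q \<in> ?T" using step Mc by simp
  qed
  moreover have "z = \<one> \<otimes> z" if "z \<in> carrier R" for z using that by simp
  ultimately show "M \<subseteq> T" using sL(3)
  proof -
    assume MT: "M \<subseteq> ?T" and one: "\<And>z. z \<in> carrier R \<Longrightarrow> z = \<one> \<otimes> z" "\<one> \<in> L"
    show ?thesis
    proof
      fix z assume "z \<in> M"
      then have "z \<in> ?T" using MT by (rule rev_subsetD)
      then have "z \<in> carrier R" "\<one> \<otimes> z \<in> T" using one(2) by auto
      then show "z \<in> T" by simp
    qed
  qed
qed

fun (in ring) derivative :: "'a list \<Rightarrow> 'a list" where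
  "derivative [] = []"
| "derivative (a # p) = (if p = [] then [] else add_pow R (length p) a # derivative p)"

lemma (in ring) derivative_length: "length (derivative p) = length p - 1"
  by (induction p) auto

lemma (in ring) derivative_in_subring:
  assumes "subring H R" "set p \<subseteq> H" shows "set (derivative p) \<subseteq> H"
proof -
  have "add_pow R (n::nat) a \<in> H" if "a \<in> H" for a n
    by (induction n) (use that subringE[OF assms(1)] in auto)
  then show ?thesis using assms(2) by (induction p) auto
qed

lemma (in ring) eval_derivative:
  "set p \<subseteq> carrier R \<Longrightarrow> x \<in> carrier R \<Longrightarrow> eval (derivative p) x = deriv_eval p x"
  by (induction p) (auto simp: derivative_length add_pow_ldistr)

lemma (in ring) derivative_zero:
  assumes "set p \<subseteq> carrier R" "set (derivative p) \<subseteq> {\<zero>}" "i < length p"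
  shows "add_pow R i (p ! (length p - 1 - i)) = \<zero>"
  using assms
proof (induction p)
  case (Cons a p)
  show ?case
  proof (cases "i = length p")
    case True
    then show ?thesis using Cons.prems by (auto split: if_splits)
  next
    case False
    then have i: "i < length p" using Cons.prems by simp
    then have "set (derivative p) \<subseteq> {\<zero>}" using Cons.prems by (auto split: if_splits)
    then have "add_pow R i (p ! (length p - 1 - i)) = \<zero>" using Cons i by auto
    moreover have "(a # p) ! (length (a # p) - 1 - i) = p ! (length p - 1 - i)"
      using i by (simp add: nth_Cons')
    ultimately show ?thesis by simp
  qed
qed simp

text \<open>If only exponents divisible by \<open>q\<close> occur in \<open>p\<close>, then \<open>p(z) = r(z ^ q)\<close>.\<close>

lemma (in cring) polynomial_in_power:
  assumes "set p \<subseteq> H" "\<zero> \<in> H" "H \<subseteq> carrier R" "0 < (q::nat)"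
    and "\<And>i. i < length p \<Longrightarrow> p ! (length p - 1 - i) \<noteq> \<zero> \<Longrightarrow> q dvd i"
  shows "\<exists>r. set r \<subseteq> H \<and> length r \<le> (length p + (q - 1)) div q \<and> (p \<noteq> [] \<longrightarrow> hd p \<noteq> \<zero> \<longrightarrow> r \<noteq> [] \<and> hd r = hd p) \<and>
     (\<forall>z\<in>carrier R. eval r (z [^] q) = eval p z)"
  using assms(1,5)
proof (induction p)
  case (Cons a p)
  have "q dvd i" if "i < length p" "p ! (length p - 1 - i) \<noteq> \<zero>" for i
    using Cons.prems(2)[of i] that by (simp add: nth_Cons')
  then obtain r where r: "set r \<subseteq> H" "length r \<le> (length p + (q - 1)) div q" "\<forall>z\<in>carrier R. eval r (z [^] q) = eval p z"
    using Cons by auto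
  have aH: "a \<in> H" "a \<in> carrier R" using Cons.prems assms(3) by auto
  have rc: "set r \<subseteq> carrier R" using r assms(3) by auto
  show ?case
  proof (cases "a = \<zero>")
    case True
    have "length r \<le> (length (a # p) + (q - 1)) div q"
      by (rule order_trans[OF r(2) div_le_mono]) simp
    moreover have "eval r (z [^] q) = eval (a # p) z" if "z \<in> carrier R" for z
    proof -
      have "eval p z \<in> carrier R" using eval_in_carrier[of p z] Cons.prems assms(3) that by auto
      then show ?thesis using r(3) that True by simp
    qed
    ultimately show ?thesis using r(1) True by (intro exI[of _ r]) auto
  next
    case False
    then have "q dvd length p" using Cons.prems(2)[of "length p"] by simp
    then obtain m where m: "length p = q * m" by blast
    have "(q * m + (q - 1)) div q = m" by (rule div_nat_eqI) (use assms(4) in auto)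
    then have lr: "length r \<le> m" using r(2) m by simp
    define r' where "r' = a # replicate (m - length r) \<zero> @ r"
    have l: "length (replicate (m - length r) \<zero> @ r) = m" using lr by simp
    have "(length (a # p) + (q - 1)) div q = Suc m"
    proof -
      have "length (a # p) + (q - 1) = q * m + q" using m assms(4) by simp
      then show ?thesis using assms(4) by simp
    qed
    moreover have "eval r' (z [^] q) = eval (a # p) z" if "z \<in> carrier R" for z
      using eval_replicate[OF rc, of "z [^] q" "m - length r"] that r(3) l m by (simp add: r'_def nat_pow_pow)
    moreover have "set r' \<subseteq> H" using r(1) aH assms(2) by (auto simp: r'_def)
    ultimately show ?thesis using l by (intro exI[of _ r']) (auto simp: r'_def)
  qed
qed (rule exI[of _ "[]"], simp)

text \<open>The \<open>q\<close>-th powers of a basis over \<open>K(x)\<close> span everything over \<open>K(x ^ q)\<close>, because the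
  \<open>q\<close>-th powers of the coefficients lie in \<open>K(x ^ q)\<close>. So the degree over \<open>K(x ^ q)\<close> is at
  most that over \<open>K(x)\<close>, and \<open>K(x ^ q)\<close> is not smaller than \<open>K(x)\<close>.\<close>

lemma (in field) frobenius_spans_simple:
  assumes K: "subfield K R" and n: "dimension n K (carrier R)" and fr: "frobenius_spans R K (carrier R)"
    and x: "x \<in> carrier R" and q: "Factorial_Ring.prime (q::nat)" "add_pow R q \<one> = \<zero>"
    and d: "(algebraic over K) x" "(algebraic over K) (x [^] q)"
  shows "length (Irr K x) \<le> length (Irr K (x [^] q))"
proof (rule ccontr)
  assume less: "\<not> ?thesis"
  let ?E = "simple_extension K x" and ?E' = "simple_extension K (x [^] q)"
  have xq: "x [^] q \<in> carrier R" using x by simp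
  have E: "subfield ?E R" "subfield ?E' R"
    using simple_extension_is_subfield[OF K x] simple_extension_is_subfield[OF K xq] d by auto
  note dE = dimension_simple_extension[OF K x d(1)] and dE' = dimension_simple_extension[OF K xq d(2)]
  have KE: "K \<subseteq> ?E" by (rule simple_extension_incl[OF subfieldE(3)[OF K] x])
  obtain Bs where Bs: "set Bs \<subseteq> carrier R" "Span K Bs = carrier R" using exists_base[OF K n] by blast
  have "Span ?E Bs = carrier R"
  proof
    show "Span ?E Bs \<subseteq> carrier R" by (rule Span_in_carrier[OF subfieldE(3)[OF E(1)] Bs(1)])
    show "carrier R \<subseteq> Span ?E Bs"
      unfolding Bs(2)[symmetric] using Span_mem_iff_length_version[OF K Bs(1)] Span_mem_iff_length_version[OF E(1) Bs(1)] KE by blast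
  qed
  then obtain Cs where Cs: "set Cs \<subseteq> carrier R" "independent ?E Cs" "Span ?E Cs = carrier R"
    using filter_base[OF E(1) Bs(1)] by metis
  have "dimension (length Cs) ?E (carrier R)" using dimensionI[OF E(1) Cs(2,3)] .
  from telescopic_base[OF K E(1) dE this] have n1: "n = degree (Irr K x) * length Cs"
    using dimension_is_inj[OF K n] by simp
  let ?Cq = "map (\<lambda>z. z [^] q) Cs"
  have Cq: "set ?Cq \<subseteq> carrier R" using Cs(1) by auto
  have pow_sum: "combine Ks Us [^] q = combine (map (\<lambda>z. z [^] q) Ks) (map (\<lambda>z. z [^] q) Us)"
    if "set Ks \<subseteq> carrier R" "set Us \<subseteq> carrier R" for Ks Us
    using that
    by (induction Ks Us rule: combine.induct)
      (use prime_gt_0_nat[OF q(1)] in \<open>auto simp: frobenius_add[OF q] nat_pow_distrib nat_pow_zero\<close>)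
  have E_pow: "z [^] q \<in> ?E'" if z: "z \<in> ?E" for z
  proof -
    obtain H where H: "set H \<subseteq> K" "z = eval H x" using simple_extension_cases[OF subfieldE(3)[OF K] x z] by blast
    have "eval H x [^] q = eval (map (\<lambda>z. z [^] q) H) (x [^] q)" if "set H \<subseteq> carrier R" for H
      using that
    proof (induction H)
      case (Cons a H)
      have "(x [^] length H) [^] q = (x [^] q) [^] length H" using x by (simp add: nat_pow_pow mult.commute)
      then show ?case using Cons x eval_in_carrier[of H x] by (simp add: frobenius_add[OF q] nat_pow_distrib)
    qed (use prime_gt_0_nat[OF q(1)] in \<open>simp add: nat_pow_zero\<close>)
    then have "z [^] q = eval (map (\<lambda>z. z [^] q) H) (x [^] q)" using H subfieldE(3)[OF K] by auto
    moreover have "set (map (\<lambda>z. z [^] q) H) \<subseteq> ?E'"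
      using H(1) eval_pow_closed[OF _ subfieldE(1)[OF K]] simple_extension_incl[OF subfieldE(3)[OF K] xq] by auto
    ultimately show ?thesis
      using eval_in_subring[OF subfieldE(1)[OF E(2)] _ simple_extension_mem[OF subfieldE(1)[OF K] xq]] by simp
  qed
  let ?T = "Span ?E' ?Cq"
  have KE': "K \<subseteq> ?E'" by (rule simple_extension_incl[OF subfieldE(3)[OF K] xq])
  have T: "carrier R \<subseteq> ?T"
  proof (rule frobenius_spansD[OF fr q])
    show "?T \<subseteq> carrier R" by (rule Span_in_carrier[OF subfieldE(3)[OF E(2)] Cq])
    show "a \<oplus> b \<in> ?T" if "a \<in> ?T" "b \<in> ?T" for a b using Span_subgroup_props(3)[OF E(2) Cq] that by blast
    show "a \<otimes> b \<in> ?T" if "a \<in> K" "b \<in> ?T" for a b using Span_smult_closed[OF E(2) Cq] that KE' by blast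
    fix z assume "z \<in> carrier R"
    then obtain Ks where Ks: "set Ks \<subseteq> ?E" "length Ks = length Cs" "z = combine Ks Cs"
      using Cs(3) Span_mem_iff_length_version[OF E(1) Cs(1)] by auto
    have "set Ks \<subseteq> carrier R" using Ks(1) subfieldE(3)[OF E(1)] by auto
    then have "z [^] q = combine (map (\<lambda>z. z [^] q) Ks) ?Cq" using pow_sum Cs(1) Ks(3) by simp
    moreover have "set (map (\<lambda>z. z [^] q) Ks) \<subseteq> ?E'" using Ks(1) E_pow by auto
    ultimately show "z [^] q \<in> ?T"
      unfolding Span_mem_iff_length_version[OF E(2) Cq] using Ks(2)
      by (intro exI[of _ "map (\<lambda>z. z [^] q) Ks"]) simp
  qed
  obtain Vs where Vs: "set Vs \<subseteq> carrier R" "independent ?E' Vs" "Span ?E' Vs = ?T"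
    using filter_base[OF E(2) Cq] by metis
  have T': "?T = carrier R" using T Span_in_carrier[OF subfieldE(3)[OF E(2)] Cq] by blast
  have "length Vs \<le> length ?Cq"
  proof -
    obtain Ws where Ws: "set Ws \<subseteq> carrier R" "independent ?E' Ws" "Span ?E' Ws = ?T" "length Ws \<le> length ?Cq"
    proof -
      have "\<exists>Ws. independent ?E' Ws \<and> Span ?E' Ws = Span ?E' Us \<and> length Ws \<le> length Us" if "set Us \<subseteq> carrier R" for Us
        using that
      proof (induction Us)
        case (Cons u Us)
        then obtain Ws where Ws: "independent ?E' Ws" "Span ?E' Ws = Span ?E' Us" "length Ws \<le> length Us" by auto
        show ?case
        proof (cases "u \<in> Span ?E' Us")
          case True
          have "Span ?E' (u # Us) = Span ?E' Us"
          proof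
            show "Span ?E' (u # Us) \<subseteq> Span ?E' Us"
              using mono_Span_subset[OF E(2), of "u # Us" Us] True Cons.prems Span_base_incl[OF E(2), of Us] by auto
            show "Span ?E' Us \<subseteq> Span ?E' (u # Us)" using mono_Span[OF E(2), of Us u] Cons.prems by auto
          qed
          then show ?thesis using Ws by (intro exI[of _ Ws]) auto
        next
          case False
          then have "independent ?E' (u # Ws)" using li_Cons[of u ?E' Ws] Cons.prems Ws by auto
          moreover have "Span ?E' (u # Ws) = Span ?E' (u # Us)" using Ws(2) by simp
          ultimately show ?thesis using Ws(3) by (intro exI[of _ "u # Ws"]) auto
        qed
      qed auto
      from this[OF Cq] show thesis using that independent_in_carrier by blast
    qed
    then have "length Vs \<le> length Ws"
      using independent_length_le[OF E(2) Vs(2) Ws(2)] Span_base_incl[OF E(2) Vs(1)] Vs(3) by auto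
    then show ?thesis using Ws(4) by simp
  qed
  moreover have "dimension (length Vs) ?E' (carrier R)" using dimensionI[OF E(2) Vs(2)] Vs(3) T' by simp
  from telescopic_base[OF K E(2) dE' this] have n2: "n = degree (Irr K (x [^] q)) * length Vs"
    using dimension_is_inj[OF K n] by simp
  moreover have "0 < length Cs"
  proof (rule ccontr)
    assume "\<not> 0 < length Cs"
    then have "carrier R = {\<zero>}" using Cs(3) by simp
    then show False using one_closed one_not_zero by (metis singletonD)
  qed
  moreover have "degree (Irr K (x [^] q)) < degree (Irr K x)"
  proof -
    have "Irr K (x [^] q) \<noteq> []" by (rule pirreducibleE(1)[OF subfieldE(1)[OF K] IrrE(1,2)[OF K xq d(2)]])
    then have "0 < length (Irr K (x [^] q))" by simp
    then show ?thesis using less by linarith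
  qed
  ultimately have "degree (Irr K (x [^] q)) * length Vs < degree (Irr K x) * length Cs"
    by (metis length_map mult_less_le_imp_less not_less_zero zero_le mult_le_mono2 mult_less_mono1 le_less_trans)
  then show False using n1 n2 by simp
qed

text \<open>The kernel is prime because \<open>S\<close> is a domain, and a nonzero prime ideal of a principal domain is
  generated by an irreducible element.\<close>

lemma (in domain) irreducible_generator:
  assumes "subfield K R" "ring_hom_ring (K[X]) S h"
    and "a_kernel (K[X]) S h \<noteq> {[]}" "a_kernel (K[X]) S h \<noteq> carrier (K[X])" "domain S"
  shows "\<exists>p\<in>carrier (K[X]). pirreducible K p \<and> a_kernel (K[X]) S h = PIdl\<^bsub>K[X]\<^esub> p"
proof -
  interpret UP: principal_domain "K[X]" using univ_poly_is_principal[OF assms(1)] .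
  obtain p where p: "p \<in> carrier (K[X])" "a_kernel (K[X]) S h = PIdl\<^bsub>K[X]\<^esub> p"
    using UP.exists_gen[OF ring_hom_ring.kernel_is_ideal[OF assms(2)]] by auto
  have "p \<in> carrier (K[X]) - {[]}"
    using UP.genideal_zero UP.cgenideal_eq_genideal[OF UP.zero_closed] assms(3) p
    by (auto simp add: univ_poly_zero)
  then have "pprime K p"
    using ring_hom_ring.primeideal_vimage[OF assms(2) UP.is_cring domain.zeroprimeideal[OF assms(5)]]
      UP.primeideal_iff_prime[of p]
    unfolding univ_poly_zero sym[OF p(2)] a_kernel_def' by simp
  then have "pirreducible K p" using pprime_iff_pirreducible[OF assms(1) p(1)] by simp
  then show ?thesis using p by (intro bexI[of _ p]) auto
qed

text \<open>The polynomials over \<open>K\<close> that vanish at a root \<open>a\<close> in the closure form the ideal generated by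
  the minimal polynomial. At a multiple root this ideal contains the derivative, which must vanish
  for reasons of degree. So the characteristic is a prime \<open>q\<close>, the minimal polynomial is a
  polynomial in the \<open>q\<close>-th power, and \<open>x ^ q\<close> has smaller degree than \<open>x\<close>.\<close>

lemma (in field) Irr_simple_roots:
  assumes K: "subfield K R" and n: "dimension n K (carrier R)" and fr: "frobenius_spans R K (carrier R)"
    and x: "x \<in> carrier R"
  shows "count (ring.roots alg_closure (map indexed_const (Irr K x))) a \<le> 1"
proof -
  have alg: "(algebraic over K) z" if "z \<in> carrier R" for z
    by (rule finite_dimension_imp_algebraic[OF K carrier_is_subring finite_dimensionI[OF n] that])
  let ?C = "alg_closure" and ?i = indexed_const
  interpret C: algebraic_closure ?C "?i ` carrier R" by (rule alg_closureE(1))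
  have ih: "?i \<in> ring_hom R ?C" by (rule alg_closureE(2))
  interpret i: ring_hom_ring R ?C ?i by (rule ring_hom_ringI2[OF ring_axioms C.ring_axioms ih])
  note I = IrrE[OF K x alg[OF x]]
  let ?h = "Irr K x"
  have hK: "set ?h \<subseteq> K" "polynomial K ?h" using I(1) polynomial_incl by (auto simp: univ_poly_carrier)
  have sK: "subring K R" by (rule subfieldE(1)[OF K])
  have Kc: "K \<subseteq> carrier R" by (rule subfieldE(3)[OF K])
  have hn: "?h \<noteq> []" by (rule pirreducibleE(1)[OF sK I(1,2)])
  have hX: "map ?i ?h \<in> carrier (poly_ring ?C)"
    by (rule polynomial_hom[OF ih field_axioms C.field_axioms carrier_polynomial_shell[OF sK I(1)]])
  show "count (C.roots (map ?i ?h)) a \<le> 1"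
  proof (rule ccontr)
    assume "\<not> ?thesis"
    then have c2: "2 \<le> count (C.roots (map ?i ?h)) a" by simp
    then have "0 < count (C.roots (map ?i ?h)) a" by linarith
    then have "a \<in># C.roots (map ?i ?h)" by (simp only: count_greater_zero_iff)
    then have a: "a \<in> carrier ?C" using C.roots_mem_iff_is_root[OF hX] by (simp add: C.is_root_def)
    note z = C.deriv_eval_multiple_root[OF hX a c2]
    let ?\<Psi> = "\<lambda>P. C.eval (map ?i P) a"
    have icl: "set P \<subseteq> carrier R \<Longrightarrow> set (map ?i P) \<subseteq> carrier ?C" for P using i.hom_closed by auto
    have Pc: "set P \<subseteq> carrier R" if "P \<in> carrier (K[X])" for P
      using that polynomial_incl Kc unfolding univ_poly_carrier[symmetric] by blast
    have hom: "?\<Psi> \<in> ring_hom (K[X]) ?C"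
    proof (rule ring_hom_memI)
      fix P Q assume P: "P \<in> carrier (K[X])" and Q: "Q \<in> carrier (K[X])"
      show "?\<Psi> P \<in> carrier ?C" using C.eval_in_carrier[OF icl[OF Pc[OF P]] a] .
      show "?\<Psi> (P \<otimes>\<^bsub>K[X]\<^esub> Q) = ?\<Psi> P \<otimes>\<^bsub>?C\<^esub> ?\<Psi> Q"
        unfolding univ_poly_mult
        using i.poly_mult_hom'[OF Pc[OF P] Pc[OF Q]] C.eval_normalize[OF icl[OF poly_mult_in_carrier[OF Pc[OF P] Pc[OF Q]]] a]
          C.eval_poly_mult[OF icl[OF Pc[OF P]] icl[OF Pc[OF Q]] a] by simp
      show "?\<Psi> (P \<oplus>\<^bsub>K[X]\<^esub> Q) = ?\<Psi> P \<oplus>\<^bsub>?C\<^esub> ?\<Psi> Q"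
        unfolding univ_poly_add
        using i.poly_add_hom'[OF Pc[OF P] Pc[OF Q]] C.eval_normalize[OF icl[OF poly_add_in_carrier[OF Pc[OF P] Pc[OF Q]]] a]
          C.eval_poly_add[OF icl[OF Pc[OF P]] icl[OF Pc[OF Q]] a] by simp
    next
      show "?\<Psi> \<one>\<^bsub>K[X]\<^esub> = \<one>\<^bsub>?C\<^esub>" unfolding univ_poly_one using a by simp
    qed
    interpret UP: principal_domain "K[X]" by (rule univ_poly_is_principal[OF K])
    interpret \<Psi>: ring_hom_ring "K[X]" ?C ?\<Psi>
      by (rule ring_hom_ringI2[OF UP.ring_axioms C.ring_axioms hom])
    have ker: "P \<in> a_kernel (K[X]) ?C ?\<Psi> \<longleftrightarrow> P \<in> carrier (K[X]) \<and> ?\<Psi> P = \<zero>\<^bsub>?C\<^esub>" for P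
      by (simp only: a_kernel_def' mem_Collect_eq)
    have hker: "?h \<in> a_kernel (K[X]) ?C ?\<Psi>" unfolding ker using z(1) I(1) by (rule conjI[rotated])
    have k1: "a_kernel (K[X]) ?C ?\<Psi> \<noteq> {[]}"
    proof
      assume "a_kernel (K[X]) ?C ?\<Psi> = {[]}"
      then have "?h \<in> {[]}" using hker by (simp only:)
      then show False using hn by simp
    qed
    have k2: "a_kernel (K[X]) ?C ?\<Psi> \<noteq> carrier (K[X])"
    proof
      assume "a_kernel (K[X]) ?C ?\<Psi> = carrier (K[X])"
      then have "\<one>\<^bsub>K[X]\<^esub> \<in> a_kernel (K[X]) ?C ?\<Psi>" using UP.one_closed by (simp only:)
      then have "?\<Psi> \<one>\<^bsub>K[X]\<^esub> = \<zero>\<^bsub>?C\<^esub>" unfolding ker by (rule conjunct2)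
      then have "\<one>\<^bsub>?C\<^esub> = \<zero>\<^bsub>?C\<^esub>" using \<Psi>.hom_one by (simp only:)
      then show False using C.one_not_zero by (rule notE[rotated])
    qed
    have rh: "ring_hom_ring (K[X]) ?C ?\<Psi>" by (rule \<Psi>.ring_hom_ring_axioms)
    have "\<exists>g\<in>carrier (K[X]). pirreducible K g \<and> a_kernel (K[X]) ?C ?\<Psi> = PIdl\<^bsub>K[X]\<^esub> g"
      by (rule irreducible_generator[where S="?C" and h="?\<Psi>", OF K rh k1 k2 C.domain_axioms])
    then obtain g where g: "g \<in> carrier (K[X])" "pirreducible K g" "a_kernel (K[X]) ?C ?\<Psi> = PIdl\<^bsub>K[X]\<^esub> g"
      by (elim bexE conjE) (rule that)
    have "g \<sim>\<^bsub>K[X]\<^esub> ?h" using cgenideal_pirreducible[OF K g(1,2) I(2)] hker g(3) by simp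
    then have lg: "length g = length ?h" by (rule associated_polynomials_imp_same_length[OF sK g(1) I(1)])
    let ?D = "derivative ?h"
    have DK: "set ?D \<subseteq> K" by (rule derivative_in_subring[OF sK hK(1)])
    have Dc: "set ?D \<subseteq> carrier R" using DK Kc by auto
    have hc: "set ?h \<subseteq> carrier R" using hK Kc by auto
    have mapD: "map ?i (derivative P) = C.derivative (map ?i P)" if "set P \<subseteq> carrier R" for P
    proof -
      have "?i (add_pow R (n::nat) c) = add_pow ?C n (?i c)" if "c \<in> carrier R" for n c
        by (induction n) (use that in auto)
      then show ?thesis using that by (induction P) auto
    qed
    have nD: "normalize ?D \<in> carrier (K[X])"
      using normalize_gives_polynomial[OF DK] univ_poly_carrier by blast
    have "?\<Psi> (normalize ?D) = ?\<Psi> ?D"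
    proof -
      have "?i \<zero> = \<zero>\<^bsub>?C\<^esub>" by simp
      then have "C.eval (map ?i (normalize P)) a = C.eval (map ?i P) a" if "set P \<subseteq> carrier R" for P
        using that
      proof (induction P)
        case (Cons b P)
        have "C.eval (map ?i P) a \<in> carrier ?C" using C.eval_in_carrier[OF icl a] Cons.prems by simp
        then show ?case using Cons a by auto
      qed simp
      then show ?thesis using Dc by simp
    qed
    also have "\<dots> = \<zero>\<^bsub>?C\<^esub>"
      unfolding mapD[OF hc] using C.eval_derivative[OF icl[OF hc] a] z(2) by simp
    finally have "normalize ?D \<in> a_kernel (K[X]) ?C ?\<Psi>" unfolding ker using nD by (rule conjI[rotated])
    then have "normalize ?D \<in> PIdl\<^bsub>K[X]\<^esub> g" by (simp only: g(3))
    then have "g divides\<^bsub>K[X]\<^esub> normalize ?D"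
      unfolding cgenideal_def factor_def using g(1) UP.m_comm by auto
    then have "g pdivides normalize ?D" using pdivides_iff_shell[OF K g(1) nD] by simp
    then have "normalize ?D \<noteq> [] \<Longrightarrow> degree g \<le> degree (normalize ?D)"
      using pdivides_imp_degree_le[OF sK g(1) nD] by blast
    moreover have "length (normalize ?D) \<le> length ?h - 1"
      using normalize_length_le[of ?D] derivative_length[of ?h] by simp
    moreover have dh: "1 \<le> degree ?h" by (rule pirreducible_degree[OF K I(1,2)])
    ultimately have "normalize ?D = []" using lg by (cases "normalize ?D") auto
    moreover have "normalize P = [] \<Longrightarrow> set P \<subseteq> {\<zero>}" for P
      by (induction P) (auto split: if_splits)
    ultimately have D0: "set ?D \<subseteq> {\<zero>}" by blast
    note cz = derivative_zero[OF hc D0]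
    let ?d = "degree ?h"
    have "add_pow R ?d (?h ! 0) = \<zero>" using cz[of ?d] hn by simp
    then have "add_pow R ?d \<one> = \<zero>" using I(3) hn by (simp add: hd_conv_nth)
    then have d0: "0 < ?d" "add_pow R ?d \<one> = \<zero>" using dh by simp_all
    obtain q where q: "Factorial_Ring.prime (q::nat)" "add_pow R q \<one> = \<zero>"
      and dv: "\<And>n. add_pow R (n::nat) \<one> = \<zero> \<longleftrightarrow> q dvd n"
      by (rule prime_characteristic[OF d0]) (rule that)
    have "q dvd i" if "i < length ?h" "?h ! (length ?h - 1 - i) \<noteq> \<zero>" for i
    proof -
      let ?c = "?h ! (length ?h - 1 - i)"
      have cc: "?c \<in> carrier R" using hc that(1) nth_mem[of "length ?h - 1 - i" ?h] hn by auto
      have "add_pow R i \<one> \<otimes> ?c = \<zero>" using cz[OF that(1)] cc by (simp add: add_pow_ldistr)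
      then show ?thesis using dv that(2) cc by (simp add: integral_iff)
    qed
    then obtain r where r: "set r \<subseteq> K" "length r \<le> (length ?h + (q - 1)) div q" "r \<noteq> []" "hd r = hd ?h"
      "\<forall>z\<in>carrier R. eval r (z [^] q) = eval ?h z"
      using polynomial_in_power[OF hK(1) subringE(2)[OF sK] Kc prime_gt_0_nat[OF q(1)]] hn I(3) by auto
    have rX: "r \<in> carrier (K[X])" using r I(3) by (auto simp: univ_poly_carrier[symmetric] polynomial_def)
    have xq: "x [^] q \<in> carrier R" using x by simp
    have "Irr K (x [^] q) pdivides r"
      by (rule Irr_minimal[OF K xq alg[OF xq] rX]) (use r(5) x I(4) in simp)
    then have "degree (Irr K (x [^] q)) \<le> degree r"
      by (rule pdivides_imp_degree_le[OF sK IrrE(1)[OF K xq alg[OF xq]] rX r(3)])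
    moreover have "length ?h \<le> length (Irr K (x [^] q))"
      by (rule frobenius_spans_simple[OF K n fr x q alg[OF x] alg[OF xq]])
    ultimately have "length ?h \<le> length r" using r(3) by (cases r) auto
    then have "Suc ?d \<le> (?d + q) div q" using r(2) hn prime_gt_0_nat[OF q(1)] by (cases ?h) auto
    then have "?d \<le> ?d div q" using prime_gt_0_nat[OF q(1)] by simp
    moreover have "?d div q < ?d" using prime_gt_1_nat[OF q(1)] dh by (intro div_less_dividend) auto
    ultimately show False by simp
  qed
qed

lemma separable_elementI:
  fixes R :: "'a ring"
  assumes R: "field R" and K: "subfield K R" and n: "ring.dimension R n K (carrier R)"
    and fr: "frobenius_spans R K (carrier R)" and x: "x \<in> carrier R"
  shows "separable_element R K x"
proof -
  interpret field R by (rule R)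
  show ?thesis
    unfolding separable_element_def
    using Irr_simple_roots[OF K n fr x] finite_dimension_imp_algebraic[OF K carrier_is_subring finite_dimensionI[OF n] x]
    by blast
qed

section \<open>The tower of two extensions\<close>

lemma place_residue_subfield:
  assumes "place R S K v \<rho>" "algebraically_closed S" "finite (\<rho> ` val_ge R K v 0)"
  shows "subfield (\<rho> ` val_ge R K v 0) S"
  by (rule residue_place.k_subfield[OF place_residue[OF assms]])

lemma (in field) valuation_subring_restrict:
  assumes U: "valuation_subring R L U" and L: "subfield L' R" "L' \<subseteq> L"
  shows "valuation_subring R L' (U \<inter> L')"
proof -
  interpret U: valuation_subring R L U by (rule U)
  have "inv x \<in> L'" if "x \<in> L'" "x \<noteq> \<zero>" for x using subfield_m_inv(1)[OF L(1)] that by auto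
  moreover have "x \<in> U \<or> inv x \<in> U" if "x \<in> L'" "x \<noteq> \<zero>" for x using U.total[of x] that L(2) by blast
  ultimately have "\<And>x. x \<in> L' \<Longrightarrow> x \<noteq> \<zero> \<Longrightarrow> x \<in> U \<inter> L' \<or> inv x \<in> U \<inter> L'" by blast
  then show ?thesis
    by (intro valuation_subring.intro[OF field_axioms] valuation_subring_axioms.intro)
       (rule L(1), rule subring_inter[OF U.U subfieldE(1)[OF L(1)]], simp_all)
qed

text \<open>In the lower extension \<open>i1\<close> gets its data and the other places are inert; in the upper one the
  extensions of \<open>i1\<close> are inert and the unique extension of every other place gets its data. The
  place \<open>i2\<close> guarantees that some place is inert in the lower step.\<close>

theorem (in field) grid_realization:
  fixes v :: "'i \<Rightarrow> 'a \<Rightarrow> int" and S :: "'i \<Rightarrow> 'k ring" and e f :: "'i \<Rightarrow> nat \<Rightarrow> nat"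
  assumes alg: "algebraically_closed R" and K: "subfield K R" and fin: "finite I"
    and pl: "\<And>i. i \<in> I \<Longrightarrow> place R (S i) K (v i) (\<rho> i)"
    and closed: "\<And>i. i \<in> I \<Longrightarrow> algebraically_closed (S i)"
    and fink: "\<And>i. i \<in> I \<Longrightarrow> finite (\<rho> i ` val_ge R K (v i) 0)"
    and distinct: "inj_on (\<lambda>i. val_ge R K (v i) 0) I"
    and data: "\<And>i j. i \<in> I \<Longrightarrow> j \<in> {1..s i} \<Longrightarrow> 0 < e i j \<and> 0 < f i j"
    and sum: "\<And>i. i \<in> I \<Longrightarrow> (\<Sum>j\<in>{1..s i}. e i j * f i j) = m" and m: "0 < m"
    and two: "i1 \<in> I" "i2 \<in> I" "i1 \<noteq> i2"
  shows "\<exists>L w \<rho>'. subfield L R \<and> K \<subseteq> L \<and> dimension (m\<^sup>2) K L \<and> frobenius_spans R K L \<and>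
     (\<forall>i\<in>I. (\<forall>j\<in>{1..s i}. extends_place R (S i) K (v i) (\<rho> i) L (w i j) (\<rho>' i j) (e i j) \<and>
        ring.dimension (S i) (m * f i j) (\<rho> i ` val_ge R K (v i) 0) (\<rho>' i j ` val_ge R L (w i j) 0)) \<and>
       inj_on (\<lambda>j. val_ge R L (w i j) 0) {1..s i} \<and>
       (\<forall>U. valuation_subring R L U \<and> U \<inter> K = val_ge R K (v i) 0 \<longrightarrow> (\<exists>j\<in>{1..s i}. U = val_ge R L (w i j) 0)))"
proof -
  define s1 where "s1 i = (if i = i1 then s i else 1)" for i
  define e1 where "e1 i j = (if i = i1 then e i j else 1)" for i j
  define f1 where "f1 i j = (if i = i1 then f i j else m)" for i j
  have data1: "0 < e1 i j \<and> 0 < f1 i j" if "i \<in> I" "j \<in> {1..s1 i}" for i j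
    using data[OF that(1), of j] that(2) m unfolding e1_def f1_def s1_def by (auto split: if_splits)
  have sum1: "(\<Sum>j\<in>{1..s1 i}. e1 i j * f1 i j) = m" if "i \<in> I" for i
    using sum[OF that] unfolding e1_def f1_def s1_def by auto
  have i2: "s1 i2 = 1" "e1 i2 1 = 1" "f1 i2 1 = m" using two(3) by (simp_all add: s1_def e1_def f1_def)
  have "\<exists>L w \<rho>'. subfield L R \<and> K \<subseteq> L \<and> dimension m K L \<and> frobenius_spans R K L \<and>
     (\<forall>i\<in>I. (\<forall>j\<in>{1..s1 i}. extends_place R (S i) K (v i) (\<rho> i) L (w i j) (\<rho>' i j) (e1 i j) \<and>
        ring.dimension (S i) (f1 i j) (\<rho> i ` val_ge R K (v i) 0) (\<rho>' i j ` val_ge R L (w i j) 0)) \<and>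
       inj_on (\<lambda>j. val_ge R L (w i j) 0) {1..s1 i} \<and>
       (\<forall>U. valuation_subring R L U \<and> U \<inter> K = val_ge R K (v i) 0 \<longrightarrow> (\<exists>j\<in>{1..s1 i}. U = val_ge R L (w i j) 0)))"
    by (rule krull_realization[where v=v and S=S and \<rho>=\<rho> and s=s1 and e=e1 and f=f1, OF alg K fin])
       (fact pl closed fink distinct data1 sum1 m two(2) i2)+
  then obtain L1 w1 \<rho>1 where L1: "subfield L1 R" "K \<subseteq> L1" "dimension m K L1" "frobenius_spans R K L1"
    and all1: "\<forall>i\<in>I. (\<forall>j\<in>{1..s1 i}. extends_place R (S i) K (v i) (\<rho> i) L1 (w1 i j) (\<rho>1 i j) (e1 i j) \<and>
        ring.dimension (S i) (f1 i j) (\<rho> i ` val_ge R K (v i) 0) (\<rho>1 i j ` val_ge R L1 (w1 i j) 0)) \<and>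
       inj_on (\<lambda>j. val_ge R L1 (w1 i j) 0) {1..s1 i} \<and>
       (\<forall>U. valuation_subring R L1 U \<and> U \<inter> K = val_ge R K (v i) 0 \<longrightarrow> (\<exists>j\<in>{1..s1 i}. U = val_ge R L1 (w1 i j) 0))"
    by (elim exE conjE) (rule that)
  have ext1: "extends_place R (S i) K (v i) (\<rho> i) L1 (w1 i j) (\<rho>1 i j) (e1 i j)"
    and dim1: "ring.dimension (S i) (f1 i j) (\<rho> i ` val_ge R K (v i) 0) (\<rho>1 i j ` val_ge R L1 (w1 i j) 0)"
    if "i \<in> I" "j \<in> {1..s1 i}" for i j
    using all1[THEN bspec, OF that(1), THEN conjunct1, THEN bspec, OF that(2)] by simp_all
  have inj1: "inj_on (\<lambda>j. val_ge R L1 (w1 i j) 0) {1..s1 i}" if "i \<in> I" for i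
    using all1[THEN bspec, OF that, THEN conjunct2, THEN conjunct1] .
  have class1: "\<exists>j\<in>{1..s1 i}. U = val_ge R L1 (w1 i j) 0"
    if "i \<in> I" "valuation_subring R L1 U" "U \<inter> K = val_ge R K (v i) 0" for i U
    using all1[THEN bspec, OF that(1), THEN conjunct2, THEN conjunct2, THEN spec, of U] that(2,3) by simp
  have pl1: "place R (S i) L1 (w1 i j) (\<rho>1 i j)" if "i \<in> I" "j \<in> {1..s1 i}" for i j
    using ext1[OF that] unfolding extends_place_def by (rule conjunct1)
  have e1pos: "0 < e1 i j" if "i \<in> I" "j \<in> {1..s1 i}" for i j
    using data[OF that(1), of j] that(2) unfolding e1_def s1_def by (auto split: if_splits)
  have res1: "val_ge R L1 (w1 i j) 0 \<inter> K = val_ge R K (v i) 0" if "i \<in> I" "j \<in> {1..s1 i}" for i j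
    by (rule extends_place_restrict[OF ext1[OF that] L1(2) e1pos[OF that]])
  have k: "subfield (\<rho> i ` val_ge R K (v i) 0) (S i)" if "i \<in> I" for i
    by (rule place_residue_subfield[OF pl[OF that] closed[OF that] fink[OF that]])
  have ringS: "ring (S i)" "field (S i)" if "i \<in> I" for i
    using closed[OF that] algebraically_closed.axioms(1) field.is_ring by blast+
  have fink1: "finite (\<rho>1 i j ` val_ge R L1 (w1 i j) 0)" if "i \<in> I" "j \<in> {1..s1 i}" for i j
    using ring.card_of_dimension[OF ringS(1)[OF that(1)] k[OF that(1)] fink[OF that(1)] dim1[OF that]] by simp
  define J where "J = Sigma I (\<lambda>i. {1..s1 i})"
  define S2 where "S2 x = S (fst x)" for x :: "'i \<times> nat"
  define v2 where "v2 x = w1 (fst x) (snd x)" for x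
  define \<rho>2 where "\<rho>2 x = \<rho>1 (fst x) (snd x)" for x
  define s2 where "s2 x = (if fst x = i1 then 1 else s (fst x))" for x :: "'i \<times> nat"
  define e2 where "e2 x j = (if fst x = i1 then 1 else e (fst x) j)" for x :: "'i \<times> nat" and j
  define f2 where "f2 x j = (if fst x = i1 then m else f (fst x) j)" for x :: "'i \<times> nat" and j
  have J: "fst x \<in> I" "snd x \<in> {1..s1 (fst x)}" if "x \<in> J" for x using that by (auto simp: J_def)
  have J': "(i, a) \<in> J" if "i \<in> I" "a \<in> {1..s1 i}" for i a using that by (simp add: J_def)
  have finJ: "finite J" using fin by (simp add: J_def)
  have pl2: "place R (S2 x) L1 (v2 x) (\<rho>2 x)" if "x \<in> J" for x
    unfolding S2_def v2_def \<rho>2_def by (rule pl1[OF J[OF that]])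
  have closed2: "algebraically_closed (S2 x)" if "x \<in> J" for x
    unfolding S2_def by (rule closed[OF J(1)[OF that]])
  have fink2: "finite (\<rho>2 x ` val_ge R L1 (v2 x) 0)" if "x \<in> J" for x
    unfolding v2_def \<rho>2_def by (rule fink1[OF J[OF that]])
  have distinct2: "inj_on (\<lambda>x. val_ge R L1 (v2 x) 0) J"
  proof (rule inj_onI)
    fix x y assume x: "x \<in> J" and y: "y \<in> J" and eq: "val_ge R L1 (v2 x) 0 = val_ge R L1 (v2 y) 0"
    have "val_ge R K (v (fst x)) 0 = val_ge R K (v (fst y)) 0"
      using res1[OF J[OF x]] res1[OF J[OF y]] eq unfolding v2_def by simp
    then have 1: "fst x = fst y" using inj_onD[OF distinct _ J(1)[OF x] J(1)[OF y]] by simp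
    then have "snd x = snd y"
      using inj_onD[OF inj1[OF J(1)[OF x]], of "snd x" "snd y"] eq J(2)[OF x] J(2)[OF y] unfolding v2_def by simp
    then show "x = y" using 1 by (rule prod_eqI[rotated])
  qed
  have data2: "0 < e2 x j \<and> 0 < f2 x j" if "x \<in> J" "j \<in> {1..s2 x}" for x j
    using data[OF J(1)[OF that(1)], of j] that(2) m unfolding e2_def f2_def s2_def by (auto split: if_splits)
  have sum2: "(\<Sum>j\<in>{1..s2 x}. e2 x j * f2 x j) = m" if "x \<in> J" for x
    using sum[OF J(1)[OF that]] unfolding e2_def f2_def s2_def by auto
  have s_pos: "0 < s i" if "i \<in> I" for i
  proof (rule ccontr)
    assume "\<not> 0 < s i"
    then show False using sum[OF that] m by simp
  qed
  have i0: "(i1, 1) \<in> J" "s2 (i1, 1) = 1" "e2 (i1, 1) 1 = 1" "f2 (i1, 1) 1 = m"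
    using two s_pos[OF two(1)] by (auto simp: J_def s1_def s2_def e2_def f2_def)
  have "\<exists>L w2 \<rho>3. subfield L R \<and> L1 \<subseteq> L \<and> dimension m L1 L \<and> frobenius_spans R L1 L \<and>
    (\<forall>x\<in>J. (\<forall>j\<in>{1..s2 x}. extends_place R (S2 x) L1 (v2 x) (\<rho>2 x) L (w2 x j) (\<rho>3 x j) (e2 x j) \<and>
        ring.dimension (S2 x) (f2 x j) (\<rho>2 x ` val_ge R L1 (v2 x) 0) (\<rho>3 x j ` val_ge R L (w2 x j) 0)) \<and>
       inj_on (\<lambda>j. val_ge R L (w2 x j) 0) {1..s2 x} \<and>
       (\<forall>U. valuation_subring R L U \<and> U \<inter> L1 = val_ge R L1 (v2 x) 0 \<longrightarrow> (\<exists>j\<in>{1..s2 x}. U = val_ge R L (w2 x j) 0)))"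
    by (rule krull_realization[where v=v2 and S=S2 and \<rho>=\<rho>2 and s=s2 and e=e2 and f=f2, OF alg L1(1) finJ])
       (fact pl2 closed2 fink2 distinct2 data2 sum2 m i0)+
  then obtain L w2 \<rho>3 where L: "subfield L R" "L1 \<subseteq> L" "dimension m L1 L" "frobenius_spans R L1 L"
    and all2: "\<forall>x\<in>J. (\<forall>j\<in>{1..s2 x}. extends_place R (S2 x) L1 (v2 x) (\<rho>2 x) L (w2 x j) (\<rho>3 x j) (e2 x j) \<and>
        ring.dimension (S2 x) (f2 x j) (\<rho>2 x ` val_ge R L1 (v2 x) 0) (\<rho>3 x j ` val_ge R L (w2 x j) 0)) \<and>
       inj_on (\<lambda>j. val_ge R L (w2 x j) 0) {1..s2 x} \<and>
       (\<forall>U. valuation_subring R L U \<and> U \<inter> L1 = val_ge R L1 (v2 x) 0 \<longrightarrow> (\<exists>j\<in>{1..s2 x}. U = val_ge R L (w2 x j) 0))"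
    by (elim exE conjE) (rule that)
  have ext2: "extends_place R (S2 x) L1 (v2 x) (\<rho>2 x) L (w2 x j) (\<rho>3 x j) (e2 x j)"
    and dim2: "ring.dimension (S2 x) (f2 x j) (\<rho>2 x ` val_ge R L1 (v2 x) 0) (\<rho>3 x j ` val_ge R L (w2 x j) 0)"
    if "x \<in> J" "j \<in> {1..s2 x}" for x j
    using all2[THEN bspec, OF that(1), THEN conjunct1, THEN bspec, OF that(2)] by simp_all
  have inj2: "inj_on (\<lambda>j. val_ge R L (w2 x j) 0) {1..s2 x}" if "x \<in> J" for x
    using all2[THEN bspec, OF that, THEN conjunct2, THEN conjunct1] .
  have class2: "\<exists>j\<in>{1..s2 x}. U = val_ge R L (w2 x j) 0"
    if "x \<in> J" "valuation_subring R L U" "U \<inter> L1 = val_ge R L1 (v2 x) 0" for x U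
    using all2[THEN bspec, OF that(1), THEN conjunct2, THEN conjunct2, THEN spec, of U] that(2,3) by simp
  have res2: "val_ge R L (w2 x j) 0 \<inter> L1 = val_ge R L1 (v2 x) 0" if "x \<in> J" "j \<in> {1..s2 x}" for x j
    by (rule extends_place_restrict[OF ext2[OF that] L(2)]) (use data2[OF that] in simp)
  (* the j-th extension of place i is the (B i j)-th one above the (A i j)-th one of the lower step *)
  define A where "A i j = (if i = i1 then j else (1::nat))" for i j
  define B where "B i j = (if i = i1 then (1::nat) else j)" for i j
  define w where "w i j = w2 (i, A i j) (B i j)" for i j
  define \<rho>' where "\<rho>' i j = \<rho>3 (i, A i j) (B i j)" for i j
  have AB: "A i j \<in> {1..s1 i}" "B i j \<in> {1..s2 (i, A i j)}" "e1 i (A i j) * e2 (i, A i j) (B i j) = e i j"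
    "f1 i (A i j) * f2 (i, A i j) (B i j) = m * f i j" if "j \<in> {1..s i}" for i j
    using that by (auto simp: A_def B_def s1_def s2_def e1_def e2_def f1_def f2_def)
  have AB_inj: "j = j'" if "A i j = A i j'" "B i j = B i j'" for i j j'
    using that by (auto simp: A_def B_def split: if_splits)
  have AB_surj: "\<exists>j\<in>{1..s i}. A i j = a \<and> B i j = b" if "a \<in> {1..s1 i}" "b \<in> {1..s2 (i, a)}" for i a b
    using that by (cases "i = i1") (auto simp: A_def B_def s1_def s2_def)
  have inJ: "(i, A i j) \<in> J" if "i \<in> I" "j \<in> {1..s i}" for i j by (rule J'[OF that(1) AB(1)[OF that(2)]])
  have "subfield L R \<and> K \<subseteq> L \<and> dimension (m\<^sup>2) K L \<and> frobenius_spans R K L"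
    using L(1) order_trans[OF L1(2) L(2)] telescopic_base[OF K L1(1,3) L(3)]
      frobenius_spans_trans[OF L1(4) L(4) L1(1) L(1) L1(2) L(2)] by (simp add: power2_eq_square)
  moreover have "extends_place R (S i) K (v i) (\<rho> i) L (w i j) (\<rho>' i j) (e i j)"
    if i: "i \<in> I" and j: "j \<in> {1..s i}" for i j
  proof -
    have "extends_place R (S i) L1 (w1 i (A i j)) (\<rho>1 i (A i j)) L (w i j) (\<rho>' i j) (e2 (i, A i j) (B i j))"
      using ext2[OF inJ[OF i j] AB(2)[OF j]] unfolding S2_def v2_def \<rho>2_def w_def \<rho>'_def by simp
    from extends_place_trans[OF ext1[OF i AB(1)[OF j]] this L1(2)] show ?thesis unfolding AB(3)[OF j] .
  qed
  moreover have "ring.dimension (S i) (m * f i j) (\<rho> i ` val_ge R K (v i) 0) (\<rho>' i j ` val_ge R L (w i j) 0)"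
    if i: "i \<in> I" and j: "j \<in> {1..s i}" for i j
  proof -
    note a = AB(1)[OF j]
    have k1: "subfield (\<rho>1 i (A i j) ` val_ge R L1 (w1 i (A i j)) 0) (S i)"
      by (rule place_residue_subfield[OF pl1[OF i a] closed[OF i] fink1[OF i a]])
    have "ring.dimension (S i) (f2 (i, A i j) (B i j)) (\<rho>1 i (A i j) ` val_ge R L1 (w1 i (A i j)) 0) (\<rho>' i j ` val_ge R L (w i j) 0)"
      using dim2[OF inJ[OF i j] AB(2)[OF j]] unfolding S2_def v2_def \<rho>2_def w_def \<rho>'_def by simp
    from ring.telescopic_base[OF ringS(1)[OF i] k[OF i] k1 dim1[OF i a] this] show ?thesis unfolding AB(4)[OF j] .
  qed
  moreover have "inj_on (\<lambda>j. val_ge R L (w i j) 0) {1..s i}" if i: "i \<in> I" for i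
  proof (rule inj_onI)
    fix j j' assume j: "j \<in> {1..s i}" and j': "j' \<in> {1..s i}" and eq: "val_ge R L (w i j) 0 = val_ge R L (w i j') 0"
    have "val_ge R L1 (v2 (i, A i j)) 0 = val_ge R L1 (v2 (i, A i j')) 0"
      using res2[OF inJ[OF i j] AB(2)[OF j]] res2[OF inJ[OF i j'] AB(2)[OF j']] eq unfolding w_def by simp
    then have "(i, A i j) = (i, A i j')"
      using inj_onD[OF distinct2 _ inJ[OF i j] inJ[OF i j']] by simp
    then have A: "A i j = A i j'" by simp
    have "B i j = B i j'"
      using inj_onD[OF inj2[OF inJ[OF i j]], of "B i j" "B i j'"] AB(2)[OF j] AB(2)[OF j'] eq A unfolding w_def by simp
    then show "j = j'" by (rule AB_inj[OF A])
  qed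
  moreover have "\<exists>j\<in>{1..s i}. U = val_ge R L (w i j) 0"
    if i: "i \<in> I" and U: "valuation_subring R L U" "U \<inter> K = val_ge R K (v i) 0" for i U
  proof -
    have "U \<inter> L1 \<inter> K = val_ge R K (v i) 0" using U(2) L1(2) by blast
    from class1[OF i valuation_subring_restrict[OF U(1) L1(1) L(2)] this]
    obtain a where a: "a \<in> {1..s1 i}" "U \<inter> L1 = val_ge R L1 (w1 i a) 0" by blast
    have "\<exists>b\<in>{1..s2 (i, a)}. U = val_ge R L (w2 (i, a) b) 0"
      by (rule class2[OF J'[OF i a(1)] U(1)]) (use a(2) in \<open>simp add: v2_def\<close>)
    then obtain b where b: "b \<in> {1..s2 (i, a)}" "U = val_ge R L (w2 (i, a) b) 0" by blast
    obtain j where "j \<in> {1..s i}" "A i j = a" "B i j = b" using AB_surj[OF a(1) b(1)] by blast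
    then show ?thesis using b(2) unfolding w_def by (intro bexI[of _ j]) simp_all
  qed
  ultimately show ?thesis
    by (intro exI[of _ L] exI[of _ w] exI[of _ \<rho>'] conjI ballI allI impI) (simp_all del: One_nat_def)
qed

section \<open>Discrete valuation rings as places\<close>

text \<open>Both sides have degree \<open>m\<close> over \<open>K\<close>, since \<open>K\<close> has \<open>card k ^ f\<close> elements.\<close>

lemma extension_of_degree_eq:
  fixes L :: "'k ring"
  assumes L: "algebraically_closed L" and k: "subfield k L" "finite k" and K: "subfield K L"
    and f: "ring.dimension L f k K" and m: "0 < (m::nat)"
  shows "extension_of_degree L m K = {x \<in> carrier L. x [^]\<^bsub>L\<^esub> (card k ^ (m * f)) = x}"
proof -
  interpret algebraically_closed L by (rule L)
  have fK: "finite K" "card K = card k ^ f" using card_of_dimension[OF k f] by auto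
  have eq: "card K ^ m = card k ^ (m * f)" using fK(2) by (simp add: power_mult mult.commute)
  note E = finite_field_extension[OF K fK(1) m]
  show ?thesis
    unfolding extension_of_degree_def eq[symmetric]
    by (rule the_equality) (use E in simp, use finite_field_extension_unique[OF K fK(1) m] in blast)
qed

context valued_field
begin

lemma ge_ring: "ring (R\<lparr>carrier := ge 0\<rparr>)"
  by (rule subring_is_ring[OF ge_0_subring])

lemma ge_ideal:
  assumes "0 \<le> n" shows "ideal (ge n) (R\<lparr>carrier := ge 0\<rparr>)"
proof -
  interpret A: ring "R\<lparr>carrier := ge 0\<rparr>" by (rule ge_ring)
  have sub: "x \<in> ge 0" if "x \<in> ge n" for x using ge_mono[OF that assms] .
  have "\<ominus>\<^bsub>R\<lparr>carrier := ge 0\<rparr>\<^esub> x \<in> ge n" if x: "x \<in> ge n" for x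
  proof -
    have "\<ominus> x \<in> ge 0" using ge_neg[OF sub[OF x]] .
    then have "\<ominus>\<^bsub>R\<lparr>carrier := ge 0\<rparr>\<^esub> x = \<ominus> x"
      using sub[OF x] K_carrier[OF ge_K[OF x]] by (intro A.minus_equality) (auto simp: l_neg)
    then show ?thesis using ge_neg[OF x] by simp
  qed
  then have "subgroup (ge n) (add_monoid (R\<lparr>carrier := ge 0\<rparr>))"
    using sub ge_add by (intro A.add.subgroupI) (auto simp: a_inv_def intro!: exI[of _ \<zero>] ge_zero)
  then show ?thesis
    using ge_mult_nonneg m_comm[OF K_carrier[OF ge_K] K_carrier[OF ge_K]]
    by (intro idealI[OF A.ring_axioms]) auto
qed

lemma ideal_mult_closed:
  assumes "ideal J (R\<lparr>carrier := ge 0\<rparr>)" "z \<in> J" "a \<in> ge 0" shows "a \<otimes> z \<in> J"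
  using ideal.I_l_closed[OF assms(1,2), of a] assms(3) by simp

lemma ge_factor:
  assumes z: "z \<in> K" "z \<noteq> \<zero>" and x: "x \<in> ge n" "v z \<le> n"
  shows "\<exists>a\<in>ge (n - v z). x = a \<otimes> z"
proof -
  note i = K_inv[OF z]
  have xK: "x \<in> K" by (rule ge_K[OF x(1)])
  have iz: "inv z \<in> ge (- v z)" using i v_inv[OF z] by (simp add: val_ge_def)
  have "x \<otimes> inv z \<in> ge (n - v z)" using ge_mult[OF x(1) iz] by simp
  moreover have "x \<otimes> inv z \<otimes> z = x"
    using i K_carrier[OF xK] K_carrier[OF z(1)] K_carrier[of "inv z"] by (simp add: m_assoc)
  ultimately show ?thesis by (intro bexI[of _ "x \<otimes> inv z"]) simp_all
qed

text \<open>Ideals of a discrete valuation ring are determined by the least value of their elements.\<close>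

lemma genideal_ge:
  assumes Z: "Z \<subseteq> ge n" and z: "z \<in> Z" "z \<noteq> \<zero>" "v z = n" and n: "0 \<le> n"
  shows "Idl\<^bsub>R\<lparr>carrier := ge 0\<rparr>\<^esub> Z = ge n"
proof
  interpret A: ring "R\<lparr>carrier := ge 0\<rparr>" by (rule ge_ring)
  show "Idl\<^bsub>R\<lparr>carrier := ge 0\<rparr>\<^esub> Z \<subseteq> ge n" by (rule A.genideal_minimal[OF ge_ideal[OF n] Z])
  have Z0: "Z \<subseteq> carrier (R\<lparr>carrier := ge 0\<rparr>)" using Z ge_mono[OF _ n] by auto
  have id: "ideal (Idl\<^bsub>R\<lparr>carrier := ge 0\<rparr>\<^esub> Z) (R\<lparr>carrier := ge 0\<rparr>)" by (rule A.genideal_ideal[OF Z0])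
  have zI: "z \<in> Idl\<^bsub>R\<lparr>carrier := ge 0\<rparr>\<^esub> Z" using A.genideal_self[OF Z0] z(1) by blast
  have zK: "z \<in> K" using z(1) Z ge_K by blast
  show "ge n \<subseteq> Idl\<^bsub>R\<lparr>carrier := ge 0\<rparr>\<^esub> Z"
  proof
    fix x assume "x \<in> ge n"
    then obtain a where "a \<in> ge 0" "x = a \<otimes> z" using ge_factor[OF zK z(2), of x n] z(3) by auto
    then show "x \<in> Idl\<^bsub>R\<lparr>carrier := ge 0\<rparr>\<^esub> Z" using ideal_mult_closed[OF id zI] by simp
  qed
qed

lemma ideal_prod_ge:
  assumes n: "0 \<le> n" shows "ideal_prod (R\<lparr>carrier := ge 0\<rparr>) (ge n) (ge 1) = ge (n + 1)"
proof
  show "ideal_prod (R\<lparr>carrier := ge 0\<rparr>) (ge n) (ge 1) \<subseteq> ge (n + 1)"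
  proof
    fix x assume "x \<in> ideal_prod (R\<lparr>carrier := ge 0\<rparr>) (ge n) (ge 1)"
    then show "x \<in> ge (n + 1)" by induction (simp_all add: ge_mult ge_add)
  qed
  obtain p where p: "p \<in> K" "p \<noteq> \<zero>" "v p = 1" by (rule v_surj)
  show "ge (n + 1) \<subseteq> ideal_prod (R\<lparr>carrier := ge 0\<rparr>) (ge n) (ge 1)"
  proof
    fix x assume "x \<in> ge (n + 1)"
    then obtain a where a: "a \<in> ge n" "x = a \<otimes> p" using ge_factor[OF p(1,2), of x "n + 1"] p(3) n by auto
    have "p \<in> ge 1" using p by (simp add: val_ge_def)
    from ideal_prod.prod[OF a(1) this, of "R\<lparr>carrier := ge 0\<rparr>"]
    show "x \<in> ideal_prod (R\<lparr>carrier := ge 0\<rparr>) (ge n) (ge 1)" using a(2) by simp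
  qed
qed

lemma ideals_pow_ge: "ge 1 [^]\<^bsub>ideals_set (R\<lparr>carrier := ge 0\<rparr>)\<^esub> (k::nat) = ge (int k)"
proof (induction k)
  case 0
  then show ?case by (simp add: ideals_set_def nat_pow_def)
next
  case (Suc k)
  have "ge 1 [^]\<^bsub>ideals_set (R\<lparr>carrier := ge 0\<rparr>)\<^esub> Suc k = ideal_prod (R\<lparr>carrier := ge 0\<rparr>) (ge (int k)) (ge 1)"
    using Suc by (simp add: ideals_set_def nat_pow_def)
  also have "\<dots> = ge (int (Suc k))" using ideal_prod_ge[of "int k"] by (simp add: add.commute)
  finally show ?case .
qed

lemma ge_1_maximal: "maximalideal (ge 1) (R\<lparr>carrier := ge 0\<rparr>)"
proof (rule maximalidealI[OF ge_ideal])
  have "\<one> \<in> ge 0" "\<one> \<notin> ge 1" using one_not_zero by (simp_all add: val_ge_def)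
  then show "carrier (R\<lparr>carrier := ge 0\<rparr>) \<noteq> ge 1" by auto
  fix J assume J: "ideal J (R\<lparr>carrier := ge 0\<rparr>)" "ge 1 \<subseteq> J" "J \<subseteq> carrier (R\<lparr>carrier := ge 0\<rparr>)"
  show "J = ge 1 \<or> J = carrier (R\<lparr>carrier := ge 0\<rparr>)"
  proof (rule disjCI)
    assume "J \<noteq> carrier (R\<lparr>carrier := ge 0\<rparr>)"
    then have one: "\<one> \<notin> J" using ideal.one_imp_carrier[OF J(1)] by auto
    show "J = ge 1"
    proof (rule ccontr)
      assume "J \<noteq> ge 1"
      then obtain z where z: "z \<in> J" "z \<in> ge 0" "z \<notin> ge 1" using J(2,3) by auto
      then have z': "z \<in> K" "z \<noteq> \<zero>" "v z = 0" by (auto simp: val_ge_def)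
      have "\<one> \<in> ge 0" by (simp add: val_ge_def)
      then obtain a where "a \<in> ge 0" "\<one> = a \<otimes> z" using ge_factor[OF z'(1,2), of \<one> 0] z'(3) by auto
      then show False using ideal_mult_closed[OF J(1) z(1)] one by simp
    qed
  qed
qed simp

lemma maximal_ideal_unique:
  assumes N: "maximalideal N (R\<lparr>carrier := ge 0\<rparr>)" shows "N = ge 1"
proof -
  interpret A: ring "R\<lparr>carrier := ge 0\<rparr>" by (rule ge_ring)
  note id = maximalideal.axioms(1)[OF N]
  have Nsub: "N \<subseteq> ge 0" using ideal.Icarr[OF id] by auto
  have one: "\<one> \<notin> N" using ideal.one_imp_carrier[OF id] maximalideal.I_notcarr[OF N] by auto
  have "N \<subseteq> ge 1"
  proof (rule ccontr)
    assume "\<not> N \<subseteq> ge 1"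
    then obtain z where z: "z \<in> N" "z \<in> ge 0" "z \<notin> ge 1" using Nsub by auto
    then have z': "z \<in> K" "z \<noteq> \<zero>" "v z = 0" by (auto simp: val_ge_def)
    have "\<one> \<in> ge 0" by (simp add: val_ge_def)
    then obtain a where "a \<in> ge 0" "\<one> = a \<otimes> z" using ge_factor[OF z'(1,2), of \<one> 0] z'(3) by auto
    then show False using ideal_mult_closed[OF id z(1)] one by simp
  qed
  moreover have "ge 1 \<subseteq> ge 0" using ge_mono by auto
  ultimately show ?thesis
    using maximalideal.I_maximal[OF N ge_ideal[of 1]] maximalideal.I_notcarr[OF ge_1_maximal] by auto
qed

end

text \<open>The residue map induces the isomorphism from the quotient onto its image.\<close>

lemma (in place) residue_iso:
  defines "W \<equiv> R\<lparr>carrier := val_ge R K v 0\<rparr>"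
  shows "\<exists>h\<in>ring_iso (W Quot val_ge R K v 1) (S\<lparr>carrier := \<rho> ` val_ge R K v 0\<rparr>).
    \<forall>x\<in>val_ge R K v 0. h (val_ge R K v 1 +>\<^bsub>W\<^esub> x) = \<rho> x"
proof -
  interpret W: ring W unfolding W_def by (rule ge_ring)
  interpret h0: ring_hom_ring W S \<rho>
    by (rule ring_hom_ringI2[OF W.ring_axioms S.ring_axioms]) (simp add: W_def hom)
  let ?T = "S\<lparr>carrier := \<rho> ` val_ge R K v 0\<rparr>"
  have T: "ring ?T" using h0.img_is_ring by (simp add: W_def)
  have "\<rho> \<in> ring_hom W ?T" using h0.homh by (auto simp: ring_hom_def W_def)
  then interpret h: ring_hom_ring W ?T \<rho> by (rule ring_hom_ringI2[OF W.ring_axioms T])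
  have ker': "a_kernel W ?T \<rho> = val_ge R K v 1"
  proof -
    have le: "x \<in> val_ge R K v 1 \<Longrightarrow> x \<in> val_ge R K v 0" for x by (auto simp: val_ge_def)
    have "x \<in> val_ge R K v 0 \<and> \<rho> x = \<zero>\<^bsub>S\<^esub> \<longleftrightarrow> x \<in> val_ge R K v 1" for x
      using ker[of x] le[of x] by blast
    then show ?thesis unfolding a_kernel_def' W_def by (intro Set.set_eqI) simp
  qed
  have "(\<lambda>Y. the_elem (\<rho> ` Y)) \<in> ring_iso (W Quot a_kernel W ?T \<rho>) ?T"
    by (rule h.FactRing_iso_set) (simp add: W_def)
  moreover have "the_elem (\<rho> ` (a_kernel W ?T \<rho> +>\<^bsub>W\<^esub> x)) = \<rho> x" if "x \<in> val_ge R K v 0" for x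
    by (rule h.the_elem_simp) (simp add: W_def that)
  ultimately show ?thesis unfolding ker' by (intro bexI[of _ "\<lambda>Y. the_elem (\<rho> ` Y)"]) simp_all
qed

text \<open>The valuation is transported to the image of \<open>F\<close> in \<open>\<Omega>\<close>, and the residue map is \<open>\<iota>\<close> after the
  quotient map; its kernel is \<open>N\<close> because a homomorphism of fields is injective.\<close>

lemma DVR_place:
  fixes F :: "'a ring" and \<Omega> :: "'b ring" and S :: "'k ring"
  assumes F: "field F" and \<Omega>: "field \<Omega>" and \<phi>: "\<phi> \<in> ring_hom F \<Omega>" and V: "DVR F V"
    and N: "maximalideal N (F\<lparr>carrier := V\<rparr>)" and S: "field S" and \<iota>: "\<iota> \<in> ring_hom (residue_field F V N) S"
  shows "field (residue_field F V N) \<and> (\<exists>v \<rho>. place \<Omega> S (\<phi> ` carrier F) v \<rho> \<and> val_ge \<Omega> (\<phi> ` carrier F) v 0 = \<phi> ` V \<and>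
    val_ge \<Omega> (\<phi> ` carrier F) v 1 = \<phi> ` N \<and> (\<forall>x\<in>V. \<rho> (\<phi> x) = \<iota> (N +>\<^bsub>F\<lparr>carrier := V\<rparr>\<^esub> x)))"
proof -
  interpret F: field F by (rule F)
  interpret \<Omega>: field \<Omega> by (rule \<Omega>)
  interpret S: field S by (rule S)
  interpret \<phi>: ring_hom_ring F \<Omega> \<phi> by (rule ring_hom_ringI2[OF F.ring_axioms \<Omega>.ring_axioms \<phi>])
  obtain v where v: "valuation_on F (carrier F) v" and V': "V = val_ge F (carrier F) v 0"
  proof -
    have eq: "val_ge F (carrier F) u 0 = insert \<zero>\<^bsub>F\<^esub> {x \<in> carrier F - {\<zero>\<^bsub>F\<^esub>}. 0 \<le> u x}" for u :: "'a \<Rightarrow> int"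
      by (auto simp: val_ge_def)
    show thesis using V unfolding DVR_def eq[symmetric] by (elim exE conjE) (rule that, auto simp only: valuation_on_def)
  qed
  interpret v: valued_field F "carrier F" v by (rule F.valued_fieldI[OF F.carrier_is_subfield v])
  have N1: "N = val_ge F (carrier F) v 1" using v.maximal_ideal_unique N unfolding V' by simp
  let ?A = "F\<lparr>carrier := V\<rparr>"
  have subV: "subring V F" unfolding V' by (rule v.ge_0_subring)
  interpret A: ring ?A by (rule F.subring_is_ring[OF subV])
  have cringA: "cring ?A" by (rule F.subcring_iff[THEN iffD1, OF subringE(1)[OF subV] F.subcringI'[OF subV]])
  interpret N: maximalideal N ?A by (rule N)
  have Q: "field (?A Quot N)" by (rule N.quotient_is_field[OF cringA])
  interpret Q: field "?A Quot N" by (rule Q)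
  have \<iota>inj: "inj_on \<iota> (carrier (?A Quot N))" by (rule non_trivial_field_hom_is_inj[OF \<iota> Q S])
  interpret \<iota>: ring_hom_ring "?A Quot N" S \<iota> by (rule ring_hom_ringI2[OF Q.ring_axioms S.ring_axioms \<iota>])
  have \<phi>inj: "inj_on \<phi> (carrier F)" by (rule non_trivial_field_hom_is_inj[OF \<phi> F \<Omega>])
  have VF: "x \<in> carrier F" if "x \<in> V" for x using subringE(1)[OF subV] that by auto
  define \<psi> where "\<psi> = inv_into (carrier F) \<phi>"
  have \<psi>: "\<psi> (\<phi> x) = x" if "x \<in> carrier F" for x using \<phi>inj that by (simp add: \<psi>_def)
  have \<phi>0: "\<phi> x = \<zero>\<^bsub>\<Omega>\<^esub> \<longleftrightarrow> x = \<zero>\<^bsub>F\<^esub>" if "x \<in> carrier F" for x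
    using inj_on_eq_iff[OF \<phi>inj that F.zero_closed] by simp
  define v' where "v' = (\<lambda>y. v (\<psi> y))"
  let ?c = "\<lambda>x. N +>\<^bsub>?A\<^esub> x"
  define \<rho> where "\<rho> = (\<lambda>y. \<iota> (?c (\<psi> y)))"
  let ?K = "\<phi> ` carrier F"
  have K: "subfield ?K \<Omega>" by (rule \<phi>.img_is_subfield(2)[OF F.carrier_is_subfield]) simp
  have ge: "val_ge \<Omega> ?K v' n = \<phi> ` val_ge F (carrier F) v n" for n
    using \<phi>0 \<psi> unfolding val_ge_def v'_def by auto
  have "?K - {\<zero>\<^bsub>\<Omega>\<^esub>} = \<phi> ` (carrier F - {\<zero>\<^bsub>F\<^esub>})" using \<phi>0 by auto
  then have "v' ` (?K - {\<zero>\<^bsub>\<Omega>\<^esub>}) = v ` (carrier F - {\<zero>\<^bsub>F\<^esub>})"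
    unfolding v'_def using \<psi> by (force simp: image_image)
  then have "valuation_on \<Omega> ?K v'"
    using v unfolding valuation_on_def v'_def
    by (auto simp: \<phi>0 \<psi> \<phi>.hom_mult[symmetric] \<phi>.hom_add[symmetric] simp del: \<phi>.hom_mult \<phi>.hom_add)
  then interpret v': valued_field \<Omega> ?K v' by (rule \<Omega>.valued_fieldI[OF K])
  have c_hom: "?c \<in> ring_hom ?A (?A Quot N)" by (rule N.rcos_ring_hom)
  have cc: "?c x \<in> carrier (?A Quot N)" if "x \<in> V" for x using ring_hom_closed[OF c_hom] that by simp
  have \<rho>: "\<rho> (\<phi> x) = \<iota> (?c x)" if "x \<in> V" for x using \<psi>[OF VF[OF that]] by (simp add: \<rho>_def)
  note sV = subringE[OF subV]
  have hom: "\<rho> \<in> ring_hom (\<Omega>\<lparr>carrier := val_ge \<Omega> ?K v' 0\<rparr>) S"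
  proof (rule ring_hom_memI)
    fix x y assume "x \<in> carrier (\<Omega>\<lparr>carrier := val_ge \<Omega> ?K v' 0\<rparr>)" "y \<in> carrier (\<Omega>\<lparr>carrier := val_ge \<Omega> ?K v' 0\<rparr>)"
    then obtain a b where a: "a \<in> V" "x = \<phi> a" and b: "b \<in> V" "y = \<phi> b" unfolding ge V' by auto
    note ab = cc[OF a(1)] cc[OF b(1)]
    show "\<rho> x \<in> carrier S" using \<rho>[OF a(1)] ab a by simp
    have "?c (a \<otimes>\<^bsub>F\<^esub> b) = ?c a \<otimes>\<^bsub>?A Quot N\<^esub> ?c b" using ring_hom_mult[OF c_hom, of a b] a b by simp
    then have "\<rho> (\<phi> (a \<otimes>\<^bsub>F\<^esub> b)) = \<rho> (\<phi> a) \<otimes>\<^bsub>S\<^esub> \<rho> (\<phi> b)"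
      using \<rho>[OF a(1)] \<rho>[OF b(1)] \<rho>[OF sV(6)[OF a(1) b(1)]] ab by simp
    then show "\<rho> (x \<otimes>\<^bsub>\<Omega>\<lparr>carrier := val_ge \<Omega> ?K v' 0\<rparr>\<^esub> y) = \<rho> x \<otimes>\<^bsub>S\<^esub> \<rho> y"
      using a b VF by simp
    have "?c (a \<oplus>\<^bsub>F\<^esub> b) = ?c a \<oplus>\<^bsub>?A Quot N\<^esub> ?c b" using ring_hom_add[OF c_hom, of a b] a b by simp
    then have "\<rho> (\<phi> (a \<oplus>\<^bsub>F\<^esub> b)) = \<rho> (\<phi> a) \<oplus>\<^bsub>S\<^esub> \<rho> (\<phi> b)"
      using \<rho>[OF a(1)] \<rho>[OF b(1)] \<rho>[OF sV(7)[OF a(1) b(1)]] ab by simp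
    then show "\<rho> (x \<oplus>\<^bsub>\<Omega>\<lparr>carrier := val_ge \<Omega> ?K v' 0\<rparr>\<^esub> y) = \<rho> x \<oplus>\<^bsub>S\<^esub> \<rho> y"
      using a b VF by simp
  next
    have "\<rho> (\<phi> \<one>\<^bsub>F\<^esub>) = \<one>\<^bsub>S\<^esub>" using \<rho>[OF sV(3)] ring_hom_one[OF c_hom] \<iota>.hom_one by simp
    then show "\<rho> \<one>\<^bsub>\<Omega>\<lparr>carrier := val_ge \<Omega> ?K v' 0\<rparr>\<^esub> = \<one>\<^bsub>S\<^esub>" by simp
  qed
  have ker: "\<rho> x = \<zero>\<^bsub>S\<^esub> \<longleftrightarrow> x \<in> val_ge \<Omega> ?K v' 1" if x: "x \<in> val_ge \<Omega> ?K v' 0" for x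
  proof -
    obtain a where a: "a \<in> V" "x = \<phi> a" using x unfolding ge V' by auto
    have "\<rho> x = \<zero>\<^bsub>S\<^esub> \<longleftrightarrow> ?c a = \<zero>\<^bsub>?A Quot N\<^esub>"
      using \<rho>[OF a(1)] inj_on_eq_iff[OF \<iota>inj cc[OF a(1)] Q.zero_closed] a(2) by simp
    also have "\<dots> \<longleftrightarrow> ?c a = N" by (simp add: FactRing_def)
    also have "\<dots> \<longleftrightarrow> a \<in> N"
      using N.a_rcos_const[of a] N.a_rcos_self[of a] a(1) by auto
    also have "\<dots> \<longleftrightarrow> x \<in> val_ge \<Omega> ?K v' 1"
      unfolding ge N1[symmetric] a(2) using inj_on_image_mem_iff[OF \<phi>inj VF[OF a(1)], of N] N.Icarr VF by auto
    finally show ?thesis .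
  qed
  have "place \<Omega> S ?K v' \<rho>"
    by (intro place.intro place_axioms.intro v'.valued_field_axioms S.field_axioms hom ker)
  then show ?thesis using Q ge[of 0] ge[of 1] \<rho> N1 V' by (intro conjI exI[of _ v'] exI[of _ \<rho>]) auto
qed

section \<open>Realization of the system\<close>

lemma valuation_ring_iff:
  fixes R :: "'a ring"
  assumes R: "field R" and L: "subfield L R"
  shows "valuation_ring (R\<lparr>carrier := L\<rparr>) U \<longleftrightarrow> valuation_subring R L U"
proof -
  interpret R: field R by (rule R)
  have sL: "subring L R" by (rule subfieldE(1)[OF L])
  interpret L: ring "R\<lparr>carrier := L\<rparr>" by (rule R.subring_is_ring[OF sL])
  have Lc: "L \<subseteq> carrier R" by (rule subfieldE(3)[OF L])
  have "subring U (R\<lparr>carrier := L\<rparr>) \<longleftrightarrow> subring U R \<and> U \<subseteq> L"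
  proof (cases "U \<subseteq> L")
    case True
    then show ?thesis using L.subring_iff[of U] R.subring_iff[of U] Lc by simp
  next
    case False
    then show ?thesis using subringE(1)[of U "R\<lparr>carrier := L\<rparr>"] by auto
  qed
  moreover have "inv\<^bsub>R\<lparr>carrier := L\<rparr>\<^esub> x = inv\<^bsub>R\<^esub> x" if x: "x \<in> L" "x \<noteq> \<zero>\<^bsub>R\<^esub>" for x
  proof -
    have i: "inv\<^bsub>R\<^esub> x \<in> L" "x \<otimes>\<^bsub>R\<^esub> inv\<^bsub>R\<^esub> x = \<one>\<^bsub>R\<^esub>" "inv\<^bsub>R\<^esub> x \<otimes>\<^bsub>R\<^esub> x = \<one>\<^bsub>R\<^esub>"
      using R.subfield_m_inv[OF L, of x] x by auto
    show ?thesis by (rule L.inv_unique'[symmetric]) (use i x in simp_all)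
  qed
  ultimately show ?thesis
    unfolding valuation_ring_def valuation_subring_def valuation_subring_axioms_def using L R by auto
qed

text \<open>Separability refers to \<open>L\<close> as a ring of its own, whereas the construction takes place inside
  \<open>\<Omega>\<close>; all notions involved only depend on the operations.\<close>

lemma separable_extensionI:
  fixes \<Omega> :: "'b ring"
  assumes \<Omega>: "field \<Omega>" and L: "subfield L \<Omega>" and K: "subfield (\<phi> ` carrier F) \<Omega>" "\<phi> ` carrier F \<subseteq> L"
    and d: "ring.dimension \<Omega> M (\<phi> ` carrier F) L" and fr: "frobenius_spans \<Omega> (\<phi> ` carrier F) L"
  shows "separable_extension F (\<Omega>\<lparr>carrier := L\<rparr>) \<phi>"
    "ring.dimension (\<Omega>\<lparr>carrier := L\<rparr>) M (\<phi> ` carrier F) (carrier (\<Omega>\<lparr>carrier := L\<rparr>))"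
    "field (\<Omega>\<lparr>carrier := L\<rparr>)"
proof -
  interpret \<Omega>: field \<Omega> by (rule \<Omega>)
  let ?L = "\<Omega>\<lparr>carrier := L\<rparr>" and ?K = "\<phi> ` carrier F"
  have sL: "subring L \<Omega>" by (rule subfieldE(1)[OF L])
  have Lc: "L \<subseteq> carrier \<Omega>" by (rule subfieldE(3)[OF L])
  show FL: "field ?L" by (rule \<Omega>.subfield_iff(2)[OF L])
  interpret L: field ?L by (rule FL)
  have "field (?L\<lparr>carrier := ?K\<rparr>)" using \<Omega>.subfield_iff(2)[OF K(1)] by simp
  then have KL: "subfield ?K ?L" using L.subfield_iff(1) K(2) by simp
  show dL: "ring.dimension ?L M ?K (carrier ?L)" using \<Omega>.dimension_restrict[OF sL K d] by simp
  have eq: "add_pow ?L q x = add_pow \<Omega> q x" "x [^]\<^bsub>?L\<^esub> q = x [^]\<^bsub>\<Omega>\<^esub> q" for q :: nat and x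
    by (simp_all add: add_pow_def nat_pow_def)
  have frL: "frobenius_spans ?L ?K (carrier ?L)"
    using fr Lc unfolding frobenius_spans_def eq by auto
  show "separable_extension F ?L \<phi>"
    unfolding separable_extension_def using separable_elementI[OF FL KL dL frL] by blast
qed

text \<open>What a field with the wanted places must satisfy, in terms of the valuations. The ideal
  generated by \<open>N i\<close> is determined by its least value \<open>e i j\<close>, attained by a uniformizer of
  \<open>V i\<close>.\<close>

lemma is_realizationI:
  fixes F :: "'a ring" and \<Omega> :: "'b ring" and S :: "nat \<Rightarrow> 'k ring"
  assumes F: "field F" and \<Omega>: "field \<Omega>" and \<phi>: "\<phi> \<in> ring_hom F \<Omega>"
    and L: "subfield L \<Omega>" "\<phi> ` carrier F \<subseteq> L" "ring.dimension \<Omega> M (\<phi> ` carrier F) L" "frobenius_spans \<Omega> (\<phi> ` carrier F) L"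
    and V: "\<And>i. i \<in> {1..n} \<Longrightarrow> V i \<subseteq> carrier F \<and> val_ge \<Omega> (\<phi> ` carrier F) (v i) 0 = \<phi> ` V i \<and>
       val_ge \<Omega> (\<phi> ` carrier F) (v i) 1 = \<phi> ` N i \<and> place \<Omega> (S i) (\<phi> ` carrier F) (v i) (\<rho> i) \<and>
       (\<forall>x\<in>V i. \<rho> i (\<phi> x) = \<iota> i (N i +>\<^bsub>F\<lparr>carrier := V i\<rparr>\<^esub> x))"
    and ext: "\<And>i j. i \<in> {1..n} \<Longrightarrow> j \<in> {1..s i} \<Longrightarrow> 0 < e i j \<and>
       extends_place \<Omega> (S i) (\<phi> ` carrier F) (v i) (\<rho> i) L (w i j) (\<rho>' i j) (e i j) \<and>
       \<rho>' i j ` val_ge \<Omega> L (w i j) 0 = E i j"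
    and inj: "\<And>i. i \<in> {1..n} \<Longrightarrow> inj_on (\<lambda>j. val_ge \<Omega> L (w i j) 0) {1..s i}"
    and complete: "\<And>i U. i \<in> {1..n} \<Longrightarrow> valuation_subring \<Omega> L U \<Longrightarrow> U \<inter> \<phi> ` carrier F = \<phi> ` V i \<Longrightarrow>
       \<exists>j\<in>{1..s i}. U = val_ge \<Omega> L (w i j) 0"
  shows "is_realization F n V N M \<lparr>sys_num = s, sys_ext = \<lambda>i j. (S i)\<lparr>carrier := E i j\<rparr>,
     sys_emb = \<lambda>i j. \<iota> i, sys_deg = d, sys_ram = e\<rparr> (\<Omega>\<lparr>carrier := L\<rparr>) \<phi>"
proof -
  interpret F: field F by (rule F)
  interpret \<Omega>: field \<Omega> by (rule \<Omega>)
  interpret \<phi>: ring_hom_ring F \<Omega> \<phi> by (rule ring_hom_ringI2[OF F.ring_axioms \<Omega>.ring_axioms \<phi>])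
  let ?L = "\<Omega>\<lparr>carrier := L\<rparr>" and ?K = "\<phi> ` carrier F"
  have \<phi>inj: "inj_on \<phi> (carrier F)" by (rule non_trivial_field_hom_is_inj[OF \<phi> F \<Omega>])
  have K: "subfield ?K \<Omega>" by (rule \<phi>.img_is_subfield(2)[OF F.carrier_is_subfield]) simp
  note sep = separable_extensionI[OF \<Omega> L(1) K L(2-4)]
  have \<phi>L: "\<phi> \<in> ring_hom F ?L" using \<phi> L(2) by (auto simp: ring_hom_def)
  have contract: "{x \<in> carrier F. \<phi> x \<in> U} = V i \<longleftrightarrow> U \<inter> ?K = \<phi> ` V i" if i: "i \<in> {1..n}" for i U
  proof -
    have Vi: "V i \<subseteq> carrier F" using V[OF i] by simp
    have "U \<inter> ?K = \<phi> ` {x \<in> carrier F. \<phi> x \<in> U}" by auto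
    then show ?thesis using inj_on_image_eq_iff[OF \<phi>inj, of "{x \<in> carrier F. \<phi> x \<in> U}" "V i"] Vi by auto
  qed
  let ?W = "\<lambda>i j. val_ge \<Omega> L (w i j) 0" and ?M = "\<lambda>i j. val_ge \<Omega> L (w i j) 1"
  have bij: "bij_betw (?W i) {1..s i} {U. valuation_ring ?L U \<and> {x \<in> carrier F. \<phi> x \<in> U} = V i}" if i: "i \<in> {1..n}" for i
  proof -
    have "?W i j \<in> {U. valuation_ring ?L U \<and> {x \<in> carrier F. \<phi> x \<in> U} = V i}" if j: "j \<in> {1..s i}" for j
    proof -
      have ex: "extends_place \<Omega> (S i) ?K (v i) (\<rho> i) L (w i j) (\<rho>' i j) (e i j)" "0 < e i j" using ext[OF i j] by simp_all
      interpret w: place \<Omega> "S i" L "w i j" "\<rho>' i j" using ex(1) unfolding extends_place_def by (rule conjunct1)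
      have "valuation_subring \<Omega> L (?W i j)"
      proof (rule valuation_subring.intro[OF \<Omega> valuation_subring_axioms.intro])
        show "subfield L \<Omega>" by (rule L(1))
        show "subring (?W i j) \<Omega>" by (rule w.ge_0_subring)
        show "?W i j \<subseteq> L" by (auto simp: val_ge_def)
        fix x assume x: "x \<in> L" "x \<noteq> \<zero>\<^bsub>\<Omega>\<^esub>"
        then show "x \<in> ?W i j \<or> inv\<^bsub>\<Omega>\<^esub> x \<in> ?W i j" using w.K_inv[OF x] w.v_inv[OF x] by (auto simp: val_ge_def)
      qed
      moreover have "?W i j \<inter> ?K = \<phi> ` V i" using extends_place_restrict[OF ex(1) L(2) ex(2)] V[OF i] by simp
      ultimately show ?thesis using contract[OF i] valuation_ring_iff[OF \<Omega> L(1)] by simp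
    qed
    moreover have "\<exists>j\<in>{1..s i}. U = ?W i j" if "valuation_ring ?L U" "{x \<in> carrier F. \<phi> x \<in> U} = V i" for U
      by (rule complete[OF i]) (use that contract[OF i] valuation_ring_iff[OF \<Omega> L(1)] in simp_all)
    ultimately have "?W i ` {1..s i} = {U. valuation_ring ?L U \<and> {x \<in> carrier F. \<phi> x \<in> U} = V i}"
      by (intro subset_antisym image_subsetI subsetI) (assumption, simp only: mem_Collect_eq image_iff)
    then show ?thesis by (rule bij_betw_imageI[OF inj[OF i]])
  qed
  have loc: "maximalideal (?M i j) (\<Omega>\<lparr>carrier := ?W i j\<rparr>) \<and>
      (\<exists>h\<in>ring_iso (residue_field \<Omega> (?W i j) (?M i j)) ((S i)\<lparr>carrier := E i j\<rparr>).
        \<forall>x\<in>V i. h (?M i j +>\<^bsub>\<Omega>\<lparr>carrier := ?W i j\<rparr>\<^esub> \<phi> x) = \<iota> i (N i +>\<^bsub>F\<lparr>carrier := V i\<rparr>\<^esub> x)) \<and>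
      Idl\<^bsub>\<Omega>\<lparr>carrier := ?W i j\<rparr>\<^esub> (\<phi> ` N i) = ?M i j [^]\<^bsub>ideals_set (\<Omega>\<lparr>carrier := ?W i j\<rparr>)\<^esub> e i j"
    if i: "i \<in> {1..n}" and j: "j \<in> {1..s i}" for i j
  proof -
    have ex: "extends_place \<Omega> (S i) ?K (v i) (\<rho> i) L (w i j) (\<rho>' i j) (e i j)" "0 < e i j" using ext[OF i j] by simp_all
    have wK: "w i j x = int (e i j) * v i x" if "x \<in> ?K" "x \<noteq> \<zero>\<^bsub>\<Omega>\<^esub>" for x
      using ex(1) that unfolding extends_place_def by blast
    have \<rho>K: "\<rho>' i j x = \<rho> i x" if "x \<in> val_ge \<Omega> ?K (v i) 0" for x
      using ex(1) that unfolding extends_place_def by blast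
    interpret w: place \<Omega> "S i" L "w i j" "\<rho>' i j" using ex(1) unfolding extends_place_def by (rule conjunct1)
    interpret v: place \<Omega> "S i" ?K "v i" "\<rho> i" using V[OF i] by simp
    have "\<phi> x \<in> ?W i j \<and> \<rho>' i j (\<phi> x) = \<iota> i (N i +>\<^bsub>F\<lparr>carrier := V i\<rparr>\<^esub> x)" if x: "x \<in> V i" for x
    proof -
      have 1: "\<phi> x \<in> val_ge \<Omega> ?K (v i) 0" using V[OF i] x by simp
      then have "\<phi> x \<in> ?W i j" using extends_place_restrict[OF ex(1) L(2) ex(2)] by blast
      then show ?thesis using \<rho>K[OF 1] V[OF i] x by simp
    qed
    moreover have E: "\<rho>' i j ` ?W i j = E i j" using ext[OF i j] by simp
    ultimately have "\<exists>h\<in>ring_iso (residue_field \<Omega> (?W i j) (?M i j)) ((S i)\<lparr>carrier := E i j\<rparr>).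
        \<forall>x\<in>V i. h (?M i j +>\<^bsub>\<Omega>\<lparr>carrier := ?W i j\<rparr>\<^esub> \<phi> x) = \<iota> i (N i +>\<^bsub>F\<lparr>carrier := V i\<rparr>\<^esub> x)"
    proof -
      assume x: "\<And>x. x \<in> V i \<Longrightarrow> \<phi> x \<in> ?W i j \<and> \<rho>' i j (\<phi> x) = \<iota> i (N i +>\<^bsub>F\<lparr>carrier := V i\<rparr>\<^esub> x)"
      obtain h where h: "h \<in> ring_iso (residue_field \<Omega> (?W i j) (?M i j)) ((S i)\<lparr>carrier := E i j\<rparr>)"
        "\<forall>x\<in>?W i j. h (?M i j +>\<^bsub>\<Omega>\<lparr>carrier := ?W i j\<rparr>\<^esub> x) = \<rho>' i j x"
        using w.residue_iso unfolding E by (elim bexE) (rule that)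
      show ?thesis
      proof (rule bexI[OF _ h(1)], rule ballI)
        fix y assume y: "y \<in> V i"
        show "h (?M i j +>\<^bsub>\<Omega>\<lparr>carrier := ?W i j\<rparr>\<^esub> \<phi> y) = \<iota> i (N i +>\<^bsub>F\<lparr>carrier := V i\<rparr>\<^esub> y)"
          using x[OF y] h(2)[THEN bspec, of "\<phi> y"] by simp
      qed
    qed
    moreover have "Idl\<^bsub>\<Omega>\<lparr>carrier := ?W i j\<rparr>\<^esub> (\<phi> ` N i) = val_ge \<Omega> L (w i j) (int (e i j))"
    proof -
      have N: "\<phi> ` N i = val_ge \<Omega> ?K (v i) 1" using V[OF i] by simp
      obtain z where z: "z \<in> ?K" "z \<noteq> \<zero>\<^bsub>\<Omega>\<^esub>" "v i z = 1" by (rule v.v_surj)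
      have "val_ge \<Omega> ?K (v i) 1 \<subseteq> val_ge \<Omega> L (w i j) (int (e i j))"
        using wK L(2) unfolding val_ge_def by (auto simp: mult_le_cancel_left1)
      then show ?thesis
        unfolding N by (rule w.genideal_ge[where z = z]) (use z wK in \<open>simp_all add: val_ge_def\<close>)
    qed
    ultimately show ?thesis using w.ge_1_maximal w.ideals_pow_ge[of "e i j"] by simp
  qed
  show ?thesis
    unfolding is_realization_def
    using sep \<phi>L bij loc
    by (intro conjI exI[of _ ?W] exI[of _ ?M] ballI) simp_all
qed

lemma simple_algebraic_extension_finite:
  fixes Q :: "'r ring" and S :: "'k ring"
  assumes Q: "field Q" and S: "field S" and \<iota>: "\<iota> \<in> ring_hom Q S"
    and E: "subfield E S" "finite E" "\<iota> ` carrier Q \<subseteq> E"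
  shows "simple_algebraic_extension Q (S\<lparr>carrier := E\<rparr>) \<iota>"
proof -
  interpret Q: field Q by (rule Q)
  interpret S: field S by (rule S)
  interpret \<iota>: ring_hom_ring Q S \<iota> by (rule ring_hom_ringI2[OF Q.ring_axioms S.ring_axioms \<iota>])
  let ?k = "\<iota> ` carrier Q"
  have k: "subfield ?k S" by (rule \<iota>.img_is_subfield(2)[OF Q.carrier_is_subfield]) simp
  have sE: "subring E S" by (rule subfieldE(1)[OF E(1)])
  obtain a where a: "a \<in> E" "S.simple_extension ?k a = E"
    by (rule S.finite_subfield_primitive_element[OF k E]) (rule that)
  have "(S.algebraic over ?k) a"
    by (rule S.finite_dimension_imp_algebraic[OF k sE S.finite_imp_finite_dimension[OF k E(1,3,2)] a(1)])
  then have "(ring.algebraic (S\<lparr>carrier := E\<rparr>) over ?k) a" using S.algebraic_consistent[OF sE] by simp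
  moreover have "ring.simple_extension (S\<lparr>carrier := E\<rparr>) ?k a = E" using S.simple_extension_consistent[OF sE] a(2) by simp
  moreover have "\<iota> \<in> ring_hom Q (S\<lparr>carrier := E\<rparr>)" using \<iota> E(3) by (auto simp: ring_hom_def)
  ultimately show ?thesis
    unfolding simple_algebraic_extension_def using a(1) S.subfield_iff(2)[OF E(1)]
    by (intro conjI bexI[of _ a]) simp_all
qed

theorem theorem2p7:
  fixes F :: "'a ring"
    and n m :: nat
    and V N :: "nat \<Rightarrow> 'a set"
    and Kbar :: "nat \<Rightarrow> 'k ring"
    and \<iota> :: "nat \<Rightarrow> 'a set \<Rightarrow> 'k"
    and s :: "nat \<Rightarrow> nat"
    and K :: "nat \<Rightarrow> nat \<Rightarrow> 'k set"
    and f e :: "nat \<Rightarrow> nat \<Rightarrow> nat"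
  assumes "field F"
    and "n > 1"
    and "\<And>i. i \<in> {1..n} \<Longrightarrow> DVR F (V i)"
    and "\<And>i. i \<in> {1..n} \<Longrightarrow> maximalideal (N i) (F\<lparr>carrier := V i\<rparr>)"
    and "inj_on V {1..n}"
    and "\<And>i. i \<in> {1..n} \<Longrightarrow> finite (carrier (residue_field F (V i) (N i)))"
    and "\<And>i. i \<in> {1..n} \<Longrightarrow> \<iota> i \<in> ring_hom (residue_field F (V i) (N i)) (Kbar i)"
    and "\<And>i. i \<in> {1..n} \<Longrightarrow>
           algebraic_closure (Kbar i) (\<iota> i ` carrier (residue_field F (V i) (N i)))"
    and "m > 0"
    and "\<And>i j. i \<in> {1..n} \<Longrightarrow> j \<in> {1..s i} \<Longrightarrow> subfield (K i j) (Kbar i)"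
    and "consistent_system F n V N m
           \<lparr>sys_num = s,
            sys_ext = \<lambda>i j. (Kbar i)\<lparr>carrier := K i j\<rparr>,
            sys_emb = \<lambda>i j. \<iota> i,
            sys_deg = f,
            sys_ram = e\<rparr>"
  defines "Tstar \<equiv>
           \<lparr>sys_num = s,
            sys_ext = \<lambda>i j. (Kbar i)\<lparr>carrier := extension_of_degree (Kbar i) m (K i j)\<rparr>,
            sys_emb = \<lambda>i j. \<iota> i,
            sys_deg = \<lambda>i j. m * f i j,
            sys_ram = e\<rparr>"
  shows "consistent_system F n V N (m\<^sup>2) Tstar \<and> realizable_system F n V N (m\<^sup>2) Tstar"
proof -
  interpret F: field F by (rule assms(1))
  let ?Q = "\<lambda>i. residue_field F (V i) (N i)"
  define k where "k i = \<iota> i ` carrier (?Q i)" for i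
  have finQ: "finite (k i)" if "i \<in> {1..n}" for i using assms(6)[OF that] by (simp add: k_def)
  have closed: "algebraically_closed (Kbar i)" if "i \<in> {1..n}" for i
  proof -
    interpret algebraic_closure "Kbar i" "\<iota> i ` carrier (?Q i)" by (rule assms(8)[OF that])
    show ?thesis by (rule algebraically_closed_axioms)
  qed
  have fieldS: "field (Kbar i)" if "i \<in> {1..n}" for i using algebraically_closed.axioms(1)[OF closed[OF that]] .
  have ringS: "ring (Kbar i)" if "i \<in> {1..n}" for i by (rule field.is_ring[OF fieldS[OF that]])
  define \<Omega> where "\<Omega> = F.alg_closure"
  define \<phi> :: "'a \<Rightarrow> ('a list \<times> nat) multiset \<Rightarrow> 'a" where "\<phi> = F.indexed_const"
  have \<phi>: "\<phi> \<in> ring_hom F \<Omega>" unfolding \<phi>_def \<Omega>_def by (rule F.alg_closureE(2))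
  have \<Omega>c: "algebraically_closed \<Omega>"
  proof -
    interpret algebraic_closure \<Omega> "\<phi> ` carrier F" unfolding \<phi>_def \<Omega>_def by (rule F.alg_closureE(1))
    show ?thesis by (rule algebraically_closed_axioms)
  qed
  have \<Omega>: "field \<Omega>" by (rule algebraically_closed.axioms(1)[OF \<Omega>c])
  interpret \<Omega>: field \<Omega> by (rule \<Omega>)
  interpret \<phi>: ring_hom_ring F \<Omega> \<phi> by (rule ring_hom_ringI2[OF F.ring_axioms \<Omega>.ring_axioms \<phi>])
  let ?F = "\<phi> ` carrier F"
  have \<phi>inj: "inj_on \<phi> (carrier F)" by (rule non_trivial_field_hom_is_inj[OF \<phi> assms(1) \<Omega>])
  have K0: "subfield ?F \<Omega>" by (rule \<phi>.img_is_subfield(2)[OF F.carrier_is_subfield]) simp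
  note pl0 = DVR_place[OF assms(1) \<Omega> \<phi> assms(3) assms(4) fieldS assms(7)]
  have Q: "field (?Q i)" if "i \<in> {1..n}" for i by (rule pl0[THEN conjunct1]) (rule that)+
  have kS: "subfield (k i) (Kbar i)" if i: "i \<in> {1..n}" for i
  proof -
    interpret Q: field "?Q i" by (rule Q[OF i])
    interpret S: field "Kbar i" by (rule fieldS[OF i])
    interpret \<iota>: ring_hom_ring "?Q i" "Kbar i" "\<iota> i" by (rule ring_hom_ringI2[OF Q.ring_axioms S.ring_axioms assms(7)[OF i]])
    show ?thesis unfolding k_def by (rule \<iota>.img_is_subfield(2)[OF Q.carrier_is_subfield]) simp
  qed
  have "\<forall>i\<in>{1..n}. \<exists>v \<rho>. place \<Omega> (Kbar i) ?F v \<rho> \<and> val_ge \<Omega> ?F v 0 = \<phi> ` V i \<and>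
    val_ge \<Omega> ?F v 1 = \<phi> ` N i \<and> (\<forall>x\<in>V i. \<rho> (\<phi> x) = \<iota> i (N i +>\<^bsub>F\<lparr>carrier := V i\<rparr>\<^esub> x))"
    by (rule ballI, rule pl0[THEN conjunct2])
  from bchoice[OF this] obtain v where "\<forall>i\<in>{1..n}. \<exists>\<rho>. place \<Omega> (Kbar i) ?F (v i) \<rho> \<and> val_ge \<Omega> ?F (v i) 0 = \<phi> ` V i \<and>
    val_ge \<Omega> ?F (v i) 1 = \<phi> ` N i \<and> (\<forall>x\<in>V i. \<rho> (\<phi> x) = \<iota> i (N i +>\<^bsub>F\<lparr>carrier := V i\<rparr>\<^esub> x))" ..
  from bchoice[OF this] obtain \<rho> where pl: "\<forall>i\<in>{1..n}. place \<Omega> (Kbar i) ?F (v i) (\<rho> i) \<and> val_ge \<Omega> ?F (v i) 0 = \<phi> ` V i \<and>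
    val_ge \<Omega> ?F (v i) 1 = \<phi> ` N i \<and> (\<forall>x\<in>V i. \<rho> i (\<phi> x) = \<iota> i (N i +>\<^bsub>F\<lparr>carrier := V i\<rparr>\<^esub> x))" ..
  have place: "place \<Omega> (Kbar i) ?F (v i) (\<rho> i)" and V: "val_ge \<Omega> ?F (v i) 0 = \<phi> ` V i"
    and \<rho>V: "\<And>x. x \<in> V i \<Longrightarrow> \<rho> i (\<phi> x) = \<iota> i (N i +>\<^bsub>F\<lparr>carrier := V i\<rparr>\<^esub> x)" if "i \<in> {1..n}" for i
    using pl that by simp_all
  have VF: "V i \<subseteq> carrier F" if "i \<in> {1..n}" for i
    using assms(3)[OF that] unfolding DVR_def by auto
  have k_image: "\<rho> i ` val_ge \<Omega> ?F (v i) 0 = k i" if "i \<in> {1..n}" for i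
  proof -
    have "carrier (?Q i) = (\<lambda>x. N i +>\<^bsub>F\<lparr>carrier := V i\<rparr>\<^esub> x) ` V i" by (auto simp: FactRing_def A_RCOSETS_def')
    then show ?thesis unfolding V[OF that] k_def image_image by (auto simp: \<rho>V[OF that] image_image)
  qed
  have distinct: "inj_on (\<lambda>i. val_ge \<Omega> ?F (v i) 0) {1..n}"
  proof (rule inj_onI)
    fix i i' assume i: "i \<in> {1..n}" "i' \<in> {1..n}" and "val_ge \<Omega> ?F (v i) 0 = val_ge \<Omega> ?F (v i') 0"
    then have "V i = V i'" using inj_on_image_eq_iff[OF \<phi>inj VF[OF i(1)] VF[OF i(2)]] V by simp
    then show "i = i'" using inj_onD[OF assms(5)] i by simp
  qed
  have sys: "0 < s i" "(\<Sum>j\<in>{1..s i}. e i j * f i j) = m" if "i \<in> {1..n}" for i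
    using assms(11) that unfolding consistent_system_def by simp_all
  have dimK: "ring.dimension (Kbar i) (f i j) (k i) (K i j)" and epos: "0 < e i j"
    if i: "i \<in> {1..n}" and j: "j \<in> {1..s i}" for i j
  proof -
    have "ring.dimension (Kbar i\<lparr>carrier := K i j\<rparr>) (f i j) (k i) (K i j)" and e: "0 < e i j"
      using assms(11) i j unfolding consistent_system_def k_def by simp_all
    then show "ring.dimension (Kbar i) (f i j) (k i) (K i j)" "0 < e i j"
      using ring.dimension_extend[OF ringS[OF i] subfieldE(1)[OF assms(10)[OF i j]]] by simp_all
  qed
  have fpos: "0 < f i j" if i: "i \<in> {1..n}" and j: "j \<in> {1..s i}" for i j
  proof (rule ccontr)
    assume "\<not> 0 < f i j"
    then have "ring.dimension (Kbar i) 0 (k i) (K i j)" using dimK[OF i j] by simp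
    then have "K i j = {\<zero>\<^bsub>Kbar i\<^esub>}" by (rule ring.dimension_zero[OF ringS[OF i] kS[OF i]])
    then show False using subringE(3)[OF subfieldE(1)[OF assms(10)[OF i j]]] subfieldE(6)[OF assms(10)[OF i j]] by simp
  qed
  let ?E = "\<lambda>i j. {x \<in> carrier (Kbar i). x [^]\<^bsub>Kbar i\<^esub> (card (k i) ^ (m * f i j)) = x}"
  have E: "extension_of_degree (Kbar i) m (K i j) = ?E i j" if i: "i \<in> {1..n}" and j: "j \<in> {1..s i}" for i j
    by (rule extension_of_degree_eq[OF closed[OF i] kS[OF i] finQ[OF i] assms(10)[OF i j] dimK[OF i j] assms(9)])
  have mf: "0 < m * f i j" if "i \<in> {1..n}" "j \<in> {1..s i}" for i j using fpos[OF that] assms(9) by simp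
  have consistent: "consistent_system F n V N (m\<^sup>2) Tstar"
    unfolding consistent_system_def
  proof (intro ballI conjI)
    fix i assume i: "i \<in> {1..n}"
    show "0 < sys_num Tstar i" using sys(1)[OF i] by (simp add: Tstar_def)
    have "(\<Sum>j\<in>{1..s i}. e i j * (m * f i j)) = m * (\<Sum>j\<in>{1..s i}. e i j * f i j)"
      by (simp add: sum_distrib_left ac_simps)
    then show "(\<Sum>j = 1..sys_num Tstar i. sys_ram Tstar i j * sys_deg Tstar i j) = m\<^sup>2"
      using sys(2)[OF i] by (simp add: Tstar_def power2_eq_square)
    fix j assume "j \<in> {1..sys_num Tstar i}"
    then have j: "j \<in> {1..s i}" by (simp add: Tstar_def)
    show "0 < sys_ram Tstar i j" using epos[OF i j] by (simp add: Tstar_def)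
    note ff = algebraically_closed.finite_field_extension[OF closed[OF i] kS[OF i] finQ[OF i] mf[OF i j]]
    have sub: "\<iota> i ` carrier (?Q i) \<subseteq> ?E i j" using ff(2) unfolding k_def .
    show "simple_algebraic_extension (?Q i) (sys_ext Tstar i j) (sys_emb Tstar i j)"
      using simple_algebraic_extension_finite[OF Q[OF i] fieldS[OF i] assms(7)[OF i] ff(1,3) sub] E[OF i j]
      by (simp add: Tstar_def k_def)
    show "ring.dimension (sys_ext Tstar i j) (sys_deg Tstar i j) (sys_emb Tstar i j ` carrier (?Q i)) (carrier (sys_ext Tstar i j))"
      using ring.dimension_restrict[OF ringS[OF i] subfieldE(1)[OF ff(1)] kS[OF i] ff(2,5) subset_refl] E[OF i j]
      by (simp add: Tstar_def k_def)
  qed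
  have fink: "finite (\<rho> i ` val_ge \<Omega> ?F (v i) 0)" if "i \<in> {1..n}" for i
    unfolding k_image[OF that] by (rule finQ[OF that])
  have data: "0 < e i j \<and> 0 < f i j" if "i \<in> {1..n}" "j \<in> {1..s i}" for i j using epos[OF that] fpos[OF that] by simp
  have two: "1 \<in> {1..n}" "2 \<in> {1..n}" "(1::nat) \<noteq> 2" using assms(2) by auto
  have "\<exists>L w \<rho>'. subfield L \<Omega> \<and> ?F \<subseteq> L \<and> ring.dimension \<Omega> (m\<^sup>2) ?F L \<and> frobenius_spans \<Omega> ?F L \<and>
     (\<forall>i\<in>{1..n}. (\<forall>j\<in>{1..s i}. extends_place \<Omega> (Kbar i) ?F (v i) (\<rho> i) L (w i j) (\<rho>' i j) (e i j) \<and>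
        ring.dimension (Kbar i) (m * f i j) (\<rho> i ` val_ge \<Omega> ?F (v i) 0) (\<rho>' i j ` val_ge \<Omega> L (w i j) 0)) \<and>
       inj_on (\<lambda>j. val_ge \<Omega> L (w i j) 0) {1..s i} \<and>
       (\<forall>U. valuation_subring \<Omega> L U \<and> U \<inter> ?F = val_ge \<Omega> ?F (v i) 0 \<longrightarrow> (\<exists>j\<in>{1..s i}. U = val_ge \<Omega> L (w i j) 0)))"
    by (rule \<Omega>.grid_realization[where v=v and S=Kbar and \<rho>=\<rho> and s=s and e=e and f=f, OF \<Omega>c K0 finite_atLeastAtMost])
       (fact place closed fink distinct data sys(2) assms(9) two)+
  then obtain L w \<rho>' where L: "subfield L \<Omega>" "?F \<subseteq> L" "ring.dimension \<Omega> (m\<^sup>2) ?F L" "frobenius_spans \<Omega> ?F L"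
    and all: "\<forall>i\<in>{1..n}. (\<forall>j\<in>{1..s i}. extends_place \<Omega> (Kbar i) ?F (v i) (\<rho> i) L (w i j) (\<rho>' i j) (e i j) \<and>
        ring.dimension (Kbar i) (m * f i j) (\<rho> i ` val_ge \<Omega> ?F (v i) 0) (\<rho>' i j ` val_ge \<Omega> L (w i j) 0)) \<and>
       inj_on (\<lambda>j. val_ge \<Omega> L (w i j) 0) {1..s i} \<and>
       (\<forall>U. valuation_subring \<Omega> L U \<and> U \<inter> ?F = val_ge \<Omega> ?F (v i) 0 \<longrightarrow> (\<exists>j\<in>{1..s i}. U = val_ge \<Omega> L (w i j) 0))"
    by (elim exE conjE) (rule that)
  have ext: "extends_place \<Omega> (Kbar i) ?F (v i) (\<rho> i) L (w i j) (\<rho>' i j) (e i j)"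
    and dim: "ring.dimension (Kbar i) (m * f i j) (k i) (\<rho>' i j ` val_ge \<Omega> L (w i j) 0)"
    if "i \<in> {1..n}" "j \<in> {1..s i}" for i j
    using all[THEN bspec, OF that(1), THEN conjunct1, THEN bspec, OF that(2)] unfolding k_image[OF that(1)] by simp_all
  have residue: "\<rho>' i j ` val_ge \<Omega> L (w i j) 0 = extension_of_degree (Kbar i) m (K i j)"
    if i: "i \<in> {1..n}" and j: "j \<in> {1..s i}" for i j
  proof -
    have "finite (\<rho>' i j ` val_ge \<Omega> L (w i j) 0)"
      using ring.card_of_dimension[OF ringS[OF i] kS[OF i] finQ[OF i] dim[OF i j]] by simp
    then have "subfield (\<rho>' i j ` val_ge \<Omega> L (w i j) 0) (Kbar i)"
      using ext[OF i j] unfolding extends_place_def by (intro place_residue_subfield[OF _ closed[OF i]]) (rule conjunct1)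
    from algebraically_closed.finite_field_extension_unique[OF closed[OF i] kS[OF i] finQ[OF i] mf[OF i j] this dim[OF i j]]
    show ?thesis using E[OF i j] by simp
  qed
  have "is_realization F n V N (m\<^sup>2) Tstar (\<Omega>\<lparr>carrier := L\<rparr>) \<phi>"
    unfolding Tstar_def
  proof (rule is_realizationI[where v=v and \<rho>=\<rho> and w=w and \<rho>'=\<rho>', OF assms(1) \<Omega> \<phi> L])
    fix i assume i: "i \<in> {1..n}"
    show "V i \<subseteq> carrier F \<and> val_ge \<Omega> ?F (v i) 0 = \<phi> ` V i \<and> val_ge \<Omega> ?F (v i) 1 = \<phi> ` N i \<and>
      place \<Omega> (Kbar i) ?F (v i) (\<rho> i) \<and> (\<forall>x\<in>V i. \<rho> i (\<phi> x) = \<iota> i (N i +>\<^bsub>F\<lparr>carrier := V i\<rparr>\<^esub> x))"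
      using VF[OF i] pl i by simp
    show "inj_on (\<lambda>j. val_ge \<Omega> L (w i j) 0) {1..s i}"
      using all[THEN bspec, OF i, THEN conjunct2, THEN conjunct1] .
    fix j assume j: "j \<in> {1..s i}"
    show "0 < e i j \<and> extends_place \<Omega> (Kbar i) ?F (v i) (\<rho> i) L (w i j) (\<rho>' i j) (e i j) \<and>
       \<rho>' i j ` val_ge \<Omega> L (w i j) 0 = extension_of_degree (Kbar i) m (K i j)"
      using epos[OF i j] ext[OF i j] residue[OF i j] by simp
  next
    fix i U assume i: "i \<in> {1..n}" and U: "valuation_subring \<Omega> L U" "U \<inter> ?F = \<phi> ` V i"
    show "\<exists>j\<in>{1..s i}. U = val_ge \<Omega> L (w i j) 0"
      using all[THEN bspec, OF i, THEN conjunct2, THEN conjunct2, THEN spec, of U] U V[OF i] by simp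
  qed
  then have "realizable_system F n V N (m\<^sup>2) Tstar"
    unfolding realizable_system_def by (intro exI[of _ "\<Omega>\<lparr>carrier := L\<rparr>"] exI[of _ \<phi>])
  then show ?thesis using consistent by (rule conjI[rotated])
qed

end
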